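(* Let $E$ be a finite-dimensional operator system which is CP-stable. Then $E\otimes_{\min}\mathcal B(\ell^2)= E\otimes_{\max}\mathcal B(\ell^2)$ as operator systems; that is, for every $k\in\mathbb N$, $M_k(E\otimes_{\min}\mathcal B(\ell^2))^+=M_k(E\otimes_{\max}\mathcal B(\ell^2))^+$ as subsets of $M_k(E\otimes\mathcal B(\ell^2))$, where $E\otimes\mathcal B(\ell^2)$ is the algebraic tensor product.
   Context: For a linear map $\phi: X\to Y$ between operator systems and $k\in\mathbb N$, $\lVert\phi\rVert_k$ denotes the norm of the amplification $\phi_k: M_k(X)\to M_k(Y)$, $[x_{ij}]\mapsto[\phi(x_{ij})]$; $\lVert\phi\rVert=\lVert\phi\rVert_1$. "u.c.p." means unital completely positive. An operator system $X$ is said to be CP-stable if for any finite-dimensional subsystem $E\subset X$ and any $\delta>0$ there are a finite-dimensional subsystem $S$ with $E\subset S\subset X$, an integer $k>0$, and $\epsilon>0$ so that for every unital C$^*$-algebra $A$ and any unital linear map $\phi: S\to A$ with $\lVert\phi\rVert_k<1+\epsilon$ there exists a u.c.p. map $\psi: E\to A$ so that $\lVert\phi|_E-\psi\rVert<\delta$. (Subsystems contain the unit of $X$.) Operator system tensor products (Kavruk, Paulsen, Todorov, Tomforde): for operator systems $X,Y$ with units $1_X,1_Y$, both $X\otimes_{\min}Y$ and $X\otimes_{\max}Y$ have underlying $*$-vector space the algebraic tensor product $X\otimes Y$ and unit $1_X\otimes 1_Y$. The matrix cones are as follows. Minimal: $u\in M_k(X\otimes Y)$ lies in $M_k(X\otimes_{\min}Y)^+$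 if and only if $(\phi\otimes\psi)_k(u)\geq 0$ in $M_k(M_p\otimes M_q)\cong M_{kpq}$ for all $p,q\in\mathbb N$ and all u.c.p. maps $\phi: X\to M_p$, $\psi: Y\to M_q$. Maximal: let $D_k$ be the set of all elements $\alpha(P\otimes Q)\alpha^*$ with $P\in M_p(X)^+$, $Q\in M_q(Y)^+$, $\alpha\in M_{k,pq}(\mathbb C)$, $p,q\in\mathbb N$; then $u\in M_k(X\otimes_{\max}Y)^+$ if and only if $u+r\,(I_k\otimes 1_X\otimes 1_Y)\in D_k$ for every $r>0$. *)

theory Defs
  imports
    Complex_Main
    "HOL-Library.FuncSet"
    "HOL-Library.Extended_Real"
    "Jordan_Normal_Form.Schur_Decomposition"
    "Jordan_Normal_Form.VS_Connect"
begin

hide_const (open) Multiset.mult Polynomial.smult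

section \<open>Complex *-vector spaces and *-algebras\<close>

text \<open>
  One record type serves both *-vector spaces with a distinguished element \<^const>\<open>one\<close> and unital
  *-algebras. The field \<^const>\<open>mult\<close> (inherited from the ring record underlying modules) is
  meaningful for *-algebras only and is never looked at for mere *-vector spaces.
\<close>

record 'a star_space = "(complex, 'a) module" +
  adj :: "'a \<Rightarrow> 'a"

locale star_vector_space = vectorspace class_ring X
  for X :: "('a, 'm) star_space_scheme" +
  assumes adj_closed: "x \<in> carrier X \<Longrightarrow> adj X x \<in> carrier X"
    and adj_adj: "x \<in> carrier X \<Longrightarrow> adj X (adj X x) = x"
    and adj_add: "\<lbrakk>x \<in> carrier X; y \<in> carrier X\<rbrakk> \<Longrightarrow> adj X (x \<oplus>\<^bsub>X\<^esub> y) = adj X x \<oplus>\<^bsub>X\<^esub> adj X y"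
    and adj_smult: "x \<in> carrier X \<Longrightarrow> adj X (c \<odot>\<^bsub>X\<^esub> x) = cnj c \<odot>\<^bsub>X\<^esub> adj X x"

locale star_algebra = star_vector_space A + A: ring A
  for A :: "('a, 'm) star_space_scheme" +
  assumes smult_mult_left:
      "\<lbrakk>x \<in> carrier A; y \<in> carrier A\<rbrakk> \<Longrightarrow> (c \<odot>\<^bsub>A\<^esub> x) \<otimes>\<^bsub>A\<^esub> y = c \<odot>\<^bsub>A\<^esub> (x \<otimes>\<^bsub>A\<^esub> y)"
    and smult_mult_right:
      "\<lbrakk>x \<in> carrier A; y \<in> carrier A\<rbrakk> \<Longrightarrow> x \<otimes>\<^bsub>A\<^esub> (c \<odot>\<^bsub>A\<^esub> y) = c \<odot>\<^bsub>A\<^esub> (x \<otimes>\<^bsub>A\<^esub> y)"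
    and adj_mult:
      "\<lbrakk>x \<in> carrier A; y \<in> carrier A\<rbrakk> \<Longrightarrow> adj A (x \<otimes>\<^bsub>A\<^esub> y) = adj A y \<otimes>\<^bsub>A\<^esub> adj A x"

definition complete_cstar_norm :: "('a, 'm) star_space_scheme \<Rightarrow> ('a \<Rightarrow> real) \<Rightarrow> bool" where
  "complete_cstar_norm A N \<longleftrightarrow>
    (\<forall>x\<in>carrier A. 0 \<le> N x) \<and>
    (\<forall>x\<in>carrier A. N x = 0 \<longleftrightarrow> x = \<zero>\<^bsub>A\<^esub>) \<and>
    (\<forall>c. \<forall>x\<in>carrier A. N (c \<odot>\<^bsub>A\<^esub> x) = cmod c * N x) \<and>
    (\<forall>x\<in>carrier A. \<forall>y\<in>carrier A. N (x \<oplus>\<^bsub>A\<^esub> y) \<le> N x + N y) \<and>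
    (\<forall>x\<in>carrier A. \<forall>y\<in>carrier A. N (x \<otimes>\<^bsub>A\<^esub> y) \<le> N x * N y) \<and>
    (\<forall>x\<in>carrier A. N (adj A x \<otimes>\<^bsub>A\<^esub> x) = (N x)\<^sup>2) \<and>
    (\<forall>s. (\<forall>n::nat. s n \<in> carrier A) \<and>
         (\<forall>e>0. \<exists>M. \<forall>m\<ge>M. \<forall>n\<ge>M. N (s m \<ominus>\<^bsub>A\<^esub> s n) < e) \<longrightarrow>
         (\<exists>l\<in>carrier A. (\<lambda>n. N (s n \<ominus>\<^bsub>A\<^esub> l)) \<longlonglongrightarrow> 0))"

text \<open>
  The norm of a C*-algebra is determined by its *-algebra structure, so it is not recorded.
\<close>

locale unital_cstar_algebra = star_algebra A
  for A :: "('a, 'm) star_space_scheme" +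
  assumes cstar_norm: "\<exists>N. complete_cstar_norm A N"


section \<open>Matrices over a *-vector space\<close>

definition mats :: "('a, 'm) partial_object_scheme \<Rightarrow> nat \<Rightarrow> nat \<Rightarrow> 'a mat set" where
  "mats X m n = {x \<in> carrier_mat m n. elements_mat x \<subseteq> carrier X}"

definition madd :: "('a, 'm) ring_scheme \<Rightarrow> 'a mat \<Rightarrow> 'a mat \<Rightarrow> 'a mat" where
  "madd X x y = mat (dim_row x) (dim_col x) (\<lambda>ij. x $$ ij \<oplus>\<^bsub>X\<^esub> y $$ ij)"

definition msmult :: "(complex, 'a, 'm) module_scheme \<Rightarrow> complex \<Rightarrow> 'a mat \<Rightarrow> 'a mat" where
  "msmult X c x = map_mat (\<lambda>v. c \<odot>\<^bsub>X\<^esub> v) x"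

definition madj :: "('a, 'm) star_space_scheme \<Rightarrow> 'a mat \<Rightarrow> 'a mat" where
  "madj X x = mat (dim_col x) (dim_row x) (\<lambda>(i, j). adj X (x $$ (j, i)))"

definition mzero :: "('a, 'm) ring_scheme \<Rightarrow> nat \<Rightarrow> 'a mat" where
  "mzero X n = mat n n (\<lambda>_. \<zero>\<^bsub>X\<^esub>)"

definition munit :: "('a, 'm) ring_scheme \<Rightarrow> nat \<Rightarrow> 'a mat" where
  "munit X n = mat n n (\<lambda>(i, j). if i = j then \<one>\<^bsub>X\<^esub> else \<zero>\<^bsub>X\<^esub>)"

definition mmult :: "('a, 'm) ring_scheme \<Rightarrow> 'a mat \<Rightarrow> 'a mat \<Rightarrow> 'a mat" where
  "mmult A x y = mat (dim_row x) (dim_col y)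
     (\<lambda>(i, j). \<Oplus>\<^bsub>A\<^esub>l\<in>{..<dim_col x}. x $$ (i, l) \<otimes>\<^bsub>A\<^esub> y $$ (l, j))"

text \<open>\<open>mconj X \<alpha> x\<close> is \<open>\<alpha> x \<alpha>\<^sup>*\<close> for a scalar matrix \<open>\<alpha>\<close>.\<close>

definition mconj :: "(complex, 'a, 'm) module_scheme \<Rightarrow> complex mat \<Rightarrow> 'a mat \<Rightarrow> 'a mat" where
  "mconj X \<alpha> x = mat (dim_row \<alpha>) (dim_row \<alpha>)
     (\<lambda>(i, j). \<Oplus>\<^bsub>X\<^esub>a\<in>{..<dim_row x}. \<Oplus>\<^bsub>X\<^esub>b\<in>{..<dim_col x}.
        (\<alpha> $$ (i, a) * cnj (\<alpha> $$ (j, b))) \<odot>\<^bsub>X\<^esub> x $$ (a, b))"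


section \<open>Operator systems\<close>

text \<open>
  Abstract operator systems in the sense of Choi and Effros: \<open>mcone X n\<close> is \<open>M\<^sub>n(X)\<^sup>+\<close>, and
  \<open>\<one>\<^bsub>X\<^esub>\<close> is the Archimedean matrix order unit.
\<close>

record 'a op_system = "'a star_space" +
  mcone :: "nat \<Rightarrow> 'a mat set"

locale operator_system = star_vector_space X
  for X :: "('a, 'm) op_system_scheme" +
  assumes unit_closed: "\<one>\<^bsub>X\<^esub> \<in> carrier X"
    and unit_adj: "adj X \<one>\<^bsub>X\<^esub> = \<one>\<^bsub>X\<^esub>"
    and cone_mats: "mcone X n \<subseteq> mats X n n"
    and cone_hermitian: "x \<in> mcone X n \<Longrightarrow> madj X x = x"
    and cone_add: "\<lbrakk>x \<in> mcone X n; y \<in> mcone X n\<rbrakk> \<Longrightarrow> madd X x y \<in> mcone X n"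
    and cone_conj: "\<lbrakk>x \<in> mcone X n; \<alpha> \<in> carrier_mat m n\<rbrakk> \<Longrightarrow> mconj X \<alpha> x \<in> mcone X m"
    and cone_proper: "\<lbrakk>x \<in> mcone X n; msmult X (-1) x \<in> mcone X n\<rbrakk> \<Longrightarrow> x = mzero X n"
    and order_unit: "\<lbrakk>x \<in> mats X n n; madj X x = x\<rbrakk>
      \<Longrightarrow> \<exists>r::real. r > 0 \<and> madd X (msmult X (of_real r) (munit X n)) x \<in> mcone X n"
    and archimedean: "\<lbrakk>x \<in> mats X n n; madj X x = x;
        \<And>r::real. r > 0 \<Longrightarrow> madd X (msmult X (of_real r) (munit X n)) x \<in> mcone X n\<rbrakk>
      \<Longrightarrow> x \<in> mcone X n"

definition cstar_opsys :: "'a star_space \<Rightarrow> 'a op_system" where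
  "cstar_opsys A = star_space.extend A
     (op_system.fields (\<lambda>n. {mmult A (madj A x) x | x. x \<in> mats A n n}))"

definition subsystem :: "'a op_system \<Rightarrow> 'a set \<Rightarrow> bool" where
  "subsystem X S \<longleftrightarrow>
     VectorSpace.subspace class_ring S X \<and> \<one>\<^bsub>X\<^esub> \<in> S \<and> (\<forall>x\<in>S. adj X x \<in> S)"

definition restrict_opsys :: "'a op_system \<Rightarrow> 'a set \<Rightarrow> 'a op_system" where
  "restrict_opsys X S = X\<lparr>carrier := S,
     mcone := \<lambda>n. {x \<in> mcone X n. elements_mat x \<subseteq> S}\<rparr>"

text \<open>
  The norm that the matrix order induces on \<open>M\<^sub>n(X)\<close>; for a C*-algebra it is the C*-norm of
  \<open>M\<^sub>n(A)\<close>.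
\<close>

definition mnorm :: "'a op_system \<Rightarrow> 'a mat \<Rightarrow> real" where
  "mnorm X x = (let n = dim_row x in
     Inf {r. 0 \<le> r \<and>
       four_block_mat (msmult X (of_real r) (munit X n)) x
                      (madj X x) (msmult X (of_real r) (munit X n)) \<in> mcone X (n + n)})"

text \<open>\<open>\<parallel>\<phi>\<parallel>\<^sub>k\<close>, the norm of the amplification of \<open>\<phi> : X \<rightarrow> Y\<close> to \<open>M\<^sub>k\<close>.\<close>

definition amp_norm :: "'a op_system \<Rightarrow> 'b op_system \<Rightarrow> nat \<Rightarrow> ('a \<Rightarrow> 'b) \<Rightarrow> ereal" where
  "amp_norm X Y k \<phi> =
     (SUP x\<in>{x \<in> mats X k k. mnorm X x \<le> 1}. ereal (mnorm Y (map_mat \<phi> x)))"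

definition unital_linear :: "'a op_system \<Rightarrow> 'b op_system \<Rightarrow> ('a \<Rightarrow> 'b) \<Rightarrow> bool" where
  "unital_linear X Y \<phi> \<longleftrightarrow> linear_map class_ring X Y \<phi> \<and> \<phi> \<one>\<^bsub>X\<^esub> = \<one>\<^bsub>Y\<^esub>"

definition ucp :: "'a op_system \<Rightarrow> 'b op_system \<Rightarrow> ('a \<Rightarrow> 'b) \<Rightarrow> bool" where
  "ucp X Y \<phi> \<longleftrightarrow>
     unital_linear X Y \<phi> \<and> (\<forall>n. \<forall>x\<in>mcone X n. map_mat \<phi> x \<in> mcone Y n)"

definition fin_dim_opsys :: "'a op_system \<Rightarrow> bool" where
  "fin_dim_opsys X \<longleftrightarrow> vectorspace.fin_dim class_ring X"


section \<open>CP-stability\<close>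

text \<open>
  HOL cannot quantify over all types inside a definition, so the C*-algebras range over those
  whose carrier is a subset of \<open>'u + real\<close>, with an arbitrary \<open>'u\<close>. The summand \<open>real\<close> makes the
  universe large enough to contain a copy of every separable C*-algebra. Nothing is lost: the
  values of \<open>\<phi>\<close> generate a separable unital C*-subalgebra of \<open>A\<close>, into which the map \<open>\<psi>\<close> may be taken.
\<close>

definition cp_stable :: "'u itself \<Rightarrow> 'a op_system \<Rightarrow> bool" where
  "cp_stable (_ :: 'u itself) X \<longleftrightarrow>
    (\<forall>E. subsystem X E \<and> fin_dim_opsys (restrict_opsys X E) \<longrightarrow>
      (\<forall>\<delta>::real. \<delta> > 0 \<longrightarrow>
        (\<exists>S k. \<exists>\<epsilon>::real.
          subsystem X S \<and> fin_dim_opsys (restrict_opsys X S) \<and> E \<subseteq> S \<and> k > 0 \<and> \<epsilon> > 0 \<and>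
          (\<forall>A :: ('u + real) star_space. unital_cstar_algebra A \<longrightarrow>
            (\<forall>\<phi>. unital_linear (restrict_opsys X S) (cstar_opsys A) \<phi> \<and>
                 amp_norm (restrict_opsys X S) (cstar_opsys A) k \<phi> < ereal (1 + \<epsilon>) \<longrightarrow>
              (\<exists>\<psi>. ucp (restrict_opsys X E) (cstar_opsys A) \<psi> \<and>
                   amp_norm (restrict_opsys X E) (cstar_opsys A) 1 (\<lambda>x. \<phi> x \<ominus>\<^bsub>A\<^esub> \<psi> x)
                     < ereal \<delta>))))))"


section \<open>The C*-algebras of complex matrices and of bounded operators on \<open>\<ell>\<^sup>2\<close>\<close>

definition mat_alg :: "nat \<Rightarrow> complex mat star_space" where
  "mat_alg p = \<lparr>carrier = carrier_mat p p, mult = (*), one = 1\<^sub>m p, zero = 0\<^sub>m p p, add = (+),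
     smult = (\<cdot>\<^sub>m), adj = mat_adjoint\<rparr>"

definition ell2 :: "(nat \<Rightarrow> complex) set" where
  "ell2 = {f. summable (\<lambda>n. (cmod (f n))\<^sup>2)}"

definition ell2_inner :: "(nat \<Rightarrow> complex) \<Rightarrow> (nat \<Rightarrow> complex) \<Rightarrow> complex" where
  "ell2_inner f g = (\<Sum>n. f n * cnj (g n))"

definition ell2_norm :: "(nat \<Rightarrow> complex) \<Rightarrow> real" where
  "ell2_norm f = sqrt (\<Sum>n. (cmod (f n))\<^sup>2)"

definition bounded_ops :: "((nat \<Rightarrow> complex) \<Rightarrow> nat \<Rightarrow> complex) set" where
  "bounded_ops = {T \<in> ell2 \<rightarrow>\<^sub>E ell2.
     (\<forall>f\<in>ell2. \<forall>g\<in>ell2. T (\<lambda>n. f n + g n) = (\<lambda>n. T f n + T g n)) \<and>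
     (\<forall>c. \<forall>f\<in>ell2. T (\<lambda>n. c * f n) = (\<lambda>n. c * T f n)) \<and>
     (\<exists>C. \<forall>f\<in>ell2. ell2_norm (T f) \<le> C * ell2_norm f)}"

definition B_ell2 :: "((nat \<Rightarrow> complex) \<Rightarrow> nat \<Rightarrow> complex) star_space" where
  "B_ell2 = \<lparr>carrier = bounded_ops,
     mult = compose ell2,
     one = (\<lambda>f\<in>ell2. f),
     zero = (\<lambda>f\<in>ell2. \<lambda>n. 0),
     add = (\<lambda>T U. \<lambda>f\<in>ell2. \<lambda>n. T f n + U f n),
     smult = (\<lambda>c T. \<lambda>f\<in>ell2. \<lambda>n. c * T f n),
     adj = (\<lambda>T. THE U. U \<in> bounded_ops \<and>
              (\<forall>f\<in>ell2. \<forall>g\<in>ell2. ell2_inner (T f) g = ell2_inner f (U g)))\<rparr>"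


section \<open>Tensor products of operator systems\<close>

definition bilinear_forms ::
    "('a, 'm) star_space_scheme \<Rightarrow> ('b, 'n) star_space_scheme \<Rightarrow> ('a \<Rightarrow> 'b \<Rightarrow> complex) set" where
  "bilinear_forms X Y = {\<beta>.
     (\<forall>x\<in>carrier X. \<forall>x'\<in>carrier X. \<forall>y\<in>carrier Y. \<beta> (x \<oplus>\<^bsub>X\<^esub> x') y = \<beta> x y + \<beta> x' y) \<and>
     (\<forall>x\<in>carrier X. \<forall>y\<in>carrier Y. \<forall>y'\<in>carrier Y. \<beta> x (y \<oplus>\<^bsub>Y\<^esub> y') = \<beta> x y + \<beta> x y') \<and>
     (\<forall>c. \<forall>x\<in>carrier X. \<forall>y\<in>carrier Y.
        \<beta> (c \<odot>\<^bsub>X\<^esub> x) y = c * \<beta> x y \<and> \<beta> x (c \<odot>\<^bsub>Y\<^esub> y) = c * \<beta> x y)}"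

text \<open>
  The algebraic tensor product of complex vector spaces, realised as the space of functionals on
  the bilinear forms on \<open>X \<times> Y\<close> that is spanned by the evaluations \<open>x \<otimes> y : \<beta> \<mapsto> \<beta> x y\<close>.
  The involution is the one with \<open>(x \<otimes> y)\<^sup>* = x\<^sup>* \<otimes> y\<^sup>*\<close>.
\<close>

definition tens ::
    "('a, 'm) star_space_scheme \<Rightarrow> ('b, 'n) star_space_scheme \<Rightarrow> 'a \<Rightarrow> 'b
      \<Rightarrow> ('a \<Rightarrow> 'b \<Rightarrow> complex) \<Rightarrow> complex" where
  "tens X Y x y = (\<lambda>\<beta>\<in>bilinear_forms X Y. \<beta> x y)"

definition alg_tensor ::
    "('a, 'm) star_space_scheme \<Rightarrow> ('b, 'n) star_space_scheme
      \<Rightarrow> (('a \<Rightarrow> 'b \<Rightarrow> complex) \<Rightarrow> complex) star_space" where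
  "alg_tensor X Y = \<lparr>
     carrier = {(\<lambda>\<beta>\<in>bilinear_forms X Y. \<Sum>i<n. tens X Y (x i) (y i) \<beta>) | (n::nat) x y.
                  \<forall>i<n. x i \<in> carrier X \<and> y i \<in> carrier Y},
     mult = undefined,
     one = tens X Y \<one>\<^bsub>X\<^esub> \<one>\<^bsub>Y\<^esub>,
     zero = (\<lambda>\<beta>\<in>bilinear_forms X Y. 0),
     add = (\<lambda>u v. \<lambda>\<beta>\<in>bilinear_forms X Y. u \<beta> + v \<beta>),
     smult = (\<lambda>c u. \<lambda>\<beta>\<in>bilinear_forms X Y. c * u \<beta>),
     adj = (\<lambda>u. \<lambda>\<beta>\<in>bilinear_forms X Y.
              cnj (u (\<lambda>x y. cnj (\<beta> (adj X x) (adj Y y)))))\<rparr>"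

text \<open>
  For linear \<open>\<phi> : X \<rightarrow> M\<^sub>p\<close> and \<open>\<psi> : Y \<rightarrow> M\<^sub>q\<close>, the linear map \<open>\<phi> \<otimes> \<psi>\<close> into
  \<open>M\<^sub>p \<otimes> M\<^sub>q \<cong> M\<^sub>p\<^sub>q\<close> takes \<open>x \<otimes> y\<close> to the Kronecker product of \<open>\<phi> x\<close> and \<open>\<psi> y\<close>: each
  entry of the Kronecker product is a bilinear form in \<open>(x, y)\<close>, at which the tensor is evaluated.
\<close>

definition tens_map ::
    "nat \<Rightarrow> nat \<Rightarrow> ('a \<Rightarrow> complex mat) \<Rightarrow> ('b \<Rightarrow> complex mat)
      \<Rightarrow> (('a \<Rightarrow> 'b \<Rightarrow> complex) \<Rightarrow> complex) \<Rightarrow> complex mat" where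
  "tens_map p q \<phi> \<psi> u = mat (p * q) (p * q)
     (\<lambda>(r, s). u (\<lambda>x y. \<phi> x $$ (r div q, s div q) * \<psi> y $$ (r mod q, s mod q)))"

definition tensor_min ::
    "'a op_system \<Rightarrow> 'b op_system \<Rightarrow> (('a \<Rightarrow> 'b \<Rightarrow> complex) \<Rightarrow> complex) op_system" where
  "tensor_min X Y = star_space.extend (alg_tensor X Y) (op_system.fields
     (\<lambda>k. {u \<in> mats (alg_tensor X Y) k k.
        \<forall>p q \<phi> \<psi>. ucp X (cstar_opsys (mat_alg p)) \<phi> \<and> ucp Y (cstar_opsys (mat_alg q)) \<psi> \<longrightarrow>
          map_mat (tens_map p q \<phi> \<psi>) u \<in> mcone (cstar_opsys (mat_alg (p * q))) k}))"

definition mtens ::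
    "('a, 'm) star_space_scheme \<Rightarrow> ('b, 'n) star_space_scheme \<Rightarrow> 'a mat \<Rightarrow> 'b mat
      \<Rightarrow> (('a \<Rightarrow> 'b \<Rightarrow> complex) \<Rightarrow> complex) mat" where
  "mtens X Y P Q = (let q = dim_row Q in
     mat (dim_row P * q) (dim_row P * q)
       (\<lambda>(r, s). tens X Y (P $$ (r div q, s div q)) (Q $$ (r mod q, s mod q))))"

definition max_precone ::
    "'a op_system \<Rightarrow> 'b op_system \<Rightarrow> nat \<Rightarrow> (('a \<Rightarrow> 'b \<Rightarrow> complex) \<Rightarrow> complex) mat set" where
  "max_precone X Y k = {mconj (alg_tensor X Y) \<alpha> (mtens X Y P Q) | \<alpha> P Q p q.
     P \<in> mcone X p \<and> Q \<in> mcone Y q \<and> \<alpha> \<in> carrier_mat k (p * q)}"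

definition tensor_max ::
    "'a op_system \<Rightarrow> 'b op_system \<Rightarrow> (('a \<Rightarrow> 'b \<Rightarrow> complex) \<Rightarrow> complex) op_system" where
  "tensor_max X Y = star_space.extend (alg_tensor X Y) (op_system.fields
     (\<lambda>k. {u \<in> mats (alg_tensor X Y) k k. \<forall>r::real. r > 0 \<longrightarrow>
        madd (alg_tensor X Y) u
          (msmult (alg_tensor X Y) (of_real r) (munit (alg_tensor X Y) k)) \<in> max_precone X Y k}))"

end

theory Submission
  imports Defs "HOL-Library.Diagonal_Subsequence" "HOL-Analysis.L2_Norm"
begin

text \<open>
Fix a hermitian basis \<open>e\<^sub>l\<close> of \<open>E\<close> and write \<open>u \<in> M\<^sub>k(E \<otimes> B(\<ell>\<^sup>2))\<close> as \<open>\<Sum>\<^sub>l e\<^sub>l \<otimes> U\<^sub>l\<close>. In the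
  standard basis of \<open>\<ell>\<^sup>2\<close>, the operator matrices \<open>U\<^sub>l\<close> become infinite scalar matrices, that is, \<open>u\<close>
  becomes one infinite matrix \<open>v\<close> over \<open>E\<close>, and minimal positivity of \<open>u\<close> makes all finite corners of
  \<open>v\<close> positive under all u.c.p. maps into matrix algebras (\<open>min_cone_coordinates\<close>). For every \<open>r > 0\<close> one
  needs \<open>u + r 1 = \<alpha> (P \<otimes> Q) \<alpha>\<^sup>*\<close> with \<open>P\<close> positive over \<open>E\<close> and \<open>Q\<close> positive over \<open>B(\<ell>\<^sup>2)\<close>.

  CP-stability provides \<open>n\<close> and \<open>\<epsilon>\<close> such that a unital hermitian map \<open>\<phi> : E \<rightarrow> M\<^sub>m\<close> that is positive up to \<open>\<epsilon>\<close> on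
  the order interval of \<open>M\<^sub>n(E)\<close> is close to a u.c.p. map, with the same \<open>n\<close> and \<open>\<epsilon>\<close> for all \<open>m\<close>
  (\<open>stable_of_cp_stable\<close>). As \<open>M\<^sub>n(E)\<close> is finite-dimensional, the order interval lies, up to \<open>\<epsilon>\<close>, in a
  cone with finitely many strictly positive generators; their direct sum \<open>P\<close> is one positive element
  over \<open>E\<close> such that \<open>\<phi>(P) \<ge> 0\<close> already gives that positivity up to \<open>\<epsilon>\<close> (\<open>test_element\<close>).

  Now suppose that some finite corner of \<open>v + r\<close> is not the contraction of \<open>P\<close> with a positive
  semidefinite scalar matrix \<open>Q\<close>. A separating functional is a map \<open>\<phi> : E \<rightarrow> M\<^sub>N\<close> with
  \<open>\<phi>(P) \<ge> 0\<close> that is negative on the corner. After a small perturbation by a state, \<open>\<phi>\<close> can be made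
  unital by a conjugation, so it is close to a u.c.p. map; but u.c.p. maps are nonnegative on \<open>v\<close>, and the
  summand \<open>r\<close> pays for the distance. This contradiction gives matrices \<open>Q\<^sub>N\<close> for all \<open>N\<close>
  with one and the same \<open>P\<close> (\<open>finite_stage\<close>).

  The matrices \<open>Q\<^sub>N\<close> are uniformly bounded because \<open>P\<close> is strictly positive, so their upper triangular
  Cholesky factors converge entrywise along a subsequence. An entry of a Gram matrix of an upper triangular
  matrix is a finite sum whose length is independent of \<open>N\<close>, so the factorization survives in the
  limit (\<open>infinite_factorization\<close>). The limit is a bounded operator matrix \<open>Y\<close>, and \<open>Q = Y\<^sup>* Y\<close> proves that
  the minimal cone lies in the maximal one (\<open>min_le_max\<close>).

  Conversely, \<open>\<phi> \<otimes> \<psi>\<close> maps \<open>\<alpha> (P \<otimes> Q) \<alpha>\<^sup>*\<close> to a compression of the Kronecker product of the positive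
  semidefinite matrices \<open>\<phi>(P)\<close> and \<open>\<psi>(Q)\<close>, and \<open>r\<close> may tend to \<open>0\<close> (\<open>max_le_min\<close>).
\<close>

section \<open>Positive semidefinite kernels\<close>

lemma complex_nonneg_iff: "0 \<le> (z::complex) \<longleftrightarrow> 0 \<le> Re z \<and> Im z = 0"
  by (auto simp: less_eq_complex_def)

lemma cmod_sq: "(complex_of_real (cmod z))\<^sup>2 = z * cnj z"
  using complex_norm_square[of z] by simp

lemma sum_pair: "(\<Sum>p\<in>A\<times>B. G (fst p) (snd p)) = (\<Sum>a\<in>A. \<Sum>b\<in>B. G a b)"
  by (simp add: sum.cartesian_product case_prod_unfold)

abbreviation "grid m n \<equiv> {..<m::nat} \<times> {..<n::nat}"

text \<open>
  Kernels on arbitrary index sets replace matrices: a matrix with matrix entries is a kernel on a product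
  of index sets, without any renumbering. Since \<open>0 \<le> z\<close> for complex \<open>z\<close> includes that \<open>z\<close> is real, positive
  semidefinite kernels are hermitian.
\<close>

definition qform :: "'i set \<Rightarrow> ('i \<Rightarrow> 'i \<Rightarrow> complex) \<Rightarrow> ('i \<Rightarrow> complex) \<Rightarrow> complex" where
  "qform I A f = (\<Sum>i\<in>I. \<Sum>j\<in>I. cnj (f i) * A i j * f j)"

definition psd :: "'i set \<Rightarrow> ('i \<Rightarrow> 'i \<Rightarrow> complex) \<Rightarrow> bool" where
  "psd I A \<longleftrightarrow> (\<forall>f. 0 \<le> qform I A f)"

lemma qform_cong:
  "(\<And>i j. i \<in> I \<Longrightarrow> j \<in> I \<Longrightarrow> A i j = B i j) \<Longrightarrow> (\<And>i. i \<in> I \<Longrightarrow> f i = g i) \<Longrightarrow> qform I A f = qform I B g"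
  unfolding qform_def by (intro sum.cong) auto

lemma psd_cong: "(\<And>i j. i \<in> I \<Longrightarrow> j \<in> I \<Longrightarrow> A i j = B i j) \<Longrightarrow> psd I A \<Longrightarrow> psd I B"
  unfolding psd_def using qform_cong[of I A B] by metis

lemma psdD: "psd I A \<Longrightarrow> 0 \<le> qform I A f"
  unfolding psd_def by blast

lemma qform_add: "qform I (\<lambda>i j. A i j + B i j) f = qform I A f + qform I B f"
  unfolding qform_def by (simp add: algebra_simps sum.distrib)

lemma qform_scale: "qform I (\<lambda>i j. c * A i j) f = c * qform I A f"
  unfolding qform_def by (simp add: sum_distrib_left mult.assoc mult.left_commute)

lemma qform_sum: "qform I (\<lambda>i j. \<Sum>k\<in>K. A k i j) f = (\<Sum>k\<in>K. qform I (A k) f)"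
proof -
  have "qform I (\<lambda>i j. \<Sum>k\<in>K. A k i j) f = (\<Sum>i\<in>I. \<Sum>j\<in>I. \<Sum>k\<in>K. cnj (f i) * A k i j * f j)"
    unfolding qform_def by (simp add: sum_distrib_left sum_distrib_right)
  also have "\<dots> = (\<Sum>i\<in>I. \<Sum>k\<in>K. \<Sum>j\<in>I. cnj (f i) * A k i j * f j)"
    by (intro sum.cong refl sum.swap)
  also have "\<dots> = (\<Sum>k\<in>K. \<Sum>i\<in>I. \<Sum>j\<in>I. cnj (f i) * A k i j * f j)"
    by (rule sum.swap)
  finally show ?thesis unfolding qform_def .
qed

lemma qform_identity:
  assumes "finite I"
  shows "qform I (\<lambda>i j. if i = j then c else 0) f = c * of_real (\<Sum>i\<in>I. (cmod (f i))\<^sup>2)"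
proof -
  have "qform I (\<lambda>i j. if i = j then c else 0) f = (\<Sum>i\<in>I. c * (f i * cnj (f i)))"
    unfolding qform_def using assms by (intro sum.cong refl) (simp add: if_distrib if_distribR sum.delta cong: if_cong)
  thus ?thesis by (simp add: sum_distrib_left cmod_sq)
qed

lemma psd_add: "psd I A \<Longrightarrow> psd I B \<Longrightarrow> psd I (\<lambda>i j. A i j + B i j)"
  unfolding psd_def qform_add by simp

lemma psd_scale: "psd I A \<Longrightarrow> 0 \<le> c \<Longrightarrow> psd I (\<lambda>i j. complex_of_real c * A i j)"
  unfolding psd_def qform_scale by (simp add: complex_nonneg_iff)

lemma psd_sum: "(\<And>k. k \<in> K \<Longrightarrow> psd I (A k)) \<Longrightarrow> psd I (\<lambda>i j. \<Sum>k\<in>K. A k i j)"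
  unfolding psd_def qform_sum by (simp add: sum_nonneg)

lemma psd_identity: "finite I \<Longrightarrow> 0 \<le> c \<Longrightarrow> psd I (\<lambda>i j. if i = j then complex_of_real c else 0)"
  unfolding psd_def
  by (simp add: qform_identity sum_nonneg less_eq_complex_def del: of_real_sum)

lemma sum_swap_pairs:
  "(\<Sum>a\<in>A. \<Sum>b\<in>B. \<Sum>i\<in>I. \<Sum>j\<in>J. F a b i j) = (\<Sum>i\<in>I. \<Sum>j\<in>J. \<Sum>a\<in>A. \<Sum>b\<in>B. F a b i j)"
proof -
  have "(\<Sum>a\<in>A. \<Sum>b\<in>B. \<Sum>i\<in>I. \<Sum>j\<in>J. F a b i j) = (\<Sum>p\<in>A\<times>B. \<Sum>q\<in>I\<times>J. F (fst p) (snd p) (fst q) (snd q))"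
    by (subst sum_pair[where G = "\<lambda>a b. \<Sum>q\<in>I\<times>J. F a b (fst q) (snd q)"], intro sum.cong refl)
      (rule sum_pair[symmetric])
  also have "\<dots> = (\<Sum>q\<in>I\<times>J. \<Sum>p\<in>A\<times>B. F (fst p) (snd p) (fst q) (snd q))" by (rule sum.swap)
  also have "\<dots> = (\<Sum>i\<in>I. \<Sum>j\<in>J. \<Sum>a\<in>A. \<Sum>b\<in>B. F a b i j)"
    by (subst sum_pair[where G = "\<lambda>i j. \<Sum>p\<in>A\<times>B. F (fst p) (snd p) i j"], intro sum.cong refl)
      (rule sum_pair)
  finally show ?thesis .
qed

lemma qform_conj:
  "qform J (\<lambda>i j. \<Sum>a\<in>I. \<Sum>b\<in>I. cnj (\<alpha> a i) * A a b * \<alpha> b j) f = qform I A (\<lambda>a. \<Sum>j\<in>J. \<alpha> a j * f j)"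
proof -
  have "qform J (\<lambda>i j. \<Sum>a\<in>I. \<Sum>b\<in>I. cnj (\<alpha> a i) * A a b * \<alpha> b j) f
      = (\<Sum>i\<in>J. \<Sum>j\<in>J. \<Sum>a\<in>I. \<Sum>b\<in>I. cnj (\<alpha> a i) * cnj (f i) * A a b * (\<alpha> b j * f j))"
    unfolding qform_def by (simp add: sum_distrib_left sum_distrib_right mult_ac)
  also have "\<dots> = (\<Sum>a\<in>I. \<Sum>b\<in>I. \<Sum>i\<in>J. \<Sum>j\<in>J. cnj (\<alpha> a i) * cnj (f i) * A a b * (\<alpha> b j * f j))"
    by (rule sum_swap_pairs)
  also have "\<dots> = (\<Sum>a\<in>I. \<Sum>b\<in>I. cnj (\<Sum>i\<in>J. \<alpha> a i * f i) * A a b * (\<Sum>j\<in>J. \<alpha> b j * f j))"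
    by (simp add: sum_distrib_left sum_distrib_right)
      (intro sum.cong refl sum.swap)
  finally show ?thesis unfolding qform_def .
qed

lemma psd_conj:
  "psd I A \<Longrightarrow> psd J (\<lambda>i j. \<Sum>a\<in>I. \<Sum>b\<in>I. cnj (\<alpha> a i) * A a b * \<alpha> b j)"
  unfolding psd_def qform_conj by simp

lemma psd_pullback:
  assumes "psd I A" "finite I" "g ` J \<subseteq> I"
  shows "psd J (\<lambda>i j. A (g i) (g j))"
proof (rule psd_cong[OF _ psd_conj[OF assms(1), of J "\<lambda>a j. if a = g j then 1 else 0"]])
  fix i j assume "i \<in> J" "j \<in> J"
  hence m: "g i \<in> I" "g j \<in> I" using assms by auto
  have "(\<Sum>a\<in>I. \<Sum>b\<in>I. cnj (if a = g i then 1 else 0) * A a b * (if b = g j then 1 else 0))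
     = (\<Sum>a\<in>I. if a = g i then A a (g j) else 0)"
  proof (intro sum.cong refl)
    fix a
    have "(\<Sum>b\<in>I. cnj (if a = g i then 1 else 0) * A a b * (if b = g j then 1 else 0))
       = (\<Sum>b\<in>I. if b = g j then (if a = g i then A a b else 0) else 0)"
      by (intro sum.cong) auto
    thus "(\<Sum>b\<in>I. cnj (if a = g i then 1 else 0) * A a b * (if b = g j then 1 else 0))
       = (if a = g i then A a (g j) else 0)"
      using m assms(2) by simp
  qed
  also have "\<dots> = A (g i) (g j)" using m assms(2) by simp
  finally show "(\<Sum>a\<in>I. \<Sum>b\<in>I. cnj (if a = g i then 1 else 0) * A a b * (if b = g j then 1 else 0)) = A (g i) (g j)" .
qed

lemma psd_subset: "psd I A \<Longrightarrow> finite I \<Longrightarrow> J \<subseteq> I \<Longrightarrow> psd J A"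
  using psd_pullback[of I A "\<lambda>x. x" J] by simp

lemma qform_gram:
  "qform I (\<lambda>i j. \<Sum>w\<in>W. cnj (R w i) * R w j) f = of_real (\<Sum>w\<in>W. (cmod (\<Sum>i\<in>I. R w i * f i))\<^sup>2)"
proof -
  have "qform I (\<lambda>i j. \<Sum>w\<in>W. cnj (R w i) * R w j) f = (\<Sum>w\<in>W. qform I (\<lambda>i j. cnj (R w i) * R w j) f)"
    by (rule qform_sum)
  also have "\<dots> = (\<Sum>w\<in>W. (\<Sum>i\<in>I. R w i * f i) * cnj (\<Sum>i\<in>I. R w i * f i))"
  proof (intro sum.cong refl)
    fix w
    show "qform I (\<lambda>i j. cnj (R w i) * R w j) f = (\<Sum>i\<in>I. R w i * f i) * cnj (\<Sum>i\<in>I. R w i * f i)"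
    proof -
      have "qform I (\<lambda>i j. cnj (R w i) * R w j) f = cnj (\<Sum>i\<in>I. R w i * f i) * (\<Sum>i\<in>I. R w i * f i)"
        unfolding qform_def cnj_sum sum_product by (intro sum.cong refl) (simp add: mult_ac)
      thus ?thesis by (simp only: mult.commute)
    qed
  qed
  finally show ?thesis by (simp add: cmod_sq)
qed

lemma psd_gram: "psd I (\<lambda>i j. \<Sum>w\<in>W. cnj (R w i) * R w j)"
  unfolding psd_def qform_gram by (simp add: less_eq_complex_def sum_nonneg)

lemma psd_diag:
  assumes "psd I A" "finite I" "i \<in> I" shows "0 \<le> A i i"
  using psdD[OF psd_subset[OF assms(1,2), of "{i}"], of "\<lambda>_. 1"] assms(3) by (simp add: qform_def)

lemma psd_pair:
  assumes "psd I A" "finite I" "i \<in> I" "j \<in> I" "i \<noteq> j"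
  shows "0 \<le> cnj a * A i i * a + cnj a * A i j * b + cnj b * A j i * a + cnj b * A j j * b"
  using psdD[OF psd_subset[OF assms(1,2), of "{i,j}"], of "\<lambda>x. if x = i then a else b"] assms(3-5)
  by (simp add: qform_def add_ac)

lemma psd_hermitian:
  assumes "psd I A" "finite I" "i \<in> I" "j \<in> I"
  shows "A j i = cnj (A i j)"
proof (cases "i = j")
  case True
  thus ?thesis using psd_diag[OF assms(1-3)] by (auto simp: complex_nonneg_iff complex_eq_iff)
next
  case False
  from psd_diag[OF assms(1,2,3)] psd_diag[OF assms(1,2,4)]
  have "Im (A i i) = 0" "Im (A j j) = 0" by (auto simp: complex_nonneg_iff)
  with psd_pair[OF assms False, of 1 1] psd_pair[OF assms False, of 1 \<i>]
  show ?thesis by (auto simp: complex_nonneg_iff complex_eq_iff)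
qed

text \<open>
  The \<open>2 \<times> 2\<close> minor at \<open>i\<close> and \<open>j\<close> has determinant \<open>- \<bar>A i j\<bar>\<^sup>2\<close>.
\<close>

lemma psd_zero_diag:
  assumes "psd I A" "finite I" "i \<in> I" "j \<in> I" "A i i = 0"
  shows "A i j = 0"
proof (rule ccontr)
  assume nz: "A i j \<noteq> 0"
  hence ne: "i \<noteq> j" using assms(5) by auto
  have h: "A j i = cnj (A i j)" by (rule psd_hermitian[OF assms(1-4)])
  define s where "s = (cmod (A i j))\<^sup>2"
  have s: "s > 0" using nz by (simp add: s_def)
  define t where "t = (Re (A j j) + 1) / s"
  have e: "A i j * cnj (A i j) = of_real s" unfolding s_def by (simp add: cmod_sq)
  have "0 \<le> cnj (- of_real t * A i j) * A i j * 1 + cnj 1 * A j i * (- of_real t * A i j) + cnj 1 * A j j * 1"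
    using psd_pair[OF assms(1-4) ne, of "- of_real t * A i j" 1] assms(5) by simp
  also have "\<dots> = - 2 * of_real t * (A i j * cnj (A i j)) + A j j" by (simp add: h algebra_simps)
  also have "\<dots> = of_real (- 2 * t * s) + A j j" by (simp add: e)
  finally have "0 \<le> - 2 * (t * s) + Re (A j j)" by (simp add: complex_nonneg_iff)
  moreover have "t * s = Re (A j j) + 1" using s by (simp add: t_def)
  ultimately have "0 \<le> - Re (A j j) - 2" by simp
  thus False using psd_diag[OF assms(1,2,4)] by (auto simp: complex_nonneg_iff)
qed

text \<open>
  Triangularity is what makes limits of such factors possible later: the sum for \<open>A i j\<close> has at
  most \<open>min i j + 1\<close> nonzero terms, whatever \<open>n\<close> is. The proof eliminates the first row and column, and the Schur
  complement \<open>B\<close> that remains is positive semidefinite again.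
\<close>

lemma cholesky:
  "psd {..<n::nat} A \<Longrightarrow> \<exists>R. (\<forall>w j. j < w \<longrightarrow> R w j = 0) \<and>
     (\<forall>i<n. \<forall>j<n. A i j = (\<Sum>w<n. cnj (R w i) * R w j))"
proof (induction n arbitrary: A)
  case 0 show ?case by (intro exI[of _ "\<lambda>_ _. 0"]) auto
next
  case (Suc n)
  note A = Suc.prems
  have herm: "A j i = cnj (A i j)" if "i < Suc n" "j < Suc n" for i j
    by (rule psd_hermitian[OF A]) (use that in auto)
  define c where "c = Re (A 0 0)"
  have "0 \<le> A 0 0" using psd_diag[OF A, of 0] by simp
  hence c: "A 0 0 = of_real c" "c \<ge> 0" by (auto simp: c_def complex_nonneg_iff complex_eq_iff)
  have z: "A 0 j = 0" if "c = 0" "j < Suc n" for j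
    using psd_zero_diag[OF A, of 0 j] that c by auto
  define R0 where "R0 j = A 0 j / of_real (sqrt c)" for j
  have R0R0: "cnj (R0 i) * R0 j = cnj (A 0 i) * A 0 j / of_real c" for i j
  proof -
    have "complex_of_real (sqrt c) * complex_of_real (sqrt c) = of_real c"
      using c(2) by (metis of_real_mult real_sqrt_mult_self abs_of_nonneg)
    thus ?thesis unfolding R0_def by simp
  qed
  define B where "B i j = A (Suc i) (Suc j) - cnj (R0 (Suc i)) * R0 (Suc j)" for i j
  have "psd {..<n} B"
    unfolding psd_def
  proof
    fix f
    define s where "s = (\<Sum>j<n. A 0 (Suc j) * f j)"
    define T where "T = qform {..<n} (\<lambda>i j. A (Suc i) (Suc j)) f"
    have s0: "s = 0" if "c = 0" using z that by (simp add: s_def)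
    have qB: "qform {..<n} B f = T - cnj s * s / of_real c"
    proof -
      have "qform {..<n} B f = T - (\<Sum>i<n. \<Sum>j<n. cnj (f i) * (cnj (R0 (Suc i)) * R0 (Suc j)) * f j)"
        unfolding T_def qform_def B_def by (simp add: algebra_simps sum_subtractf)
      also have "(\<Sum>i<n. \<Sum>j<n. cnj (f i) * (cnj (R0 (Suc i)) * R0 (Suc j)) * f j) = cnj s * s / of_real c"
        unfolding R0R0 s_def cnj_sum sum_product sum_divide_distrib
        by (intro sum.cong refl) (simp add: mult_ac)
      finally show ?thesis .
    qed
    define g where "g i = (if i = 0 then - s / of_real c else f (i - 1))" for i :: nat
    have s': "(\<Sum>i<n. cnj (f i) * A (Suc i) 0) = cnj s"
      unfolding s_def cnj_sum by (intro sum.cong refl) (auto simp: herm[of 0])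
    have gS: "g (Suc i) = f i" for i by (simp add: g_def)
    have sp1: "(\<Sum>j<n. cnj (g 0) * A 0 (Suc j) * f j) = cnj (g 0) * s"
      unfolding s_def sum_distrib_left by (simp only: mult.assoc)
    have sp2: "(\<Sum>i<n. cnj (f i) * A (Suc i) 0 * g 0) = cnj s * g 0"
      unfolding s'[symmetric] sum_distrib_right ..
    have sp: "qform {..<Suc n} A g = cnj (g 0) * A 0 0 * g 0 + cnj (g 0) * s + (cnj s * g 0 + T)"
      unfolding qform_def sum.lessThan_Suc_shift T_def gS sum.distrib sp1 sp2
      by (simp only: add_ac)
    have "qform {..<Suc n} A g = qform {..<n} B f"
    proof (cases "c = 0")
      case True thus ?thesis unfolding sp qB by (simp add: s0 g_def c(1))
    next
      case False thus ?thesis unfolding sp qB c(1) by (simp add: g_def field_simps)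
    qed
    thus "0 \<le> qform {..<n} B f" using psdD[OF A, of g] by simp
  qed
  from Suc.IH[OF this] obtain R where R: "\<And>w j. j < w \<Longrightarrow> R w j = 0"
    "\<And>i j. i < n \<Longrightarrow> j < n \<Longrightarrow> B i j = (\<Sum>w<n. cnj (R w i) * R w j)" by blast
  define R' where "R' w j = (case w of 0 \<Rightarrow> R0 j | Suc w' \<Rightarrow> (case j of 0 \<Rightarrow> 0 | Suc j' \<Rightarrow> R w' j'))" for w j
  have "\<forall>w j. j < w \<longrightarrow> R' w j = 0" by (auto simp: R'_def R(1) split: nat.splits)
  moreover have "A i j = (\<Sum>w<Suc n. cnj (R' w i) * R' w j)" if ij: "i < Suc n" "j < Suc n" for i j
  proof -
    have cs: "(\<Sum>w<Suc n. cnj (R' w i) * R' w j) = cnj (A 0 i) * A 0 j / of_real c + (\<Sum>w<n. cnj (R' (Suc w) i) * R' (Suc w) j)"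
      by (simp add: sum.lessThan_Suc_shift R'_def R0R0 del: sum.lessThan_Suc)
    show ?thesis
    proof (cases "i = 0 \<or> j = 0")
      case True
      have "(\<Sum>w<n. cnj (R' (Suc w) i) * R' (Suc w) j) = 0" using True by (auto simp: R'_def)
      moreover have "cnj (A 0 i) * A 0 j / of_real c = A i j"
      proof (cases "c = 0")
        case True
        hence "A 0 i = 0" "A 0 j = 0" using z ij by auto
        moreover from this have "A i 0 = 0" using herm[of 0 i] ij by simp
        ultimately have "A i j = 0" using \<open>i = 0 \<or> j = 0\<close> by metis
        thus ?thesis using True by simp
      next
        case False
        have "cnj (A 0 0) = A 0 0" using c by simp
        moreover have "A i 0 = cnj (A 0 i)" using herm[of 0 i] ij by simp
        ultimately show ?thesis using \<open>i = 0 \<or> j = 0\<close> c(1) False by fastforce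
      qed
      ultimately show ?thesis using cs by simp
    next
      case False
      then obtain i' j' where e: "i = Suc i'" "j = Suc j'" by (auto simp: gr0_conv_Suc)
      have "(\<Sum>w<n. cnj (R' (Suc w) i) * R' (Suc w) j) = B i' j'"
        using ij e by (simp add: R'_def R(2))
      thus ?thesis unfolding cs by (simp add: B_def e R0R0)
    qed
  qed
  ultimately show ?case by blast
qed

lemma psd_factor:
  assumes "psd I A" "finite I"
  obtains R where "\<And>i j. i \<in> I \<Longrightarrow> j \<in> I \<Longrightarrow> A i j = (\<Sum>w<card I. cnj (R w i) * R w j)"
proof -
  obtain h where h: "bij_betw h {..<card I} I"
    using ex_bij_betw_nat_finite[OF assms(2)] by (auto simp: atLeast0LessThan)
  have "psd {..<card I} (\<lambda>i j. A (h i) (h j))"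
    by (rule psd_pullback[OF assms]) (use h in \<open>auto simp: bij_betw_def\<close>)
  from cholesky[OF this] obtain R where
    R: "\<And>i j. i < card I \<Longrightarrow> j < card I \<Longrightarrow> A (h i) (h j) = (\<Sum>w<card I. cnj (R w i) * R w j)" by blast
  define k where "k = inv_into {..<card I} h"
  have k: "h (k i) = i" "k i < card I" if "i \<in> I" for i
    using bij_betw_inv_into_right[OF h that] bij_betw_apply[OF bij_betw_inv_into[OF h] that]
    by (auto simp: k_def)
  have "A i j = (\<Sum>w<card I. cnj (R w (k i)) * R w (k j))" if "i \<in> I" "j \<in> I" for i j
    using R[OF k(2)[OF that(1)] k(2)[OF that(2)]] k(1)[OF that(1)] k(1)[OF that(2)] by simp
  thus ?thesis by (rule that)
qed

text \<open>
  A Gram factorization of \<open>A\<close> turns the sum into a sum of conjugations of \<open>B\<close> by scalar matrices.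
\<close>

lemma psd_partial_schur:
  assumes A: "psd G A" "finite G" and B: "psd (I \<times> G) (\<lambda>(i,g) (j,h). B i g j h)" "finite I"
  shows "psd I (\<lambda>i j. \<Sum>g\<in>G. \<Sum>h\<in>G. A g h * B i g j h)"
proof -
  from psd_factor[OF A] obtain R where
    R: "\<And>g h. g \<in> G \<Longrightarrow> h \<in> G \<Longrightarrow> A g h = (\<Sum>w<card G. cnj (R w g) * R w h)" by blast
  have "psd I (\<lambda>i j. \<Sum>w<card G. \<Sum>a\<in>I\<times>G. \<Sum>b\<in>I\<times>G.
     cnj (if fst a = i then R w (snd a) else 0) * (case a of (i,g) \<Rightarrow> \<lambda>(j,h). B i g j h) b * (if fst b = j then R w (snd b) else 0))"
    by (rule psd_sum, rule psd_conj, rule B(1))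
  then show ?thesis
  proof (rule psd_cong[rotated])
    fix i j assume ij: "i \<in> I" "j \<in> I"
    have "(\<Sum>w<card G. \<Sum>a\<in>I\<times>G. \<Sum>b\<in>I\<times>G.
       cnj (if fst a = i then R w (snd a) else 0) * (case a of (i,g) \<Rightarrow> \<lambda>(j,h). B i g j h) b * (if fst b = j then R w (snd b) else 0))
      = (\<Sum>w<card G. \<Sum>i'\<in>I. \<Sum>g\<in>G. \<Sum>j'\<in>I. \<Sum>h\<in>G.
          if i' = i \<and> j' = j then cnj (R w g) * B i g j h * R w h else 0)"
    proof (intro sum.cong refl)
      fix w
      let ?F = "\<lambda>a b. cnj (if fst a = i then R w (snd a) else 0) * (case a of (i,g) \<Rightarrow> \<lambda>(j,h). B i g j h) b * (if fst b = j then R w (snd b) else 0)"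
      have "(\<Sum>a\<in>I\<times>G. \<Sum>b\<in>I\<times>G. ?F a b) = (\<Sum>a\<in>I\<times>G. \<Sum>b\<in>I\<times>G. ?F (fst a, snd a) (fst b, snd b))"
        by (simp only: prod.collapse)
      also have "\<dots> = (\<Sum>a\<in>I\<times>G. \<Sum>j'\<in>I. \<Sum>h\<in>G. ?F (fst a, snd a) (j', h))"
        by (intro sum.cong refl sum_pair)
      also have "\<dots> = (\<Sum>i'\<in>I. \<Sum>g\<in>G. \<Sum>j'\<in>I. \<Sum>h\<in>G. ?F (i', g) (j', h))"
        by (rule sum_pair)
      also have "\<dots> = (\<Sum>i'\<in>I. \<Sum>g\<in>G. \<Sum>j'\<in>I. \<Sum>h\<in>G. if i' = i \<and> j' = j then cnj (R w g) * B i g j h * R w h else 0)"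
        by (intro sum.cong refl) auto
      finally show "(\<Sum>a\<in>I\<times>G. \<Sum>b\<in>I\<times>G. ?F a b) = (\<Sum>i'\<in>I. \<Sum>g\<in>G. \<Sum>j'\<in>I. \<Sum>h\<in>G. if i' = i \<and> j' = j then cnj (R w g) * B i g j h * R w h else 0)" .
    qed
    also have "\<dots> = (\<Sum>w<card G. \<Sum>g\<in>G. \<Sum>h\<in>G. cnj (R w g) * B i g j h * R w h)"
    proof (intro sum.cong refl)
      fix w
      have "(\<Sum>i'\<in>I. \<Sum>g\<in>G. \<Sum>j'\<in>I. \<Sum>h\<in>G. if i' = i \<and> j' = j then cnj (R w g) * B i g j h * R w h else 0)
        = (\<Sum>i'\<in>I. if i' = i then (\<Sum>g\<in>G. \<Sum>j'\<in>I. if j' = j then (\<Sum>h\<in>G. cnj (R w g) * B i g j h * R w h) else 0) else 0)"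
        by (intro sum.cong refl) (auto intro!: sum.cong)
      also have "\<dots> = (\<Sum>g\<in>G. \<Sum>h\<in>G. cnj (R w g) * B i g j h * R w h)" using ij B(2) by simp
      finally show "(\<Sum>i'\<in>I. \<Sum>g\<in>G. \<Sum>j'\<in>I. \<Sum>h\<in>G. if i' = i \<and> j' = j then cnj (R w g) * B i g j h * R w h else 0)
        = (\<Sum>g\<in>G. \<Sum>h\<in>G. cnj (R w g) * B i g j h * R w h)" .
    qed
    also have "\<dots> = (\<Sum>g\<in>G. \<Sum>h\<in>G. \<Sum>w<card G. cnj (R w g) * B i g j h * R w h)"
      by (subst sum.swap, intro sum.cong refl sum.swap)
    also have "\<dots> = (\<Sum>g\<in>G. \<Sum>h\<in>G. A g h * B i g j h)"
      by (intro sum.cong refl) (simp add: R sum_distrib_left sum_distrib_right mult_ac)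
    finally show "(\<Sum>w<card G. \<Sum>a\<in>I\<times>G. \<Sum>b\<in>I\<times>G.
       cnj (if fst a = i then R w (snd a) else 0) * (case a of (i,g) \<Rightarrow> \<lambda>(j,h). B i g j h) b * (if fst b = j then R w (snd b) else 0))
      = (\<Sum>g\<in>G. \<Sum>h\<in>G. A g h * B i g j h)" .
  qed
qed

lemma psd_limit:
  assumes "finite I" "\<And>n::nat. psd I (A n)" "\<And>i j. i \<in> I \<Longrightarrow> j \<in> I \<Longrightarrow> (\<lambda>n. A n i j) \<longlonglongrightarrow> B i j"
  shows "psd I B"
  unfolding psd_def
proof
  fix f
  have l: "(\<lambda>n. qform I (A n) f) \<longlonglongrightarrow> qform I B f"
    unfolding qform_def by (intro tendsto_intros assms(3))
  have "0 \<le> Re (qform I B f)"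
    by (rule LIMSEQ_le_const[OF tendsto_Re[OF l]]) (use psdD[OF assms(2)] in \<open>auto simp: complex_nonneg_iff\<close>)
  moreover have "(\<lambda>n. Im (qform I (A n) f)) = (\<lambda>_. 0)"
    using psdD[OF assms(2)] by (auto simp: complex_nonneg_iff)
  hence "Im (qform I B f) = 0" using tendsto_Im[OF l] by (simp add: LIMSEQ_const_iff)
  ultimately show "0 \<le> qform I B f" by (simp add: complex_nonneg_iff)
qed

definition opbound :: "'i set \<Rightarrow> ('i \<Rightarrow> 'i \<Rightarrow> complex) \<Rightarrow> real \<Rightarrow> bool" where
  "opbound I A B \<longleftrightarrow> (\<forall>f. (\<Sum>i\<in>I. (cmod (\<Sum>j\<in>I. A i j * f j))\<^sup>2) \<le> B\<^sup>2 * (\<Sum>j\<in>I. (cmod (f j))\<^sup>2))"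

lemma opbound_mono: "opbound I A B \<Longrightarrow> 0 \<le> B \<Longrightarrow> B \<le> B' \<Longrightarrow> opbound I A B'"
  unfolding opbound_def
  by (meson order_trans mult_right_mono power_mono sum_nonneg zero_le_power2)

lemma weighted_am_gm: "(t::real) > 0 \<Longrightarrow> a * b \<le> (t * a\<^sup>2 + b\<^sup>2 / t) / 2"
proof -
  assume t: "t > 0"
  have "0 \<le> (t * a - b)\<^sup>2 / t" using t by simp
  also have "\<dots> = t * a\<^sup>2 + b\<^sup>2 / t - 2 * (a * b)" using t by (simp add: power2_eq_square field_simps)
  finally show ?thesis by simp
qed

lemma norm_pairing_le:
  assumes t: "t > 0" and b: "(\<Sum>i\<in>I. (cmod (z i))\<^sup>2) \<le> t\<^sup>2 * (\<Sum>i\<in>I. (cmod (f i))\<^sup>2)"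
  shows "cmod (\<Sum>i\<in>I. cnj (f i) * z i) \<le> t * (\<Sum>i\<in>I. (cmod (f i))\<^sup>2)"
proof -
  have "cmod (\<Sum>i\<in>I. cnj (f i) * z i) \<le> (\<Sum>i\<in>I. cmod (f i) * cmod (z i))"
    by (rule order_trans[OF norm_sum]) (simp add: norm_mult)
  also have "\<dots> \<le> (\<Sum>i\<in>I. (t * (cmod (f i))\<^sup>2 + (cmod (z i))\<^sup>2 / t) / 2)"
    by (intro sum_mono weighted_am_gm t)
  also have "\<dots> = (t * (\<Sum>i\<in>I. (cmod (f i))\<^sup>2) + (\<Sum>i\<in>I. (cmod (z i))\<^sup>2) / t) / 2"
    by (simp add: sum.distrib sum_distrib_left flip: sum_divide_distrib)
  also have "\<dots> \<le> (t * (\<Sum>i\<in>I. (cmod (f i))\<^sup>2) + (t\<^sup>2 * (\<Sum>i\<in>I. (cmod (f i))\<^sup>2)) / t) / 2"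
    using b t by (intro divide_right_mono add_left_mono) auto
  also have "\<dots> = t * (\<Sum>i\<in>I. (cmod (f i))\<^sup>2)" using t by (simp add: power2_eq_square)
  finally show ?thesis .
qed

lemma qform_opbound:
  assumes "opbound I A B" "B > 0"
  shows "cmod (qform I A f) \<le> B * (\<Sum>i\<in>I. (cmod (f i))\<^sup>2)"
proof -
  have "qform I A f = (\<Sum>i\<in>I. cnj (f i) * (\<Sum>j\<in>I. A i j * f j))"
    unfolding qform_def by (simp add: sum_distrib_left mult.assoc)
  moreover have "(\<Sum>i\<in>I. (cmod (\<Sum>j\<in>I. A i j * f j))\<^sup>2) \<le> B\<^sup>2 * (\<Sum>j\<in>I. (cmod (f j))\<^sup>2)"
    using assms(1) by (simp add: opbound_def)
  ultimately show ?thesis using norm_pairing_le[OF assms(2), where f = f] by simp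
qed

text \<open>
  Apply \<open>y\<close> and \<open>w\<close> one after the other, each in its own tensor factor.
\<close>

lemma qform_tensor_opbound:
  assumes y: "opbound C y \<delta>" "\<delta> > 0" and w: "opbound I w B" "B > 0"
  shows "cmod (qform (I \<times> C) (\<lambda>(i,c) (j,c'). w i j * y c c') \<xi>)
    \<le> \<delta> * B * (\<Sum>i\<in>I\<times>C. (cmod (\<xi> i))\<^sup>2)"
proof -
  define \<eta> where "\<eta> i c' = (\<Sum>j\<in>I. w i j * \<xi> (j,c'))" for i c'
  define z where "z p = (\<Sum>c'\<in>C. y (snd p) c' * \<eta> (fst p) c')" for p
  have "qform (I \<times> C) (\<lambda>(i,c) (j,c'). w i j * y c c') \<xi> = (\<Sum>p\<in>I\<times>C. cnj (\<xi> p) * z p)"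
    unfolding qform_def
  proof (rule sum.cong[OF refl])
    fix p
    have "(\<Sum>q\<in>I\<times>C. cnj (\<xi> p) * (case p of (i,c) \<Rightarrow> \<lambda>(j,c'). w i j * y c c') q * \<xi> q)
      = (\<Sum>j\<in>I. \<Sum>c'\<in>C. cnj (\<xi> p) * (w (fst p) j * y (snd p) c') * \<xi> (j,c'))"
      by (simp add: sum.cartesian_product case_prod_unfold)
    also have "\<dots> = (\<Sum>c'\<in>C. \<Sum>j\<in>I. cnj (\<xi> p) * (w (fst p) j * y (snd p) c') * \<xi> (j,c'))"
      by (rule sum.swap)
    also have "\<dots> = cnj (\<xi> p) * z p"
      unfolding z_def \<eta>_def by (simp add: sum_distrib_left mult_ac)
    finally show "(\<Sum>q\<in>I\<times>C. cnj (\<xi> p) * (case p of (i,c) \<Rightarrow> \<lambda>(j,c'). w i j * y c c') q * \<xi> q) = cnj (\<xi> p) * z p" .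
  qed
  moreover have "(\<Sum>p\<in>I\<times>C. (cmod (z p))\<^sup>2) \<le> (\<delta> * B)\<^sup>2 * (\<Sum>p\<in>I\<times>C. (cmod (\<xi> p))\<^sup>2)"
  proof -
    have "(\<Sum>p\<in>I\<times>C. (cmod (z p))\<^sup>2) = (\<Sum>i\<in>I. \<Sum>c\<in>C. (cmod (\<Sum>c'\<in>C. y c c' * \<eta> i c'))\<^sup>2)"
      by (simp add: z_def sum.cartesian_product case_prod_unfold)
    also have "\<dots> \<le> (\<Sum>i\<in>I. \<delta>\<^sup>2 * (\<Sum>c\<in>C. (cmod (\<eta> i c))\<^sup>2))"
      using y(1) unfolding opbound_def by (intro sum_mono) blast
    also have "\<dots> = \<delta>\<^sup>2 * (\<Sum>c\<in>C. \<Sum>i\<in>I. (cmod (\<eta> i c))\<^sup>2)"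
      by (subst sum.swap) (simp add: sum_distrib_left)
    also have "\<dots> \<le> \<delta>\<^sup>2 * (\<Sum>c\<in>C. B\<^sup>2 * (\<Sum>i\<in>I. (cmod (\<xi> (i,c)))\<^sup>2))"
      using w(1) unfolding opbound_def \<eta>_def
      by (intro mult_left_mono sum_mono) auto
    also have "\<dots> = (\<delta> * B)\<^sup>2 * (\<Sum>c\<in>C. \<Sum>i\<in>I. (cmod (\<xi> (i,c)))\<^sup>2)"
      by (simp add: sum_distrib_left power_mult_distrib mult_ac)
    also have "(\<Sum>c\<in>C. \<Sum>i\<in>I. (cmod (\<xi> (i,c)))\<^sup>2) = (\<Sum>p\<in>I\<times>C. (cmod (\<xi> p))\<^sup>2)"
      by (subst sum.swap) (simp add: sum.cartesian_product case_prod_unfold)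
    finally show ?thesis .
  qed
  ultimately show ?thesis using norm_pairing_le[of "\<delta> * B" z "I \<times> C" \<xi>] y w by simp
qed

section \<open>Subsequences and separation in finite dimensions\<close>

lemma complex_bounded_subseq:
  fixes f :: "nat \<Rightarrow> complex"
  assumes "\<And>n. cmod (f n) \<le> B"
  obtains r l where "strict_mono (r::nat\<Rightarrow>nat)" "(\<lambda>n. f (r n)) \<longlonglongrightarrow> l"
proof -
  have R: "\<exists>r l. strict_mono (r::nat\<Rightarrow>nat) \<and> (\<lambda>n. g (r n)) \<longlonglongrightarrow> l"
    if "\<And>n. \<bar>g n\<bar> \<le> B" for g :: "nat \<Rightarrow> real"
  proof -
    obtain r :: "nat \<Rightarrow> nat" where r: "strict_mono r" "monoseq (\<lambda>n. g (r n))"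
      using seq_monosub[of g] by blast
    have "Bseq (\<lambda>n. g (r n))" by (rule BseqI'[of _ B]) (use that in simp)
    hence "convergent (\<lambda>n. g (r n))" using r by (simp add: Bseq_monoseq_convergent)
    thus ?thesis using r by (auto simp: convergent_def)
  qed
  obtain r1 l1 where r1: "strict_mono (r1::nat\<Rightarrow>nat)" "(\<lambda>n. Re (f (r1 n))) \<longlonglongrightarrow> l1"
    using R[of "\<lambda>n. Re (f n)"] assms abs_Re_le_cmod order_trans by blast
  obtain r2 l2 where r2: "strict_mono (r2::nat\<Rightarrow>nat)" "(\<lambda>n. Im (f (r1 (r2 n)))) \<longlonglongrightarrow> l2"
    using R[of "\<lambda>n. Im (f (r1 n))"] assms abs_Im_le_cmod order_trans by blast
  have "(\<lambda>n. Re (f (r1 (r2 n)))) \<longlonglongrightarrow> l1"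
    using LIMSEQ_subseq_LIMSEQ[OF r1(2) r2(1)] by (simp add: o_def)
  hence "(\<lambda>n. f (r1 (r2 n))) \<longlonglongrightarrow> Complex l1 l2"
    using r2(2) by (simp add: tendsto_complex_iff)
  moreover have "strict_mono (\<lambda>n. r1 (r2 n))" using r1(1) r2(1) by (simp add: strict_mono_def)
  ultimately show ?thesis using that by blast
qed

lemma finite_bounded_subseq:
  fixes f :: "nat \<Rightarrow> 'i \<Rightarrow> complex"
  assumes "finite I" "\<And>n i. i \<in> I \<Longrightarrow> cmod (f n i) \<le> B"
  obtains r g where "strict_mono (r::nat\<Rightarrow>nat)" "\<And>i. i \<in> I \<Longrightarrow> (\<lambda>n. f (r n) i) \<longlonglongrightarrow> g i"
proof -
  have "\<exists>r g. strict_mono (r::nat\<Rightarrow>nat) \<and> (\<forall>i\<in>I. (\<lambda>n. f (r n) i) \<longlonglongrightarrow> g i)"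
    using assms
  proof (induction I rule: finite_induct)
    case empty show ?case by (intro exI[of _ id]) (auto simp: strict_mono_def)
  next
    case (insert x F)
    then obtain r g where r: "strict_mono (r::nat\<Rightarrow>nat)" "\<forall>i\<in>F. (\<lambda>n. f (r n) i) \<longlonglongrightarrow> g i" by auto
    obtain r' l where r': "strict_mono (r'::nat\<Rightarrow>nat)" "(\<lambda>n. f (r (r' n)) x) \<longlonglongrightarrow> l"
      using complex_bounded_subseq[of "\<lambda>n. f (r n) x" B] insert.prems by auto
    have "(\<lambda>n. f (r (r' n)) i) \<longlonglongrightarrow> g i" if "i \<in> F" for i
      using LIMSEQ_subseq_LIMSEQ[OF _ r'(1)] r(2) that by (fastforce simp: o_def)
    hence "\<forall>i\<in>insert x F. (\<lambda>n. f (r (r' n)) i) \<longlonglongrightarrow> (g(x := l)) i"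
      using r'(2) insert.hyps by auto
    moreover have "strict_mono (\<lambda>n. r (r' n))" using r(1) r'(1) by (simp add: strict_mono_def)
    ultimately show ?case by (intro exI[of _ "\<lambda>n. r (r' n)"] exI[of _ "g(x:=l)"] conjI)
  qed
  thus ?thesis using that by blast
qed

text \<open>
  A diagonal sequence. The bound is only asked for eventually, since an entry with a fixed position
  exists only in sufficiently large finite matrices.
\<close>

lemma countable_bounded_subseq:
  fixes f :: "nat \<Rightarrow> nat \<Rightarrow> complex"
  assumes "\<And>i. eventually (\<lambda>n. cmod (f n i) \<le> B i) sequentially"
  obtains r g where "strict_mono (r::nat\<Rightarrow>nat)" "\<And>i. (\<lambda>n. f (r n) i) \<longlonglongrightarrow> g i"
proof -
  interpret subseqs "\<lambda>i s. convergent (\<lambda>n. f (s n) i)"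
  proof
    fix i and s :: "nat \<Rightarrow> nat" assume s: "strict_mono s"
    obtain N where N: "\<And>n. n \<ge> N \<Longrightarrow> cmod (f n i) \<le> B i"
      using assms[of i] by (auto simp: eventually_sequentially)
    have "s (n + N) \<ge> N" for n using strict_mono_imp_increasing[OF s, of "n+N"] by simp
    then obtain r l where r: "strict_mono (r::nat\<Rightarrow>nat)" "(\<lambda>n. f (s (r n + N)) i) \<longlonglongrightarrow> l"
      using complex_bounded_subseq[of "\<lambda>n. f (s (n + N)) i" "B i"] N by auto
    have "strict_mono (\<lambda>n. r n + N)" using r(1) by (simp add: strict_mono_def)
    thus "\<exists>r'. strict_mono r' \<and> convergent (\<lambda>n. f ((s \<circ> r') n) i)"
      using r(2) by (intro exI[of _ "\<lambda>n. r n + N"]) (auto simp: convergent_def o_def)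
  qed
  have "convergent (\<lambda>n. f (diagseq n) i)" for i
  proof -
    have "convergent (\<lambda>n. f ((diagseq \<circ> ((+) (Suc i))) n) i)"
    proof (rule diagseq_holds)
      fix r s :: "nat \<Rightarrow> nat" and n :: nat
      assume "strict_mono r" "convergent (\<lambda>na. f (s na) n)"
      thus "convergent (\<lambda>na. f ((s \<circ> r) na) n)"
        using convergent_subseq_convergent[of "\<lambda>na. f (s na) n" r] by (simp add: o_def)
    qed
    hence "convergent (\<lambda>n. f (diagseq (n + Suc i)) i)" by (simp add: o_def add.commute)
    thus ?thesis by (rule convergent_ignore_initial_segment[THEN iffD1])
  qed
  hence "(\<lambda>n. f (diagseq n) i) \<longlonglongrightarrow> lim (\<lambda>n. f (diagseq n) i)" for i
    by (simp add: convergent_LIMSEQ_iff)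
  thus ?thesis by (rule that[OF subseq_diagseq])
qed

lemma cmod_sq_add: "(cmod (a + b))\<^sup>2 = (cmod a)\<^sup>2 + 2 * Re (cnj a * b) + (cmod b)\<^sup>2"
  unfolding cmod_power2 by (simp add: power2_eq_square algebra_simps)

text \<open>
  A minimizing sequence for the distance to \<open>y\<close> is bounded, so a nearest point \<open>z\<close> in the cone exists;
  the separating functional is given by \<open>z - y\<close>. Only the coordinates in the finite set \<open>I\<close> count.
\<close>

lemma closed_cone_separation:
  fixes K :: "('i \<Rightarrow> complex) set"
  assumes I: "finite I"
    and add: "\<And>x y. x \<in> K \<Longrightarrow> y \<in> K \<Longrightarrow> (\<lambda>i. x i + y i) \<in> K"
    and scale: "\<And>x c. x \<in> K \<Longrightarrow> 0 \<le> c \<Longrightarrow> (\<lambda>i. complex_of_real c * x i) \<in> K"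
    and closed: "\<And>s x. (\<And>n::nat. s n \<in> K) \<Longrightarrow> (\<And>i. i \<in> I \<Longrightarrow> (\<lambda>n. s n i) \<longlonglongrightarrow> x i) \<Longrightarrow> x \<in> K"
    and ne: "K \<noteq> {}" and y: "y \<notin> K"
  obtains w where "\<And>x. x \<in> K \<Longrightarrow> 0 \<le> Re (\<Sum>i\<in>I. cnj (w i) * x i)" "Re (\<Sum>i\<in>I. cnj (w i) * y i) < 0"
proof -
  define q where "q x = (\<Sum>i\<in>I. (cmod (x i - y i))\<^sup>2)" for x
  have q0: "0 \<le> q x" for x unfolding q_def by (simp add: sum_nonneg)
  define D where "D = Inf (q ` K)"
  have bdd: "bdd_below (q ` K)" using q0 by (auto intro: bdd_belowI[of _ 0])
  have Dle: "D \<le> q x" if "x \<in> K" for x unfolding D_def by (rule cInf_lower[OF _ bdd]) (use that in auto)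
  have "\<exists>x\<in>K. q x < D + 1 / real (Suc n)" for n
    using cInf_lessD[of "q ` K" "D + 1 / real (Suc n)"] ne unfolding D_def by auto
  then obtain s where s: "\<And>n. s n \<in> K" "\<And>n. q (s n) < D + 1 / real (Suc n)" by metis
  have norm_bound: "cmod (s n i) \<le> sqrt (D + 1) + (\<Sum>i\<in>I. cmod (y i))" if "i \<in> I" for n i
  proof -
    have "1 / real (Suc n) \<le> 1" by simp
    with s(2)[of n] have "q (s n) \<le> D + 1" by linarith
    moreover have "(cmod (s n i - y i))\<^sup>2 \<le> q (s n)"
      unfolding q_def using that I by (intro member_le_sum) auto
    ultimately have "cmod (s n i - y i) \<le> sqrt (D + 1)" by (intro real_le_rsqrt) simp
    moreover have "cmod (y i) \<le> (\<Sum>i\<in>I. cmod (y i))" using that I by (intro member_le_sum) auto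
    moreover have "cmod (s n i) \<le> cmod (s n i - y i) + cmod (y i)"
      using norm_triangle_ineq[of "s n i - y i" "y i"] by simp
    ultimately show ?thesis by linarith
  qed
  obtain r z where r: "strict_mono (r::nat\<Rightarrow>nat)" "\<And>i. i \<in> I \<Longrightarrow> (\<lambda>n. s (r n) i) \<longlonglongrightarrow> z i"
    using finite_bounded_subseq[OF I, of s, OF norm_bound] by blast
  have zK: "z \<in> K" by (rule closed[OF s(1) r(2)])
  have "(\<lambda>n. q (s (r n))) \<longlonglongrightarrow> q z" unfolding q_def by (intro tendsto_intros r(2))
  moreover have "(\<lambda>n. D + 1 / real (Suc (r n))) \<longlonglongrightarrow> D + 0"
    by (intro tendsto_intros LIMSEQ_subseq_LIMSEQ[OF LIMSEQ_Suc[OF lim_1_over_n] r(1), unfolded o_def])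
  ultimately have "q z \<le> D + 0"
    by (rule LIMSEQ_le) (intro exI[of _ 0] allI impI less_imp_le s(2))
  hence qz: "q z \<le> q x" if "x \<in> K" for x using Dle[OF that] by simp
  define w where "w i = z i - y i" for i
  define ip where "ip x = Re (\<Sum>i\<in>I. cnj (w i) * x i)" for x
  have expand: "q (\<lambda>i. z i + complex_of_real t * x i) = q z + 2 * t * ip x + t\<^sup>2 * (\<Sum>i\<in>I. (cmod (x i))\<^sup>2)" for t x
  proof -
    have "q (\<lambda>i. z i + complex_of_real t * x i) = (\<Sum>i\<in>I. (cmod (w i + complex_of_real t * x i))\<^sup>2)"
      unfolding q_def w_def by (simp add: algebra_simps)
    also have "\<dots> = (\<Sum>i\<in>I. (cmod (w i))\<^sup>2 + 2 * t * Re (cnj (w i) * x i) + t\<^sup>2 * (cmod (x i))\<^sup>2)"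
      by (intro sum.cong refl) (simp add: cmod_sq_add norm_mult power_mult_distrib algebra_simps)
    finally show ?thesis
      unfolding q_def ip_def w_def by (simp add: sum.distrib sum_distrib_left Re_sum)
  qed
  have key: "0 \<le> ip x" if x: "\<And>t. 0 < t \<Longrightarrow> t < 1 \<Longrightarrow> (\<lambda>i. z i + complex_of_real t * x i) \<in> K" for x
  proof (rule ccontr)
    assume "\<not> 0 \<le> ip x"
    hence neg: "ip x < 0" by simp
    define S where "S = (\<Sum>i\<in>I. (cmod (x i))\<^sup>2)"
    have S: "S \<ge> 0" by (simp add: S_def sum_nonneg)
    define t where "t = min (1/2) (- ip x / (S + 1))"
    have t: "0 < t" "t < 1" using neg S by (auto simp: t_def field_simps)
    have "0 \<le> 2 * t * ip x + t\<^sup>2 * S" using qz[OF x[OF t]] expand[of t x] by (simp add: S_def)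
    hence "0 \<le> t * (2 * ip x + t * S)" by (simp add: power2_eq_square algebra_simps)
    hence a: "0 \<le> 2 * ip x + t * S" using t by (simp add: zero_le_mult_iff)
    have "t * (S + 1) \<le> - ip x"
    proof -
      have "t \<le> - ip x / (S + 1)" by (simp add: t_def)
      thus ?thesis using S pos_le_divide_eq[of "S + 1" t "- ip x"] by linarith
    qed
    hence "t * S + t \<le> - ip x" by (simp add: algebra_simps)
    thus False using a neg t by linarith
  qed
  have ipK: "0 \<le> ip x" if "x \<in> K" for x
    by (rule key, rule add[OF zK scale[OF that]]) simp
  have "0 \<le> ip (\<lambda>i. - z i)"
  proof (rule key)
    fix t :: real assume "0 < t" "t < 1"
    hence "(\<lambda>i. complex_of_real (1 - t) * z i) \<in> K" by (intro scale zK) simp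
    thus "(\<lambda>i. z i + complex_of_real t * - z i) \<in> K" by (simp add: algebra_simps)
  qed
  hence ipz: "ip z \<le> 0" unfolding ip_def by (simp add: sum_negf)
  have "\<exists>i\<in>I. z i \<noteq> y i"
  proof (rule ccontr)
    assume "\<not> ?thesis"
    hence "y \<in> K" by (intro closed[of "\<lambda>_. z", OF zK]) auto
    thus False using y by simp
  qed
  then obtain i where i: "i \<in> I" "z i \<noteq> y i" by blast
  have "0 < (cmod (w i))\<^sup>2" using i by (simp add: w_def)
  moreover have "(cmod (w i))\<^sup>2 \<le> (\<Sum>i\<in>I. (cmod (w i))\<^sup>2)"
    by (rule member_le_sum[OF i(1) _ I]) simp
  moreover have "(\<Sum>i\<in>I. (cmod (w i))\<^sup>2) = ip z - ip y"
  proof -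
    have "(cmod (w i))\<^sup>2 = Re (cnj (w i) * z i) - Re (cnj (w i) * y i)" for i
      unfolding w_def cmod_power2 by (simp add: power2_eq_square algebra_simps)
    thus ?thesis unfolding ip_def by (simp add: sum_subtractf)
  qed
  ultimately have "ip y < 0" using ipz by linarith
  show ?thesis
  proof (rule that[of w])
    show "0 \<le> Re (\<Sum>i\<in>I. cnj (w i) * x i)" if "x \<in> K" for x
      using ipK[OF that] by (simp only: ip_def)
    show "Re (\<Sum>i\<in>I. cnj (w i) * y i) < 0" using \<open>ip y < 0\<close> by (simp only: ip_def)
  qed
qed

section \<open>Products and bounds of positive semidefinite kernels\<close>

text \<open>
  The form at a vector supported on \<open>i\<close> and \<open>j\<close>, with the phase chosen so that the off-diagonal terms
  contribute \<open>- 2 \<bar>A i j\<bar>\<close>.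
\<close>

lemma psd_entry_bound:
  assumes "psd I A" "finite I" "i \<in> I" "j \<in> I"
  shows "2 * cmod (A i j) \<le> Re (A i i) + Re (A j j)"
proof (cases "i = j \<or> A i j = 0")
  case True
  have "0 \<le> A i i \<and> 0 \<le> A j j" using psd_diag[OF assms(1,2,3)] psd_diag[OF assms(1,2,4)] by simp
  thus ?thesis using True by (auto simp: complex_nonneg_iff cmod_eq_Re)
next
  case False
  define z where "z = A i j"
  define b where "b = - cnj z / complex_of_real (cmod z)"
  have z: "cmod z > 0" using False by (simp add: z_def)
  have bb: "cnj b * b = 1"
  proof -
    have "cnj b * b = (z * cnj z) / (complex_of_real (cmod z) * complex_of_real (cmod z))"
      by (simp add: b_def)
    also have "\<dots> = 1" using z by (simp add: cmod_sq[symmetric] power2_eq_square)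
    finally show ?thesis .
  qed
  have zb: "z * b = - complex_of_real (cmod z)"
  proof -
    have "z * b = - ((z * cnj z) / complex_of_real (cmod z))" by (simp add: b_def)
    also have "\<dots> = - complex_of_real (cmod z)" using z by (simp add: cmod_sq[symmetric] power2_eq_square)
    finally show ?thesis .
  qed
  have h: "A j i = cnj z" unfolding z_def by (rule psd_hermitian[OF assms])
  have bz: "cnj b * cnj z = - complex_of_real (cmod z)"
    using arg_cong[OF zb, of cnj] by (simp add: mult.commute)
  have "0 \<le> cnj 1 * A i i * 1 + cnj 1 * A i j * b + cnj b * A j i * 1 + cnj b * A j j * b"
    by (rule psd_pair[OF assms]) (use False in simp)
  also have "\<dots> = A i i + z * b + cnj b * cnj z + (cnj b * b) * A j j"
    by (simp add: h z_def algebra_simps)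
  finally have "0 \<le> Re (A i i - 2 * complex_of_real (cmod z) + A j j)"
    unfolding zb bz bb by (simp add: complex_nonneg_iff)
  thus ?thesis by (simp add: z_def)
qed

lemma psd_kron:
  assumes A: "psd I A" "finite I" and B: "psd J B" "finite J"
  shows "psd (I \<times> J) (\<lambda>(i,a) (j,b). A i j * B a b)"
proof -
  obtain R where R: "\<And>i j. i \<in> I \<Longrightarrow> j \<in> I \<Longrightarrow> A i j = (\<Sum>w<card I. cnj (R w i) * R w j)"
    using psd_factor[OF A] by blast
  obtain S where S: "\<And>i j. i \<in> J \<Longrightarrow> j \<in> J \<Longrightarrow> B i j = (\<Sum>w<card J. cnj (S w i) * S w j)"
    using psd_factor[OF B] by blast
  have "psd (I \<times> J) (\<lambda>x y. \<Sum>w\<in>{..<card I} \<times> {..<card J}.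
    cnj (R (fst w) (fst x) * S (snd w) (snd x)) * (R (fst w) (fst y) * S (snd w) (snd y)))"
    by (rule psd_gram)
  thus ?thesis
  proof (rule psd_cong[rotated])
    fix x y assume xy: "x \<in> I \<times> J" "y \<in> I \<times> J"
    have "(\<Sum>w\<in>{..<card I} \<times> {..<card J}.
        cnj (R (fst w) (fst x) * S (snd w) (snd x)) * (R (fst w) (fst y) * S (snd w) (snd y)))
      = (\<Sum>w<card I. \<Sum>v<card J. (cnj (R w (fst x)) * R w (fst y)) * (cnj (S v (snd x)) * S v (snd y)))"
      by (subst sum_pair[where G = "\<lambda>w v. cnj (R w (fst x) * S v (snd x)) * (R w (fst y) * S v (snd y))"])
        (simp add: mult_ac)
    also have "\<dots> = A (fst x) (fst y) * B (snd x) (snd y)"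
      using xy by (simp only: sum_product[symmetric] R S mem_Times_iff)
    finally show "(\<Sum>w\<in>{..<card I} \<times> {..<card J}.
        cnj (R (fst w) (fst x) * S (snd w) (snd x)) * (R (fst w) (fst y) * S (snd w) (snd y)))
      = (case x of (i,a) \<Rightarrow> \<lambda>(j,b). A i j * B a b) y" by (simp add: case_prod_unfold)
  qed
qed

lemma sum_norm_squared_le:
  "(cmod (\<Sum>g<p. z g))\<^sup>2 \<le> real p * (\<Sum>g<p. (cmod (z g))\<^sup>2)"
proof (induction p)
  case (Suc p)
  show ?case
  proof (cases "p = 0")
    case False
    define a where "a = cmod (\<Sum>g<p. z g)"
    define b where "b = cmod (z p)"
    have "(cmod (\<Sum>g<Suc p. z g))\<^sup>2 \<le> (a + b)\<^sup>2"
      unfolding a_def b_def by (intro power_mono) (simp_all add: norm_triangle_ineq)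
    also have "\<dots> = a\<^sup>2 + 2 * (a * b) + b\<^sup>2" by (simp add: power2_eq_square algebra_simps)
    also have "2 * (a * b) \<le> a\<^sup>2 / p + p * b\<^sup>2"
      using weighted_am_gm[of "1 / p" a b] False by (simp add: mult.commute)
    also have "a\<^sup>2 / p \<le> (\<Sum>g<p. (cmod (z g))\<^sup>2)"
      using Suc.IH False by (simp add: a_def field_simps)
    also have "a\<^sup>2 \<le> p * (\<Sum>g<p. (cmod (z g))\<^sup>2)" using Suc.IH by (simp add: a_def)
    finally show ?thesis by (simp add: b_def algebra_simps)
  qed simp
qed simp

lemma inverse_of_injective:
  fixes L :: "nat \<Rightarrow> nat \<Rightarrow> complex"
  assumes inj: "\<And>f. (\<And>i. i < m \<Longrightarrow> (\<Sum>j<m. L i j * f j) = 0) \<Longrightarrow> (\<And>j. j < m \<Longrightarrow> f j = (0::complex))"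
  obtains \<Lambda> where "\<And>i j. i < m \<Longrightarrow> j < m \<Longrightarrow> (\<Sum>w<m. \<Lambda> i w * L w j) = (if i = j then 1 else 0)"
    "\<And>i j. i < m \<Longrightarrow> j < m \<Longrightarrow> (\<Sum>w<m. L i w * \<Lambda> w j) = (if i = j then 1 else 0)"
proof -
  define A where "A = mat m m (\<lambda>(i,j). L i j)"
  have A: "A \<in> carrier_mat m m" by (simp add: A_def)
  have "det A \<noteq> 0"
  proof
    assume "det A = 0"
    then obtain v where v: "v \<in> carrier_vec m" "v \<noteq> 0\<^sub>v m" "A *\<^sub>v v = 0\<^sub>v m"
      using det_0_iff_vec_prod_zero_field[OF A] by blast
    have "(\<Sum>j<m. L i j * (v $ j)) = 0" if "i < m" for i
    proof -
      have "(A *\<^sub>v v) $ i = (\<Sum>j<m. L i j * (v $ j))"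
        using that v(1) by (simp add: A_def scalar_prod_def atLeast0LessThan)
      thus ?thesis using v(3) that by simp
    qed
    hence "\<And>i. i < m \<Longrightarrow> (\<Sum>j<m. L i j * (\<lambda>j. v $ j) j) = 0" .
    note v0 = inj[of "\<lambda>j. v $ j", OF this]
    have "v $ j = 0" if "j < m" for j using v0[OF _ that] by simp
    hence "v = 0\<^sub>v m" using v(1) by (intro eq_vecI) auto
    thus False using v(2) by simp
  qed
  from det_non_zero_imp_unit[OF A this, of "()"] obtain B where
    B: "B \<in> carrier_mat m m" "B * A = 1\<^sub>m m" "A * B = 1\<^sub>m m"
    by (auto simp: Units_def ring_mat_simps)
  show ?thesis
  proof (rule that[of "\<lambda>i j. B $$ (i,j)"])
    fix i j assume ij: "i < m" "j < m"
    have "(B * A) $$ (i,j) = (\<Sum>w<m. B $$ (i,w) * L w j)"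
      using ij B(1) by (simp add: A_def scalar_prod_def atLeast0LessThan)
    thus "(\<Sum>w<m. B $$ (i,w) * L w j) = (if i = j then 1 else 0)" unfolding B(2) by (simp add: ij)
    have "(A * B) $$ (i,j) = (\<Sum>w<m. L i w * B $$ (w,j))"
      using ij B(1) by (simp add: A_def scalar_prod_def atLeast0LessThan)
    thus "(\<Sum>w<m. L i w * B $$ (w,j)) = (if i = j then 1 else 0)" unfolding B(3) by (simp add: ij)
  qed
qed

section \<open>Operator systems in coordinates\<close>

text \<open>
  Coordinate arrays: \<open>X i j l\<close> is the \<open>l\<close>-th coordinate of the entry \<open>(i,j)\<close> of a matrix over an operator
  system. A linear map \<open>\<phi>\<close> into matrices has the same type, \<open>\<phi> l i j\<close> being the entry \<open>(i,j)\<close> of the image of the \<open>l\<close>-th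
  basis vector.
\<close>

type_synonym arr = "nat \<Rightarrow> nat \<Rightarrow> nat \<Rightarrow> complex"

text \<open>
  An operator system of dimension \<open>d\<close> with a basis of hermitian vectors: \<open>e\<close> are the coordinates
  of the unit, \<open>C n\<close> is the cone of the positive \<open>n \<times> n\<close> matrices. The involution is entrywise conjugation because
  the basis is hermitian.
\<close>

locale coord_opsys =
  fixes d :: nat and e :: "nat \<Rightarrow> complex" and C :: "nat \<Rightarrow> arr set"
  assumes e_real: "l < d \<Longrightarrow> cnj (e l) = e l"
    and C_cong: "X \<in> C n \<Longrightarrow> (\<And>i j l. i < n \<Longrightarrow> j < n \<Longrightarrow> l < d \<Longrightarrow> X i j l = Y i j l) \<Longrightarrow> Y \<in> C n"
    and C_herm: "X \<in> C n \<Longrightarrow> i < n \<Longrightarrow> j < n \<Longrightarrow> l < d \<Longrightarrow> X j i l = cnj (X i j l)"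
    and C_add: "X \<in> C n \<Longrightarrow> Y \<in> C n \<Longrightarrow> (\<lambda>i j l. X i j l + Y i j l) \<in> C n"
    and C_conj: "X \<in> C n \<Longrightarrow> (\<lambda>i j l. \<Sum>a<n. \<Sum>b<n. \<alpha> i a * cnj (\<alpha> j b) * X a b l) \<in> C m"
    and C_proper: "X \<in> C n \<Longrightarrow> (\<lambda>i j l. - X i j l) \<in> C n \<Longrightarrow> i < n \<Longrightarrow> j < n \<Longrightarrow> l < d \<Longrightarrow> X i j l = 0"
    and C_unit: "(\<And>i j l. i < n \<Longrightarrow> j < n \<Longrightarrow> l < d \<Longrightarrow> X j i l = cnj (X i j l)) \<Longrightarrow>
      \<exists>r>0. (\<lambda>i j l. (if i = j then complex_of_real r * e l else 0) + X i j l) \<in> C n"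
    and C_arch: "(\<And>i j l. i < n \<Longrightarrow> j < n \<Longrightarrow> l < d \<Longrightarrow> X j i l = cnj (X i j l)) \<Longrightarrow>
      (\<And>r. r > 0 \<Longrightarrow> (\<lambda>i j l. (if i = j then complex_of_real r * e l else 0) + X i j l) \<in> C n) \<Longrightarrow> X \<in> C n"
begin

definition shift :: "real \<Rightarrow> arr \<Rightarrow> arr" where
  "shift r X = (\<lambda>i j l. (if i = j then complex_of_real r * e l else 0) + X i j l)"

definition neg :: "arr \<Rightarrow> arr" where
  "neg X = (\<lambda>i j l. - X i j l)"

definition herm :: "nat \<Rightarrow> arr \<Rightarrow> bool" where
  "herm n X \<longleftrightarrow> (\<forall>i<n. \<forall>j<n. \<forall>l<d. X j i l = cnj (X i j l))"

lemma hermI: "(\<And>i j l. i < n \<Longrightarrow> j < n \<Longrightarrow> l < d \<Longrightarrow> X j i l = cnj (X i j l)) \<Longrightarrow> herm n X"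
  unfolding herm_def by blast

lemma hermD: "herm n X \<Longrightarrow> i < n \<Longrightarrow> j < n \<Longrightarrow> l < d \<Longrightarrow> X j i l = cnj (X i j l)"
  unfolding herm_def by blast

lemma herm_neg: "herm n X \<Longrightarrow> herm n (neg X)"
  by (rule hermI, drule (3) hermD) (simp only: neg_def complex_cnj_minus)

lemma herm_shift: "herm n X \<Longrightarrow> \<exists>r>0. shift r X \<in> C n"
  unfolding shift_def by (rule C_unit) (rule hermD)

lemma C_archI: "herm n X \<Longrightarrow> (\<And>r. r > 0 \<Longrightarrow> shift r X \<in> C n) \<Longrightarrow> X \<in> C n"
  unfolding shift_def by (rule C_arch) (rule hermD)

lemma C_scale:
  assumes X: "X \<in> C n" and c: "0 \<le> c" shows "(\<lambda>i j l. complex_of_real c * X i j l) \<in> C n"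
proof (rule C_cong[OF C_conj[OF X, of "\<lambda>i a. if i = a then complex_of_real (sqrt c) else 0"]])
  fix i j l assume "i < n" "j < n"
  have s: "complex_of_real (sqrt c) * complex_of_real (sqrt c) = complex_of_real c"
    using c by (metis of_real_mult real_sqrt_mult_self abs_of_nonneg)
  have "(\<Sum>a<n. \<Sum>b<n. (if i = a then complex_of_real (sqrt c) else 0) * cnj (if j = b then complex_of_real (sqrt c) else 0) * X a b l)
    = (\<Sum>a<n. if i = a then (\<Sum>b<n. if j = b then complex_of_real (sqrt c) * complex_of_real (sqrt c) * X a b l else 0) else 0)"
  proof (rule sum.cong[OF refl])
    fix a
    show "(\<Sum>b<n. (if i = a then complex_of_real (sqrt c) else 0) * cnj (if j = b then complex_of_real (sqrt c) else 0) * X a b l)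
      = (if i = a then (\<Sum>b<n. if j = b then complex_of_real (sqrt c) * complex_of_real (sqrt c) * X a b l else 0) else 0)"
    proof (cases "i = a")
      case True
      have "(\<Sum>b<n. (if i = a then complex_of_real (sqrt c) else 0) * cnj (if j = b then complex_of_real (sqrt c) else 0) * X a b l)
        = (\<Sum>b<n. if j = b then complex_of_real (sqrt c) * complex_of_real (sqrt c) * X a b l else 0)"
        by (rule sum.cong) (simp_all add: True)
      thus ?thesis by (simp only: True if_True simp_thms)
    qed simp
  qed
  also have "\<dots> = complex_of_real c * X i j l" using \<open>i < n\<close> \<open>j < n\<close> by (simp add: s)
  finally show "(\<Sum>a<n. \<Sum>b<n. (if i = a then complex_of_real (sqrt c) else 0) * cnj (if j = b then complex_of_real (sqrt c) else 0) * X a b l)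
    = complex_of_real c * X i j l" .
qed

lemma C_zero: "(\<lambda>i j l. 0) \<in> C n"
proof -
  obtain X where "X \<in> C n" using C_unit[of n "\<lambda>_ _ _. 0"] by auto
  from C_scale[OF this, of 0] show ?thesis by simp
qed

lemma C_sum: "(\<And>k. k \<in> K \<Longrightarrow> X k \<in> C n) \<Longrightarrow> (\<lambda>i j l. \<Sum>k\<in>K. X k i j l) \<in> C n"
proof (induction K rule: infinite_finite_induct)
  case (insert x F)
  then show ?case using C_add[of "X x" n "\<lambda>i j l. \<Sum>k\<in>F. X k i j l"] by simp
qed (simp_all add: C_zero)

lemma shift_pos: "0 \<le> r \<Longrightarrow> shift r (\<lambda>_ _ _. 0) \<in> C n"
proof -
  assume r: "0 \<le> r"
  obtain c where c: "c > 0" "shift c (\<lambda>_ _ _. 0) \<in> C n"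
    using C_unit[of n "\<lambda>_ _ _. 0"] by (auto simp: shift_def)
  show ?thesis
    by (rule C_cong[OF C_scale[OF c(2), of "r / c"]]) (use c(1) r in \<open>auto simp: shift_def\<close>)
qed

lemma shift_add:
  assumes "shift r X \<in> C n" "shift t Y \<in> C n"
  shows "shift (r + t) (\<lambda>i j l. X i j l + Y i j l) \<in> C n"
  by (rule C_cong[OF C_add[OF assms]]) (auto simp: shift_def algebra_simps)

lemma shift_0[simp]: "shift 0 X = X"
  by (auto simp: shift_def intro!: ext)

lemma shift_mono: "shift r X \<in> C n \<Longrightarrow> r \<le> t \<Longrightarrow> shift t X \<in> C n"
  using shift_add[of r X n "t - r" "\<lambda>_ _ _. 0"] shift_pos[of "t - r" n] by simp

lemma shift_scale:
  assumes "shift r X \<in> C n" "0 \<le> c"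
  shows "shift (c * r) (\<lambda>i j l. complex_of_real c * X i j l) \<in> C n"
  by (rule C_cong[OF C_scale[OF assms]]) (auto simp: shift_def algebra_simps)

lemma shift_cong:
  "shift r X \<in> C n \<Longrightarrow> (\<And>i j l. i < n \<Longrightarrow> j < n \<Longrightarrow> l < d \<Longrightarrow> X i j l = Y i j l) \<Longrightarrow> shift r Y \<in> C n"
  using C_cong[of "shift r X" n "shift r Y"] by (auto simp: shift_def)

text \<open>
  \<open>-r \<le> X \<le> r\<close> in the matrix order.
\<close>

definition norm_bound :: "nat \<Rightarrow> arr \<Rightarrow> real \<Rightarrow> bool" where
  "norm_bound n X r \<longleftrightarrow> shift r X \<in> C n \<and> shift r (neg X) \<in> C n"

lemma norm_bound_ex: "herm n X \<Longrightarrow> \<exists>r>0. norm_bound n X r"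
proof -
  assume h: "herm n X"
  obtain r1 where r1: "r1 > 0" "shift r1 X \<in> C n"
    using herm_shift[OF h] by blast
  obtain r2 where r2: "r2 > 0" "shift r2 (neg X) \<in> C n"
    using herm_shift[OF herm_neg[OF h]] by blast
  have "norm_bound n X (max r1 r2)" unfolding norm_bound_def
    using shift_mono[OF r1(2), of "max r1 r2"] shift_mono[OF r2(2), of "max r1 r2"] by simp
  thus ?thesis using r1(1) by (intro exI[of _ "max r1 r2"]) simp
qed

lemma norm_bound_mono: "norm_bound n X r \<Longrightarrow> r \<le> t \<Longrightarrow> norm_bound n X t"
  unfolding norm_bound_def using shift_mono by blast

lemma norm_bound_add: "norm_bound n X r \<Longrightarrow> norm_bound n Y t \<Longrightarrow> norm_bound n (\<lambda>i j l. X i j l + Y i j l) (r + t)"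
  unfolding norm_bound_def neg_def using shift_add[of r X n t Y] shift_add[of r "neg X" n t "neg Y"]
  by (simp add: neg_def)

lemma norm_bound_scale: assumes "norm_bound n X r" shows "norm_bound n (\<lambda>i j l. complex_of_real c * X i j l) (\<bar>c\<bar> * r)"
proof (cases "0 \<le> c")
  case True
  thus ?thesis using assms shift_scale[of r X n c] shift_scale[of r "neg X" n c]
    by (simp add: norm_bound_def neg_def)
next
  case False
  thus ?thesis using assms shift_scale[of r X n "-c"] shift_scale[of r "neg X" n "-c"]
    by (simp add: norm_bound_def neg_def)
qed

lemma norm_bound_sum: "(\<And>k. k \<in> K \<Longrightarrow> norm_bound n (X k) (r k)) \<Longrightarrow> norm_bound n (\<lambda>i j l. \<Sum>k\<in>K. X k i j l) (\<Sum>k\<in>K. r k)"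
proof (induction K rule: infinite_finite_induct)
  case (insert x F)
  then show ?case using norm_bound_add[of n "X x" "r x" "\<lambda>i j l. \<Sum>k\<in>F. X k i j l"] by simp
qed (simp_all add: C_zero norm_bound_def neg_def)

lemma norm_bound_cong: "norm_bound n X r \<Longrightarrow> (\<And>i j l. i < n \<Longrightarrow> j < n \<Longrightarrow> l < d \<Longrightarrow> X i j l = Y i j l) \<Longrightarrow> norm_bound n Y r"
  unfolding norm_bound_def neg_def using shift_cong[of r X n Y] shift_cong[of r "neg X" n "neg Y"] 
  by (auto simp: neg_def)

section \<open>Real coordinates\<close>

text \<open>
  The hermitian arrays \<open>E\<^sub>a\<^sub>b + E\<^sub>b\<^sub>a\<close> and \<open>\<i> E\<^sub>a\<^sub>b - \<i> E\<^sub>b\<^sub>a\<close> in the coordinate \<open>c\<close> span all hermitian arrays over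
  the reals. Both \<open>(a,b)\<close> and \<open>(b,a)\<close> occur, whence the factor \<open>1/2\<close> in the coefficients.
\<close>

definition gens :: "nat \<Rightarrow> (nat \<times> nat \<times> nat \<times> bool) set" where
  "gens n = {..<n} \<times> {..<n} \<times> {..<d} \<times> UNIV"

definition gen :: "nat \<times> nat \<times> nat \<times> bool \<Rightarrow> arr" where
  "gen = (\<lambda>(a, b, c, t) i j l. if l = c
     then (if t then 1 else \<i>) * of_bool (i = a \<and> j = b) + (if t then 1 else - \<i>) * of_bool (i = b \<and> j = a) else 0)"

definition coef :: "arr \<Rightarrow> nat \<times> nat \<times> nat \<times> bool \<Rightarrow> real" where
  "coef X = (\<lambda>(a, b, c, t). (if t then Re (X a b c) else Im (X a b c)) / 2)"

lemma finite_gens: "finite (gens n)" by (simp add: gens_def)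

lemma gen_herm: "herm n (gen g)"
proof (rule hermI)
  fix i j l
  obtain a b c t where [simp]: "g = (a, b, c, t)" by (cases g)
  show "gen g j i l = cnj (gen g i j l)"
    by (cases t; cases "i = a"; cases "j = b"; cases "i = b"; cases "j = a") (simp_all add: gen_def)
qed

lemma sum_delta3:
  fixes n :: nat
  assumes "i < n" "j < n" "l < d"
  shows "(\<Sum>a<n. \<Sum>b<n. \<Sum>c<d. if i = a \<and> j = b \<and> l = c then f a b c else 0) = (f i j l :: complex)"
proof -
  have 1: "(\<Sum>c<d. if i = a \<and> j = b \<and> l = c then f a b c else 0)
    = (if j = b then if i = a then f a b l else 0 else 0)" for a b
    by (cases "i = a"; cases "j = b") (use assms in simp_all)
  have 2: "(\<Sum>b<n. if j = b then if i = a then f a b l else 0 else 0) = (if i = a then f a j l else 0)" for a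
    using assms by simp
  show ?thesis unfolding 1 2 using assms by simp
qed

lemma herm_decomp:
  assumes "herm n X" "i < n" "j < n" "l < d"
  shows "X i j l = (\<Sum>g\<in>gens n. complex_of_real (coef X g) * gen g i j l)"
proof -
  have h: "X i j l = cnj (X j i l)" by (rule hermD[OF assms(1,3,2,4)])
  have "(\<Sum>g\<in>gens n. complex_of_real (coef X g) * gen g i j l)
    = (\<Sum>a<n. \<Sum>b<n. \<Sum>c<d. \<Sum>t\<in>UNIV. complex_of_real (coef X (a,b,c,t)) * gen (a,b,c,t) i j l)"
    unfolding gens_def by (simp only: sum.cartesian_product')
  also have "\<dots> = (\<Sum>a<n. \<Sum>b<n. \<Sum>c<d. (if i = a \<and> j = b \<and> l = c then X a b c / 2 else 0)
      + (if j = a \<and> i = b \<and> l = c then cnj (X a b c) / 2 else 0))"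
  proof (intro sum.cong refl)
    fix a b c
    have "(\<Sum>t\<in>UNIV. complex_of_real (coef X (a,b,c,t)) * gen (a,b,c,t) i j l)
      = complex_of_real (coef X (a,b,c,True)) * gen (a,b,c,True) i j l
      + complex_of_real (coef X (a,b,c,False)) * gen (a,b,c,False) i j l"
      by (simp add: UNIV_bool)
    also have "\<dots> = (if i = a \<and> j = b \<and> l = c then X a b c / 2 else 0)
      + (if j = a \<and> i = b \<and> l = c then cnj (X a b c) / 2 else 0)"
      by (cases "i = a"; cases "j = b"; cases "j = a"; cases "i = b"; cases "l = c")
        (simp_all add: coef_def gen_def complex_eq_iff)
    finally show "(\<Sum>t\<in>UNIV. complex_of_real (coef X (a,b,c,t)) * gen (a,b,c,t) i j l)
      = (if i = a \<and> j = b \<and> l = c then X a b c / 2 else 0)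
      + (if j = a \<and> i = b \<and> l = c then cnj (X a b c) / 2 else 0)" .
  qed
  also have "\<dots> = X i j l / 2 + cnj (X j i l) / 2"
    unfolding sum.distrib sum_delta3[OF assms(2,3,4)] sum_delta3[OF assms(3,2,4)] ..
  finally show ?thesis by (simp add: h)
qed

lemma coef_le: "(a, b, c, t) \<in> gens n \<Longrightarrow> cmod (X a b c) \<le> s \<Longrightarrow> \<bar>coef X (a,b,c,t)\<bar> \<le> s"
  using abs_Re_le_cmod[of "X a b c"] abs_Im_le_cmod[of "X a b c"] by (auto simp: coef_def)

definition gen_bound :: "nat \<Rightarrow> nat \<times> nat \<times> nat \<times> bool \<Rightarrow> real" where
  "gen_bound n g = (SOME r. r > 0 \<and> norm_bound n (gen g) r)"

lemma gen_bound: "gen_bound n g > 0" "norm_bound n (gen g) (gen_bound n g)"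
  using someI_ex[of "\<lambda>r. r > 0 \<and> norm_bound n (gen g) r"] norm_bound_ex[OF gen_herm[of n g]] unfolding gen_bound_def by auto

definition entry_const :: "nat \<Rightarrow> real" where "entry_const n = 1 + (\<Sum>g\<in>gens n. gen_bound n g)"

lemma entry_const_pos: "entry_const n > 0"
  unfolding entry_const_def using sum_nonneg[of "gens n" "gen_bound n", OF less_imp_le[OF gen_bound(1)]] by linarith

text \<open>
  Small entries give a small order norm, since there are only finitely many generators.
\<close>

lemma norm_bound_of_entries:
  assumes "herm n X" "\<And>i j l. i < n \<Longrightarrow> j < n \<Longrightarrow> l < d \<Longrightarrow> cmod (X i j l) \<le> t" "0 \<le> t"
  shows "norm_bound n X (entry_const n * t)"
proof -
  have "norm_bound n (\<lambda>i j l. \<Sum>g\<in>gens n. complex_of_real (coef X g) * gen g i j l) (\<Sum>g\<in>gens n. \<bar>coef X g\<bar> * gen_bound n g)"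
    by (intro norm_bound_sum norm_bound_scale gen_bound)
  hence 1: "norm_bound n X (\<Sum>g\<in>gens n. \<bar>coef X g\<bar> * gen_bound n g)"
    by (rule norm_bound_cong) (rule herm_decomp[OF assms(1), symmetric])
  have "(\<Sum>g\<in>gens n. \<bar>coef X g\<bar> * gen_bound n g) \<le> (\<Sum>g\<in>gens n. t * gen_bound n g)"
  proof (rule sum_mono, rule mult_right_mono)
    fix g assume g: "g \<in> gens n"
    obtain a b c s where [simp]: "g = (a,b,c,s)" by (cases g)
    show "\<bar>coef X g\<bar> \<le> t" using coef_le[of a b c s n X t] g assms(2)[of a b c] by (auto simp: gens_def)
  qed (rule less_imp_le[OF gen_bound(1)])
  also have "\<dots> \<le> entry_const n * t"
    using assms(3) by (simp add: entry_const_def sum_distrib_left[symmetric] algebra_simps)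
  finally show ?thesis using norm_bound_mono[OF 1] by blast
qed

text \<open>
  By \<open>norm_bound_of_entries\<close>, \<open>x\<close> plus arbitrarily small multiples of the unit is positive; the Archimedean
  property does the rest.
\<close>

lemma C_closed:
  assumes s: "\<And>k::nat. s k \<in> C n" and l: "\<And>i j l. i < n \<Longrightarrow> j < n \<Longrightarrow> l < d \<Longrightarrow> (\<lambda>k. s k i j l) \<longlonglongrightarrow> x i j l"
  shows "x \<in> C n"
proof (rule C_archI)
  have h: "x j i l = cnj (x i j l)" if "i < n" "j < n" "l < d" for i j l
  proof -
    have "(\<lambda>k. s k j i l) = (\<lambda>k. cnj (s k i j l))" using C_herm[OF s that] by (rule ext)
    hence "(\<lambda>k. s k j i l) \<longlonglongrightarrow> cnj (x i j l)" using tendsto_cnj[OF l[OF that]] by simp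
    thus ?thesis using l[of j i l] that LIMSEQ_unique by blast
  qed
  show "herm n x" by (rule hermI) (rule h)
  fix r :: real assume r: "r > 0"
  define t where "t = r / entry_const n"
  have t: "t > 0" "entry_const n * t = r" using r entry_const_pos[of n] by (auto simp: t_def)
  have "eventually (\<lambda>k. \<forall>i\<in>{..<n}. \<forall>j\<in>{..<n}. \<forall>c\<in>{..<d}. cmod (s k i j c - x i j c) < t) sequentially"
  proof (intro eventually_ball_finite ballI finite_lessThan)
    fix i j c assume "i \<in> {..<n}" "j \<in> {..<n}" "c \<in> {..<d}"
    hence "(\<lambda>k. s k i j c) \<longlonglongrightarrow> x i j c" using l by simp
    from tendstoD[OF this t(1)] show "eventually (\<lambda>k. cmod (s k i j c - x i j c) < t) sequentially"
      by (simp add: dist_norm)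
  qed
  from eventually_happens'[OF sequentially_bot this]
  obtain k where "\<forall>i\<in>{..<n}. \<forall>j\<in>{..<n}. \<forall>c\<in>{..<d}. cmod (s k i j c - x i j c) < t" ..
  hence k: "\<And>i j c. i < n \<Longrightarrow> j < n \<Longrightarrow> c < d \<Longrightarrow> cmod (s k i j c - x i j c) < t" by simp
  define y where "y = (\<lambda>i j l. x i j l - s k i j l)"
  have "norm_bound n y (entry_const n * t)"
  proof (rule norm_bound_of_entries)
    show "herm n y"
    proof (rule hermI)
      fix i j l assume "i < n" "j < n" "l < d"
      thus "y j i l = cnj (y i j l)" using h[of i j l] C_herm[OF s[of k], of i j l] by (simp only: y_def complex_cnj_diff)
    qed
    show "cmod (y i j l) \<le> t" if "i < n" "j < n" "l < d" for i j l
      using k[OF that] by (simp add: y_def norm_minus_commute)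
  qed (use t in simp)
  hence "shift r y \<in> C n" by (simp add: norm_bound_def t)
  from shift_add[OF this, of 0 "s k"] s[of k] have "shift r (\<lambda>i j l. y i j l + s k i j l) \<in> C n" by simp
  thus "shift r x \<in> C n" by (simp add: y_def)
qed

text \<open>
  Otherwise normalized elements of the order interval would have a nonzero limit \<open>x\<close> with both \<open>x\<close> and \<open>-x\<close>
  positive.
\<close>

lemma C_interval_bounded:
  "\<exists>K. \<forall>X\<in>C n. shift 2 (neg X) \<in> C n \<longrightarrow> (\<forall>i<n. \<forall>j<n. \<forall>l<d. cmod (X i j l) \<le> K)"
proof (rule ccontr)
  assume neg: "\<not> ?thesis"
  define I where "I = {..<n} \<times> grid n d"
  have I: "finite I" by (simp add: I_def)
  define S where "S X = (\<Sum>(i,j,l)\<in>I. cmod (X i j l))" for X :: arr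
  have Sge: "cmod (X i j l) \<le> S X" if "i < n" "j < n" "l < d" for X i j l
    unfolding S_def using member_le_sum[of "(i,j,l)" I "\<lambda>(i,j,l). cmod (X i j l)"] that I by (auto simp: I_def)
  have "\<exists>X. X \<in> C n \<and> shift 2 (neg X) \<in> C n \<and> real (Suc k) < S X" for k
  proof -
    obtain X i j l where "X \<in> C n" "shift 2 (neg X) \<in> C n" "i < n" "j < n" "l < d" "\<not> cmod (X i j l) \<le> real (Suc k)"
      using neg by blast
    thus ?thesis using Sge[of i j l X] by (intro exI[of _ X]) auto
  qed
  hence "\<forall>k. \<exists>X. X \<in> C n \<and> shift 2 (neg X) \<in> C n \<and> real (Suc k) < S X" by (rule allI)
  from choice[OF this] obtain s where "\<forall>k. s k \<in> C n \<and> shift 2 (neg (s k)) \<in> C n \<and> real (Suc k) < S (s k)" ..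
  hence s: "\<And>k. s k \<in> C n" "\<And>k. shift 2 (neg (s k)) \<in> C n" "\<And>k. real (Suc k) < S (s k)" by simp_all
  have Spos: "S (s k) > 0" for k using s(3)[of k] by simp
  define y where "y k = (\<lambda>i j l. complex_of_real (1 / S (s k)) * s k i j l)" for k
  have yC: "y k \<in> C n" for k unfolding y_def using Spos[of k] by (intro C_scale s) simp
  have yle: "cmod (y k i j l) \<le> 1" if "i < n" "j < n" "l < d" for k i j l
    using Sge[OF that, of "s k"] Spos[of k] by (simp add: y_def norm_mult norm_divide)
  obtain r g where r: "strict_mono (r::nat\<Rightarrow>nat)" "\<And>p. p \<in> I \<Longrightarrow> (\<lambda>k. (\<lambda>(i,j,l). y (r k) i j l) p) \<longlonglongrightarrow> g p"
  proof -
    have "cmod ((\<lambda>(i,j,l). y k i j l) p) \<le> 1" if "p \<in> I" for k p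
      using that yle by (auto simp: I_def)
    from finite_bounded_subseq[OF I, of "\<lambda>k p. (\<lambda>(i,j,l). y k i j l) p", OF this] that
    show ?thesis by blast
  qed
  define G where "G = (\<lambda>i j l. g (i,j,l))"
  have lim: "(\<lambda>k. y (r k) i j l) \<longlonglongrightarrow> G i j l" if "i < n" "j < n" "l < d" for i j l
    using r(2)[of "(i,j,l)"] that by (simp add: I_def G_def)
  have GC: "G \<in> C n" by (rule C_closed[OF yC lim])
  have lim0: "(\<lambda>k. 2 / S (s (r k))) \<longlonglongrightarrow> 0"
  proof (rule tendsto_sandwich)
    show "eventually (\<lambda>k. 0 \<le> 2 / S (s (r k))) sequentially"
      by (intro always_eventually allI divide_nonneg_pos Spos) simp
    have "2 / S (s (r k)) \<le> 2 * inverse (real (Suc k))" for k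
    proof -
      have "real (Suc k) \<le> real (Suc (r k))" using strict_mono_imp_increasing[OF r(1), of k] by simp
      also have "\<dots> \<le> S (s (r k))" by (rule less_imp_le[OF s(3)])
      finally have "real (Suc k) \<le> S (s (r k))" .
      thus ?thesis using Spos[of "r k"] by (simp add: field_simps)
    qed
    thus "eventually (\<lambda>k. 2 / S (s (r k)) \<le> 2 * inverse (real (Suc k))) sequentially" by (auto intro!: always_eventually)
    show "(\<lambda>k. 2 * inverse (real (Suc k))) \<longlonglongrightarrow> 0"
      using tendsto_mult[OF tendsto_const[of 2] LIMSEQ_inverse_real_of_nat] by simp
  qed simp
  have "neg G \<in> C n"
  proof (rule C_closed)
    show "shift (2 / S (s (r k))) (neg (y (r k))) \<in> C n" for k
      using shift_scale[OF s(2)[of "r k"], of "1 / S (s (r k))"] Spos[of "r k"] by (simp add: neg_def y_def)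
    fix i j l assume "i < n" "j < n" "l < d"
    have "(\<lambda>k. if i = j then complex_of_real (2 / S (s (r k))) * e l else 0) \<longlonglongrightarrow> 0"
    proof (cases "i = j")
      case True
      have "(\<lambda>k. complex_of_real (2 / S (s (r k))) * e l) \<longlonglongrightarrow> complex_of_real 0 * e l"
        by (intro tendsto_intros lim0)
      thus ?thesis by (simp only: True if_True of_real_0 mult_zero_left simp_thms)
    qed simp
    from tendsto_add[OF this tendsto_minus[OF lim[OF \<open>i < n\<close> \<open>j < n\<close> \<open>l < d\<close>]]]
    show "(\<lambda>k. shift (2 / S (s (r k))) (neg (y (r k))) i j l) \<longlonglongrightarrow> neg G i j l"
      by (simp only: shift_def neg_def add_0)
  qed
  hence G0: "G i j l = 0" if "i < n" "j < n" "l < d" for i j l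
    using C_proper[OF GC _ that] by (simp add: neg_def)
  have "S (y k) = 1" for k
  proof -
    have "S (y k) = (\<Sum>p\<in>I. (1 / S (s k)) * (\<lambda>(i,j,l). cmod (s k i j l)) p)"
      unfolding S_def[of "y k"] using Spos[of k] by (intro sum.cong refl) (auto simp: y_def norm_mult norm_divide)
    also have "\<dots> = (1 / S (s k)) * S (s k)" unfolding S_def[of "s k"] sum_distrib_left ..
    finally show ?thesis using Spos[of k] by simp
  qed
  moreover have "(\<lambda>k. S (y (r k))) \<longlonglongrightarrow> S G"
    unfolding S_def by (intro tendsto_sum) (auto intro!: tendsto_norm lim simp: I_def)
  ultimately have "S G = 1" by (simp add: LIMSEQ_const_iff)
  moreover have "S G = 0" unfolding S_def by (rule sum.neutral) (auto simp: I_def G0)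
  ultimately show False by simp
qed

end

section \<open>Testing positivity with a single element\<close>

context coord_opsys
begin

text \<open>
  Rounding the entries to a grid of width \<open>h\<close> sorts the order interval into finitely many classes; the net
  takes one element from each.
\<close>

lemma C_ball_net:
  assumes h: "h > 0"
  shows "\<exists>F. finite F \<and> F \<subseteq> C n \<and> (\<forall>X\<in>C n. shift 2 (neg X) \<in> C n \<longrightarrow>
    (\<exists>Y\<in>F. \<forall>i<n. \<forall>j<n. \<forall>l<d. cmod (X i j l - Y i j l) \<le> 2 * h))"
proof -
  obtain K where K: "\<forall>X\<in>C n. shift 2 (neg X) \<in> C n \<longrightarrow> (\<forall>i<n. \<forall>j<n. \<forall>l<d. cmod (X i j l) \<le> K)"
    using C_interval_bounded[of n] by blast
  define B where "B = {X \<in> C n. shift 2 (neg X) \<in> C n}"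
  define I where "I = {..<n} \<times> grid n d"
  define key where "key X = (\<lambda>p\<in>I. case p of (i,j,l) \<Rightarrow> (\<lfloor>Re (X i j l) / h\<rfloor>, \<lfloor>Im (X i j l) / h\<rfloor>))" for X :: arr
  define T where "T = {\<lfloor>- K / h\<rfloor>..\<lfloor>K / h\<rfloor>}"
  have fl: "\<lfloor>x / h\<rfloor> \<in> T" if "\<bar>x\<bar> \<le> K" for x
  proof -
    have "- K / h \<le> x / h" "x / h \<le> K / h"
      by (rule divide_right_mono; use that h in linarith)+
    from floor_mono[OF this(1)] floor_mono[OF this(2)] show ?thesis by (simp add: T_def)
  qed
  have "key ` B \<subseteq> I \<rightarrow>\<^sub>E T \<times> T"
  proof (intro subsetI)
    fix k assume "k \<in> key ` B"
    then obtain X where X: "X \<in> B" "k = key X" by blast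
    have "\<bar>Re (X i j l)\<bar> \<le> K \<and> \<bar>Im (X i j l)\<bar> \<le> K" if "i < n" "j < n" "l < d" for i j l
    proof -
      have "cmod (X i j l) \<le> K" using K X(1) that by (auto simp: B_def)
      thus ?thesis using abs_Re_le_cmod[of "X i j l"] abs_Im_le_cmod[of "X i j l"] by linarith
    qed
    thus "k \<in> I \<rightarrow>\<^sub>E T \<times> T" unfolding X(2) key_def by (auto simp: I_def fl)
  qed
  hence fin: "finite (key ` B)"
    by (rule finite_subset) (auto intro!: finite_PiE simp: I_def T_def)
  define op_tensor where "op_tensor k = (SOME X. X \<in> B \<and> key X = k)" for k
  have op_tensor: "op_tensor (key X) \<in> B \<and> key (op_tensor (key X)) = key X" if "X \<in> B" for X
    unfolding op_tensor_def by (rule someI[of "\<lambda>Z. Z \<in> B \<and> key Z = key X" X]) (use that in simp)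
  have close: "\<bar>x - y\<bar> \<le> h" if "\<lfloor>x / h\<rfloor> = \<lfloor>y / h\<rfloor>" for x y :: real
  proof -
    have "\<bar>x / h - y / h\<bar> \<le> 1" using that by linarith
    hence "\<bar>x / h - y / h\<bar> * h \<le> 1 * h" using h by (intro mult_right_mono) auto
    moreover have "\<bar>x / h - y / h\<bar> * h = \<bar>x - y\<bar>"
      using h by (simp flip: diff_divide_distrib)
    ultimately show ?thesis by simp
  qed
  have "\<exists>Y\<in>op_tensor ` key ` B. \<forall>i<n. \<forall>j<n. \<forall>l<d. cmod (X i j l - Y i j l) \<le> 2 * h" if X: "X \<in> B" for X
  proof (intro bexI[of _ "op_tensor (key X)"] allI impI)
    fix i j l assume "i < n" "j < n" "l < d"
    hence m: "(i,j,l) \<in> I" by (simp add: I_def)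
    have "key X (i,j,l) = key (op_tensor (key X)) (i,j,l)" using op_tensor[OF X] by simp
    hence "\<lfloor>Re (X i j l) / h\<rfloor> = \<lfloor>Re (op_tensor (key X) i j l) / h\<rfloor>" "\<lfloor>Im (X i j l) / h\<rfloor> = \<lfloor>Im (op_tensor (key X) i j l) / h\<rfloor>"
      using m unfolding key_def by simp_all
    from close[OF this(1)] close[OF this(2)]
    show "cmod (X i j l - op_tensor (key X) i j l) \<le> 2 * h"
      using cmod_le[of "X i j l - op_tensor (key X) i j l"] by simp
  qed (use X in blast)
  moreover have "op_tensor ` key ` B \<subseteq> C n" using op_tensor by (auto simp: B_def)
  ultimately show ?thesis using fin by (intro exI[of _ "op_tensor ` key ` B"]) (auto simp: B_def)
qed

text \<open>
  The order interval is compact, so a shift by \<open>2s\<close> moves it into a cone with finitely many generators \<open>F\<close>: the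
  unit, a finite net, and the arrays \<open>\<plusminus> gen\<close> to absorb the rounding error, all shifted far enough to be positive with
  margin \<open>\<eta>\<close>. Membership in the generated cone is stated as an induction principle for properties \<open>Q\<close> that
  are stable under conic combinations.
\<close>

lemma polyhedral_approx:
  assumes s: "s > 0"
  obtains F \<eta> where "finite F" "\<eta> > 0" "F \<subseteq> C n" "\<And>Y. Y \<in> F \<Longrightarrow> shift (- \<eta>) Y \<in> C n"
    "\<And>Q X. (\<And>Y. Y \<in> F \<Longrightarrow> Q Y) \<Longrightarrow> (\<And>X Y. Q X \<Longrightarrow> Q Y \<Longrightarrow> Q (\<lambda>i j l. X i j l + Y i j l)) \<Longrightarrow>
      (\<And>c X. 0 \<le> c \<Longrightarrow> Q X \<Longrightarrow> Q (\<lambda>i j l. complex_of_real c * X i j l)) \<Longrightarrow>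
      (\<And>X Y. Q X \<Longrightarrow> (\<And>i j l. i < n \<Longrightarrow> j < n \<Longrightarrow> l < d \<Longrightarrow> X i j l = Y i j l) \<Longrightarrow> Q Y) \<Longrightarrow>
      X \<in> C n \<Longrightarrow> shift 2 (neg X) \<in> C n \<Longrightarrow> Q (shift (2 * s) X)"
proof -
  define one where "one = shift 1 (\<lambda>_ _ _. 0)"
  define R where "R g = gen_bound n g + 1" for g
  have R: "R g > 0" for g using gen_bound(1)[of n g] by (simp add: R_def)
  define SR where "SR = (\<Sum>g\<in>gens n. R g)"
  have SR: "SR \<ge> 0" unfolding SR_def by (intro sum_nonneg less_imp_le R)
  (* the grid is so fine that the rounding error is absorbed by a shift by s *)
  define h where "h = s / (2 * (SR + 1))"
  have h: "h > 0" using s SR by (simp add: h_def)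
  have hs: "2 * h * SR \<le> s"
  proof -
    have "2 * h * SR = s * (SR / (SR + 1))" using SR by (simp add: h_def field_simps)
    also have "\<dots> \<le> s * 1" using s SR by (intro mult_left_mono) auto
    finally show ?thesis by simp
  qed
  obtain F0 where F0: "finite F0" "F0 \<subseteq> C n" "\<forall>X\<in>C n. shift 2 (neg X) \<in> C n \<longrightarrow>
    (\<exists>Y\<in>F0. \<forall>i<n. \<forall>j<n. \<forall>l<d. cmod (X i j l - Y i j l) \<le> 2 * h)"
    using C_ball_net[OF h, of n] by blast
  define F where "F = shift s ` F0 \<union> (\<lambda>g. shift (R g) (gen g)) ` gens n \<union> (\<lambda>g. shift (R g) (neg (gen g))) ` gens n \<union> {one}"
  define \<eta> where "\<eta> = min s 1"
  have ss: "shift r (shift t X) = shift (r + t) X" for r t X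
    by (auto simp: shift_def algebra_simps intro!: ext)
  have Fm: "shift (- \<eta>) Y \<in> C n" if "Y \<in> F" for Y
  proof -
    consider Z where "Z \<in> F0" "Y = shift s Z" | g where "Y = shift (R g) (gen g)" | g where "Y = shift (R g) (neg (gen g))" | "Y = one"
    proof -
      from \<open>Y \<in> F\<close> have "Y \<in> shift s ` F0 \<or> Y \<in> (\<lambda>g. shift (R g) (gen g)) ` gens n
        \<or> Y \<in> (\<lambda>g. shift (R g) (neg (gen g))) ` gens n \<or> Y = one" by (simp only: F_def Un_iff singleton_iff disj_assoc)
      thus ?thesis by (elim disjE imageE) (rule that; assumption)+
    qed
    thus ?thesis
    proof cases
      case 1
      hence "shift 0 Z \<in> C n" using F0 by auto
      thus ?thesis unfolding 1 ss by (rule shift_mono) (simp add: \<eta>_def)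
    next
      case 2
      have "shift (gen_bound n g) (gen g) \<in> C n" using gen_bound(2)[of n g] by (simp add: norm_bound_def)
      thus ?thesis unfolding 2 ss by (rule shift_mono) (simp add: \<eta>_def R_def)
    next
      case 3
      have "shift (gen_bound n g) (neg (gen g)) \<in> C n" using gen_bound(2)[of n g] by (simp add: norm_bound_def)
      thus ?thesis unfolding 3 ss by (rule shift_mono) (simp add: \<eta>_def R_def)
    next
      case 4
      thus ?thesis unfolding 4 one_def ss by (intro shift_pos) (simp add: \<eta>_def)
    qed
  qed
  have FC: "F \<subseteq> C n"
  proof
    fix Y assume "Y \<in> F"
    from shift_mono[OF Fm[OF this], of 0] s show "Y \<in> C n" by (simp add: \<eta>_def)
  qed
  show ?thesis
  proof (rule that)
    show "finite F" unfolding F_def using F0(1) finite_gens by simp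
    show "\<eta> > 0" using s by (simp add: \<eta>_def)
    show "F \<subseteq> C n" by (rule FC)
    show "shift (- \<eta>) Y \<in> C n" if "Y \<in> F" for Y by (rule Fm[OF that])
    fix Q :: "arr \<Rightarrow> bool" and X
    assume QF: "\<And>Y. Y \<in> F \<Longrightarrow> Q Y"
      and Qadd: "\<And>X Y. Q X \<Longrightarrow> Q Y \<Longrightarrow> Q (\<lambda>i j l. X i j l + Y i j l)"
      and Qscale: "\<And>c X. 0 \<le> c \<Longrightarrow> Q X \<Longrightarrow> Q (\<lambda>i j l. complex_of_real c * X i j l)"
      and Qcong: "\<And>X Y. Q X \<Longrightarrow> (\<And>i j l. i < n \<Longrightarrow> j < n \<Longrightarrow> l < d \<Longrightarrow> X i j l = Y i j l) \<Longrightarrow> Q Y"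
      and X: "X \<in> C n" "shift 2 (neg X) \<in> C n"
    have Qone: "Q one" by (rule QF) (simp add: F_def)
    have Q0: "Q (\<lambda>_ _ _. 0)" using Qscale[OF _ Qone, of 0] by simp
    have Qsum: "Q (\<lambda>i j l. \<Sum>k\<in>A. Z k i j l)" if "finite A" "\<And>k. k \<in> A \<Longrightarrow> Q (Z k)" for A :: "(nat \<times> nat \<times> nat \<times> bool) set" and Z
      using that
    proof (induction A rule: finite_induct)
      case empty thus ?case using Q0 by simp
    next
      case (insert x A)
      thus ?case using Qadd[of "Z x" "\<lambda>i j l. \<Sum>k\<in>A. Z k i j l"] by simp
    qed
    obtain Y where Y: "Y \<in> F0" "\<And>i j l. i < n \<Longrightarrow> j < n \<Longrightarrow> l < d \<Longrightarrow> cmod (X i j l - Y i j l) \<le> 2 * h"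
      using F0(3) X by blast
    define D where "D = (\<lambda>i j l. X i j l - Y i j l)"
    have D: "herm n D"
    proof (rule hermI)
      fix i j l assume ij: "i < n" "j < n" "l < d"
      show "D j i l = cnj (D i j l)" unfolding D_def complex_cnj_diff
        using C_herm[OF X(1) ij] C_herm[OF _ ij, of Y] F0(2) Y(1) by (simp only: subset_eq)
    qed
    (* signs are absorbed, so that all coefficients are nonnegative *)
    define G where "G g = shift (R g) (if coef D g \<ge> 0 then gen g else neg (gen g))" for g
    have QG: "Q (G g)" if "g \<in> gens n" for g
      unfolding G_def using that by (intro QF) (auto simp: F_def)
    (* what is left of the shift after the generators have used their share *)
    define c where "c = s - (\<Sum>g\<in>gens n. \<bar>coef D g\<bar> * R g)"
    have cle: "\<bar>coef D g\<bar> \<le> 2 * h" if "g \<in> gens n" for g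
    proof -
      obtain a b c t where [simp]: "g = (a,b,c,t)" by (cases g)
      show ?thesis using coef_le[of a b c t n D "2*h"] that Y(2)[of a b c] by (auto simp: gens_def D_def)
    qed
    have "(\<Sum>g\<in>gens n. \<bar>coef D g\<bar> * R g) \<le> (\<Sum>g\<in>gens n. 2 * h * R g)"
      by (intro sum_mono mult_right_mono cle less_imp_le[OF R])
    also have "\<dots> = 2 * h * SR" by (simp add: SR_def sum_distrib_left)
    finally have c0: "0 \<le> c" using hs by (simp add: c_def)
    have "Q (\<lambda>i j l. shift s Y i j l + ((\<Sum>g\<in>gens n. complex_of_real \<bar>coef D g\<bar> * G g i j l) + complex_of_real c * one i j l))"
      by (intro Qadd Qscale Qone c0 Qsum finite_gens QG QF) (auto simp: F_def Y(1))
    thus "Q (shift (2 * s) X)"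
    proof (rule Qcong)
      fix i j l assume ij: "i < n" "j < n" "l < d"
      have "(\<Sum>g\<in>gens n. complex_of_real \<bar>coef D g\<bar> * G g i j l)
        = (\<Sum>g\<in>gens n. complex_of_real (coef D g) * gen g i j l + (if i = j then complex_of_real (\<bar>coef D g\<bar> * R g) * e l else 0))"
        by (intro sum.cong refl) (auto simp: G_def shift_def neg_def algebra_simps)
      also have "\<dots> = D i j l + (if i = j then complex_of_real (s - c) * e l else 0)"
        by (simp add: sum.distrib herm_decomp[OF D ij, symmetric] c_def sum_distrib_right)
      finally have e1: "(\<Sum>g\<in>gens n. complex_of_real \<bar>coef D g\<bar> * G g i j l)
        = D i j l + (if i = j then complex_of_real (s - c) * e l else 0)" .
      show "shift s Y i j l + ((\<Sum>g\<in>gens n. complex_of_real \<bar>coef D g\<bar> * G g i j l) + complex_of_real c * one i j l)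
        = shift (2 * s) X i j l"
        unfolding e1 by (simp add: shift_def one_def D_def algebra_simps)
    qed
  qed
qed

lemma C_direct_sum:
  assumes F: "\<And>t. t < N \<Longrightarrow> F t \<in> C n" and n: "n > 0"
  shows "(\<lambda>i j l. if i div n = j div n then F (i div n) (i mod n) (j mod n) l else 0) \<in> C (N * n)"
proof -
  define \<alpha> where "\<alpha> t i a = (if i div n = t \<and> i mod n = a then 1 else (0::complex))" for t i a
  have "(\<lambda>i j l. \<Sum>t<N. (\<lambda>i j l. \<Sum>a<n. \<Sum>b<n. \<alpha> t i a * cnj (\<alpha> t j b) * F t a b l) i j l) \<in> C (N * n)"
    by (rule C_sum, rule C_conj, rule F) simp
  thus ?thesis
  proof (rule C_cong)
    fix i j l assume ij: "i < N * n" "j < N * n"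
    hence iN: "i div n < N" by (simp add: less_mult_imp_div_less)
    have "(\<Sum>t<N. \<Sum>a<n. \<Sum>b<n. \<alpha> t i a * cnj (\<alpha> t j b) * F t a b l)
      = (\<Sum>t<N. if i div n = t then (if j div n = t then F t (i mod n) (j mod n) l else 0) else 0)"
    proof (intro sum.cong refl)
      fix t
      have 1: "(\<Sum>b<n. \<alpha> t i a * cnj (\<alpha> t j b) * F t a b l)
        = (if i mod n = a then if i div n = t \<and> j div n = t then F t a (j mod n) l else 0 else 0)" for a
      proof -
        have "(\<Sum>b<n. \<alpha> t i a * cnj (\<alpha> t j b) * F t a b l)
          = (\<Sum>b<n. if j mod n = b then if i mod n = a \<and> i div n = t \<and> j div n = t then F t a b l else 0 else 0)"
          by (intro sum.cong refl) (auto simp: \<alpha>_def)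
        thus ?thesis using n by simp
      qed
      show "(\<Sum>a<n. \<Sum>b<n. \<alpha> t i a * cnj (\<alpha> t j b) * F t a b l) = (if i div n = t then (if j div n = t then F t (i mod n) (j mod n) l else 0) else 0)"
        unfolding 1 using n by simp
    qed
    also have "\<dots> = (if i div n = j div n then F (i div n) (i mod n) (j mod n) l else 0)"
      using iN by simp
    finally show "(\<Sum>t<N. \<Sum>a<n. \<Sum>b<n. \<alpha> t i a * cnj (\<alpha> t j b) * F t a b l)
      = (if i div n = j div n then F (i div n) (i mod n) (j mod n) l else 0)" .
  qed
qed

text \<open>
  The amplification of \<open>\<phi>\<close> applied to the matrix \<open>X\<close>, as a kernel on pairs of a row of \<open>X\<close> and a row of the
  value of \<open>\<phi>\<close>.
\<close>

definition amp :: "(nat \<Rightarrow> nat \<Rightarrow> nat \<Rightarrow> complex) \<Rightarrow> arr \<Rightarrow> nat \<times> nat \<Rightarrow> nat \<times> nat \<Rightarrow> complex" where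
  "amp \<phi> X = (\<lambda>(g,i) (h,j). \<Sum>l<d. X g h l * \<phi> l i j)"

definition amp_psd :: "nat \<Rightarrow> (nat \<Rightarrow> nat \<Rightarrow> nat \<Rightarrow> complex) \<Rightarrow> nat \<Rightarrow> arr \<Rightarrow> bool" where
  "amp_psd m \<phi> n X \<longleftrightarrow> psd (grid n m) (amp \<phi> X)"

lemma amp_psd_cong:
  "amp_psd m \<phi> n X \<Longrightarrow> (\<And>i j l. i < n \<Longrightarrow> j < n \<Longrightarrow> l < d \<Longrightarrow> X i j l = Y i j l) \<Longrightarrow> amp_psd m \<phi> n Y"
  unfolding amp_psd_def by (erule psd_cong[rotated]) (auto simp: amp_def intro!: sum.cong)

lemma amp_psd_add: "amp_psd m \<phi> n X \<Longrightarrow> amp_psd m \<phi> n Y \<Longrightarrow> amp_psd m \<phi> n (\<lambda>i j l. X i j l + Y i j l)"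
  unfolding amp_psd_def
  by (drule (1) psd_add, erule psd_cong[rotated])
    (auto simp: amp_def sum.distrib distrib_right)

lemma amp_psd_scale: "0 \<le> c \<Longrightarrow> amp_psd m \<phi> n X \<Longrightarrow> amp_psd m \<phi> n (\<lambda>i j l. complex_of_real c * X i j l)"
  unfolding amp_psd_def
  by (drule (1) psd_scale[rotated], erule psd_cong[rotated])
    (auto simp: amp_def sum_distrib_left mult.assoc)

text \<open>
  \<open>P\<close> is the direct sum of the generators from \<open>polyhedral_approx\<close>: positivity of \<open>\<phi>\<close> on \<open>P\<close> is positivity
  on each of them, and hence, up to \<open>2s\<close>, on the whole order interval. One \<open>P\<close> serves maps into
  matrices of all sizes.
\<close>

lemma test_element:
  assumes s: "s > 0" and n: "n > 0"
  obtains p P \<eta> where "p > 0" "P \<in> C p" "\<eta> > 0" "shift (- \<eta>) P \<in> C p"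
    "\<And>m \<phi> X. amp_psd m \<phi> p P \<Longrightarrow> X \<in> C n \<Longrightarrow> shift 2 (neg X) \<in> C n \<Longrightarrow> amp_psd m \<phi> n (shift (2 * s) X)"
proof (rule polyhedral_approx[OF s, of n])
  fix F \<eta>
  assume F: "finite F" "(\<eta>::real) > 0" "F \<subseteq> C n" "\<And>Y. Y \<in> F \<Longrightarrow> shift (- \<eta>) Y \<in> C n"
   and cone: "\<And>Q X. (\<And>Y. Y \<in> F \<Longrightarrow> Q Y) \<Longrightarrow> (\<And>X Y. Q X \<Longrightarrow> Q Y \<Longrightarrow> Q (\<lambda>i j l. X i j l + Y i j l)) \<Longrightarrow>
      (\<And>c X. 0 \<le> c \<Longrightarrow> Q X \<Longrightarrow> Q (\<lambda>i j l. complex_of_real c * X i j l)) \<Longrightarrow>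
      (\<And>X Y. Q X \<Longrightarrow> (\<And>i j l. i < n \<Longrightarrow> j < n \<Longrightarrow> l < d \<Longrightarrow> X i j l = Y i j l) \<Longrightarrow> Q Y) \<Longrightarrow>
      X \<in> C n \<Longrightarrow> shift 2 (neg X) \<in> C n \<Longrightarrow> Q (shift (2 * s) X)"
  define N where "N = card F"
  obtain f where f: "bij_betw f {..<N} F"
    using ex_bij_betw_nat_finite[OF F(1)] by (auto simp: N_def atLeast0LessThan)
  have fF: "f t \<in> F" if "t < N" for t using f that by (auto simp: bij_betw_def)
  define P where "P = (\<lambda>i j l. if i div n = j div n then f (i div n) (i mod n) (j mod n) l else 0)"
  have P1: "P \<in> C (N * n)" unfolding P_def by (rule C_direct_sum[OF _ n]) (use fF F(3) in blast)
  have "(\<lambda>i j l. if i div n = j div n then shift (- \<eta>) (f (i div n)) (i mod n) (j mod n) l else 0) \<in> C (N * n)"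
    by (rule C_direct_sum[OF _ n]) (use fF F(4) in blast)
  hence P2: "shift (- \<eta>) P \<in> C (N * n)"
  proof (rule C_cong)
    fix i j l
    have "i = j \<longleftrightarrow> i div n = j div n \<and> i mod n = j mod n" by (metis div_mult_mod_eq)
    thus "(if i div n = j div n then shift (- \<eta>) (f (i div n)) (i mod n) (j mod n) l else 0) = shift (- \<eta>) P i j l"
      by (auto simp: shift_def P_def)
  qed
  have P3: "amp_psd m \<phi> n (shift (2 * s) X)" if A: "amp_psd m \<phi> (N * n) P" and X: "X \<in> C n" "shift 2 (neg X) \<in> C n" for m \<phi> X
  proof (rule cone[where Q = "amp_psd m \<phi> n", OF _ amp_psd_add amp_psd_scale amp_psd_cong X])
    fix Y assume "Y \<in> F"
    then obtain t where t: "t < N" "Y = f t" using f by (auto simp: bij_betw_def)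
    have "psd (grid n m) (\<lambda>x y. amp \<phi> P (case x of (i, a) \<Rightarrow> (t * n + i, a)) (case y of (i, a) \<Rightarrow> (t * n + i, a)))"
    proof (rule psd_pullback)
      show "psd ({..<N * n} \<times> {..<m}) (amp \<phi> P)" using A by (simp add: amp_psd_def)
      have "t * n + i < N * n" if "i < n" for i
      proof -
        have "t * n + i < t * n + n" using that by simp
        also have "\<dots> = (t + 1) * n" by simp
        also have "\<dots> \<le> N * n" using t by (intro mult_right_mono) auto
        finally show ?thesis .
      qed
      thus "(\<lambda>x. case x of (i, a) \<Rightarrow> (t * n + i, a)) ` (grid n m) \<subseteq> {..<N * n} \<times> {..<m}" by auto
    qed simp
    thus "amp_psd m \<phi> n Y" unfolding amp_psd_def
      by (rule psd_cong[rotated]) (auto simp: amp_def P_def t(2))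
  qed
  have "F \<noteq> {}"
  proof
    assume "F = {}"
    from cone[where Q = "\<lambda>_. False" and X = "\<lambda>_ _ _. 0"] this show False
      using C_zero[of n] shift_pos[of 2 n] by (simp add: neg_def)
  qed
  hence "N > 0" using F(1) by (simp add: N_def card_gt_0_iff)
  hence "N * n > 0" using n by simp
  from that[OF this P1 F(2) P2 P3] show ?thesis .
qed

abbreviation "ev \<omega> X i j \<equiv> \<Sum>l<d. complex_of_real (\<omega> l) * X i j l"

definition state :: "(nat \<Rightarrow> real) \<Rightarrow> bool" where
  "state \<omega> \<longleftrightarrow> (\<Sum>l<d. complex_of_real (\<omega> l) * e l) = 1 \<and>
     (\<forall>n. \<forall>X\<in>C n. psd {..<n} (\<lambda>i j. ev \<omega> X i j))"

lemma C1_real: "(\<lambda>i j l. x l) \<in> C 1 \<Longrightarrow> l < d \<Longrightarrow> Im (x l) = 0"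
  using C_herm[of "\<lambda>i j l. x l" 1 0 0 l] by (simp add: complex_eq_iff)

lemma positive_functional_psd:
  assumes pos: "\<And>x. (\<lambda>i j l. x l) \<in> C 1 \<Longrightarrow> 0 \<le> (\<Sum>l<d. \<omega> l * Re (x l))"
    and X: "X \<in> C n"
  shows "psd {..<n} (\<lambda>i j. ev \<omega> X i j)"
  unfolding psd_def
proof
  fix f
  define x where "x l = (\<Sum>a<n. \<Sum>b<n. cnj (f a) * cnj (cnj (f b)) * X a b l)" for l
  have x: "(\<lambda>i j l. x l) \<in> C 1"
    unfolding x_def using C_conj[OF X, of "\<lambda>i a. cnj (f a)" 1] .
  have "(\<Sum>l<d. complex_of_real (\<omega> l) * x l) = complex_of_real (\<Sum>l<d. \<omega> l * Re (x l))"
    unfolding of_real_sum by (intro sum.cong refl) (auto simp: complex_eq_iff C1_real[OF x])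
  hence "0 \<le> (\<Sum>l<d. complex_of_real (\<omega> l) * x l)" using pos[OF x] by (simp only: complex_nonneg_iff) simp
  also have "\<dots> = (\<Sum>l<d. \<Sum>a<n. \<Sum>b<n. cnj (f a) * (complex_of_real (\<omega> l) * X a b l) * f b)"
    by (simp add: x_def sum_distrib_left mult_ac)
  also have "\<dots> = (\<Sum>l<d. qform {..<n} (\<lambda>a b. complex_of_real (\<omega> l) * X a b l) f)"
    unfolding qform_def ..
  also have "\<dots> = qform {..<n} (\<lambda>i j. ev \<omega> X i j) f"
    by (rule qform_sum[symmetric])
  finally show "0 \<le> qform {..<n} (\<lambda>i j. ev \<omega> X i j) f" .
qed

lemma e_sum: "(\<Sum>l<d. complex_of_real (\<omega> l) * e l) = complex_of_real (\<Sum>l<d. \<omega> l * Re (e l))"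
proof -
  have "Im (e l) = 0" if "l < d" for l using e_real[OF that] by (auto simp: complex_eq_iff)
  thus ?thesis unfolding of_real_sum by (intro sum.cong refl) (auto simp: complex_eq_iff)
qed

lemma stateI:
  assumes pos: "\<And>x. (\<lambda>i j l. x l) \<in> C 1 \<Longrightarrow> 0 \<le> (\<Sum>l<d. \<omega> l * Re (x l))"
    and N: "(\<Sum>l<d. \<omega> l * Re (e l)) = N" "N > 0"
  shows "state (\<lambda>l. \<omega> l / N)"
  unfolding state_def
proof (intro conjI allI ballI)
  have "(\<Sum>l<d. \<omega> l / N * Re (e l)) = 1"
    using N by (simp flip: sum_divide_distrib)
  thus "(\<Sum>l<d. complex_of_real (\<omega> l / N) * e l) = 1" unfolding e_sum by simp
  fix n X assume X: "X \<in> C n"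
  show "psd {..<n} (\<lambda>i j. \<Sum>l<d. complex_of_real (\<omega> l / N) * X i j l)"
  proof (rule positive_functional_psd[OF _ X])
    fix x assume "(\<lambda>i j l. x l) \<in> C 1"
    from pos[OF this] N(2) have "0 \<le> (\<Sum>l<d. \<omega> l * Re (x l)) / N" by simp
    thus "0 \<le> (\<Sum>l<d. \<omega> l / N * Re (x l))" by (simp add: sum_divide_distrib)
  qed
qed

lemma separate_from_cone:
  assumes y: "(\<lambda>i j l. y l) \<notin> C 1" and yr: "\<And>l. l < d \<Longrightarrow> Im (y l) = 0"
  obtains \<omega> :: "nat \<Rightarrow> real" where "\<And>x. (\<lambda>i j l. x l) \<in> C 1 \<Longrightarrow> 0 \<le> (\<Sum>l<d. \<omega> l * Re (x l))"
    "(\<Sum>l<d. \<omega> l * Re (y l)) < 0"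
proof -
  define K where "K = {x. (\<lambda>i j l. x l) \<in> C 1}"
  have yK: "y \<notin> K" using y by (simp add: K_def)
  obtain w where w: "\<And>x. x \<in> K \<Longrightarrow> 0 \<le> Re (\<Sum>l<d. cnj (w l) * x l)" "Re (\<Sum>l<d. cnj (w l) * y l) < 0"
  proof (rule closed_cone_separation[of "{..<d}" K y])
    show "(\<lambda>i. x i + z i) \<in> K" if "x \<in> K" "z \<in> K" for x z
      using C_add[of "\<lambda>i j l. x l" 1 "\<lambda>i j l. z l"] that by (simp add: K_def)
    show "(\<lambda>i. complex_of_real c * x i) \<in> K" if "x \<in> K" "0 \<le> c" for x c
      using C_scale[of "\<lambda>i j l. x l" 1 c] that by (simp add: K_def)
    show "x \<in> K" if "\<And>n::nat. s n \<in> K" "\<And>i. i \<in> {..<d} \<Longrightarrow> (\<lambda>n. s n i) \<longlonglongrightarrow> x i" for s x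
      using C_closed[of "\<lambda>k i j l. s k l" 1 "\<lambda>i j l. x l"] that by (simp add: K_def)
    show "K \<noteq> {}" using C_zero[of 1] unfolding K_def by blast
  qed (use yK in auto)
  show ?thesis
  proof (rule that[of "\<lambda>l. Re (w l)"])
    fix x assume x: "(\<lambda>i j l. x l) \<in> C 1"
    have "0 \<le> Re (\<Sum>l<d. cnj (w l) * x l)" using w(1)[of x] x by (simp only: K_def mem_Collect_eq)
    also have "\<dots> = (\<Sum>l<d. Re (w l) * Re (x l))"
      unfolding Re_sum by (intro sum.cong refl) (simp add: C1_real[OF x])
    finally show "0 \<le> (\<Sum>l<d. Re (w l) * Re (x l))" .
  next
    have "Re (\<Sum>l<d. cnj (w l) * y l) = (\<Sum>l<d. Re (w l) * Re (y l))"
      unfolding Re_sum by (intro sum.cong refl) (simp add: yr)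
    thus "(\<Sum>l<d. Re (w l) * Re (y l)) < 0" using w(2) by simp
  qed
qed

lemma state_exists:
  assumes nz: "\<exists>l<d. e l \<noteq> 0"
  obtains \<omega> where "state \<omega>"
proof -
  have ime: "Im (e l) = 0" if "l < d" for l using e_real[OF that] by (auto simp: complex_eq_iff)
  have "(\<lambda>i j l. - e l) \<notin> C 1"
  proof
    assume "(\<lambda>i j l. - e l) \<in> C 1"
    moreover have "(\<lambda>i j l. - (- e l)) \<in> C 1"
      by (rule C_cong[OF shift_pos[of 1 1]]) (auto simp: shift_def)
    ultimately have "- e l = 0" if "l < d" for l using C_proper[of "\<lambda>i j l. - e l" 1 0 0 l] that by simp
    thus False using nz by auto
  qed
  then obtain \<omega> where \<omega>: "\<And>x. (\<lambda>i j l. x l) \<in> C 1 \<Longrightarrow> 0 \<le> (\<Sum>l<d. \<omega> l * Re (x l))"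
    "(\<Sum>l<d. \<omega> l * Re (- e l)) < 0"
    using separate_from_cone[of "\<lambda>l. - e l"] ime by auto
  have "0 < (\<Sum>l<d. \<omega> l * Re (e l))" using \<omega>(2) by (simp add: sum_negf)
  from that[OF stateI[OF \<omega>(1) refl this]] show ?thesis .
qed

text \<open>
  A functional that is nonnegative on the cone becomes a state after a known state is added and the sum
  is normalized. So a vector on which all states vanish is positive together with its negative.
\<close>

lemma states_separate:
  assumes x: "\<And>\<omega>. state \<omega> \<Longrightarrow> (\<Sum>l<d. \<omega> l * x l) = (0::real)" and "l < d"
  shows "x l = 0"
proof (cases "\<exists>l<d. e l \<noteq> 0")
  case False
  have h: "herm 1 (\<lambda>i j l. of_real (c * x l))" for c by (rule hermI) simp
  have m: "(\<lambda>i j l. of_real (c * x l)) \<in> C 1" for c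
  proof -
    obtain r where "shift r (\<lambda>i j l. of_real (c * x l)) \<in> C 1" using herm_shift[OF h] by blast
    thus ?thesis by (rule C_cong) (use False in \<open>auto simp: shift_def\<close>)
  qed
  show ?thesis using C_proper[OF m[of 1], of 0 0 l] m[of "-1"] \<open>l < d\<close> by simp
next
  case True
  have m: "(\<lambda>i j l. of_real (c * x l)) \<in> C 1" for c
  proof (rule ccontr)
    assume n: "(\<lambda>i j l. of_real (c * x l)) \<notin> C 1"
    obtain \<omega> where \<omega>: "\<And>x. (\<lambda>i j l. x l) \<in> C 1 \<Longrightarrow> 0 \<le> (\<Sum>l<d. \<omega> l * Re (x l))"
      "(\<Sum>l<d. \<omega> l * Re (of_real (c * x l))) < 0"
      using separate_from_cone[OF n] by auto
    obtain \<tau> where \<tau>: "state \<tau>" using state_exists[OF True] .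
    have \<tau>1: "(\<Sum>l<d. \<tau> l * Re (e l)) = 1" using \<tau> unfolding state_def e_sum by (simp only: of_real_eq_1_iff)
    have \<tau>2: "0 \<le> (\<Sum>l<d. \<tau> l * Re (z l))" if z: "(\<lambda>i j l. z l) \<in> C 1" for z
    proof -
      have "psd {..<1::nat} (\<lambda>i j. \<Sum>l<d. complex_of_real (\<tau> l) * z l)"
        using \<tau> z unfolding state_def by fastforce
      from psd_diag[OF this, of 0] have "0 \<le> Re (\<Sum>l<d. complex_of_real (\<tau> l) * z l)"
        by (simp add: complex_nonneg_iff)
      thus ?thesis by (simp add: Re_sum)
    qed
    define N where "N = (\<Sum>l<d. (\<omega> l + \<tau> l) * Re (e l))"
    have "0 \<le> (\<Sum>l<d. \<omega> l * Re (e l))"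
      by (rule \<omega>(1)) (rule C_cong[OF shift_pos[of 1 1]], auto simp: shift_def)
    hence N: "N > 0" using \<tau>1 by (simp add: N_def distrib_right sum.distrib)
    have st: "state (\<lambda>l. (\<omega> l + \<tau> l) / N)"
    proof (rule stateI[OF _ N_def[symmetric] N])
      fix z assume z: "(\<lambda>i j l. z l) \<in> C 1"
      show "0 \<le> (\<Sum>l<d. (\<omega> l + \<tau> l) * Re (z l))"
        using \<omega>(1)[OF z] \<tau>2[OF z] by (simp add: distrib_right sum.distrib)
    qed
    have "(\<Sum>l<d. (\<omega> l + \<tau> l) / N * x l) = 0" by (rule x[OF st])
    hence "(\<Sum>l<d. (\<omega> l + \<tau> l) * x l) = 0" using N by (simp flip: sum_divide_distrib)
    moreover have "(\<Sum>l<d. \<tau> l * x l) = 0" by (rule x[OF \<tau>])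
    ultimately have "(\<Sum>l<d. \<omega> l * x l) = 0" by (simp add: distrib_right sum.distrib)
    hence "(\<Sum>l<d. \<omega> l * Re (of_real (c * x l))) = 0"
      by (simp add: mult.left_commute flip: sum_distrib_left)
    thus False using \<omega>(2) by simp
  qed
  show ?thesis using C_proper[OF m[of 1], of 0 0 l] m[of "-1"] \<open>l < d\<close> by simp
qed

end

section \<open>Contractions of a positive element\<close>

lemma sum_rotate3: "(\<Sum>g\<in>G. \<Sum>h\<in>H. \<Sum>l\<in>D. F g h l) = (\<Sum>l\<in>D. \<Sum>g\<in>G. \<Sum>h\<in>H. F g h l)"
proof -
  have "(\<Sum>g\<in>G. \<Sum>h\<in>H. \<Sum>l\<in>D. F g h l) = (\<Sum>g\<in>G. \<Sum>l\<in>D. \<Sum>h\<in>H. F g h l)"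
    by (intro sum.cong refl sum.swap)
  also have "\<dots> = (\<Sum>l\<in>D. \<Sum>g\<in>G. \<Sum>h\<in>H. F g h l)" by (rule sum.swap)
  finally show ?thesis .
qed

lemma qform_pairs:
  "qform (G \<times> I) (\<lambda>x y. A (fst x) (snd x) (fst y) (snd y)) f
   = (\<Sum>g\<in>G. \<Sum>h\<in>G. \<Sum>i\<in>I. \<Sum>j\<in>I. cnj (f (g,i)) * A g i h j * f (h,j))"
proof -
  have "qform (G \<times> I) (\<lambda>x y. A (fst x) (snd x) (fst y) (snd y)) f
    = (\<Sum>x\<in>G\<times>I. \<Sum>y\<in>G\<times>I. cnj (f (fst x, snd x)) * A (fst x) (snd x) (fst y) (snd y) * f (fst y, snd y))"
    unfolding qform_def by (simp only: prod.collapse)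
  also have "\<dots> = (\<Sum>x\<in>G\<times>I. \<Sum>h\<in>G. \<Sum>j\<in>I. cnj (f (fst x, snd x)) * A (fst x) (snd x) h j * f (h, j))"
    by (intro sum.cong refl sum_pair)
  also have "\<dots> = (\<Sum>g\<in>G. \<Sum>i\<in>I. \<Sum>h\<in>G. \<Sum>j\<in>I. cnj (f (g, i)) * A g i h j * f (h, j))"
    by (rule sum_pair)
  also have "\<dots> = (\<Sum>g\<in>G. \<Sum>h\<in>G. \<Sum>i\<in>I. \<Sum>j\<in>I. cnj (f (g, i)) * A g i h j * f (h, j))"
    by (intro sum.cong refl sum.swap)
  finally show ?thesis .
qed

lemma conj_conj:
  fixes T :: "'a \<Rightarrow> 'a \<Rightarrow> complex"
  shows "(\<Sum>c\<in>J. \<Sum>c'\<in>J. cnj (M c) * (\<Sum>a\<in>I. \<Sum>b\<in>I. cnj (K a c) * T a b * K b c') * M' c')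
    = (\<Sum>a\<in>I. \<Sum>b\<in>I. cnj (\<Sum>c\<in>J. K a c * M c) * T a b * (\<Sum>c'\<in>J. K b c' * M' c'))"
proof -
  have "(\<Sum>c\<in>J. \<Sum>c'\<in>J. cnj (M c) * (\<Sum>a\<in>I. \<Sum>b\<in>I. cnj (K a c) * T a b * K b c') * M' c')
    = (\<Sum>c\<in>J. \<Sum>c'\<in>J. \<Sum>a\<in>I. \<Sum>b\<in>I. (cnj (K a c) * cnj (M c)) * T a b * (K b c' * M' c'))"
    by (simp add: sum_distrib_left sum_distrib_right mult_ac)
  also have "\<dots> = (\<Sum>a\<in>I. \<Sum>b\<in>I. \<Sum>c\<in>J. \<Sum>c'\<in>J. (cnj (K a c) * cnj (M c)) * T a b * (K b c' * M' c'))"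
    by (rule sum_swap_pairs)
  also have "\<dots> = (\<Sum>a\<in>I. \<Sum>b\<in>I. cnj (\<Sum>c\<in>J. K a c * M c) * T a b * (\<Sum>c'\<in>J. K b c' * M' c'))"
  proof (intro sum.cong refl)
    fix a b
    have "cnj (\<Sum>c\<in>J. K a c * M c) * T a b * (\<Sum>c'\<in>J. K b c' * M' c')
      = (\<Sum>c\<in>J. cnj (K a c) * cnj (M c)) * (\<Sum>c'\<in>J. T a b * (K b c' * M' c'))"
      by (simp only: cnj_sum complex_cnj_mult sum_distrib_left[symmetric] mult.assoc)
    also have "\<dots> = (\<Sum>c\<in>J. \<Sum>c'\<in>J. (cnj (K a c) * cnj (M c)) * (T a b * (K b c' * M' c')))"
      by (rule sum_product)
    finally show "(\<Sum>c\<in>J. \<Sum>c'\<in>J. (cnj (K a c) * cnj (M c)) * T a b * (K b c' * M' c'))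
      = cnj (\<Sum>c\<in>J. K a c * M c) * T a b * (\<Sum>c'\<in>J. K b c' * M' c')" by (simp only: mult.assoc)
  qed
  finally show ?thesis .
qed

lemma nonneg_of_small_perturbation:
  fixes x c :: real
  assumes "\<And>t. t > 0 \<Longrightarrow> 0 \<le> x + t * c"
  shows "0 \<le> x"
proof (rule ccontr)
  assume "\<not> 0 \<le> x"
  hence x: "x < 0" by simp
  define t where "t = - x / (2 * (\<bar>c\<bar> + 1))"
  have t: "t > 0" unfolding t_def by (rule divide_pos_pos) (use x in auto)
  have "t * (\<bar>c\<bar> + 1) = - x / 2" unfolding t_def by (simp add: field_simps)
  moreover have "t * c \<le> t * (\<bar>c\<bar> + 1)" using t by (intro mult_left_mono) auto
  ultimately have "x + t * c \<le> x / 2" by simp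
  thus False using assms[OF t] x by simp
qed

context coord_opsys
begin

definition unital :: "nat \<Rightarrow> arr \<Rightarrow> bool" where
  "unital m \<phi> \<longleftrightarrow> (\<forall>i<m. \<forall>j<m. (\<Sum>l<d. e l * \<phi> l i j) = (if i = j then 1 else 0))"

definition ucp_co :: "nat \<Rightarrow> arr \<Rightarrow> bool" where
  "ucp_co m \<psi> \<longleftrightarrow> unital m \<psi> \<and> (\<forall>n. \<forall>X\<in>C n. amp_psd m \<psi> n X)"

definition hermitian_map :: "nat \<Rightarrow> arr \<Rightarrow> bool" where
  "hermitian_map m \<phi> \<longleftrightarrow> (\<forall>l<d. \<forall>i<m. \<forall>j<m. \<phi> l j i = cnj (\<phi> l i j))"

text \<open>
  What CP-stability says about maps into matrix algebras, with the norm condition replaced by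
  positivity up to \<open>\<epsilon>\<close> on the order interval \<open>[0,2]\<close>. The size \<open>m\<close> comes after \<open>n\<close> and \<open>\<epsilon>\<close>.
\<close>

definition stable :: bool where
  "stable \<longleftrightarrow> (\<forall>\<delta>>0. \<exists>n>0. \<exists>\<epsilon>>0. \<forall>m \<phi>. hermitian_map m \<phi> \<longrightarrow> unital m \<phi> \<longrightarrow>
     (\<forall>X\<in>C n. shift 2 (neg X) \<in> C n \<longrightarrow> amp_psd m \<phi> n (shift \<epsilon> X)) \<longrightarrow>
     (\<exists>\<psi>. ucp_co m \<psi> \<and> (\<forall>l<d. opbound {..<m} (\<lambda>i j. \<phi> l i j - \<psi> l i j) \<delta>)))"

text \<open>
  For positive semidefinite \<open>Q \<in> M\<^sub>m \<otimes> M\<^sub>p\<close> these are the elements \<open>\<alpha> (P \<otimes> Q) \<alpha>\<^sup>*\<close>, where \<open>\<alpha>\<close> pairs the two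
  indices that run up to \<open>p\<close>.
\<close>

definition contract :: "arr \<Rightarrow> nat \<Rightarrow> (nat \<times> nat \<Rightarrow> nat \<times> nat \<Rightarrow> complex) \<Rightarrow> arr" where
  "contract P p Q = (\<lambda>i j l. \<Sum>g<p. \<Sum>h<p. P g h l * Q (i,g) (j,h))"

lemma contract_herm:
  assumes P: "P \<in> C p" and Q: "psd (grid m p) Q"
  shows "herm m (contract P p Q)"
proof (rule hermI)
  fix i j l assume ij: "i < m" "j < m" "l < d"
  have "cnj (contract P p Q i j l) = (\<Sum>g<p. \<Sum>h<p. P h g l * Q (j,h) (i,g))"
    unfolding contract_def cnj_sum complex_cnj_mult
  proof (intro sum.cong refl)
    fix g h assume gh: "g \<in> {..<p}" "h \<in> {..<p}"
    have "cnj (P g h l) = P h g l" using C_herm[OF P, of g h l] gh ij by simp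
    moreover have "cnj (Q (i,g) (j,h)) = Q (j,h) (i,g)"
      using psd_hermitian[OF Q, of "(i,g)" "(j,h)"] gh ij by simp
    ultimately show "cnj (P g h l) * cnj (Q (i,g) (j,h)) = P h g l * Q (j,h) (i,g)" by simp
  qed
  also have "\<dots> = contract P p Q j i l" unfolding contract_def by (rule sum.swap)
  finally show "contract P p Q j i l = cnj (contract P p Q i j l)" by simp
qed

text \<open>
  Contract \<open>P - \<eta> \<ge> 0\<close> with \<open>Q\<close> and apply \<open>\<omega>\<close>.
\<close>

lemma contract_trace:
  assumes \<omega>: "state \<omega>" and P: "shift (- \<eta>) P \<in> C p" and Q: "psd (grid m p) Q"
  shows "psd {..<m} (\<lambda>i j. (ev \<omega> (contract P p Q) i j)
     - complex_of_real \<eta> * (\<Sum>g<p. Q (i,g) (j,g)))"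
proof -
  define A where "A g h = (\<Sum>l<d. complex_of_real (\<omega> l) * shift (- \<eta>) P g h l)" for g h
  have A: "psd {..<p} A" using \<omega> P unfolding state_def A_def by blast
  have Aeq: "A g h = (ev \<omega> P g h) - (if g = h then complex_of_real \<eta> else 0)" for g h
  proof -
    have "A g h = (\<Sum>l<d. complex_of_real (\<omega> l) * (if g = h then complex_of_real (- \<eta>) * e l else 0))
      + (ev \<omega> P g h)"
      unfolding A_def shift_def distrib_left sum.distrib ..
    also have "(\<Sum>l<d. complex_of_real (\<omega> l) * (if g = h then complex_of_real (- \<eta>) * e l else 0))
      = (if g = h then complex_of_real (- \<eta>) * (\<Sum>l<d. complex_of_real (\<omega> l) * e l) else 0)"
      by (simp add: sum_distrib_left mult.left_commute sum_negf)
    finally show ?thesis using \<omega> by (simp add: state_def)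
  qed
  have "psd {..<m} (\<lambda>i j. \<Sum>g<p. \<Sum>h<p. A g h * Q (i,g) (j,h))"
    by (rule psd_partial_schur[OF A]) (use Q in \<open>simp_all add: case_prod_unfold\<close>)
  thus ?thesis
  proof (rule psd_cong[rotated])
    fix i j
    have "(\<Sum>g<p. \<Sum>h<p. A g h * Q (i,g) (j,h))
      = (\<Sum>g<p. \<Sum>h<p. \<Sum>l<d. complex_of_real (\<omega> l) * (P g h l * Q (i,g) (j,h)))
       - (\<Sum>g<p. \<Sum>h<p. if g = h then complex_of_real \<eta> * Q (i,g) (j,h) else 0)"
      unfolding sum_subtractf[symmetric]
      by (intro sum.cong refl) (auto simp: Aeq left_diff_distrib sum_distrib_right mult.assoc)
    also have "(\<Sum>g<p. \<Sum>h<p. \<Sum>l<d. complex_of_real (\<omega> l) * (P g h l * Q (i,g) (j,h)))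
      = (ev \<omega> (contract P p Q) i j)"
      unfolding contract_def by (subst sum_rotate3) (simp add: sum_distrib_left)
    also have "(\<Sum>g<p. \<Sum>h<p. if g = h then complex_of_real \<eta> * Q (i,g) (j,h) else 0)
      = complex_of_real \<eta> * (\<Sum>g<p. Q (i,g) (j,g))"
      by (simp add: sum_distrib_left)
    finally show "(\<Sum>g<p. \<Sum>h<p. A g h * Q (i,g) (j,h))
      = (ev \<omega> (contract P p Q) i j) - complex_of_real \<eta> * (\<Sum>g<p. Q (i,g) (j,g))" .
  qed
qed

text \<open>
  The strict positivity of \<open>P\<close> turns a bound for the contraction into a bound for \<open>Q\<close>. All compactness of
  sets of \<open>Q\<close> rests on this.
\<close>

lemma contract_diag_bound:
  assumes \<omega>: "state \<omega>" and P: "shift (- \<eta>) P \<in> C p" and Q: "psd (grid m p) Q"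
    and "0 < \<eta>" "i < m" "g < p"
  shows "\<eta> * Re (Q (i,g) (i,g)) \<le> Re (ev \<omega> (contract P p Q) i i)"
proof -
  have "0 \<le> (ev \<omega> (contract P p Q) i i) - complex_of_real \<eta> * (\<Sum>g<p. Q (i,g) (i,g))"
    using psd_diag[OF contract_trace[OF \<omega> P Q], of i] assms by simp
  hence "\<eta> * Re (\<Sum>g<p. Q (i,g) (i,g)) \<le> Re (ev \<omega> (contract P p Q) i i)"
    by (simp add: complex_nonneg_iff)
  moreover have "Re (Q (i,g) (i,g)) \<le> (\<Sum>g<p. Re (Q (i,g) (i,g)))"
  proof (rule member_le_sum)
    show "0 \<le> Re (Q (i,x) (i,x))" if "x \<in> {..<p} - {g}" for x
      using psd_diag[OF Q, of "(i,x)"] that assms by (simp add: complex_nonneg_iff)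
  qed (use assms in auto)
  hence "\<eta> * Re (Q (i,g) (i,g)) \<le> \<eta> * Re (\<Sum>g<p. Q (i,g) (i,g))"
    using \<open>0 < \<eta>\<close> by (intro mult_left_mono) (auto simp: Re_sum)
  ultimately show ?thesis by linarith
qed

text \<open>
  The matrices \<open>Q\<close> for the approximants are bounded by \<open>contract_diag_bound\<close>, so a subsequence converges.
\<close>

lemma contract_closed:
  assumes \<omega>: "state \<omega>" and P: "shift (- \<eta>) P \<in> C p" "0 < \<eta>"
    and s: "\<And>k::nat. \<exists>Q. psd (grid m p) Q \<and> (\<forall>i<m. \<forall>j<m. \<forall>l<d. s k i j l = contract P p Q i j l)"
    and lim: "\<And>i j l. i < m \<Longrightarrow> j < m \<Longrightarrow> l < d \<Longrightarrow> (\<lambda>k. s k i j l) \<longlonglongrightarrow> x i j l"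
  shows "\<exists>Q. psd (grid m p) Q \<and> (\<forall>i<m. \<forall>j<m. \<forall>l<d. x i j l = contract P p Q i j l)"
proof -
  from choice[OF allI[OF s]] obtain Q where
    "\<forall>k. psd (grid m p) (Q k) \<and> (\<forall>i<m. \<forall>j<m. \<forall>l<d. s k i j l = contract P p (Q k) i j l)" ..
  hence Q: "\<And>k. psd (grid m p) (Q k)"
    and sQ: "\<And>k i j l. i < m \<Longrightarrow> j < m \<Longrightarrow> l < d \<Longrightarrow> s k i j l = contract P p (Q k) i j l" by simp_all
  define I where "I = grid m p"
  have fI: "finite I" by (simp add: I_def)
  define t where "t k = (\<Sum>i<m. \<bar>Re (ev \<omega> (s k) i i)\<bar>)" for k
  have "t \<longlonglongrightarrow> (\<Sum>i<m. \<bar>Re (ev \<omega> x i i)\<bar>)"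
    unfolding t_def by (intro tendsto_intros lim) auto
  hence "Bseq t" by (rule convergent_imp_Bseq[OF convergentI])
  then obtain B where B: "\<And>k. norm (t k) \<le> B" by (auto simp: Bseq_def)
  have diag: "Re (Q k a a) \<le> B / \<eta>" if "a \<in> I" for k a
  proof -
    obtain i g where a: "a = (i,g)" "i < m" "g < p" using \<open>a \<in> I\<close> by (auto simp: I_def)
    have "\<eta> * Re (Q k a a) \<le> Re (\<Sum>l<d. complex_of_real (\<omega> l) * contract P p (Q k) i i l)"
      unfolding a by (rule contract_diag_bound[OF \<omega> P(1) Q P(2) a(2,3)])
    also have "(\<Sum>l<d. complex_of_real (\<omega> l) * contract P p (Q k) i i l) = (ev \<omega> (s k) i i)"
      using a by (intro sum.cong refl) (simp add: sQ)
    also have "Re \<dots> \<le> \<bar>Re (ev \<omega> (s k) i i)\<bar>" by simp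
    also have "\<dots> \<le> t k" unfolding t_def
      by (rule member_le_sum[of i "{..<m}" "\<lambda>i. \<bar>Re (ev \<omega> (s k) i i)\<bar>"]) (use a in auto)
    also have "\<dots> \<le> B" using B[of k] by simp
    finally show ?thesis using P(2) by (simp add: field_simps)
  qed
  have ent: "cmod ((\<lambda>(a,b). Q k a b) q) \<le> B / \<eta>" if "q \<in> I \<times> I" for k q
  proof -
    obtain a b where q: "q = (a,b)" "a \<in> I" "b \<in> I" using \<open>q \<in> I \<times> I\<close> by auto
    have "2 * cmod (Q k a b) \<le> Re (Q k a a) + Re (Q k b b)"
      by (rule psd_entry_bound[OF Q[of k, folded I_def] fI q(2,3)])
    thus ?thesis using diag[OF q(2), of k] diag[OF q(3), of k] by (simp add: q)
  qed
  have fII: "finite (I \<times> I)" using fI by simp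
  obtain r q where r: "strict_mono (r::nat\<Rightarrow>nat)"
    "\<And>z. z \<in> I \<times> I \<Longrightarrow> (\<lambda>k. (\<lambda>(a,b). Q (r k) a b) z) \<longlonglongrightarrow> q z"
    using finite_bounded_subseq[OF fII, of "\<lambda>k z. (\<lambda>(a,b). Q k a b) z", OF ent] by blast
  define Q' where "Q' a b = q (a,b)" for a b
  have limQ: "(\<lambda>k. Q (r k) a b) \<longlonglongrightarrow> Q' a b" if "a \<in> I" "b \<in> I" for a b
    using r(2)[of "(a,b)"] that by (simp add: Q'_def)
  have "psd I Q'" by (rule psd_limit[OF fI Q[folded I_def] limQ])
  moreover have "x i j l = contract P p Q' i j l" if ij: "i < m" "j < m" "l < d" for i j l
  proof (rule LIMSEQ_unique)
    show "(\<lambda>k. s (r k) i j l) \<longlonglongrightarrow> x i j l"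
      using LIMSEQ_subseq_LIMSEQ[OF lim[OF ij] r(1)] by (simp add: o_def)
    show "(\<lambda>k. s (r k) i j l) \<longlonglongrightarrow> contract P p Q' i j l"
      unfolding sQ[OF ij] unfolding contract_def
      by (intro tendsto_intros limQ) (use ij in \<open>auto simp: I_def\<close>)
  qed
  ultimately show ?thesis unfolding I_def by blast
qed

text \<open>
  The linear functionals on \<open>M\<^sub>m(E)\<close> correspond to the linear maps \<open>E \<rightarrow> M\<^sub>m\<close>.
\<close>

definition pairing :: "nat \<Rightarrow> arr \<Rightarrow> arr \<Rightarrow> complex" where
  "pairing m \<phi> x = (\<Sum>i<m. \<Sum>j<m. \<Sum>l<d. \<phi> l i j * x i j l)"

text \<open>
  Use \<open>Q\<close> of rank one.
\<close>

lemma amp_psd_of_pairing: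
  assumes "\<And>Q. psd (grid m p) Q \<Longrightarrow> 0 \<le> pairing m \<phi> (contract P p Q)"
  shows "amp_psd m \<phi> p P"
  unfolding amp_psd_def psd_def
proof
  fix f :: "nat \<times> nat \<Rightarrow> complex"
  define Q where "Q a b = (\<Sum>w\<in>{()}. cnj (f (snd a, fst a)) * f (snd b, fst b))" for a b
  have "psd (grid m p) Q" unfolding Q_def by (rule psd_gram)
  from assms[OF this] have "0 \<le> pairing m \<phi> (contract P p Q)" .
  also have "\<dots> = (\<Sum>i<m. \<Sum>j<m. \<Sum>l<d. \<Sum>g<p. \<Sum>h<p. cnj (f (g,i)) * (P g h l * \<phi> l i j) * f (h,j))"
    unfolding pairing_def contract_def Q_def by (simp add: sum_distrib_left mult_ac)
  also have "\<dots> = (\<Sum>i<m. \<Sum>j<m. \<Sum>g<p. \<Sum>h<p. \<Sum>l<d. cnj (f (g,i)) * (P g h l * \<phi> l i j) * f (h,j))"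
    by (rule sum.cong[OF refl], rule sum.cong[OF refl], rule sum_rotate3[symmetric])
  also have "\<dots> = (\<Sum>g<p. \<Sum>h<p. \<Sum>i<m. \<Sum>j<m. \<Sum>l<d. cnj (f (g,i)) * (P g h l * \<phi> l i j) * f (h,j))"
    by (rule sum_swap_pairs)
  also have "\<dots> = (\<Sum>g<p. \<Sum>h<p. \<Sum>i<m. \<Sum>j<m. cnj (f (g,i)) * (\<Sum>l<d. P g h l * \<phi> l i j) * f (h,j))"
    by (simp add: sum_distrib_left sum_distrib_right)
  also have "\<dots> = qform (grid p m) (\<lambda>x y. (\<lambda>g i h j. \<Sum>l<d. P g h l * \<phi> l i j) (fst x) (snd x) (fst y) (snd y)) f"
    by (rule qform_pairs[symmetric])
  also have "\<dots> = qform (grid p m) (amp \<phi> P) f"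
    by (simp add: amp_def case_prod_unfold)
  finally show "0 \<le> qform (grid p m) (amp \<phi> P) f" .
qed

lemma pairing_factor:
  assumes "\<And>l i j. l < d \<Longrightarrow> i < m \<Longrightarrow> j < m \<Longrightarrow> \<phi> l i j = (\<Sum>c<m. \<Sum>c'<m. cnj (L c i) * \<phi>' l c c' * L c' j)"
  shows "pairing m \<phi> x = qform (grid m m) (amp \<phi>' x) (\<lambda>(j,c). L c j)"
proof -
  have "pairing m \<phi> x = (\<Sum>i<m. \<Sum>j<m. \<Sum>l<d. \<Sum>c<m. \<Sum>c'<m. cnj (L c i) * (x i j l * \<phi>' l c c') * L c' j)"
    unfolding pairing_def by (intro sum.cong refl) (simp add: assms sum_distrib_left sum_distrib_right mult_ac)
  also have "\<dots> = (\<Sum>i<m. \<Sum>j<m. \<Sum>c<m. \<Sum>c'<m. \<Sum>l<d. cnj (L c i) * (x i j l * \<phi>' l c c') * L c' j)"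
    by (rule sum.cong[OF refl], rule sum.cong[OF refl], rule sum_rotate3[symmetric])
  also have "\<dots> = (\<Sum>i<m. \<Sum>j<m. \<Sum>c<m. \<Sum>c'<m. cnj ((\<lambda>(j,c). L c j) (i,c)) * (\<Sum>l<d. x i j l * \<phi>' l c c') * (\<lambda>(j,c). L c j) (j,c'))"
    by (simp add: sum_distrib_left sum_distrib_right)
  also have "\<dots> = qform (grid m m) (\<lambda>x' y. (\<lambda>i c j c'. \<Sum>l<d. x i j l * \<phi>' l c c') (fst x') (snd x') (fst y) (snd y)) (\<lambda>(j,c). L c j)"
    by (rule qform_pairs[symmetric])
  finally show ?thesis by (simp add: amp_def case_prod_unfold)
qed

text \<open>
  The contractions of \<open>P\<close> form a closed convex cone. Its elements and \<open>y\<close> are hermitian, so the separating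
  functional can be replaced by its hermitian part.
\<close>

lemma contract_separation:
  assumes \<omega>: "state \<omega>" and P: "P \<in> C p" "shift (- \<eta>) P \<in> C p" "0 < \<eta>"
    and y: "herm m y"
    and n: "\<not> (\<exists>Q. psd (grid m p) Q \<and> (\<forall>i<m. \<forall>j<m. \<forall>l<d. y i j l = contract P p Q i j l))"
  obtains \<phi> where "hermitian_map m \<phi>" "\<And>Q. psd (grid m p) Q \<Longrightarrow> 0 \<le> pairing m \<phi> (contract P p Q)"
    "Re (pairing m \<phi> y) < 0"
proof -
  define I where "I = {..<m} \<times> grid m d"
  define F where "F x = (\<lambda>(i,j,l). x i j l)" for x :: arr
  define K where "K = {x. \<exists>Q. psd (grid m p) Q \<and> (\<forall>i<m. \<forall>j<m. \<forall>l<d. x (i,j,l) = contract P p Q i j l)}"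
  have KI: "F (contract P p Q) \<in> K" if "psd (grid m p) Q" for Q
    using that unfolding K_def F_def by auto
  obtain w where w: "\<And>x. x \<in> K \<Longrightarrow> 0 \<le> Re (\<Sum>i\<in>I. cnj (w i) * x i)" "Re (\<Sum>i\<in>I. cnj (w i) * F y i) < 0"
  proof (rule closed_cone_separation[of I K "F y"])
    show "finite I" by (simp add: I_def)
    show "(\<lambda>i. x i + z i) \<in> K" if xz: "x \<in> K" "z \<in> K" for x z
    proof -
      obtain Q1 where Q1: "psd (grid m p) Q1" "\<forall>i<m. \<forall>j<m. \<forall>l<d. x (i,j,l) = contract P p Q1 i j l"
        using xz(1) by (auto simp: K_def)
      obtain Q2 where Q2: "psd (grid m p) Q2" "\<forall>i<m. \<forall>j<m. \<forall>l<d. z (i,j,l) = contract P p Q2 i j l"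
        using xz(2) by (auto simp: K_def)
      have "\<forall>i<m. \<forall>j<m. \<forall>l<d. x (i,j,l) + z (i,j,l) = contract P p (\<lambda>a b. Q1 a b + Q2 a b) i j l"
        using Q1(2) Q2(2) by (simp add: contract_def distrib_left sum.distrib)
      thus ?thesis unfolding K_def using psd_add[OF Q1(1) Q2(1)] by blast
    qed
    show "(\<lambda>i. complex_of_real c * x i) \<in> K" if x: "x \<in> K" "0 \<le> c" for x c
    proof -
      obtain Q1 where Q1: "psd (grid m p) Q1" "\<forall>i<m. \<forall>j<m. \<forall>l<d. x (i,j,l) = contract P p Q1 i j l"
        using x(1) by (auto simp: K_def)
      have "\<forall>i<m. \<forall>j<m. \<forall>l<d. complex_of_real c * x (i,j,l) = contract P p (\<lambda>a b. complex_of_real c * Q1 a b) i j l"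
        using Q1(2) by (simp add: contract_def sum_distrib_left mult_ac)
      thus ?thesis unfolding K_def using psd_scale[OF Q1(1) x(2)] by blast
    qed
    show "x \<in> K" if s: "\<And>k::nat. s k \<in> K" "\<And>i. i \<in> I \<Longrightarrow> (\<lambda>k. s k i) \<longlonglongrightarrow> x i" for s x
    proof -
      have "\<exists>Q. psd (grid m p) Q \<and> (\<forall>i<m. \<forall>j<m. \<forall>l<d. (\<lambda>i j l. x (i,j,l)) i j l = contract P p Q i j l)"
        by (rule contract_closed[OF \<omega> P(2,3), of _ "\<lambda>k i j l. s k (i,j,l)"])
          (use s in \<open>auto simp: K_def I_def\<close>)
      thus ?thesis by (simp add: K_def)
    qed
    show "K \<noteq> {}" using KI[of "\<lambda>_ _. 0"] by (auto simp: psd_def qform_def)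
    show "F y \<notin> K" using n by (auto simp: K_def F_def)
  qed blast
  define \<phi> where "\<phi> l i j = (cnj (w (i,j,l)) + w (j,i,l)) / 2" for l i j
  have key: "pairing m \<phi> x = complex_of_real (Re (\<Sum>i\<in>I. cnj (w i) * F x i))" if x: "herm m x" for x
  proof -
    define S where "S = (\<Sum>i<m. \<Sum>j<m. \<Sum>l<d. cnj (w (i,j,l)) * x i j l)"
    have SI: "(\<Sum>i\<in>I. cnj (w i) * F x i) = S"
      unfolding S_def I_def F_def sum.cartesian_product' by simp
    have "(\<Sum>i<m. \<Sum>j<m. \<Sum>l<d. w (j,i,l) * x i j l) = (\<Sum>i<m. \<Sum>j<m. \<Sum>l<d. w (i,j,l) * x j i l)"
      by (rule sum.swap)
    also have "\<dots> = cnj S"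
      unfolding S_def cnj_sum
    proof (intro sum.cong refl)
      fix i j l assume "i \<in> {..<m}" "j \<in> {..<m}" "l \<in> {..<d}"
      hence "x j i l = cnj (x i j l)" using hermD[OF x, of i j l] by simp
      thus "w (i,j,l) * x j i l = cnj (cnj (w (i,j,l)) * x i j l)" by simp
    qed
    finally have S': "(\<Sum>i<m. \<Sum>j<m. \<Sum>l<d. w (j,i,l) * x i j l) = cnj S" .
    have "pairing m \<phi> x = (S + (\<Sum>i<m. \<Sum>j<m. \<Sum>l<d. w (j,i,l) * x i j l)) / 2"
      unfolding pairing_def \<phi>_def S_def sum.distrib[symmetric] sum_divide_distrib
      by (intro sum.cong refl) (simp add: algebra_simps)
    also have "\<dots> = complex_of_real (Re S)" unfolding S' by (simp add: complex_eq_iff)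
    finally show ?thesis by (simp add: SI)
  qed
  show ?thesis
  proof (rule that)
    show "hermitian_map m \<phi>" by (auto simp: hermitian_map_def \<phi>_def)
    show "0 \<le> pairing m \<phi> (contract P p Q)" if Q: "psd (grid m p) Q" for Q
      unfolding key[OF contract_herm[OF P(1) Q]] using w(1)[OF KI[OF Q]] by (simp add: complex_nonneg_iff)
    show "Re (pairing m \<phi> y) < 0" unfolding key[OF y] using w(2) by simp
  qed
qed

end

section \<open>Factorization of finite corners\<close>

context coord_opsys
begin

lemma state_ucp_co:
  assumes "state \<omega>" shows "ucp_co 1 (\<lambda>l i j. complex_of_real (\<omega> l))"
  unfolding ucp_co_def
proof (intro conjI allI ballI)
  show "unital 1 (\<lambda>l i j. complex_of_real (\<omega> l))"
    using assms by (simp add: unital_def state_def mult.commute)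
  fix n X assume "X \<in> C n"
  hence p: "psd {..<n} (\<lambda>i j. ev \<omega> X i j)"
    using assms by (simp add: state_def)
  have "psd ({..<n} \<times> {..<1::nat}) (\<lambda>x y. ev \<omega> X (fst x) (fst y))"
    by (rule psd_pullback[OF p]) auto
  thus "amp_psd 1 (\<lambda>l i j. complex_of_real (\<omega> l)) n X"
    unfolding amp_psd_def amp_def by (simp add: case_prod_unfold mult.commute)
qed

text \<open>
  States are u.c.p. maps into \<open>M\<^sub>1\<close>, and they separate the coordinates.
\<close>

lemma ucp_positive_imp_herm:
  assumes v: "\<And>N m \<psi>. ucp_co m \<psi> \<Longrightarrow> amp_psd m \<psi> N v" and l: "l < d"
  shows "v j i l = cnj (v i j l)"
proof -
  define z where "z l = v j i l - cnj (v i j l)" for l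
  have 0: "(\<Sum>l<d. complex_of_real (\<omega> l) * z l) = 0" if \<omega>: "state \<omega>" for \<omega>
  proof -
    define N where "N = Suc (max i j)"
    have ps: "psd (grid N 1) (amp (\<lambda>l i j. complex_of_real (\<omega> l)) v)"
      using v[OF state_ucp_co[OF \<omega>], of N] by (simp add: amp_psd_def)
    have "amp (\<lambda>l i j. complex_of_real (\<omega> l)) v (j,0) (i,0) = cnj (amp (\<lambda>l i j. complex_of_real (\<omega> l)) v (i,0) (j,0))"
      by (rule psd_hermitian[OF ps]) (auto simp: N_def)
    hence "(\<Sum>l<d. v j i l * complex_of_real (\<omega> l)) = (\<Sum>l<d. cnj (v i j l) * complex_of_real (\<omega> l))"
      by (simp add: amp_def)
    thus ?thesis unfolding z_def by (simp add: right_diff_distrib sum_subtractf mult.commute)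
  qed
  have "(\<Sum>l<d. \<omega> l * Re (z l)) = 0" if "state \<omega>" for \<omega>
    using arg_cong[OF 0[OF that], of Re] by (simp add: Re_sum)
  from states_separate[OF this l] have r: "Re (z l) = 0" .
  have "(\<Sum>l<d. \<omega> l * Im (z l)) = 0" if "state \<omega>" for \<omega>
    using arg_cong[OF 0[OF that], of Im] by (simp add: Im_sum)
  from states_separate[OF this l] have "Im (z l) = 0" .
  with r have "z l = 0" by (simp add: complex_eq_iff)
  thus ?thesis by (simp add: z_def)
qed

lemma amp_psd_conj:
  assumes "amp_psd m \<phi> p P"
  shows "amp_psd m' (\<lambda>l c c'. \<Sum>a<m. \<Sum>b<m. cnj (K a c) * \<phi> l a b * K b c') p P"
  unfolding amp_psd_def
proof (rule psd_cong[rotated])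
  define \<alpha> where "\<alpha> = (\<lambda>(g'::nat,a) (g,c). if g' = g then K a c else 0)"
  show "psd ({..<p} \<times> {..<m'}) (\<lambda>x y. \<Sum>a\<in>grid p m. \<Sum>b\<in>grid p m. cnj (\<alpha> a x) * amp \<phi> P a b * \<alpha> b y)"
    by (rule psd_conj) (use assms in \<open>simp add: amp_psd_def\<close>)
  fix x y assume xy: "x \<in> {..<p} \<times> {..<m'}" "y \<in> {..<p} \<times> {..<m'}"
  obtain g c where x: "x = (g,c)" "g < p" using xy by auto
  obtain h c' where y: "y = (h,c')" "h < p" using xy by auto
  have inner: "(\<Sum>b\<in>grid p m. F b * \<alpha> b y) = (\<Sum>b<m. F (h,b) * K b c')" for F
  proof -
    have "(\<Sum>b\<in>grid p m. F b * \<alpha> b y) = (\<Sum>h'<p. \<Sum>b<m. F (h',b) * \<alpha> (h',b) y)"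
      by (rule sum.cartesian_product')
    also have "\<dots> = (\<Sum>h'<p. if h' = h then \<Sum>b<m. F (h',b) * K b c' else 0)"
      by (intro sum.cong refl) (simp add: \<alpha>_def y)
    finally show ?thesis using y by simp
  qed
  have outer: "(\<Sum>a\<in>grid p m. cnj (\<alpha> a x) * F a) = (\<Sum>a<m. cnj (K a c) * F (g,a))" for F
  proof -
    have "(\<Sum>b\<in>grid p m. cnj (\<alpha> b x) * F b) = (\<Sum>h'<p. \<Sum>b<m. cnj (\<alpha> (h',b) x) * F (h',b))"
      by (rule sum.cartesian_product')
    also have "\<dots> = (\<Sum>h'<p. if h' = g then \<Sum>b<m. cnj (K b c) * F (h',b) else 0)"
      by (intro sum.cong refl) (simp add: \<alpha>_def x)
    finally show ?thesis using x by simp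
  qed
  have "(\<Sum>a\<in>grid p m. \<Sum>b\<in>grid p m. cnj (\<alpha> a x) * amp \<phi> P a b * \<alpha> b y)
    = (\<Sum>a\<in>grid p m. cnj (\<alpha> a x) * (\<Sum>b<m. amp \<phi> P a (h,b) * K b c'))"
  proof (rule sum.cong[OF refl])
    fix a
    show "(\<Sum>b\<in>grid p m. cnj (\<alpha> a x) * amp \<phi> P a b * \<alpha> b y) = cnj (\<alpha> a x) * (\<Sum>b<m. amp \<phi> P a (h,b) * K b c')"
      unfolding inner sum_distrib_left by (simp only: mult.assoc)
  qed
  also have "\<dots> = (\<Sum>a<m. cnj (K a c) * (\<Sum>b<m. amp \<phi> P (g,a) (h,b) * K b c'))" by (rule outer)
  also have "\<dots> = (\<Sum>a<m. \<Sum>b<m. \<Sum>l<d. P g h l * (cnj (K a c) * \<phi> l a b * K b c'))"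
    by (simp add: amp_def sum_distrib_left sum_distrib_right mult_ac)
  also have "\<dots> = (\<Sum>l<d. \<Sum>a<m. \<Sum>b<m. P g h l * (cnj (K a c) * \<phi> l a b * K b c'))"
    by (rule sum_rotate3)
  also have "\<dots> = amp (\<lambda>l c c'. \<Sum>a<m. \<Sum>b<m. cnj (K a c) * \<phi> l a b * K b c') P x y"
    by (simp add: amp_def x y sum_distrib_left)
  finally show "(\<Sum>a\<in>grid p m. \<Sum>b\<in>grid p m. cnj (\<alpha> a x) * amp \<phi> P a b * \<alpha> b y)
    = amp (\<lambda>l c c'. \<Sum>a<m. \<Sum>b<m. cnj (K a c) * \<phi> l a b * K b c') P x y" .
qed

text \<open>
  The summand \<open>t \<omega>\<close> makes the value \<open>A\<close> at the unit invertible. With \<open>A = L\<^sup>* L\<close>, conjugation by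
  \<open>\<Lambda> = L\<^sup>-\<^sup>1\<close> gives a unital map, from which conjugation by \<open>L\<close> recovers \<open>\<phi>t\<close>.
\<close>

lemma unitalization:
  assumes herm: "hermitian_map m \<phi>"
    and a0: "psd {..<m} (\<lambda>i j. \<Sum>l<d. e l * \<phi> l i j)" and t: "t > 0"
    and \<phi>t: "\<And>l i j. \<phi>t l i j = \<phi> l i j + (if i = j then complex_of_real (t * \<omega> l) else 0)"
    and \<omega>: "state \<omega>"
  obtains L \<Lambda> \<phi>' where
    "\<phi>' = (\<lambda>l c c'. \<Sum>a<m. \<Sum>b<m. cnj (\<Lambda> a c) * \<phi>t l a b * \<Lambda> b c')"
    "unital m \<phi>'" "hermitian_map m \<phi>'"
    "\<And>l i j. i < m \<Longrightarrow> j < m \<Longrightarrow> \<phi>t l i j = (\<Sum>c<m. \<Sum>c'<m. cnj (L c i) * \<phi>' l c c' * L c' j)"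
proof -
  define A where "A i j = (\<Sum>l<d. e l * \<phi>t l i j)" for i j
  have Aeq: "A i j = (\<Sum>l<d. e l * \<phi> l i j) + (if i = j then complex_of_real t else 0)" for i j
  proof -
    have "A i j = (\<Sum>l<d. e l * \<phi> l i j) + (\<Sum>l<d. if i = j then complex_of_real t * (complex_of_real (\<omega> l) * e l) else 0)"
      unfolding A_def \<phi>t sum.distrib[symmetric] by (intro sum.cong refl) (simp add: algebra_simps)
    also have "(\<Sum>l<d. if i = j then complex_of_real t * (complex_of_real (\<omega> l) * e l) else 0)
      = (if i = j then complex_of_real t * (\<Sum>l<d. complex_of_real (\<omega> l) * e l) else 0)"
      by (simp add: sum_distrib_left)
    finally show ?thesis using \<omega> by (simp add: state_def)
  qed
  have "psd {..<m} A"
    by (rule psd_cong[OF _ psd_add[OF a0 psd_identity[of _ t]]]) (use t in \<open>simp_all add: Aeq\<close>)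
  then obtain L where L: "\<And>i j. i < m \<Longrightarrow> j < m \<Longrightarrow> A i j = (\<Sum>w<m. cnj (L w i) * L w j)"
    using cholesky[of m A] by blast
  obtain \<Lambda> where inv: "\<And>i j. i < m \<Longrightarrow> j < m \<Longrightarrow> (\<Sum>w<m. \<Lambda> i w * L w j) = (if i = j then 1 else 0)"
    "\<And>i j. i < m \<Longrightarrow> j < m \<Longrightarrow> (\<Sum>w<m. L i w * \<Lambda> w j) = (if i = j then 1 else 0)"
  (* L f = 0 makes the form of A vanish at f, but that form is at least t times the square norm *)
  proof (rule inverse_of_injective[of m L])
    fix f j assume f: "\<And>i. i < m \<Longrightarrow> (\<Sum>j<m. L i j * f j) = 0" and j: "j < m"
    have "qform {..<m} A f = qform {..<m} (\<lambda>i j. \<Sum>w<m. cnj (L w i) * L w j) f"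
      by (rule qform_cong) (simp_all add: L)
    also have "\<dots> = 0" unfolding qform_gram by (simp add: f)
    finally have "qform {..<m} A f = 0" .
    moreover have "qform {..<m} A f = qform {..<m} (\<lambda>i j. \<Sum>l<d. e l * \<phi> l i j) f + complex_of_real t * of_real (\<Sum>i<m. (cmod (f i))\<^sup>2)"
      unfolding Aeq qform_add by (subst qform_identity) simp_all
    moreover have "0 \<le> Re (qform {..<m} (\<lambda>i j. \<Sum>l<d. e l * \<phi> l i j) f)"
      using psdD[OF a0, of f] by (simp add: complex_nonneg_iff)
    ultimately have "qform {..<m} (\<lambda>i j. \<Sum>l<d. e l * \<phi> l i j) f + complex_of_real (t * (\<Sum>i<m. (cmod (f i))\<^sup>2)) = 0"
      by (simp only: of_real_mult)
    from arg_cong[OF this, of Re]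
    have "Re (qform {..<m} (\<lambda>i j. \<Sum>l<d. e l * \<phi> l i j) f) + t * (\<Sum>i<m. (cmod (f i))\<^sup>2) = 0"
      by (simp only: plus_complex.sel Re_complex_of_real zero_complex.sel)
    hence "t * (\<Sum>i<m. (cmod (f i))\<^sup>2) \<le> 0"
      using \<open>0 \<le> Re (qform {..<m} (\<lambda>i j. \<Sum>l<d. e l * \<phi> l i j) f)\<close> by linarith
    hence "(\<Sum>i<m. (cmod (f i))\<^sup>2) \<le> 0" using t by (simp add: mult_le_0_iff)
    moreover have "(cmod (f j))\<^sup>2 \<le> (\<Sum>i<m. (cmod (f i))\<^sup>2)"
      by (rule member_le_sum[of j "{..<m}" "\<lambda>i. (cmod (f i))\<^sup>2"]) (use j in auto)
    ultimately have "(cmod (f j))\<^sup>2 \<le> 0" by linarith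
    thus "f j = 0" by simp
  qed blast
  define \<phi>' where "\<phi>' = (\<lambda>l c c'. \<Sum>a<m. \<Sum>b<m. cnj (\<Lambda> a c) * \<phi>t l a b * \<Lambda> b c')"
  have fac: "\<phi>t l i j = (\<Sum>c<m. \<Sum>c'<m. cnj (L c i) * \<phi>' l c c' * L c' j)" if ij: "i < m" "j < m" for l i j
  proof -
    have "(\<Sum>c<m. \<Sum>c'<m. cnj (L c i) * \<phi>' l c c' * L c' j)
      = (\<Sum>a<m. \<Sum>b<m. cnj (\<Sum>c<m. \<Lambda> a c * L c i) * \<phi>t l a b * (\<Sum>c'<m. \<Lambda> b c' * L c' j))"
      unfolding \<phi>'_def by (rule conj_conj)
    also have "\<dots> = (\<Sum>a<m. \<Sum>b<m. if b = j then (if a = i then \<phi>t l a b else 0) else 0)"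
      using ij by (intro sum.cong refl) (simp add: inv)
    also have "\<dots> = \<phi>t l i j" using ij by simp
    finally show ?thesis by simp
  qed
  have un: "unital m \<phi>'" unfolding unital_def
  proof (intro allI impI)
    fix c c' assume cc: "c < m" "c' < m"
    have "(\<Sum>l<d. e l * \<phi>' l c c') = (\<Sum>l<d. \<Sum>a<m. \<Sum>b<m. cnj (\<Lambda> a c) * (e l * \<phi>t l a b) * \<Lambda> b c')"
      unfolding \<phi>'_def by (simp add: sum_distrib_left mult_ac)
    also have "\<dots> = (\<Sum>a<m. \<Sum>b<m. \<Sum>l<d. cnj (\<Lambda> a c) * (e l * \<phi>t l a b) * \<Lambda> b c')"
      by (rule sum_rotate3[symmetric])
    also have "\<dots> = (\<Sum>a<m. \<Sum>b<m. cnj (\<Lambda> a c) * A a b * \<Lambda> b c')"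
      unfolding A_def by (simp add: sum_distrib_left sum_distrib_right)
    also have "\<dots> = (\<Sum>a<m. \<Sum>b<m. cnj (\<Lambda> a c) * (\<Sum>w<m. \<Sum>w'<m. cnj (L w a) * (if w = w' then 1 else 0) * L w' b) * \<Lambda> b c')"
    proof -
      have "A a b = (\<Sum>w<m. \<Sum>w'<m. cnj (L w a) * (if w = w' then 1 else 0) * L w' b)" if "a < m" "b < m" for a b
      proof -
        have "(\<Sum>w<m. \<Sum>w'<m. cnj (L w a) * (if w = w' then 1 else 0) * L w' b) = (\<Sum>w<m. \<Sum>w'<m. if w' = w then cnj (L w a) * L w' b else 0)"
          by (intro sum.cong refl) simp
        thus ?thesis by (simp add: L[OF that])
      qed
      thus ?thesis by simp
    qed
    also have "\<dots> = (\<Sum>w<m. \<Sum>w'<m. cnj (\<Sum>a<m. L w a * \<Lambda> a c) * (if w = w' then 1 else 0) * (\<Sum>b<m. L w' b * \<Lambda> b c'))"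
      by (rule conj_conj)
    also have "\<dots> = (\<Sum>w<m. \<Sum>w'<m. if w' = c' then (if w = c then (if c = c' then 1 else 0) else 0) else 0)"
      using cc by (intro sum.cong refl) (simp add: inv)
    also have "\<dots> = (if c = c' then 1 else 0)" using cc by simp
    finally show "(\<Sum>l<d. e l * \<phi>' l c c') = (if c = c' then 1 else 0)" .
  qed
  have hm: "hermitian_map m \<phi>'" unfolding hermitian_map_def
  proof (intro allI impI)
    fix l c c' assume l: "l < d"
    have ht: "cnj (\<phi>t l a b) = \<phi>t l b a" if "a < m" "b < m" for a b
    proof -
      have "\<phi> l b a = cnj (\<phi> l a b)" using herm that l unfolding hermitian_map_def by blast
      thus ?thesis unfolding \<phi>t by auto
    qed
    have "cnj (\<phi>' l c c') = (\<Sum>a<m. \<Sum>b<m. cnj (\<Lambda> b c') * \<phi>t l b a * \<Lambda> a c)"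
      unfolding \<phi>'_def cnj_sum by (intro sum.cong refl) (simp add: ht mult_ac)
    also have "\<dots> = \<phi>' l c' c" unfolding \<phi>'_def by (rule sum.swap)
    finally show "\<phi>' l c' c = cnj (\<phi>' l c c')" by simp
  qed
  show ?thesis by (rule that[OF \<phi>'_def un hm fac])
qed

lemma amp_psd_state:
  assumes \<omega>: "state \<omega>" and P: "P \<in> C p" and A: "amp_psd m \<phi> p P" and t: "0 \<le> t"
  shows "amp_psd m (\<lambda>l i j. \<phi> l i j + (if i = j then complex_of_real (t * \<omega> l) else 0)) p P"
proof -
  have k: "psd (grid p m) (\<lambda>(g,i) (h,j). (ev \<omega> P g h) * (if i = j then complex_of_real t else 0))"
    by (rule psd_kron[OF _ _ psd_identity]) (use \<omega> P t in \<open>auto simp: state_def\<close>)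
  show ?thesis unfolding amp_psd_def
    by (rule psd_cong[OF _ psd_add[OF A[unfolded amp_psd_def] k]])
      (auto simp: amp_def distrib_left sum.distrib sum_distrib_left sum_distrib_right mult_ac)
qed

text \<open>
  The duality argument. The hypothesis on \<open>v\<close> is its minimal positivity; the constant \<open>\<delta>\<close> is so small
  that replacing a map by one at distance \<open>\<delta>\<close> costs at most the summand \<open>r\<close> of \<open>shift r v\<close>. The matrix \<open>P\<close> does
  not depend on the size \<open>N\<close> of the corner.
\<close>

lemma finite_stage:
  assumes st: "stable" and \<omega>: "state \<omega>"
    and v: "\<And>N m \<psi>. ucp_co m \<psi> \<Longrightarrow> amp_psd m \<psi> N v"
    and B: "B > 0" "\<And>l N. l < d \<Longrightarrow> opbound {..<N} (\<lambda>i j. v i j l) B"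
    and r: "r > 0"
  obtains p P \<eta> where "p > 0" "P \<in> C p" "\<eta> > 0" "shift (- \<eta>) P \<in> C p"
    "\<And>N. \<exists>Q. psd (grid N p) Q \<and> (\<forall>i<N. \<forall>j<N. \<forall>l<d. shift r v i j l = contract P p Q i j l)"
proof -
  define \<delta> where "\<delta> = r / (real d * B + 1)"
  have dB: "real d * B + 1 > 0" using B(1) by (simp add: add_nonneg_pos)
  have \<delta>: "\<delta> > 0" using r dB by (simp add: \<delta>_def)
  have dd: "real d * (\<delta> * B) \<le> r"
  proof -
    have "\<delta> * (real d * B + 1) = r" using dB by (simp add: \<delta>_def)
    thus ?thesis using \<delta> by (simp add: algebra_simps)
  qed
  from st[unfolded stable_def, THEN spec, THEN mp, OF \<delta>]
  obtain n \<epsilon> where n: "n > 0" "\<epsilon> > 0" and stab': "\<forall>m \<phi>. hermitian_map m \<phi> \<longrightarrow> unital m \<phi> \<longrightarrow>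
     (\<forall>X\<in>C n. shift 2 (neg X) \<in> C n \<longrightarrow> amp_psd m \<phi> n (shift \<epsilon> X)) \<longrightarrow>
     (\<exists>\<psi>. ucp_co m \<psi> \<and> (\<forall>l<d. opbound {..<m} (\<lambda>i j. \<phi> l i j - \<psi> l i j) \<delta>))"
    by (elim exE conjE)
  have stab: "\<exists>\<psi>. ucp_co m \<psi> \<and> (\<forall>l<d. opbound {..<m} (\<lambda>i j. \<phi> l i j - \<psi> l i j) \<delta>)"
    if "hermitian_map m \<phi>" "unital m \<phi>"
      "\<And>X. X \<in> C n \<Longrightarrow> shift 2 (neg X) \<in> C n \<Longrightarrow> amp_psd m \<phi> n (shift \<epsilon> X)" for m \<phi>
    by (rule stab'[rule_format, OF that(1,2)]) (rule that(3))
  (* half of the tolerance, because test_element loses twice its parameter *)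
  obtain p P \<eta> where p: "p > 0" and P: "P \<in> C p" "\<eta> > 0" "shift (- \<eta>) P \<in> C p" and
    test: "\<And>m \<phi> X. amp_psd m \<phi> p P \<Longrightarrow> X \<in> C n \<Longrightarrow> shift 2 (neg X) \<in> C n \<Longrightarrow> amp_psd m \<phi> n (shift (2 * (\<epsilon>/2)) X)"
    using test_element[of "\<epsilon>/2" n] n by auto
  have "\<exists>Q. psd (grid N p) Q \<and> (\<forall>i<N. \<forall>j<N. \<forall>l<d. shift r v i j l = contract P p Q i j l)" for N
  proof (rule ccontr)
    assume no: "\<not> ?thesis"
    have hv: "herm N (shift r v)"
    proof (rule hermI)
      fix i j l assume "l < d"
      from ucp_positive_imp_herm[OF v this, of j i] e_real[OF this]
      show "shift r v j i l = cnj (shift r v i j l)" by (auto simp: shift_def)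
    qed
    obtain \<phi> where \<phi>: "hermitian_map N \<phi>" "\<And>Q. psd (grid N p) Q \<Longrightarrow> 0 \<le> pairing N \<phi> (contract P p Q)"
      "Re (pairing N \<phi> (shift r v)) < 0"
      using contract_separation[OF \<omega> P(1,3,2) hv no] by blast
    have A: "amp_psd N \<phi> p P" by (rule amp_psd_of_pairing[OF \<phi>(2)])
    have a0: "psd {..<N} (\<lambda>i j. \<Sum>l<d. e l * \<phi> l i j)"
    proof -
      have "amp_psd N \<phi> n (shift \<epsilon> (\<lambda>_ _ _. 0))"
        using test[OF A, of "\<lambda>_ _ _. 0"] C_zero[of n] shift_pos[of 2 n] by (simp add: neg_def)
      hence "psd {..<N} (\<lambda>i j. amp \<phi> (shift \<epsilon> (\<lambda>_ _ _. 0)) (0,i) (0,j))"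
        unfolding amp_psd_def by (rule psd_pullback) (use n in auto)
      from psd_scale[OF this, of "1 / \<epsilon>"] n show ?thesis
        by (simp add: amp_def shift_def sum_distrib_left)
    qed
    (* the perturbed functional is nonnegative at v + r, for every size t of the perturbation *)
    have claim: "0 \<le> Re (pairing N (\<lambda>l i j. \<phi> l i j + (if i = j then complex_of_real (t * \<omega> l) else 0)) (shift r v))"
      if t: "t > 0" for t
    proof -
      define \<phi>t where "\<phi>t = (\<lambda>l i j. \<phi> l i j + (if i = j then complex_of_real (t * \<omega> l) else 0))"
      have At: "amp_psd N \<phi>t p P" unfolding \<phi>t_def by (rule amp_psd_state[OF \<omega> P(1) A]) (use t in simp)
      obtain L \<Lambda> \<phi>' where \<phi>': "\<phi>' = (\<lambda>l c c'. \<Sum>a<N. \<Sum>b<N. cnj (\<Lambda> a c) * \<phi>t l a b * \<Lambda> b c')"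
        "unital N \<phi>'" "hermitian_map N \<phi>'"
        and fac: "\<And>l i j. i < N \<Longrightarrow> j < N \<Longrightarrow> \<phi>t l i j = (\<Sum>c<N. \<Sum>c'<N. cnj (L c i) * \<phi>' l c c' * L c' j)"
      proof (rule unitalization[OF \<phi>(1) a0 t _ \<omega>, of \<phi>t])
        show "\<phi>t l i j = \<phi> l i j + (if i = j then complex_of_real (t * \<omega> l) else 0)" for l i j
          by (simp only: \<phi>t_def)
      qed (rule that; assumption)
      have A': "amp_psd N \<phi>' p P" unfolding \<phi>'(1) by (rule amp_psd_conj[OF At])
      have "amp_psd N \<phi>' n (shift \<epsilon> X)" if "X \<in> C n" "shift 2 (neg X) \<in> C n" for X
        using test[OF A' that] by simp
      from stab[OF \<phi>'(3,2) this] obtain \<psi> where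
        \<psi>: "ucp_co N \<psi>" "\<And>l. l < d \<Longrightarrow> opbound {..<N} (\<lambda>i j. \<phi>' l i j - \<psi> l i j) \<delta>" by blast
      define I where "I = grid N N"
      define \<xi> where "\<xi> = (\<lambda>(j,c). L c j)"
      define S where "S = (\<Sum>i\<in>I. (cmod (\<xi> i))\<^sup>2)"
      have S: "S \<ge> 0" by (simp add: S_def sum_nonneg)
      have "pairing N \<phi>t (shift r v) = qform I (amp \<phi>' (shift r v)) \<xi>"
        unfolding I_def \<xi>_def by (rule pairing_factor) (rule fac)
      (* \<phi>' = \<psi> + (\<phi>' - \<psi>) on v, while the summand r contributes r times the identity as \<phi>' is unital *)
      also have "\<dots> = qform I (\<lambda>x y. amp \<psi> v x y + ((\<Sum>l<d. (\<lambda>(i,c) (j,c'). v i j l * (\<phi>' l c c' - \<psi> l c c')) x y)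
          + (if x = y then complex_of_real r else 0))) \<xi>"
      proof (rule qform_cong)
        fix x y assume "x \<in> I" "y \<in> I"
        then obtain i c j c' where xy: "x = (i,c)" "y = (j,c')" "i < N" "c < N" "j < N" "c' < N"
          by (auto simp: I_def)
        have "amp \<phi>' (shift r v) x y = (\<Sum>l<d. v i j l * \<phi>' l c c')
          + (if i = j then complex_of_real r * (\<Sum>l<d. e l * \<phi>' l c c') else 0)"
          by (simp add: amp_def xy shift_def distrib_right sum.distrib sum_distrib_left mult.assoc)
        also have "(\<Sum>l<d. e l * \<phi>' l c c') = (if c = c' then 1 else 0)"
          using \<phi>'(2) xy by (simp add: unital_def)
        also have "(\<Sum>l<d. v i j l * \<phi>' l c c') = amp \<psi> v x y + (\<Sum>l<d. v i j l * (\<phi>' l c c' - \<psi> l c c'))"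
          by (simp add: amp_def xy right_diff_distrib sum_subtractf)
        finally show "amp \<phi>' (shift r v) x y = amp \<psi> v x y + ((\<Sum>l<d. (\<lambda>(i,c) (j,c'). v i j l * (\<phi>' l c c' - \<psi> l c c')) x y)
          + (if x = y then complex_of_real r else 0))"
          by (simp add: xy)
      qed simp
      also have "\<dots> = qform I (amp \<psi> v) \<xi> + ((\<Sum>l<d. qform I (\<lambda>(i,c) (j,c'). v i j l * (\<phi>' l c c' - \<psi> l c c')) \<xi>)
          + complex_of_real r * complex_of_real S)"
        unfolding qform_add qform_sum S_def by (subst qform_identity) (simp_all add: I_def)
      finally have eq: "pairing N \<phi>t (shift r v) = qform I (amp \<psi> v) \<xi>
        + ((\<Sum>l<d. qform I (\<lambda>(i,c) (j,c'). v i j l * (\<phi>' l c c' - \<psi> l c c')) \<xi>) + complex_of_real r * complex_of_real S)" .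
      have "0 \<le> qform I (amp \<psi> v) \<xi>"
        unfolding I_def using v[OF \<psi>(1), of N] unfolding amp_psd_def by (rule psdD)
      hence 1: "0 \<le> Re (qform I (amp \<psi> v) \<xi>)" by (simp add: complex_nonneg_iff)
      have "cmod (\<Sum>l<d. qform I (\<lambda>(i,c) (j,c'). v i j l * (\<phi>' l c c' - \<psi> l c c')) \<xi>) \<le> (\<Sum>l<d. \<delta> * B * S)"
        unfolding I_def S_def
        by (rule order_trans[OF norm_sum], rule sum_mono, rule qform_tensor_opbound[OF \<psi>(2) \<delta> B(2,1)]) auto
      also have "\<dots> = real d * (\<delta> * B) * S" by simp
      also have "\<dots> \<le> r * S" by (rule mult_right_mono[OF dd S])
      finally have "- Re (\<Sum>l<d. qform I (\<lambda>(i,c) (j,c'). v i j l * (\<phi>' l c c' - \<psi> l c c')) \<xi>) \<le> r * S"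
        using abs_Re_le_cmod[of "\<Sum>l<d. qform I (\<lambda>(i,c) (j,c'). v i j l * (\<phi>' l c c' - \<psi> l c c')) \<xi>"] by linarith
      with 1 have "0 \<le> Re (pairing N \<phi>t (shift r v))" unfolding eq by simp
      thus ?thesis by (simp only: \<phi>t_def)
    qed
    have lin: "pairing N (\<lambda>l i j. \<phi> l i j + (if i = j then complex_of_real (t * \<omega> l) else 0)) y
      = pairing N \<phi> y + complex_of_real t * pairing N (\<lambda>l i j. if i = j then complex_of_real (\<omega> l) else 0) y" for t y
      unfolding pairing_def sum_distrib_left sum.distrib[symmetric]
      by (intro sum.cong refl) (simp add: algebra_simps)
    have "0 \<le> Re (pairing N \<phi> (shift r v))"
      by (rule nonneg_of_small_perturbation[of _ "Re (pairing N (\<lambda>l i j. if i = j then complex_of_real (\<omega> l) else 0) (shift r v))"])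
        (use claim[unfolded lin] in simp)
    thus False using \<phi>(3) by simp
  qed
  from that[OF p P this] show ?thesis .
qed

end

section \<open>Factorization of infinite matrices\<close>

lemma bij_betw_divmod:
  fixes N p :: nat
  assumes "p > 0"
  shows "bij_betw (\<lambda>a. (a div p, a mod p)) {..<N * p} (grid N p)"
proof (rule bij_betw_byWitness[where f' = "\<lambda>(i,g). i * p + g"])
  show "(\<lambda>(i, g). i * p + g) ` (grid N p) \<subseteq> {..<N * p}"
  proof clarsimp
    fix i g assume "i < N" "g < p"
    hence "i * p + g < i * p + p" by simp
    also have "\<dots> = (i + 1) * p" by simp
    also have "\<dots> \<le> N * p" using \<open>i < N\<close> by (intro mult_right_mono) auto
    finally show "i * p + g < N * p" .
  qed
qed (use assms in \<open>auto simp: less_mult_imp_div_less\<close>)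

lemma sum_divmod:
  fixes N p :: nat
  assumes "p > 0"
  shows "(\<Sum>a<N * p. F (a div p, a mod p)) = (\<Sum>x\<in>grid N p. F x)"
  using sum.reindex_bij_betw[OF bij_betw_divmod[OF assms], of F] by simp

lemma sum_lessThan_mult:
  fixes F :: "nat \<Rightarrow> 'b::comm_monoid_add"
  assumes "k > 0"
  shows "(\<Sum>i<N * k. F i) = (\<Sum>s<N. \<Sum>a<k. F (s * k + a))"
  using sum_divmod[OF assms, of "\<lambda>(s,a). F (s * k + a)" N] by (simp add: sum.cartesian_product')

context coord_opsys
begin

text \<open>
  A bound for \<open>Q\<close> as an operator that does not depend on \<open>N\<close>: for the diagonal blocks of \<open>Q\<close> it follows
  from \<open>contract_trace\<close>, and a positive semidefinite matrix with \<open>p \<times> p\<close> blocks is at most \<open>p\<close> times its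
  block diagonal.
\<close>

lemma contract_form_bound:
  assumes \<omega>: "state \<omega>" and P: "shift (- \<eta>) P \<in> C p" "0 < \<eta>"
    and Q: "psd (grid N p) Q"
    and e: "\<And>i j l. i < N \<Longrightarrow> j < N \<Longrightarrow> l < d \<Longrightarrow> shift r v i j l = contract P p Q i j l"
    and B: "B > 0" "\<And>l. l < d \<Longrightarrow> opbound {..<N} (\<lambda>i j. v i j l) B"
  shows "Re (qform (grid N p) Q f)
    \<le> real p * (((\<Sum>l<d. \<bar>\<omega> l\<bar>) * B + r) / \<eta>) * (\<Sum>x\<in>grid N p. (cmod (f x))\<^sup>2)"
proof -
  define c where "c = (\<Sum>l<d. \<bar>\<omega> l\<bar>) * B + r"
  have diag: "\<eta> * Re (qform {..<N} (\<lambda>i j. Q (i,g) (j,g)) f') \<le> c * (\<Sum>i<N. (cmod (f' i))\<^sup>2)"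
    if g: "g < p" for g f'
  proof -
    define S where "S = (\<Sum>i<N. (cmod (f' i))\<^sup>2)"
    have nn: "0 \<le> Re (qform {..<N} (\<lambda>i j. Q (i,h) (j,h)) f')" if "h < p" for h
    proof -
      have "psd {..<N} (\<lambda>i j. Q (i,h) (j,h))" by (rule psd_pullback[OF Q]) (use that in auto)
      from psdD[OF this, of f'] show ?thesis by (simp add: complex_nonneg_iff)
    qed
    have "Re (qform {..<N} (\<lambda>i j. Q (i,g) (j,g)) f') \<le> (\<Sum>h<p. Re (qform {..<N} (\<lambda>i j. Q (i,h) (j,h)) f'))"
      by (rule member_le_sum[of g "{..<p}" "\<lambda>h. Re (qform {..<N} (\<lambda>i j. Q (i,h) (j,h)) f')"]) (use g nn in auto)
    also have "\<dots> = Re (qform {..<N} (\<lambda>i j. \<Sum>h<p. Q (i,h) (j,h)) f')" by (simp add: qform_sum Re_sum)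
    finally have 1: "\<eta> * Re (qform {..<N} (\<lambda>i j. Q (i,g) (j,g)) f') \<le> \<eta> * Re (qform {..<N} (\<lambda>i j. \<Sum>h<p. Q (i,h) (j,h)) f')"
      using P(2) by simp
    have "0 \<le> qform {..<N} (\<lambda>i j. (ev \<omega> (contract P p Q) i j) - complex_of_real \<eta> * (\<Sum>g<p. Q (i,g) (j,g))) f'"
      by (rule psdD[OF contract_trace[OF \<omega> P(1) Q]])
    also have "\<dots> = qform {..<N} (\<lambda>i j. (ev \<omega> (contract P p Q) i j) + (- complex_of_real \<eta>) * (\<Sum>g<p. Q (i,g) (j,g))) f'"
      by simp
    also have "\<dots> = qform {..<N} (\<lambda>i j. ev \<omega> (contract P p Q) i j) f'
      + (- complex_of_real \<eta>) * qform {..<N} (\<lambda>i j. \<Sum>g<p. Q (i,g) (j,g)) f'"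
      unfolding qform_add qform_scale ..
    finally have 2: "\<eta> * Re (qform {..<N} (\<lambda>i j. \<Sum>g<p. Q (i,g) (j,g)) f')
      \<le> Re (qform {..<N} (\<lambda>i j. ev \<omega> (contract P p Q) i j) f')"
      by (simp add: complex_nonneg_iff)
    have "qform {..<N} (\<lambda>i j. ev \<omega> (contract P p Q) i j) f'
      = qform {..<N} (\<lambda>i j. (ev \<omega> v i j) + (if i = j then complex_of_real r else 0)) f'"
    proof (rule qform_cong[OF _ refl])
      fix i j assume "i \<in> {..<N}" "j \<in> {..<N}"
      hence "(ev \<omega> (contract P p Q) i j) = (ev \<omega> (shift r v) i j)"
        by (intro sum.cong refl) (simp add: e)
      also have "\<dots> = (\<Sum>l<d. complex_of_real (\<omega> l) * (if i = j then complex_of_real r * e l else 0)) + (ev \<omega> v i j)"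
        unfolding shift_def distrib_left sum.distrib ..
      also have "(\<Sum>l<d. complex_of_real (\<omega> l) * (if i = j then complex_of_real r * e l else 0))
        = (if i = j then complex_of_real r * (\<Sum>l<d. complex_of_real (\<omega> l) * e l) else 0)"
        by (simp add: sum_distrib_left mult.left_commute)
      finally show "(ev \<omega> (contract P p Q) i j)
        = (ev \<omega> v i j) + (if i = j then complex_of_real r else 0)"
        using \<omega> by (simp add: state_def)
    qed
    also have "\<dots> = (\<Sum>l<d. complex_of_real (\<omega> l) * qform {..<N} (\<lambda>i j. v i j l) f') + complex_of_real r * complex_of_real S"
      unfolding qform_add qform_sum qform_scale S_def by (subst qform_identity) simp_all
    finally have "Re (qform {..<N} (\<lambda>i j. ev \<omega> (contract P p Q) i j) f')
      = (\<Sum>l<d. \<omega> l * Re (qform {..<N} (\<lambda>i j. v i j l) f')) + r * S"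
      by (simp add: Re_sum)
    also have "(\<Sum>l<d. \<omega> l * Re (qform {..<N} (\<lambda>i j. v i j l) f')) \<le> (\<Sum>l<d. \<bar>\<omega> l\<bar> * (B * S))"
    proof (rule sum_mono)
      fix l assume "l \<in> {..<d}"
      hence "cmod (qform {..<N} (\<lambda>i j. v i j l) f') \<le> B * S"
        unfolding S_def by (intro qform_opbound B) simp
      hence b: "\<bar>Re (qform {..<N} (\<lambda>i j. v i j l) f')\<bar> \<le> B * S"
        using abs_Re_le_cmod order_trans by blast
      have "\<omega> l * Re (qform {..<N} (\<lambda>i j. v i j l) f') \<le> \<bar>\<omega> l\<bar> * \<bar>Re (qform {..<N} (\<lambda>i j. v i j l) f')\<bar>"
        by (metis abs_ge_self abs_mult)
      also have "\<dots> \<le> \<bar>\<omega> l\<bar> * (B * S)" by (rule mult_left_mono[OF b]) simp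
      finally show "\<omega> l * Re (qform {..<N} (\<lambda>i j. v i j l) f') \<le> \<bar>\<omega> l\<bar> * (B * S)" .
    qed
    also have "(\<Sum>l<d. \<bar>\<omega> l\<bar> * (B * S)) + r * S = c * S"
      by (simp add: c_def algebra_simps sum_distrib_left sum_distrib_right)
    finally show ?thesis using 1 2 by (simp add: S_def)
  qed
  obtain R where R: "\<And>x y. x \<in> grid N p \<Longrightarrow> y \<in> grid N p \<Longrightarrow> Q x y = (\<Sum>w<card (grid N p). cnj (R w x) * R w y)"
    using psd_factor[OF Q] by blast
  define W where "W = {..<card (grid N p)}"
  define z where "z w g = (\<Sum>i<N. R w (i,g) * f (i,g))" for w g
  have "qform (grid N p) Q f = qform (grid N p) (\<lambda>x y. \<Sum>w\<in>W. cnj (R w x) * R w y) f"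
    by (rule qform_cong) (simp_all add: R W_def)
  also have "\<dots> = of_real (\<Sum>w\<in>W. (cmod (\<Sum>x\<in>grid N p. R w x * f x))\<^sup>2)"
    by (rule qform_gram)
  also have "(\<lambda>w. \<Sum>x\<in>grid N p. R w x * f x) = (\<lambda>w. \<Sum>g<p. z w g)"
  proof
    fix w
    have "(\<Sum>x\<in>grid N p. R w x * f x) = (\<Sum>i<N. \<Sum>g<p. R w (i,g) * f (i,g))"
      by (rule sum.cartesian_product')
    also have "\<dots> = (\<Sum>g<p. z w g)" unfolding z_def by (rule sum.swap)
    finally show "(\<Sum>x\<in>grid N p. R w x * f x) = (\<Sum>g<p. z w g)" .
  qed
  finally have "Re (qform (grid N p) Q f) = (\<Sum>w\<in>W. (cmod (\<Sum>g<p. z w g))\<^sup>2)"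
    by (simp only: Re_complex_of_real)
  also have "\<dots> \<le> (\<Sum>w\<in>W. real p * (\<Sum>g<p. (cmod (z w g))\<^sup>2))"
    by (intro sum_mono sum_norm_squared_le)
  also have "\<dots> = real p * (\<Sum>g<p. \<Sum>w\<in>W. (cmod (z w g))\<^sup>2)"
    unfolding sum.swap[of "\<lambda>g w. (cmod (z w g))\<^sup>2" W] by (simp add: sum_distrib_left)
  also have "\<dots> \<le> real p * (\<Sum>g<p. (c / \<eta>) * (\<Sum>i<N. (cmod (f (i,g)))\<^sup>2))"
  proof (intro mult_left_mono sum_mono)
    fix g assume g: "g \<in> {..<p}"
    have "qform {..<N} (\<lambda>i j. Q (i,g) (j,g)) (\<lambda>i. f (i,g)) = qform {..<N} (\<lambda>i j. \<Sum>w\<in>W. cnj (R w (i,g)) * R w (j,g)) (\<lambda>i. f (i,g))"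
      using g by (intro qform_cong) (simp_all add: R W_def)
    also have "\<dots> = of_real (\<Sum>w\<in>W. (cmod (z w g))\<^sup>2)"
      unfolding z_def by (rule qform_gram)
    finally have "\<eta> * (\<Sum>w\<in>W. (cmod (z w g))\<^sup>2) \<le> c * (\<Sum>i<N. (cmod (f (i,g)))\<^sup>2)"
      using diag[of g "\<lambda>i. f (i,g)"] g by simp
    thus "(\<Sum>w\<in>W. (cmod (z w g))\<^sup>2) \<le> (c / \<eta>) * (\<Sum>i<N. (cmod (f (i,g)))\<^sup>2)"
      using P(2) by (simp add: field_simps)
  qed simp
  also have "(\<Sum>g<p. (c / \<eta>) * (\<Sum>i<N. (cmod (f (i,g)))\<^sup>2)) = (c / \<eta>) * (\<Sum>g<p. \<Sum>i<N. (cmod (f (i,g)))\<^sup>2)"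
    by (simp add: sum_distrib_left)
  also have "(\<Sum>g<p. \<Sum>i<N. (cmod (f (i,g)))\<^sup>2) = (\<Sum>i<N. \<Sum>g<p. (cmod (f (i,g)))\<^sup>2)"
    by (rule sum.swap)
  also have "\<dots> = (\<Sum>x\<in>grid N p. (cmod (f x))\<^sup>2)"
    by (rule sum.cartesian_product'[symmetric])
  finally show ?thesis by (simp add: c_def)
qed

text \<open>
  The position \<open>(i,g)\<close> is numbered \<open>i * p + g\<close>, so that the corners of size \<open>N\<close> are nested and a
  triangular factor of the \<open>N\<close>-th matrix \<open>Q\<close> has entries at positions that do not depend on \<open>N\<close>. The inner sum stops at
  \<open>i * p + g\<close> because the later rows of column \<open>i * p + g\<close> vanish.
\<close>

lemma infinite_factorization:
  assumes st: "stable" and \<omega>: "state \<omega>"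
    and v: "\<And>N m \<psi>. ucp_co m \<psi> \<Longrightarrow> amp_psd m \<psi> N v"
    and B: "B > 0" "\<And>l N. l < d \<Longrightarrow> opbound {..<N} (\<lambda>i j. v i j l) B"
    and r: "r > 0"
  obtains p P R c where "p > 0" "P \<in> C p" "\<And>w j. j < w \<Longrightarrow> R w j = 0" "c \<ge> 0"
    "\<And>M f. (\<Sum>w<M. (cmod (\<Sum>j<M. R w j * f j))\<^sup>2) \<le> c * (\<Sum>j<M. (cmod (f j))\<^sup>2)"
    "\<And>i j l. l < d \<Longrightarrow> shift r v i j l =
      (\<Sum>g<p. \<Sum>h<p. P g h l * (\<Sum>w\<le>i * p + g. cnj (R w (i * p + g)) * R w (j * p + h)))"
proof (rule finite_stage[OF st \<omega> v B r])
  fix p P \<eta> assume p: "p > 0" and P: "P \<in> C p" "(\<eta>::real) > 0" "shift (- \<eta>) P \<in> C p"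
    and ex: "\<And>N. \<exists>Q. psd (grid N p) Q \<and> (\<forall>i<N. \<forall>j<N. \<forall>l<d. shift r v i j l = contract P p Q i j l)"
  from choice[OF allI[OF ex]] obtain Q where
    "\<forall>N. psd (grid N p) (Q N) \<and> (\<forall>i<N. \<forall>j<N. \<forall>l<d. shift r v i j l = contract P p (Q N) i j l)" ..
  hence Q: "\<And>N. psd (grid N p) (Q N)"
    and vQ: "\<And>N i j l. i < N \<Longrightarrow> j < N \<Longrightarrow> l < d \<Longrightarrow> shift r v i j l = contract P p (Q N) i j l" by simp_all
  define A where "A N a b = Q N (a div p, a mod p) (b div p, b mod p)" for N a b
  have A: "psd {..<N * p} (A N)" for N
    unfolding A_def by (rule psd_pullback[OF Q]) (use p in \<open>auto simp: less_mult_imp_div_less\<close>)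
  have "\<exists>R. (\<forall>w j. j < w \<longrightarrow> R w j = 0) \<and> (\<forall>i<N * p. \<forall>j<N * p. A N i j = (\<Sum>w<N * p. cnj (R w i) * R w j))" for N
    by (rule cholesky[OF A])
  from choice[OF allI[OF this]] obtain R where
    "\<forall>N. (\<forall>w j. j < w \<longrightarrow> R N w j = 0) \<and> (\<forall>i<N * p. \<forall>j<N * p. A N i j = (\<Sum>w<N * p. cnj (R N w i) * R N w j))" ..
  hence R0: "\<And>N w j. j < w \<Longrightarrow> R N w j = 0"
    and RA: "\<And>N i j. i < N * p \<Longrightarrow> j < N * p \<Longrightarrow> A N i j = (\<Sum>w<N * p. cnj (R N w i) * R N w j)" by simp_all
  (* column b of a factor is bounded by the diagonal entry b of the Gram matrix, uniformly in N *)
  define \<beta> where "\<beta> b = Re (ev \<omega> (shift r v) (b div p) (b div p)) / \<eta>" for b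
  have ent: "cmod (R N w b) \<le> sqrt (\<beta> b)" if b: "b < N * p" for N w b
  proof -
    have bd: "b div p < N" "b mod p < p" using b p by (auto simp: less_mult_imp_div_less)
    have "\<eta> * Re (A N b b) \<le> Re (\<Sum>l<d. complex_of_real (\<omega> l) * contract P p (Q N) (b div p) (b div p) l)"
      unfolding A_def by (rule contract_diag_bound[OF \<omega> P(3) Q P(2) bd])
    also have "(\<Sum>l<d. complex_of_real (\<omega> l) * contract P p (Q N) (b div p) (b div p) l)
      = (ev \<omega> (shift r v) (b div p) (b div p))"
      by (intro sum.cong refl) (simp add: vQ[OF bd(1) bd(1)])
    finally have 1: "Re (A N b b) \<le> \<beta> b" using P(2) by (simp add: \<beta>_def field_simps)
    have 2: "Re (A N b b) = (\<Sum>w<N * p. (cmod (R N w b))\<^sup>2)"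
    proof -
      have "A N b b = (\<Sum>w<N * p. complex_of_real ((cmod (R N w b))\<^sup>2))"
        unfolding RA[OF b b] by (intro sum.cong refl) (simp add: cmod_sq mult.commute)
      thus ?thesis by (simp add: Re_sum)
    qed
    have "(cmod (R N w b))\<^sup>2 \<le> (\<Sum>w<N * p. (cmod (R N w b))\<^sup>2)"
    proof (cases "w < N * p")
      case True
      thus ?thesis by (intro member_le_sum[of w "{..<N*p}" "\<lambda>w. (cmod (R N w b))\<^sup>2"]) auto
    next
      case False
      hence "R N w b = 0" using b by (intro R0) simp
      thus ?thesis by (simp add: sum_nonneg)
    qed
    thus ?thesis using 1 2 by (intro real_le_rsqrt) simp
  qed
  have large: "eventually (\<lambda>N. b < N * p) sequentially" for b
    using eventually_gt_at_top[of b]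
  proof eventually_elim
    case (elim N)
    have "N * 1 \<le> N * p" using p by (intro mult_le_mono2) simp
    thus ?case using elim by linarith
  qed
  obtain s q where s: "strict_mono (s::nat\<Rightarrow>nat)"
    and q: "\<And>k. (\<lambda>n. R (s n) (fst (prod_decode k)) (snd (prod_decode k))) \<longlonglongrightarrow> q k"
  proof (rule countable_bounded_subseq[of "\<lambda>N k. R N (fst (prod_decode k)) (snd (prod_decode k))" "\<lambda>k. sqrt (\<beta> (snd (prod_decode k)))"])
    fix k
    show "eventually (\<lambda>N. cmod (R N (fst (prod_decode k)) (snd (prod_decode k))) \<le> sqrt (\<beta> (snd (prod_decode k)))) sequentially"
      using large[of "snd (prod_decode k)"] by eventually_elim (rule ent)
  qed (rule that; assumption)
  define T where "T w j = q (prod_encode (w,j))" for w j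
  have T: "(\<lambda>n. R (s n) w j) \<longlonglongrightarrow> T w j" for w j
    using q[of "prod_encode (w,j)"] by (simp add: T_def)
  have large': "eventually (\<lambda>n. b < s n * p) sequentially" for b
    using filterlim_subseq[OF s] large[of b] by (rule eventually_compose_filterlim[rotated])
  have large2: "eventually (\<lambda>n. b < s n) sequentially" for b
    using filterlim_subseq[OF s] eventually_gt_at_top[of b] by (rule eventually_compose_filterlim[rotated])
  define c where "c = real p * (((\<Sum>l<d. \<bar>\<omega> l\<bar>) * B + r) / \<eta>)"
  show ?thesis
  proof (rule that[of p P T c])
    show "p > 0" "P \<in> C p" by fact+
    show "T w j = 0" if "j < w" for w j
      using T[of w j] unfolding R0[OF that] by (simp add: LIMSEQ_const_iff)
    show "c \<ge> 0" unfolding c_def using B(1) r P(2)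
      by (intro mult_nonneg_nonneg divide_nonneg_nonneg add_nonneg_nonneg sum_nonneg) auto
  next
    fix M and f :: "nat \<Rightarrow> complex"
    define f0 where "f0 j = (if j < M then f j else 0)" for j
    have bound: "(\<Sum>w<M. (cmod (\<Sum>j<M. R N w j * f j))\<^sup>2) \<le> c * (\<Sum>j<M. (cmod (f j))\<^sup>2)" if M: "M < N * p" for N
    proof -
      have ex: "(\<Sum>j<M. R N w j * f j) = (\<Sum>j<N * p. R N w j * f0 j)" for w
        using M by (intro sum.mono_neutral_cong_left) (auto simp: f0_def)
      have "(\<Sum>w<M. (cmod (\<Sum>j<M. R N w j * f j))\<^sup>2) \<le> (\<Sum>w<N * p. (cmod (\<Sum>j<N * p. R N w j * f0 j))\<^sup>2)"
        unfolding ex using M by (intro sum_mono2) auto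
      also have "\<dots> = Re (qform {..<N * p} (\<lambda>i j. \<Sum>w<N * p. cnj (R N w i) * R N w j) f0)"
        unfolding qform_gram by simp
      also have "qform {..<N * p} (\<lambda>i j. \<Sum>w<N * p. cnj (R N w i) * R N w j) f0 = qform {..<N * p} (A N) f0"
        by (rule qform_cong) (simp_all add: RA)
      also have "\<dots> = qform (grid N p) (Q N) (\<lambda>(i,g). f0 (i * p + g))"
      proof -
        define F where "F x y = cnj ((\<lambda>(i,g). f0 (i * p + g)) x) * Q N x y * (\<lambda>(i,g). f0 (i * p + g)) y" for x y
        have "qform {..<N * p} (A N) f0 = (\<Sum>a<N * p. \<Sum>b<N * p. F (a div p, a mod p) (b div p, b mod p))"
          unfolding qform_def F_def A_def by simp
        also have "\<dots> = (\<Sum>a<N * p. \<Sum>y\<in>grid N p. F (a div p, a mod p) y)"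
          by (intro sum.cong refl sum_divmod p)
        also have "\<dots> = (\<Sum>x\<in>grid N p. \<Sum>y\<in>grid N p. F x y)"
          by (rule sum_divmod[OF p])
        finally show ?thesis unfolding qform_def F_def .
      qed
      also have "Re \<dots> \<le> c * (\<Sum>x\<in>grid N p. (cmod ((\<lambda>(i,g). f0 (i * p + g)) x))\<^sup>2)"
        unfolding c_def by (rule contract_form_bound[OF \<omega> P(3,2) Q vQ B])
      also have "(\<Sum>x\<in>grid N p. (cmod ((\<lambda>(i,g). f0 (i * p + g)) x))\<^sup>2)
        = (\<Sum>a<N * p. (cmod (f0 a))\<^sup>2)"
        by (subst sum_divmod[OF p, symmetric]) simp
      also have "\<dots> = (\<Sum>j<M. (cmod (f j))\<^sup>2)"
        using M by (intro sum.mono_neutral_cong_right) (auto simp: f0_def)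
      finally show ?thesis .
    qed
    show "(\<Sum>w<M. (cmod (\<Sum>j<M. T w j * f j))\<^sup>2) \<le> c * (\<Sum>j<M. (cmod (f j))\<^sup>2)"
    proof (rule tendsto_upperbound)
      show "(\<lambda>n. \<Sum>w<M. (cmod (\<Sum>j<M. R (s n) w j * f j))\<^sup>2) \<longlonglongrightarrow> (\<Sum>w<M. (cmod (\<Sum>j<M. T w j * f j))\<^sup>2)"
        by (intro tendsto_intros T)
      show "eventually (\<lambda>n. (\<Sum>w<M. (cmod (\<Sum>j<M. R (s n) w j * f j))\<^sup>2) \<le> c * (\<Sum>j<M. (cmod (f j))\<^sup>2)) sequentially"
        using large'[of M] by eventually_elim (rule bound)
    qed simp
  next
    fix i j l assume l: "l < d"
    define X where "X n = (\<Sum>g<p. \<Sum>h<p. P g h l * (\<Sum>w\<le>i * p + g. cnj (R (s n) w (i * p + g)) * R (s n) w (j * p + h)))" for n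
    have lim: "X \<longlonglongrightarrow> (\<Sum>g<p. \<Sum>h<p. P g h l * (\<Sum>w\<le>i * p + g. cnj (T w (i * p + g)) * T w (j * p + h)))"
      unfolding X_def by (intro tendsto_intros T)
    have "eventually (\<lambda>n. X n = shift r v i j l) sequentially"
      using large2[of i] large2[of j]
    proof eventually_elim
      case (elim n)
      have flat: "a * p + g < s n * p" if "a < s n" "g < p" for a g
      proof -
        have "a * p + g < (a + 1) * p" using that by simp
        also have "\<dots> \<le> s n * p" using that by (intro mult_le_mono1) simp
        finally show ?thesis .
      qed
      have "shift r v i j l = contract P p (Q (s n)) i j l" by (rule vQ[OF elim l])
      also have "\<dots> = X n" unfolding contract_def X_def
      proof (intro sum.cong refl)
        fix g h assume "g \<in> {..<p}" "h \<in> {..<p}"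
        hence gh: "g < p" "h < p" by simp_all
        have "Q (s n) (i,g) (j,h) = A (s n) (i * p + g) (j * p + h)" using gh by (simp add: A_def)
        also have "\<dots> = (\<Sum>w<s n * p. cnj (R (s n) w (i * p + g)) * R (s n) w (j * p + h))"
          by (rule RA[OF flat flat]) (use elim gh in auto)
        also have "\<dots> = (\<Sum>w\<le>i * p + g. cnj (R (s n) w (i * p + g)) * R (s n) w (j * p + h))"
          using flat[OF elim(1) gh(1)] by (intro sum.mono_neutral_right) (auto simp: R0 not_le)
        finally show "P g h l * Q (s n) (i,g) (j,h) = P g h l * (\<Sum>w\<le>i * p + g. cnj (R (s n) w (i * p + g)) * R (s n) w (j * p + h))"
          by simp
      qed
      finally show "X n = shift r v i j l" by simp
    qed
    hence "X \<longlonglongrightarrow> shift r v i j l" by (rule tendsto_eventually)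
    from LIMSEQ_unique[OF this lim]
    show "shift r v i j l = (\<Sum>g<p. \<Sum>h<p. P g h l * (\<Sum>w\<le>i * p + g. cnj (T w (i * p + g)) * T w (j * p + h)))" .
  qed
qed

end

section \<open>Hermitian coordinates\<close>

context star_vector_space
begin

lemma smul_closed[simp]: "x \<in> carrier X \<Longrightarrow> c \<odot>\<^bsub>X\<^esub> x \<in> carrier X"
  using smult_closed[of c x] by simp

lemma smul_add_left: "x \<in> carrier X \<Longrightarrow> (c + d) \<odot>\<^bsub>X\<^esub> x = c \<odot>\<^bsub>X\<^esub> x \<oplus>\<^bsub>X\<^esub> d \<odot>\<^bsub>X\<^esub> x"
  using smult_l_distr[of c d x] by simp

lemma smul_add_right: "x \<in> carrier X \<Longrightarrow> y \<in> carrier X \<Longrightarrow> c \<odot>\<^bsub>X\<^esub> (x \<oplus>\<^bsub>X\<^esub> y) = c \<odot>\<^bsub>X\<^esub> x \<oplus>\<^bsub>X\<^esub> c \<odot>\<^bsub>X\<^esub> y"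
  using smult_r_distr[of c x y] by simp

lemma smul_mult: "x \<in> carrier X \<Longrightarrow> (c * d) \<odot>\<^bsub>X\<^esub> x = c \<odot>\<^bsub>X\<^esub> (d \<odot>\<^bsub>X\<^esub> x)"
  using smult_assoc1[of c d x] by simp

lemma smul_one: "x \<in> carrier X \<Longrightarrow> 1 \<odot>\<^bsub>X\<^esub> x = x"
  using smult_one[of x] by simp

lemma smul_zero: "x \<in> carrier X \<Longrightarrow> 0 \<odot>\<^bsub>X\<^esub> x = \<zero>\<^bsub>X\<^esub>"
  using smult_l_null[of x] by simp

lemma adj_finsum:
  assumes "finite I" "f \<in> I \<rightarrow> carrier X"
  shows "adj X (finsum X f I) = finsum X (\<lambda>i. adj X (f i)) I"
  using assms
proof (induction I rule: finite_induct)
  case empty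
  have "adj X \<zero>\<^bsub>X\<^esub> = adj X (0 \<odot>\<^bsub>X\<^esub> \<zero>\<^bsub>X\<^esub>)" by (simp add: smul_zero)
  also have "\<dots> = \<zero>\<^bsub>X\<^esub>" by (subst adj_smult) (simp_all add: smul_zero adj_closed)
  finally show ?case by simp
next
  case (insert x F)
  hence f: "f x \<in> carrier X" "f \<in> F \<rightarrow> carrier X" by auto
  have a: "(\<lambda>i. adj X (f i)) \<in> F \<rightarrow> carrier X" using f adj_closed by auto
  show ?case using insert f a by (simp add: adj_add adj_closed)
qed

text \<open>
  The real and imaginary parts of a finite spanning set span, and a spanning set contains a basis.
\<close>

lemma hermitian_basis_exists:
  assumes fd: "fin_dim"
  obtains \<beta> where "finite \<beta>" "basis \<beta>" "\<And>b. b \<in> \<beta> \<Longrightarrow> adj X b = b"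
proof -
  obtain B where B: "finite B" "B \<subseteq> carrier X" "span B = carrier X"
    using fd unfolding fin_dim_def by blast
  define re where "re b = b \<oplus>\<^bsub>X\<^esub> adj X b" for b
  define im where "im b = \<i> \<odot>\<^bsub>X\<^esub> (b \<oplus>\<^bsub>X\<^esub> (-1) \<odot>\<^bsub>X\<^esub> adj X b)" for b
  define H where "H = re ` B \<union> im ` B"
  have cl: "re b \<in> carrier X" "im b \<in> carrier X" if "b \<in> carrier X" for b
    using that by (simp_all add: re_def im_def adj_closed)
  have HC: "H \<subseteq> carrier X" using B(2) cl by (auto simp: H_def)
  have Hadj: "adj X h = h" if hH: "h \<in> H" for h
  proof -
    obtain b where b: "b \<in> carrier X" "h = re b \<or> h = im b" using hH B(2) by (auto simp: H_def)
    have 1: "adj X (re b) = re b"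
      using b(1) by (simp add: re_def adj_add adj_adj adj_closed M.a_comm)
    have "adj X (im b) = (- \<i>) \<odot>\<^bsub>X\<^esub> (adj X b \<oplus>\<^bsub>X\<^esub> (-1) \<odot>\<^bsub>X\<^esub> b)"
      using b(1) by (simp add: im_def adj_add adj_adj adj_closed adj_smult)
    also have "\<dots> = (- \<i>) \<odot>\<^bsub>X\<^esub> adj X b \<oplus>\<^bsub>X\<^esub> \<i> \<odot>\<^bsub>X\<^esub> b"
      using b(1) by (simp add: smul_add_right adj_closed smul_mult[symmetric])
    also have "\<dots> = \<i> \<odot>\<^bsub>X\<^esub> b \<oplus>\<^bsub>X\<^esub> (- \<i>) \<odot>\<^bsub>X\<^esub> adj X b"
      using b(1) by (intro M.a_comm) (simp_all add: adj_closed)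
    also have "\<dots> = im b"
      using b(1) by (simp add: im_def smul_add_right adj_closed smul_mult[symmetric])
    finally show ?thesis using 1 b(2) by auto
  qed
  have sub: "submodule class_ring (span H) X" by (rule span_is_submodule[OF HC])
  interpret S: submodule class_ring "span H" X by (rule sub)
  have "B \<subseteq> span H"
  proof
    fix b assume b: "b \<in> B"
    hence bc: "b \<in> carrier X" using B by auto
    note ac = adj_closed[OF bc]
    have m: "re b \<in> span H" "im b \<in> span H" using in_own_span[OF HC] b by (auto simp: H_def)
    have "(1/2) \<odot>\<^bsub>X\<^esub> re b \<oplus>\<^bsub>X\<^esub> (- \<i>/2) \<odot>\<^bsub>X\<^esub> im b \<in> span H"
      using m by (intro S.m_closed S.smult_closed) auto
    also have "(1/2) \<odot>\<^bsub>X\<^esub> re b \<oplus>\<^bsub>X\<^esub> (- \<i>/2) \<odot>\<^bsub>X\<^esub> im b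
      = ((1/2) \<odot>\<^bsub>X\<^esub> b \<oplus>\<^bsub>X\<^esub> (1/2) \<odot>\<^bsub>X\<^esub> adj X b) \<oplus>\<^bsub>X\<^esub> ((1/2) \<odot>\<^bsub>X\<^esub> b \<oplus>\<^bsub>X\<^esub> (-1/2) \<odot>\<^bsub>X\<^esub> adj X b)"
      using bc ac by (simp add: re_def im_def smul_add_right smul_mult[symmetric])
    also have "\<dots> = ((1/2) \<odot>\<^bsub>X\<^esub> b \<oplus>\<^bsub>X\<^esub> (1/2) \<odot>\<^bsub>X\<^esub> b) \<oplus>\<^bsub>X\<^esub> ((1/2) \<odot>\<^bsub>X\<^esub> adj X b \<oplus>\<^bsub>X\<^esub> (-1/2) \<odot>\<^bsub>X\<^esub> adj X b)"
      using bc ac by (simp add: M.a_ac)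
    also have "\<dots> = b"
      using bc ac by (simp add: smul_add_left[symmetric] smul_one smul_zero)
    finally show "b \<in> span H" .
  qed
  hence "span B \<subseteq> span H" by (rule span_is_subset[OF _ sub])
  hence gen: "span H = carrier X" using B(3) span_is_subset2[OF HC] by auto
  have fH: "finite H" using B(1) by (simp add: H_def)
  have "\<exists>\<beta>. \<beta> \<subseteq> H \<and> minimal \<beta> (\<lambda>S. S \<subseteq> carrier X \<and> span S = carrier X)"
    by (rule minimal_exists[OF fH]) (use HC gen in simp)
  then obtain \<beta> where \<beta>: "\<beta> \<subseteq> H" "minimal \<beta> (\<lambda>S. S \<subseteq> carrier X \<and> span S = carrier X)" by blast
  show ?thesis
    by (rule that[of \<beta>]) (use \<beta> fH finite_subset min_gen_is_basis[OF \<beta>(2)] Hadj in auto)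
qed

text \<open>
  \<open>co\<close> reads off the coordinates below \<open>d\<close> in a hermitian basis and \<open>cb\<close> forms the corresponding linear
  combination.
\<close>

definition coordinates :: "nat \<Rightarrow> ('a \<Rightarrow> nat \<Rightarrow> complex) \<Rightarrow> ((nat \<Rightarrow> complex) \<Rightarrow> 'a) \<Rightarrow> bool" where
  "coordinates d co cb \<longleftrightarrow>
    (\<forall>c. cb c \<in> carrier X) \<and> (\<forall>c. \<forall>l<d. co (cb c) l = c l) \<and>
    (\<forall>x\<in>carrier X. \<forall>y\<in>carrier X. (\<forall>l<d. co x l = co y l) \<longrightarrow> x = y) \<and>
    (\<forall>x\<in>carrier X. \<forall>y\<in>carrier X. \<forall>l<d. co (x \<oplus>\<^bsub>X\<^esub> y) l = co x l + co y l) \<and>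
    (\<forall>c. \<forall>x\<in>carrier X. \<forall>l<d. co (c \<odot>\<^bsub>X\<^esub> x) l = c * co x l) \<and>
    (\<forall>x\<in>carrier X. \<forall>l<d. co (adj X x) l = cnj (co x l))"

lemma coordinates_exist:
  assumes fd: "fin_dim"
  obtains d co cb where "coordinates d co cb"
proof -
  obtain \<beta> where \<beta>: "finite \<beta>" "basis \<beta>" "\<And>b. b \<in> \<beta> \<Longrightarrow> adj X b = b"
    using hermitian_basis_exists[OF fd] by blast
  have \<beta>C: "\<beta> \<subseteq> carrier X" using \<beta>(2) by (simp add: basis_def)
  have uniq: "\<exists>!a. a \<in> \<beta> \<rightarrow>\<^sub>E UNIV \<and> lincomb a \<beta> = v" if "v \<in> carrier X" for v
    using basis_criterion[OF \<beta>(1) \<beta>C] \<beta>(2) that by simp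
  define cf where "cf v = (THE a. a \<in> \<beta> \<rightarrow>\<^sub>E UNIV \<and> lincomb a \<beta> = v)" for v
  have cf: "cf v \<in> \<beta> \<rightarrow>\<^sub>E UNIV" "lincomb (cf v) \<beta> = v" if "v \<in> carrier X" for v
    using theI'[OF uniq[OF that]] by (simp_all add: cf_def)
  have lc_restrict: "lincomb (restrict a \<beta>) \<beta> = lincomb a \<beta>" for a
    by (rule lincomb_cong[OF refl \<beta>C]) auto
  have lc_cl: "lincomb a \<beta> \<in> carrier X" for a by (rule lincomb_closed[OF \<beta>C]) simp
  have cf_lc: "cf (lincomb a \<beta>) b = a b" if "b \<in> \<beta>" for a b
  proof -
    have "cf (lincomb a \<beta>) = restrict a \<beta>"
      using uniq[OF lc_cl[of a]] cf[OF lc_cl[of a]] lc_restrict[of a] by (metis PiE_restrict restrict_PiE_iff UNIV_I)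
    thus ?thesis using that by simp
  qed
  define d where "d = card \<beta>"
  obtain h where h: "bij_betw h {..<d} \<beta>"
    using ex_bij_betw_nat_finite[OF \<beta>(1)] by (auto simp: d_def atLeast0LessThan)
  have hm: "h l \<in> \<beta>" if "l < d" for l using h that by (auto simp: bij_betw_def)
  define hi where "hi = inv_into {..<d} h"
  have hi: "hi (h l) = l" if "l < d" for l
    using bij_betw_inv_into_left[OF h] that by (simp add: hi_def)
  have ih: "\<exists>l<d. h l = b" if "b \<in> \<beta>" for b using h that by (auto simp: bij_betw_def)
  define co where "co v l = cf v (h l)" for v l
  define cb where "cb c = lincomb (\<lambda>b. c (hi b)) \<beta>" for c
  have adj_lc: "adj X (lincomb a \<beta>) = lincomb (\<lambda>b. cnj (a b)) \<beta>" for a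
  proof -
    have "adj X (lincomb a \<beta>) = finsum X (\<lambda>b. adj X (a b \<odot>\<^bsub>X\<^esub> b)) \<beta>"
      unfolding lincomb_def by (rule adj_finsum[OF \<beta>(1)]) (use \<beta>C in auto)
    also have "\<dots> = finsum X (\<lambda>b. cnj (a b) \<odot>\<^bsub>X\<^esub> b) \<beta>"
    proof (rule M.finsum_cong')
      fix b assume "b \<in> \<beta>"
      hence "b \<in> carrier X" using \<beta>C by auto
      thus "adj X (a b \<odot>\<^bsub>X\<^esub> b) = cnj (a b) \<odot>\<^bsub>X\<^esub> b" using \<beta>(3)[OF \<open>b \<in> \<beta>\<close>] by (simp add: adj_smult)
    qed (use \<beta>C in auto)
    finally show ?thesis by (simp add: lincomb_def)
  qed
  have co_lc: "co (lincomb a \<beta>) l = a (h l)" if "l < d" for a l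
    using cf_lc[OF hm[OF that]] by (simp add: co_def)
  have lc: "lincomb (cf x) \<beta> = x" if "x \<in> carrier X" for x using cf(2)[OF that] .
  have "coordinates d co cb" unfolding coordinates_def
  proof (intro conjI allI ballI impI)
    show "cb c \<in> carrier X" for c unfolding cb_def by (rule lc_cl)
    show "co (cb c) l = c l" if "l < d" for c l
      using co_lc[OF that] hi[OF that] by (simp add: cb_def)
  next
    fix x y assume xy: "x \<in> carrier X" "y \<in> carrier X" "\<forall>l<d. co x l = co y l"
    have "cf x b = cf y b" if "b \<in> \<beta>" for b using ih[OF that] xy(3) by (auto simp: co_def)
    hence "lincomb (cf x) \<beta> = lincomb (cf y) \<beta>" by (intro lincomb_cong[OF refl \<beta>C]) auto
    thus "x = y" using lc xy by simp
  next
    fix x y l assume xy: "x \<in> carrier X" "y \<in> carrier X" "l < d"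
    have "lincomb (\<lambda>b. cf x b + cf y b) \<beta> = x \<oplus>\<^bsub>X\<^esub> y"
      using lincomb_sum[OF \<beta>(1) \<beta>C, of "cf x" "cf y"] lc xy by simp
    thus "co (x \<oplus>\<^bsub>X\<^esub> y) l = co x l + co y l"
      using co_lc[OF xy(3), of "\<lambda>b. cf x b + cf y b"] by (simp add: co_def)
  next
    fix c x l assume xy: "x \<in> carrier X" "l < d"
    have "lincomb (\<lambda>b. c * cf x b) \<beta> = c \<odot>\<^bsub>X\<^esub> x"
      using lincomb_smult[OF \<beta>C, of "cf x" c] lc xy by simp
    thus "co (c \<odot>\<^bsub>X\<^esub> x) l = c * co x l"
      using co_lc[OF xy(2), of "\<lambda>b. c * cf x b"] by (simp add: co_def)
  next
    fix x l assume xy: "x \<in> carrier X" "l < d"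
    have "lincomb (\<lambda>b. cnj (cf x b)) \<beta> = adj X x"
      using adj_lc[of "cf x"] lc xy by simp
    thus "co (adj X x) l = cnj (co x l)"
      using co_lc[OF xy(2), of "\<lambda>b. cnj (cf x b)"] by (simp add: co_def)
  qed
  thus ?thesis by (rule that)
qed

end

section \<open>Matrix algebras and their positive cones\<close>

lemma mats_iff: "x \<in> mats X m n \<longleftrightarrow> x \<in> carrier_mat m n \<and> (\<forall>i<m. \<forall>j<n. x $$ (i,j) \<in> carrier X)"
  unfolding mats_def by (auto dest!: elements_matD intro: elements_matI)

lemma matsD: "x \<in> mats X m n \<Longrightarrow> i < m \<Longrightarrow> j < n \<Longrightarrow> x $$ (i,j) \<in> carrier X"
  and mats_carrier: "x \<in> mats X m n \<Longrightarrow> x \<in> carrier_mat m n"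
  by (auto simp: mats_iff)

lemma matsI: "x \<in> carrier_mat m n \<Longrightarrow> (\<And>i j. i < m \<Longrightarrow> j < n \<Longrightarrow> x $$ (i,j) \<in> carrier X) \<Longrightarrow> x \<in> mats X m n"
  by (auto simp: mats_iff)

lemma mat_adjoint_dim[simp]: "dim_row (mat_adjoint A) = dim_col A" "dim_col (mat_adjoint A) = dim_row A"
  unfolding mat_adjoint_def by auto

lemma mat_adjoint_index[simp]:
  "i < dim_col A \<Longrightarrow> j < dim_row A \<Longrightarrow> mat_adjoint A $$ (i,j) = cnj (A $$ (j,i))" for A :: "complex mat"
  unfolding mat_adjoint_def by (simp add: mat_of_rows_def)

lemma mat_adjoint_carrier[simp]: "A \<in> carrier_mat m n \<Longrightarrow> mat_adjoint A \<in> carrier_mat n m"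
  by (auto intro!: carrier_matI)

lemma mat_times_index:
  "A \<in> carrier_mat m p \<Longrightarrow> B \<in> carrier_mat p n \<Longrightarrow> i < m \<Longrightarrow> j < n \<Longrightarrow> (A * B) $$ (i,j) = (\<Sum>w<p. A $$ (i,w) * B $$ (w,j))"
  for A B :: "complex mat"
  by (auto simp: scalar_prod_def atLeast0LessThan intro!: sum.cong)

lemma mat_alg_simps:
  "carrier (mat_alg p) = carrier_mat p p" "mult (mat_alg p) = (*)" "one (mat_alg p) = 1\<^sub>m p"
  "zero (mat_alg p) = 0\<^sub>m p p" "add (mat_alg p) = (+)" "smult (mat_alg p) = (\<cdot>\<^sub>m)" "adj (mat_alg p) = mat_adjoint"
  by (simp_all add: mat_alg_def)

lemma mat_alg_ring: "ring (mat_alg p)"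
proof (rule ringI)
  show "abelian_group (mat_alg p)"
  proof (rule abelian_groupI, simp_all only: mat_alg_simps)
    fix x :: "complex mat" assume "x \<in> carrier_mat p p"
    thus "\<exists>y\<in>carrier_mat p p. y + x = 0\<^sub>m p p" by (intro bexI[of _ "- x"]) auto
  qed (auto simp: comm_add_mat)
  show "Group.monoid (mat_alg p)"
    by (rule monoidI) (auto simp: mat_alg_simps)
qed (auto simp: mat_alg_simps add_mult_distrib_mat mult_add_distrib_mat)

lemma vectorspace_class_ringI:
  assumes "abelian_group V"
    and "\<And>a x. x \<in> carrier V \<Longrightarrow> a \<odot>\<^bsub>V\<^esub> x \<in> carrier V"
    and "\<And>a b x. x \<in> carrier V \<Longrightarrow> (a + b) \<odot>\<^bsub>V\<^esub> x = a \<odot>\<^bsub>V\<^esub> x \<oplus>\<^bsub>V\<^esub> b \<odot>\<^bsub>V\<^esub> x"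
    and "\<And>a x y. x \<in> carrier V \<Longrightarrow> y \<in> carrier V \<Longrightarrow> a \<odot>\<^bsub>V\<^esub> (x \<oplus>\<^bsub>V\<^esub> y) = a \<odot>\<^bsub>V\<^esub> x \<oplus>\<^bsub>V\<^esub> a \<odot>\<^bsub>V\<^esub> y"
    and "\<And>a b x. x \<in> carrier V \<Longrightarrow> (a * b) \<odot>\<^bsub>V\<^esub> x = a \<odot>\<^bsub>V\<^esub> (b \<odot>\<^bsub>V\<^esub> x)"
    and "\<And>x. x \<in> carrier V \<Longrightarrow> 1 \<odot>\<^bsub>V\<^esub> x = x"
  shows "vectorspace (class_ring :: complex ring) V"
proof -
  have "module (class_ring :: complex ring) V"
    by (rule moduleI) (use assms class_cring.is_cring in auto)
  thus ?thesis using class_field unfolding vectorspace_def by blast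
qed

lemma mat_alg_star_algebra: "star_algebra (mat_alg p)"
proof (intro star_algebra.intro star_vector_space.intro)
  show "vectorspace class_ring (mat_alg p)"
    by (rule vectorspace_class_ringI[OF ring.is_abelian_group[OF mat_alg_ring]])
      (auto simp: mat_alg_simps add_smult_distrib_left_mat add_smult_distrib_right_mat intro!: eq_matI simp: algebra_simps)
  show "star_vector_space_axioms (mat_alg p)"
    by unfold_locales (auto simp: mat_alg_simps intro!: eq_matI)
  show "ring (mat_alg p)" by (rule mat_alg_ring)
  show "star_algebra_axioms (mat_alg p)"
  proof (unfold_locales, simp_all only: mat_alg_simps)
    fix x y :: "complex mat" and c assume xy: "x \<in> carrier_mat p p" "y \<in> carrier_mat p p"
    show "c \<cdot>\<^sub>m x * y = c \<cdot>\<^sub>m (x * y)" using xy by (rule mult_smult_assoc_mat)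
    show "x * (c \<cdot>\<^sub>m y) = c \<cdot>\<^sub>m (x * y)" using xy by (rule mult_smult_distrib)
    show "mat_adjoint (x * y) = mat_adjoint y * mat_adjoint x"
    proof (rule eq_matI)
      fix i j assume "i < dim_row (mat_adjoint y * mat_adjoint x)" "j < dim_col (mat_adjoint y * mat_adjoint x)"
      hence ij: "i < p" "j < p" using xy by auto
      have "mat_adjoint (x * y) $$ (i,j) = cnj ((x * y) $$ (j,i))" using xy ij by simp
      also have "\<dots> = (\<Sum>w<p. mat_adjoint y $$ (i,w) * mat_adjoint x $$ (w,j))"
        unfolding mat_times_index[OF xy ij(2,1)] cnj_sum
        by (intro sum.cong refl) (use xy ij in simp)
      also have "\<dots> = (mat_adjoint y * mat_adjoint x) $$ (i,j)"
        by (rule mat_times_index[symmetric, of _ p p _ p]) (use xy ij in auto)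
      finally show "mat_adjoint (x * y) $$ (i,j) = (mat_adjoint y * mat_adjoint x) $$ (i,j)" .
    qed (use xy in auto)
  qed
qed

lemma mat_alg_finsum_index:
  assumes "finite I" "\<And>k. k \<in> I \<Longrightarrow> f k \<in> carrier_mat p p"
  shows "finsum (mat_alg p) f I \<in> carrier_mat p p \<and>
    (\<forall>i<p. \<forall>j<p. finsum (mat_alg p) f I $$ (i,j) = (\<Sum>k\<in>I. f k $$ (i,j)))"
  using assms
proof (induction I rule: finite_induct)
  case empty
  interpret ring "mat_alg p" by (rule mat_alg_ring)
  show ?case by (simp add: mat_alg_simps)
next
  case (insert x F)
  interpret ring "mat_alg p" by (rule mat_alg_ring)
  have "finsum (mat_alg p) f (insert x F) = f x + finsum (mat_alg p) f F"
    using insert.hyps insert.prems by (subst finsum_insert) (auto simp: mat_alg_simps)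
  moreover have "finsum (mat_alg p) f F \<in> carrier_mat p p" using insert by auto
  ultimately show ?case using insert by auto
qed

abbreviation "gram A x \<equiv> mmult A (madj A x) x"

lemma mmult_madj_entry:
  assumes "star_algebra A" and x: "x \<in> mats A n n" and ab: "a < n" "b < n"
  shows "gram A x $$ (a,b) = finsum A (\<lambda>c. adj A (x $$ (c,a)) \<otimes>\<^bsub>A\<^esub> x $$ (c,b)) {..<n}"
    and "gram A x $$ (a,b) \<in> carrier A"
proof -
  interpret star_algebra A by (rule assms(1))
  have xc: "x $$ (c,b) \<in> carrier A" if "c < n" "b < n" for b c using matsD[OF x that] .
  have dx: "dim_row x = n" "dim_col x = n" using mats_carrier[OF x] by auto
  have cl: "(\<lambda>c. adj A (x $$ (c,a)) \<otimes>\<^bsub>A\<^esub> x $$ (c,b)) \<in> {..<n} \<rightarrow> carrier A"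
    using xc ab adj_closed by auto
  have "gram A x $$ (a,b) = finsum A (\<lambda>l. madj A x $$ (a,l) \<otimes>\<^bsub>A\<^esub> x $$ (l,b)) {..<n}"
    unfolding mmult_def using ab dx by (simp add: madj_def)
  also have "\<dots> = finsum A (\<lambda>c. adj A (x $$ (c,a)) \<otimes>\<^bsub>A\<^esub> x $$ (c,b)) {..<n}"
    by (rule M.finsum_cong'[OF refl cl]) (use ab dx in \<open>simp add: madj_def\<close>)
  finally show eq: "gram A x $$ (a,b) = finsum A (\<lambda>c. adj A (x $$ (c,a)) \<otimes>\<^bsub>A\<^esub> x $$ (c,b)) {..<n}" .
  show "gram A x $$ (a,b) \<in> carrier A" unfolding eq by (rule M.finsum_closed[OF cl])
qed

lemma mmult_madj_mats:
  assumes "star_algebra A" and x: "x \<in> mats A n n"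
  shows "gram A x \<in> mats A n n"
proof (rule matsI)
  show "gram A x \<in> carrier_mat n n"
    using mats_carrier[OF x] by (auto simp: mmult_def madj_def)
qed (rule mmult_madj_entry(2)[OF assms])

lemma mat_cone_entry:
  assumes x: "x \<in> mats (mat_alg p) n n" and "a < n" "b < n" "i < p" "j < p"
  shows "gram (mat_alg p) x $$ (a,b) \<in> carrier_mat p p"
    and "gram (mat_alg p) x $$ (a,b) $$ (i,j)
      = (\<Sum>c<n. \<Sum>w<p. cnj (x $$ (c,a) $$ (w,i)) * x $$ (c,b) $$ (w,j))"
proof -
  have xc: "x $$ (c,b) \<in> carrier_mat p p" if "c < n" "b < n" for b c
    using matsD[OF x that] by (simp add: mat_alg_simps)
  have eq: "gram (mat_alg p) x $$ (a,b)
    = finsum (mat_alg p) (\<lambda>c. mat_adjoint (x $$ (c,a)) * x $$ (c,b)) {..<n}"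
    using mmult_madj_entry(1)[OF mat_alg_star_algebra x assms(2,3)] by (simp add: mat_alg_simps)
  have cl: "mat_adjoint (x $$ (c,a)) * x $$ (c,b) \<in> carrier_mat p p" if "c \<in> {..<n}" for c
    by (rule mult_carrier_mat[OF mat_adjoint_carrier[of _ p p]]) (use xc that assms in auto)
  note fi = mat_alg_finsum_index[of "{..<n}" "\<lambda>c. mat_adjoint (x $$ (c,a)) * x $$ (c,b)" p, OF finite_lessThan cl]
  show "gram (mat_alg p) x $$ (a,b) \<in> carrier_mat p p"
    using fi by (simp add: eq)
  have "gram (mat_alg p) x $$ (a,b) $$ (i,j) = (\<Sum>c<n. (mat_adjoint (x $$ (c,a)) * x $$ (c,b)) $$ (i,j))"
    using fi assms by (simp add: eq)
  also have "\<dots> = (\<Sum>c<n. \<Sum>w<p. cnj (x $$ (c,a) $$ (w,i)) * x $$ (c,b) $$ (w,j))"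
  proof (rule sum.cong[OF refl])
    fix c assume "c \<in> {..<n}"
    hence c: "x $$ (c,a) \<in> carrier_mat p p" "x $$ (c,b) \<in> carrier_mat p p" using xc assms by auto
    show "(mat_adjoint (x $$ (c,a)) * x $$ (c,b)) $$ (i,j) = (\<Sum>w<p. cnj (x $$ (c,a) $$ (w,i)) * x $$ (c,b) $$ (w,j))"
      unfolding mat_times_index[OF mat_adjoint_carrier[OF c(1)] c(2) assms(4,5)]
      by (intro sum.cong refl) (use c assms in simp)
  qed
  finally show "gram (mat_alg p) x $$ (a,b) $$ (i,j)
      = (\<Sum>c<n. \<Sum>w<p. cnj (x $$ (c,a) $$ (w,i)) * x $$ (c,b) $$ (w,j))" .
qed

lemma mcone_cstar: "mcone (cstar_opsys A) n = {gram A x | x. x \<in> mats A n n}"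
  by (simp add: cstar_opsys_def star_space.extend_def op_system.fields_def)

lemma cstar_simps:
  "carrier (cstar_opsys A) = carrier A" "mult (cstar_opsys A) = mult A" "one (cstar_opsys A) = one A"
  "zero (cstar_opsys A) = zero A" "add (cstar_opsys A) = add A" "smult (cstar_opsys A) = smult A" "adj (cstar_opsys A) = adj A"
  by (simp_all add: cstar_opsys_def star_space.extend_def op_system.fields_def)

definition mat_psd :: "nat \<Rightarrow> nat \<Rightarrow> complex mat mat \<Rightarrow> bool" where
  "mat_psd p n Y \<longleftrightarrow> psd (grid n p) (\<lambda>(a,i) (b,j). Y $$ (a,b) $$ (i,j))"

text \<open>
  Square roots are taken by \<open>psd_factor\<close>, which provides exactly as many rows as there are pairs of
  indices.
\<close>

lemma mat_cone_iff:
  "Y \<in> mcone (cstar_opsys (mat_alg p)) n \<longleftrightarrow> Y \<in> mats (mat_alg p) n n \<and> mat_psd p n Y"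
proof
  assume "Y \<in> mcone (cstar_opsys (mat_alg p)) n"
  then obtain x where x: "x \<in> mats (mat_alg p) n n" "Y = gram (mat_alg p) x"
    by (auto simp: mcone_cstar)
  have "Y \<in> mats (mat_alg p) n n"
    unfolding x(2) by (rule mmult_madj_mats[OF mat_alg_star_algebra x(1)])
  moreover have "mat_psd p n Y" unfolding mat_psd_def
  proof (rule psd_cong[OF _ psd_gram[of "grid n p" "\<lambda>cw ai. x $$ (fst cw, fst ai) $$ (snd cw, snd ai)" "grid n p"]])
    fix u v assume uv: "u \<in> grid n p" "v \<in> grid n p"
    have "(\<Sum>w\<in>grid n p. cnj (x $$ (fst w, fst u) $$ (snd w, snd u)) * x $$ (fst w, fst v) $$ (snd w, snd v))
      = (\<Sum>c<n. \<Sum>w<p. cnj (x $$ (c, fst u) $$ (w, snd u)) * x $$ (c, fst v) $$ (w, snd v))"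
      by (rule sum_pair)
    also have "\<dots> = Y $$ (fst u, fst v) $$ (snd u, snd v)"
      unfolding x(2) by (rule mat_cone_entry(2)[OF x(1), symmetric]) (use uv in auto)
    finally show "(\<Sum>w\<in>grid n p. cnj (x $$ (fst w, fst u) $$ (snd w, snd u)) * x $$ (fst w, fst v) $$ (snd w, snd v))
      = (case u of (a,i) \<Rightarrow> \<lambda>(b,j). Y $$ (a,b) $$ (i,j)) v" by (simp add: case_prod_unfold)
  qed
  ultimately show "Y \<in> mats (mat_alg p) n n \<and> mat_psd p n Y" ..
next
  assume "Y \<in> mats (mat_alg p) n n \<and> mat_psd p n Y"
  hence Y: "Y \<in> mats (mat_alg p) n n" and ps: "psd (grid n p) (\<lambda>(a,i) (b,j). Y $$ (a,b) $$ (i,j))"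
    by (auto simp: mat_psd_def)
  have fin: "finite (grid n p)" by simp
  obtain R where R: "\<And>u v. u \<in> grid n p \<Longrightarrow> v \<in> grid n p \<Longrightarrow>
      (\<lambda>(a,i) (b,j). Y $$ (a,b) $$ (i,j)) u v = (\<Sum>w<card (grid n p). cnj (R w u) * R w v)"
    using psd_factor[OF ps fin] by blast
  obtain h where h: "bij_betw h (grid n p) {..<card (grid n p)}"
    using ex_bij_betw_finite_nat[OF fin] by (auto simp: atLeast0LessThan)
  define x where "x = mat n n (\<lambda>(c,a). mat p p (\<lambda>(w,i). R (h (c,w)) (a,i)))"
  have x: "x \<in> mats (mat_alg p) n n" by (rule matsI) (auto simp: x_def mat_alg_simps)
  have "Y = gram (mat_alg p) x"
  proof (rule eq_matI)
    have d: "gram (mat_alg p) x \<in> carrier_mat n n"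
      by (simp add: mmult_def madj_def x_def)
    show "dim_row Y = dim_row (gram (mat_alg p) x)"
      "dim_col Y = dim_col (gram (mat_alg p) x)" using d mats_carrier[OF Y] by auto
    fix a b assume "a < dim_row (gram (mat_alg p) x)" "b < dim_col (gram (mat_alg p) x)"
    hence ab: "a < n" "b < n" using d by auto
    have Yab: "Y $$ (a,b) \<in> carrier_mat p p" using matsD[OF Y ab] by (simp add: mat_alg_simps)
    have Zab: "gram (mat_alg p) x $$ (a,b) \<in> carrier_mat p p"
      using mmult_madj_entry(2)[OF mat_alg_star_algebra x ab] by (simp add: mat_alg_simps)
    show "Y $$ (a,b) = gram (mat_alg p) x $$ (a,b)"
    proof (rule eq_matI)
      fix i j assume "i < dim_row (gram (mat_alg p) x $$ (a,b))"
        "j < dim_col (gram (mat_alg p) x $$ (a,b))"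
      hence ij: "i < p" "j < p" using Zab by auto
      have "Y $$ (a,b) $$ (i,j) = (\<Sum>w<card (grid n p). cnj (R w (a,i)) * R w (b,j))"
        using R[of "(a,i)" "(b,j)"] ab ij by simp
      also have "\<dots> = (\<Sum>cw\<in>grid n p. cnj (R (h cw) (a,i)) * R (h cw) (b,j))"
        by (rule sum.reindex_bij_betw[OF h, symmetric])
      also have "\<dots> = (\<Sum>c<n. \<Sum>w<p. cnj (R (h (c,w)) (a,i)) * R (h (c,w)) (b,j))"
        by (rule sum.cartesian_product')
      also have "\<dots> = (\<Sum>c<n. \<Sum>w<p. cnj (x $$ (c,a) $$ (w,i)) * x $$ (c,b) $$ (w,j))"
        using ab ij by (intro sum.cong refl) (simp add: x_def)
      also have "\<dots> = gram (mat_alg p) x $$ (a,b) $$ (i,j)"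
        by (rule mat_cone_entry(2)[OF x ab ij, symmetric])
      finally show "Y $$ (a,b) $$ (i,j) = gram (mat_alg p) x $$ (a,b) $$ (i,j)" .
    qed (use Yab Zab in auto)
  qed
  thus "Y \<in> mcone (cstar_opsys (mat_alg p)) n" using x by (auto simp: mcone_cstar)
qed

section \<open>Transport along an injection\<close>

text \<open>
  The *-algebra structure on the image of an injection. CP-stability speaks of C*-algebras on one given
  type, and matrix algebras are carried there by such injections.
\<close>

definition transport :: "('a \<Rightarrow> 'b) \<Rightarrow> 'a star_space \<Rightarrow> 'b star_space" where
  "transport g A = (let h = the_inv_into (carrier A) g in
    \<lparr>carrier = g ` carrier A, mult = (\<lambda>x y. g (h x \<otimes>\<^bsub>A\<^esub> h y)), one = g \<one>\<^bsub>A\<^esub>, zero = g \<zero>\<^bsub>A\<^esub>,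
     add = (\<lambda>x y. g (h x \<oplus>\<^bsub>A\<^esub> h y)), smult = (\<lambda>c x. g (c \<odot>\<^bsub>A\<^esub> h x)), adj = (\<lambda>x. g (adj A (h x)))\<rparr>)"

context
  fixes A :: "'a star_space" and g :: "'a \<Rightarrow> 'b"
  assumes A: "star_algebra A" and g: "inj_on g (carrier A)"
begin

interpretation star_algebra A by (rule A)

abbreviation "h \<equiv> the_inv_into (carrier A) g"

lemma transport_inv: "x \<in> carrier A \<Longrightarrow> h (g x) = x"
  by (rule the_inv_into_f_f[OF g])

lemma transport_simps:
  "carrier (transport g A) = g ` carrier A"
  "\<one>\<^bsub>transport g A\<^esub> = g \<one>\<^bsub>A\<^esub>" "\<zero>\<^bsub>transport g A\<^esub> = g \<zero>\<^bsub>A\<^esub>"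
  "x \<in> carrier A \<Longrightarrow> y \<in> carrier A \<Longrightarrow> g x \<otimes>\<^bsub>transport g A\<^esub> g y = g (x \<otimes>\<^bsub>A\<^esub> y)"
  "x \<in> carrier A \<Longrightarrow> y \<in> carrier A \<Longrightarrow> g x \<oplus>\<^bsub>transport g A\<^esub> g y = g (x \<oplus>\<^bsub>A\<^esub> y)"
  "x \<in> carrier A \<Longrightarrow> c \<odot>\<^bsub>transport g A\<^esub> g x = g (c \<odot>\<^bsub>A\<^esub> x)"
  "x \<in> carrier A \<Longrightarrow> adj (transport g A) (g x) = g (adj A x)"
  by (simp_all add: transport_def Let_def transport_inv)

lemma transport_abelian_group: "abelian_group (transport g A)"
proof (rule abelian_groupI)
  fix x assume "x \<in> carrier (transport g A)"
  then obtain x' where x: "x' \<in> carrier A" "x = g x'" by (auto simp: transport_simps)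
  show "\<exists>y\<in>carrier (transport g A). y \<oplus>\<^bsub>transport g A\<^esub> x = \<zero>\<^bsub>transport g A\<^esub>"
    by (rule bexI[of _ "g (\<ominus>\<^bsub>A\<^esub> x')"]) (use x in \<open>auto simp: transport_simps M.l_neg\<close>)
qed (auto simp: transport_simps M.a_ac)

lemma transport_star_algebra: "star_algebra (transport g A)"
proof (intro star_algebra.intro star_vector_space.intro)
  show "vectorspace class_ring (transport g A)"
    by (rule vectorspace_class_ringI[OF transport_abelian_group])
      (auto simp: transport_simps smul_add_left smul_add_right smul_mult smul_one)
  show "star_vector_space_axioms (transport g A)"
    by unfold_locales (auto simp: transport_simps adj_closed adj_adj adj_add adj_smult)
  show "ring (transport g A)"
  proof (rule ringI[OF transport_abelian_group])
    show "Group.monoid (transport g A)"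
      by (rule monoidI) (auto simp: transport_simps A.m_assoc)
  qed (auto simp: transport_simps A.l_distr A.r_distr)
  show "star_algebra_axioms (transport g A)"
    by unfold_locales (auto simp: transport_simps smult_mult_left smult_mult_right adj_mult adj_closed)
qed

lemma transport_minus:
  assumes "x \<in> carrier A" "y \<in> carrier A"
  shows "g x \<ominus>\<^bsub>transport g A\<^esub> g y = g (x \<ominus>\<^bsub>A\<^esub> y)"
proof -
  interpret T: star_algebra "transport g A" by (rule transport_star_algebra)
  have "g x = g (x \<ominus>\<^bsub>A\<^esub> y) \<oplus>\<^bsub>transport g A\<^esub> g y"
  proof -
    have "(x \<ominus>\<^bsub>A\<^esub> y) \<oplus>\<^bsub>A\<^esub> y = x" using assms by (simp add: M.minus_eq M.a_assoc M.l_neg)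
    thus ?thesis using assms by (simp add: transport_simps)
  qed
  hence "g x \<ominus>\<^bsub>transport g A\<^esub> g y = (g (x \<ominus>\<^bsub>A\<^esub> y) \<oplus>\<^bsub>transport g A\<^esub> g y) \<ominus>\<^bsub>transport g A\<^esub> g y" by simp
  also have "\<dots> = g (x \<ominus>\<^bsub>A\<^esub> y)"
  proof -
    have "g (x \<ominus>\<^bsub>A\<^esub> y) \<in> carrier (transport g A)" "g y \<in> carrier (transport g A)"
      using assms by (auto simp: transport_simps)
    thus ?thesis by (simp add: T.M.minus_eq T.M.a_assoc T.M.r_neg)
  qed
  finally show ?thesis .
qed

lemma transport_cstar_norm:
  assumes "complete_cstar_norm A N"
  shows "complete_cstar_norm (transport g A) (\<lambda>x. N (h x))"
proof -
  note N = assms[unfolded complete_cstar_norm_def]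
  show ?thesis unfolding complete_cstar_norm_def
  proof (intro conjI)
    show "\<forall>x\<in>carrier (transport g A). 0 \<le> N (h x)"
      using N by (auto simp: transport_simps transport_inv)
    show "\<forall>x\<in>carrier (transport g A). (N (h x) = 0) = (x = \<zero>\<^bsub>transport g A\<^esub>)"
      using N by (auto simp: transport_simps transport_inv dest: inj_onD[OF g])
    show "\<forall>c. \<forall>x\<in>carrier (transport g A). N (h (c \<odot>\<^bsub>transport g A\<^esub> x)) = cmod c * N (h x)"
      using N by (auto simp: transport_simps transport_inv)
    show "\<forall>x\<in>carrier (transport g A). \<forall>y\<in>carrier (transport g A). N (h (x \<oplus>\<^bsub>transport g A\<^esub> y)) \<le> N (h x) + N (h y)"
      using N by (auto simp: transport_simps transport_inv)
    show "\<forall>x\<in>carrier (transport g A). \<forall>y\<in>carrier (transport g A). N (h (x \<otimes>\<^bsub>transport g A\<^esub> y)) \<le> N (h x) * N (h y)"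
      using N by (auto simp: transport_simps transport_inv)
    show "\<forall>x\<in>carrier (transport g A). N (h (adj (transport g A) x \<otimes>\<^bsub>transport g A\<^esub> x)) = (N (h x))\<^sup>2"
      using N by (auto simp: transport_simps transport_inv adj_closed)
    show "\<forall>s. (\<forall>n. s n \<in> carrier (transport g A)) \<and> (\<forall>e>0. \<exists>M. \<forall>m\<ge>M. \<forall>n\<ge>M. N (h (s m \<ominus>\<^bsub>transport g A\<^esub> s n)) < e) \<longrightarrow>
      (\<exists>l\<in>carrier (transport g A). (\<lambda>n. N (h (s n \<ominus>\<^bsub>transport g A\<^esub> l))) \<longlonglongrightarrow> 0)"
    proof (intro allI impI)
      fix s assume s: "(\<forall>n::nat. s n \<in> carrier (transport g A)) \<and> (\<forall>e>0. \<exists>M. \<forall>m\<ge>M. \<forall>n\<ge>M. N (h (s m \<ominus>\<^bsub>transport g A\<^esub> s n)) < e)"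
      hence "\<forall>n. \<exists>t. t \<in> carrier A \<and> s n = g t" by (auto simp: transport_simps)
      from choice[OF this] obtain t where t: "\<And>n. t n \<in> carrier A" "\<And>n. s n = g (t n)" by auto
      have eq: "h (s n \<ominus>\<^bsub>transport g A\<^esub> g l) = t n \<ominus>\<^bsub>A\<^esub> l" if "l \<in> carrier A" for n l
        using t that by (simp add: transport_minus transport_inv)
      have "\<forall>e>0. \<exists>M. \<forall>m\<ge>M. \<forall>n\<ge>M. N (t m \<ominus>\<^bsub>A\<^esub> t n) < e"
        using s eq[OF t(1)] by (simp add: t(2)[symmetric])
      hence "\<exists>l\<in>carrier A. (\<lambda>n. N (t n \<ominus>\<^bsub>A\<^esub> l)) \<longlonglongrightarrow> 0" using N t(1) by blast
      then obtain l where l: "l \<in> carrier A" "(\<lambda>n. N (t n \<ominus>\<^bsub>A\<^esub> l)) \<longlonglongrightarrow> 0" by blast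
      show "\<exists>l\<in>carrier (transport g A). (\<lambda>n. N (h (s n \<ominus>\<^bsub>transport g A\<^esub> l))) \<longlonglongrightarrow> 0"
        by (rule bexI[of _ "g l"]) (use l in \<open>simp_all add: eq transport_simps\<close>)
    qed
  qed
qed

text \<open>
  Positive elements are those of the form \<open>x\<^sup>* x\<close>, which only refers to the *-algebra structure.
\<close>

lemma transport_cone:
  assumes Y: "Y \<in> mats A n n"
  shows "map_mat g Y \<in> mcone (cstar_opsys (transport g A)) n \<longleftrightarrow> Y \<in> mcone (cstar_opsys A) n"
proof -
  have eq: "mmult (transport g A) (madj (transport g A) (map_mat g x)) (map_mat g x) = map_mat g (gram A x)"
    and gm: "map_mat g x \<in> mats (transport g A) n n"
    if x: "x \<in> mats A n n" for x
  proof -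
    have dx: "x \<in> carrier_mat n n" by (rule mats_carrier[OF x])
    show gm: "map_mat g x \<in> mats (transport g A) n n"
      by (rule matsI) (use dx matsD[OF x] in \<open>auto simp: transport_simps\<close>)
    interpret T: star_algebra "transport g A" by (rule transport_star_algebra)
    have fs: "finsum (transport g A) (\<lambda>c. g (f c)) I = g (finsum A f I)"
      if "finite I" "f \<in> I \<rightarrow> carrier A" for f and I :: "nat set"
      using that
    proof (induction I rule: finite_induct)
      case empty thus ?case by (simp add: transport_simps)
    next
      case (insert a F)
      have 1: "f a \<in> carrier A" "f \<in> F \<rightarrow> carrier A" using insert.prems by auto
      have 2: "(\<lambda>c. g (f c)) \<in> F \<rightarrow> carrier (transport g A)" "g (f a) \<in> carrier (transport g A)"
        using 1 by (auto simp: transport_simps)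
      show ?case
        using insert 1 2 by (simp add: T.M.finsum_insert M.finsum_insert transport_simps)
    qed
    show "mmult (transport g A) (madj (transport g A) (map_mat g x)) (map_mat g x) = map_mat g (gram A x)"
    proof (rule eq_matI)
      show "dim_row (mmult (transport g A) (madj (transport g A) (map_mat g x)) (map_mat g x)) = dim_row (map_mat g (gram A x))"
        "dim_col (mmult (transport g A) (madj (transport g A) (map_mat g x)) (map_mat g x)) = dim_col (map_mat g (gram A x))"
        by (simp_all add: mmult_def madj_def)
      fix a b assume "a < dim_row (map_mat g (gram A x))" "b < dim_col (map_mat g (gram A x))"
      hence ab: "a < n" "b < n" using dx by (simp_all add: mmult_def madj_def)
      have d: "dim_row (gram A x) = n" "dim_col (gram A x) = n"
        using dx by (simp_all add: mmult_def madj_def)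
      have xc: "x $$ (c,b) \<in> carrier A" if "c < n" "b < n" for b c using matsD[OF x that] .
      have "mmult (transport g A) (madj (transport g A) (map_mat g x)) (map_mat g x) $$ (a,b)
        = finsum (transport g A) (\<lambda>c. adj (transport g A) (map_mat g x $$ (c,a)) \<otimes>\<^bsub>transport g A\<^esub> map_mat g x $$ (c,b)) {..<n}"
        by (rule mmult_madj_entry(1)[OF transport_star_algebra gm ab])
      also have "\<dots> = finsum (transport g A) (\<lambda>c. g (adj A (x $$ (c,a)) \<otimes>\<^bsub>A\<^esub> x $$ (c,b))) {..<n}"
        by (rule T.M.finsum_cong') (use dx ab xc in \<open>auto simp: transport_simps adj_closed\<close>)
      also have "\<dots> = g (finsum A (\<lambda>c. adj A (x $$ (c,a)) \<otimes>\<^bsub>A\<^esub> x $$ (c,b)) {..<n})"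
        by (rule fs) (use ab xc adj_closed in auto)
      also have "\<dots> = map_mat g (gram A x) $$ (a,b)"
        using ab d mmult_madj_entry(1)[OF A x ab] by simp
      finally show "mmult (transport g A) (madj (transport g A) (map_mat g x)) (map_mat g x) $$ (a,b)
        = map_mat g (gram A x) $$ (a,b)" .
    qed
  qed
  show ?thesis
  proof
    assume "Y \<in> mcone (cstar_opsys A) n"
    then obtain x where x: "x \<in> mats A n n" "Y = gram A x" by (auto simp: mcone_cstar)
    thus "map_mat g Y \<in> mcone (cstar_opsys (transport g A)) n"
      using eq[OF x(1)] gm[OF x(1)] by (force simp: mcone_cstar)
  next
    assume "map_mat g Y \<in> mcone (cstar_opsys (transport g A)) n"
    then obtain z where z: "z \<in> mats (transport g A) n n" "map_mat g Y = gram (transport g A) z"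
      by (auto simp: mcone_cstar)
    define x where "x = map_mat h z"
    have dz: "z \<in> carrier_mat n n" by (rule mats_carrier[OF z(1)])
    have zx: "h (z $$ (i,j)) \<in> carrier A \<and> g (h (z $$ (i,j))) = z $$ (i,j)" if "i < n" "j < n" for i j
      using matsD[OF z(1) that] by (auto simp: transport_simps transport_inv)
    have x: "x \<in> mats A n n" by (rule matsI) (use dz zx in \<open>auto simp: x_def\<close>)
    have "map_mat g x = z" by (rule eq_matI) (use dz zx in \<open>auto simp: x_def\<close>)
    hence e: "map_mat g Y = map_mat g (gram A x)" using z(2) eq[OF x] by simp
    have m: "gram A x \<in> mats A n n" by (rule mmult_madj_mats[OF A x])
    have "Y = gram A x"
    proof (rule eq_matI)
      fix i j assume "i < dim_row (gram A x)" "j < dim_col (gram A x)"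
      hence ij: "i < n" "j < n" using mats_carrier[OF m] by auto
      have "g (Y $$ (i,j)) = g (gram A x $$ (i,j))"
        using arg_cong[OF e, of "\<lambda>M. M $$ (i,j)"] ij mats_carrier[OF m] mats_carrier[OF Y] by simp
      thus "Y $$ (i,j) = gram A x $$ (i,j)"
        by (rule inj_onD[OF g]) (use matsD[OF Y ij] matsD[OF m ij] in auto)
    qed (use mats_carrier[OF m] mats_carrier[OF Y] in auto)
    thus "Y \<in> mcone (cstar_opsys A) n" using x by (auto simp: mcone_cstar)
  qed
qed

end

lemma transport_unital_cstar:
  assumes "star_algebra A" "inj_on g (carrier A)" "complete_cstar_norm A N"
  shows "unital_cstar_algebra (transport g A)"
  using transport_star_algebra[OF assms(1,2)] transport_cstar_norm[OF assms]
  by (auto simp: unital_cstar_algebra_def unital_cstar_algebra_axioms_def)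

section \<open>The operator norm of a matrix\<close>

definition mapply :: "nat \<Rightarrow> complex mat \<Rightarrow> (nat \<Rightarrow> complex) \<Rightarrow> nat \<Rightarrow> complex" where
  "mapply p x f i = (\<Sum>j<p. x $$ (i,j) * f j)"

definition norm_sq :: "nat \<Rightarrow> (nat \<Rightarrow> complex) \<Rightarrow> real" where
  "norm_sq p f = (\<Sum>i<p. (cmod (f i))\<^sup>2)"

definition op_norm :: "nat \<Rightarrow> complex mat \<Rightarrow> real" where
  "op_norm p x = Inf {c. 0 \<le> c \<and> (\<forall>f. norm_sq p (mapply p x f) \<le> c\<^sup>2 * norm_sq p f)}"

lemma norm_sq_nonneg[simp]: "0 \<le> norm_sq p f" by (simp add: norm_sq_def sum_nonneg)

lemma norm_sq_cong: "(\<And>i. i < p \<Longrightarrow> f i = g i) \<Longrightarrow> norm_sq p f = norm_sq p g"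
  by (simp add: norm_sq_def)

text \<open>
  The entries bound the operator norm, so the infimum that defines it is over a nonempty set.
\<close>

lemma op_norm_crude:
  "norm_sq p (mapply p x f) \<le> (real p * (\<Sum>i<p. \<Sum>j<p. cmod (x $$ (i,j))))\<^sup>2 * norm_sq p f"
proof -
  define S where "S = (\<Sum>i<p. \<Sum>j<p. cmod (x $$ (i,j)))"
  have xj: "cmod (x $$ (i,j)) \<le> S" if "i < p" "j < p" for i j
  proof -
    have "cmod (x $$ (i,j)) \<le> (\<Sum>j<p. cmod (x $$ (i,j)))"
      by (rule member_le_sum[of j "{..<p}" "\<lambda>j. cmod (x $$ (i,j))"]) (use that in auto)
    also have "\<dots> \<le> S" unfolding S_def
      by (rule member_le_sum[of i "{..<p}" "\<lambda>i. \<Sum>j<p. cmod (x $$ (i,j))"]) (use that in \<open>auto intro: sum_nonneg\<close>)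
    finally show ?thesis .
  qed
  have "norm_sq p (mapply p x f) \<le> (\<Sum>i<p. real p * (S\<^sup>2 * norm_sq p f))"
    unfolding norm_sq_def[of p "mapply p x f"]
  proof (rule sum_mono)
    fix i assume i: "i \<in> {..<p}"
    have "(cmod (mapply p x f i))\<^sup>2 \<le> real p * (\<Sum>j<p. (cmod (x $$ (i,j) * f j))\<^sup>2)"
      unfolding mapply_def by (rule sum_norm_squared_le)
    also have "(\<Sum>j<p. (cmod (x $$ (i,j) * f j))\<^sup>2) \<le> (\<Sum>j<p. S\<^sup>2 * (cmod (f j))\<^sup>2)"
      using i xj by (intro sum_mono) (auto simp: norm_mult power_mult_distrib intro!: mult_right_mono power_mono)
    also have "\<dots> = S\<^sup>2 * norm_sq p f" by (simp add: norm_sq_def sum_distrib_left)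
    finally show "(cmod (mapply p x f i))\<^sup>2 \<le> real p * (S\<^sup>2 * norm_sq p f)" by (simp add: mult_left_mono)
  qed
  thus ?thesis by (simp add: S_def power2_eq_square mult_ac)
qed

lemma op_norm_props:
  shows op_norm_nonneg: "0 \<le> op_norm p x" and op_norm_le: "norm_sq p (mapply p x f) \<le> (op_norm p x)\<^sup>2 * norm_sq p f"
proof -
  define T where "T = {c. 0 \<le> c \<and> (\<forall>f. norm_sq p (mapply p x f) \<le> c\<^sup>2 * norm_sq p f)}"
  have "real p * (\<Sum>i<p. \<Sum>j<p. cmod (x $$ (i,j))) \<in> T"
    unfolding T_def using op_norm_crude by (auto intro!: mult_nonneg_nonneg sum_nonneg)
  hence ne: "T \<noteq> {}" by blast
  have o: "op_norm p x = Inf T" by (simp add: op_norm_def T_def)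
  show o0: "0 \<le> op_norm p x" unfolding o by (rule cInf_greatest[OF ne]) (simp add: T_def)
  have k: "norm_sq p (mapply p x f) \<le> (op_norm p x + 1 / real (Suc n))\<^sup>2 * norm_sq p f" for n
  proof -
    have "\<exists>c\<in>T. c < op_norm p x + 1 / real (Suc n)" using cInf_lessD[OF ne, of "op_norm p x + 1 / real (Suc n)"] by (auto simp: o)
    then obtain c where c: "c \<in> T" "c < op_norm p x + 1 / real (Suc n)" by blast
    have "norm_sq p (mapply p x f) \<le> c\<^sup>2 * norm_sq p f" using c by (auto simp: T_def)
    also have "\<dots> \<le> (op_norm p x + 1 / real (Suc n))\<^sup>2 * norm_sq p f"
      using c by (intro mult_right_mono power_mono) (auto simp: T_def)
    finally show ?thesis .
  qed
  have "(\<lambda>n. (op_norm p x + 1 / real (Suc n))\<^sup>2 * norm_sq p f) \<longlonglongrightarrow> (op_norm p x + 0)\<^sup>2 * norm_sq p f"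
    by (intro tendsto_intros LIMSEQ_Suc[OF lim_1_over_n])
  from LIMSEQ_le_const[OF this] k show "norm_sq p (mapply p x f) \<le> (op_norm p x)\<^sup>2 * norm_sq p f" by auto
qed

lemma op_norm_least:
  assumes "0 \<le> c" "\<And>f. norm_sq p (mapply p x f) \<le> c\<^sup>2 * norm_sq p f" shows "op_norm p x \<le> c"
  unfolding op_norm_def by (rule cInf_lower) (use assms in \<open>auto intro!: bdd_belowI[of _ 0]\<close>)

lemma op_norm_le_crude: "op_norm p x \<le> real p * (\<Sum>i<p. \<Sum>j<p. cmod (x $$ (i,j)))"
  by (rule op_norm_least[OF _ op_norm_crude]) (auto intro!: mult_nonneg_nonneg sum_nonneg)

lemma op_norm_entry: assumes "i < p" "j < p" shows "cmod (x $$ (i,j)) \<le> op_norm p x"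
proof -
  define f where "f k = (if k = j then 1 else 0 :: complex)" for k
  have "mapply p x f i = (\<Sum>k<p. if k = j then x $$ (i,k) else 0)"
    unfolding mapply_def f_def by (intro sum.cong) auto
  hence m: "mapply p x f i = x $$ (i,j)" using assms by simp
  have "norm_sq p f = (\<Sum>k<p. if k = j then 1 else 0)"
    unfolding norm_sq_def f_def by (intro sum.cong) auto
  hence nf: "norm_sq p f = 1" using assms by simp
  have "(cmod (mapply p x f i))\<^sup>2 \<le> norm_sq p (mapply p x f)"
    unfolding norm_sq_def by (rule member_le_sum[of i "{..<p}" "\<lambda>i. (cmod (mapply p x f i))\<^sup>2"]) (use assms in auto)
  also have "\<dots> \<le> (op_norm p x)\<^sup>2" using op_norm_le[of p x f] by (simp add: nf)
  finally show ?thesis unfolding m by (rule power2_le_imp_le[OF _ op_norm_nonneg])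
qed

lemma norm_sq_add_le:
  assumes "norm_sq p a \<le> c1\<^sup>2 * S" "norm_sq p b \<le> c2\<^sup>2 * S" "0 < c1" "0 < c2"
  shows "norm_sq p (\<lambda>i. a i + b i) \<le> (c1 + c2)\<^sup>2 * S"
proof -
  have "norm_sq p (\<lambda>i. a i + b i) \<le> (\<Sum>i<p. (1 + c2 / c1) * (cmod (a i))\<^sup>2 + (1 + c1 / c2) * (cmod (b i))\<^sup>2)"
    unfolding norm_sq_def
  proof (rule sum_mono)
    fix i
    have "(cmod (a i + b i))\<^sup>2 \<le> (cmod (a i) + cmod (b i))\<^sup>2" by (intro power_mono norm_triangle_ineq) simp
    also have "\<dots> = (cmod (a i))\<^sup>2 + 2 * (cmod (a i) * cmod (b i)) + (cmod (b i))\<^sup>2"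
      by (simp add: power2_eq_square algebra_simps)
    also have "2 * (cmod (a i) * cmod (b i)) \<le> c2 / c1 * (cmod (a i))\<^sup>2 + (cmod (b i))\<^sup>2 / (c2 / c1)"
      using weighted_am_gm[of "c2 / c1" "cmod (a i)" "cmod (b i)"] assms(3,4) by simp
    finally show "(cmod (a i + b i))\<^sup>2 \<le> (1 + c2 / c1) * (cmod (a i))\<^sup>2 + (1 + c1 / c2) * (cmod (b i))\<^sup>2"
      by (simp add: algebra_simps)
  qed
  also have "\<dots> = (1 + c2 / c1) * norm_sq p a + (1 + c1 / c2) * norm_sq p b"
    by (simp add: norm_sq_def sum.distrib sum_distrib_left)
  also have "\<dots> \<le> (1 + c2 / c1) * (c1\<^sup>2 * S) + (1 + c1 / c2) * (c2\<^sup>2 * S)"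
    using assms by (intro add_mono mult_left_mono) auto
  also have "\<dots> = (c1 + c2)\<^sup>2 * S" using assms(3,4) by (simp add: field_simps power2_eq_square)
  finally show ?thesis .
qed

lemma mapply_mult:
  assumes "x \<in> carrier_mat p p" "y \<in> carrier_mat p p" "i < p"
  shows "mapply p (x * y) f i = mapply p x (mapply p y f) i"
proof -
  have "mapply p (x * y) f i = (\<Sum>j<p. \<Sum>w<p. x $$ (i,w) * (y $$ (w,j) * f j))"
    unfolding mapply_def
    by (intro sum.cong refl) (simp add: mat_times_index[OF assms(1,2,3)] sum_distrib_right mult.assoc del: index_mult_mat)
  also have "\<dots> = (\<Sum>w<p. \<Sum>j<p. x $$ (i,w) * (y $$ (w,j) * f j))" by (rule sum.swap)
  finally show ?thesis by (simp add: mapply_def sum_distrib_left)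
qed

lemma mapply_adjoint:
  assumes "x \<in> carrier_mat p p"
  shows "(\<Sum>i<p. cnj (g i) * mapply p (mat_adjoint x) f i) = cnj (\<Sum>i<p. cnj (f i) * mapply p x g i)"
proof -
  have "(\<Sum>i<p. cnj (g i) * mapply p (mat_adjoint x) f i) = (\<Sum>i<p. \<Sum>j<p. cnj (g i) * (cnj (x $$ (j,i)) * f j))"
    unfolding mapply_def sum_distrib_left by (intro sum.cong refl) (use assms in auto)
  also have "\<dots> = (\<Sum>j<p. \<Sum>i<p. cnj (g i) * (cnj (x $$ (j,i)) * f j))" by (rule sum.swap)
  also have "\<dots> = cnj (\<Sum>i<p. cnj (f i) * mapply p x g i)"
    unfolding mapply_def by (simp add: sum_distrib_left mult_ac)
  finally show ?thesis .
qed

lemma norm_sq_inner: "complex_of_real (norm_sq p f) = (\<Sum>i<p. cnj (f i) * f i)"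
  unfolding norm_sq_def by (simp add: cmod_sq mult.commute)

lemma op_norm_adjoint_le:
  assumes x: "x \<in> carrier_mat p p" shows "op_norm p (mat_adjoint x) \<le> op_norm p x"
proof (rule op_norm_least[OF op_norm_nonneg])
  fix f
  define hh where "hh = mapply p (mat_adjoint x) f"
  have "complex_of_real (norm_sq p hh) = (\<Sum>i<p. cnj (hh i) * mapply p (mat_adjoint x) f i)"
    unfolding norm_sq_inner by (simp add: hh_def)
  also have "\<dots> = cnj (\<Sum>i<p. cnj (f i) * mapply p x hh i)" by (rule mapply_adjoint[OF x])
  finally have "cmod (complex_of_real (norm_sq p hh)) = cmod (cnj (\<Sum>i<p. cnj (f i) * mapply p x hh i))" by (rule arg_cong)
  also have "\<dots> = cmod (\<Sum>i<p. cnj (f i) * mapply p x hh i)" by (rule complex_mod_cnj)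
  finally have e: "norm_sq p hh = cmod (\<Sum>i<p. cnj (f i) * mapply p x hh i)" by simp
  show "norm_sq p (mapply p (mat_adjoint x) f) \<le> (op_norm p x)\<^sup>2 * norm_sq p f"
  proof (cases "op_norm p x = 0")
    case True
    have "x $$ (i,j) = 0" if "i < p" "j < p" for i j using op_norm_entry[OF that, of x] True by simp
    hence "mapply p x hh i = 0" if "i < p" for i using that by (simp add: mapply_def)
    hence "norm_sq p hh = 0" using e by simp
    thus ?thesis by (simp add: hh_def)
  next
    case False
    define N where "N = op_norm p x"
    have N: "N > 0" using False op_norm_nonneg[of p x] by (simp add: N_def)
    have "norm_sq p hh \<le> (\<Sum>i<p. cmod (f i) * cmod (mapply p x hh i))"
      unfolding e by (rule order_trans[OF norm_sum]) (simp add: norm_mult)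
    also have "\<dots> \<le> (\<Sum>i<p. (N\<^sup>2 * (cmod (f i))\<^sup>2 + (cmod (mapply p x hh i))\<^sup>2 / N\<^sup>2) / 2)"
      by (intro sum_mono weighted_am_gm) (use N in simp)
    also have "\<dots> = (N\<^sup>2 * norm_sq p f + norm_sq p (mapply p x hh) / N\<^sup>2) / 2"
      by (simp add: norm_sq_def sum.distrib sum_distrib_left flip: sum_divide_distrib)
    also have "norm_sq p (mapply p x hh) / N\<^sup>2 \<le> norm_sq p hh"
      using op_norm_le[of p x hh] N by (simp add: N_def field_simps)
    finally show ?thesis by (simp add: hh_def N_def)
  qed
qed

lemma mat_alg_minus:
  assumes "x \<in> carrier_mat p p" "y \<in> carrier_mat p p"
  shows "x \<ominus>\<^bsub>mat_alg p\<^esub> y = x - y"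
proof -
  interpret ring "mat_alg p" by (rule mat_alg_ring)
  have "\<ominus>\<^bsub>mat_alg p\<^esub> y = - y"
    by (rule minus_equality) (use assms in \<open>auto simp: mat_alg_simps\<close>)
  thus ?thesis using assms by (auto simp: a_minus_def mat_alg_simps)
qed

text \<open>
  The C*-identity comes from \<open>norm_sq p (x f) = \<langle>x\<^sup>* x f, f\<rangle>\<close>. For completeness, the norm dominates the
  entries and is dominated by a multiple of the sum of their moduli, so a Cauchy sequence converges entrywise and hence in norm.
\<close>

lemma op_norm_cstar_norm: "complete_cstar_norm (mat_alg p) (op_norm p)"
  unfolding complete_cstar_norm_def mat_alg_simps
proof (intro conjI ballI allI impI)
  show "0 \<le> op_norm p x" for x by (rule op_norm_nonneg)
next
  fix x :: "complex mat" assume x: "x \<in> carrier_mat p p"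
  show "(op_norm p x = 0) = (x = 0\<^sub>m p p)"
  proof
    assume "op_norm p x = 0"
    hence "x $$ (i,j) = 0" if "i < p" "j < p" for i j using op_norm_entry[OF that, of x] by simp
    thus "x = 0\<^sub>m p p" using x by (intro eq_matI) auto
  next
    assume "x = 0\<^sub>m p p"
    hence "op_norm p x \<le> 0" using op_norm_le_crude[of p x] by simp
    thus "op_norm p x = 0" using op_norm_nonneg[of p x] by simp
  qed
next
  fix c and x :: "complex mat" assume x: "x \<in> carrier_mat p p"
  have sc: "norm_sq p (mapply p (c \<cdot>\<^sub>m x) f) = (cmod c)\<^sup>2 * norm_sq p (mapply p x f)" if "x \<in> carrier_mat p p" for c x f
  proof -
    have "mapply p (c \<cdot>\<^sub>m x) f i = c * mapply p x f i" if "i < p" for i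
      using that \<open>x \<in> carrier_mat p p\<close> by (auto simp: mapply_def sum_distrib_left mult.assoc intro!: sum.cong)
    thus ?thesis unfolding norm_sq_def by (simp add: norm_mult power_mult_distrib sum_distrib_left)
  qed
  have le: "op_norm p (c \<cdot>\<^sub>m x) \<le> cmod c * op_norm p x" if "x \<in> carrier_mat p p" for c x
  proof (rule op_norm_least)
    fix f
    show "norm_sq p (mapply p (c \<cdot>\<^sub>m x) f) \<le> (cmod c * op_norm p x)\<^sup>2 * norm_sq p f"
      unfolding sc[OF that] power_mult_distrib mult.assoc
      by (rule mult_left_mono[OF op_norm_le]) simp
  qed (simp add: op_norm_nonneg)
  show "op_norm p (c \<cdot>\<^sub>m x) = cmod c * op_norm p x"
  proof (cases "c = 0")
    case True
    thus ?thesis using le[OF x, of c] op_norm_nonneg[of p "c \<cdot>\<^sub>m x"] by simp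
  next
    case False
    have "(1 / c) \<cdot>\<^sub>m (c \<cdot>\<^sub>m x) = x" using x False by (auto intro!: eq_matI)
    hence "op_norm p x \<le> cmod (1 / c) * op_norm p (c \<cdot>\<^sub>m x)" using le[of "c \<cdot>\<^sub>m x" "1 / c"] x by simp
    hence "cmod c * op_norm p x \<le> op_norm p (c \<cdot>\<^sub>m x)" using False by (simp add: norm_divide field_simps)
    thus ?thesis using le[OF x, of c] by simp
  qed
next
  fix x y :: "complex mat" assume xy: "x \<in> carrier_mat p p" "y \<in> carrier_mat p p"
  have ap: "norm_sq p (mapply p (x + y) f) = norm_sq p (\<lambda>i. mapply p x f i + mapply p y f i)" for f
    by (rule norm_sq_cong) (use xy in \<open>simp add: mapply_def distrib_right sum.distrib\<close>)
  show "op_norm p (x + y) \<le> op_norm p x + op_norm p y"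
  proof (rule field_le_epsilon)
    fix \<epsilon> :: real assume e: "\<epsilon> > 0"
    have pos: "op_norm p x + \<epsilon> / 2 > 0" "op_norm p y + \<epsilon> / 2 > 0"
      using e op_norm_nonneg[of p x] op_norm_nonneg[of p y] by linarith+
    have le: "norm_sq p (mapply p z f) \<le> (op_norm p z + \<epsilon> / 2)\<^sup>2 * norm_sq p f" for z f
      by (rule order_trans[OF op_norm_le], intro mult_right_mono power_mono) (use e in \<open>auto simp: op_norm_nonneg\<close>)
    have "op_norm p (x + y) \<le> (op_norm p x + \<epsilon> / 2) + (op_norm p y + \<epsilon> / 2)"
      by (rule op_norm_least) (use pos norm_sq_add_le[OF le le pos] in \<open>auto simp: ap\<close>)
    thus "op_norm p (x + y) \<le> op_norm p x + op_norm p y + \<epsilon>" by simp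
  qed
next
  have ml: "op_norm p (x * y) \<le> op_norm p x * op_norm p y" if xy: "x \<in> carrier_mat p p" "y \<in> carrier_mat p p" for x y
  proof (rule op_norm_least)
    fix f
    have "norm_sq p (mapply p (x * y) f) = norm_sq p (mapply p x (mapply p y f))"
      by (rule norm_sq_cong) (rule mapply_mult[OF xy])
    also have "\<dots> \<le> (op_norm p x)\<^sup>2 * norm_sq p (mapply p y f)" by (rule op_norm_le)
    also have "\<dots> \<le> (op_norm p x)\<^sup>2 * ((op_norm p y)\<^sup>2 * norm_sq p f)" by (intro mult_left_mono op_norm_le) simp
    finally show "norm_sq p (mapply p (x * y) f) \<le> (op_norm p x * op_norm p y)\<^sup>2 * norm_sq p f"
      by (simp add: power_mult_distrib)
  qed (simp add: op_norm_nonneg)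
  show "op_norm p (x * y) \<le> op_norm p x * op_norm p y" if "x \<in> carrier_mat p p" "y \<in> carrier_mat p p" for x y by (rule ml[OF that])
  fix x :: "complex mat" assume x: "x \<in> carrier_mat p p"
  have "op_norm p (mat_adjoint x * x) \<le> op_norm p (mat_adjoint x) * op_norm p x" by (rule ml) (use x in auto)
  also have "\<dots> \<le> op_norm p x * op_norm p x" by (intro mult_right_mono op_norm_adjoint_le x op_norm_nonneg)
  finally have 1: "op_norm p (mat_adjoint x * x) \<le> (op_norm p x)\<^sup>2" by (simp add: power2_eq_square)
  define N where "N = op_norm p (mat_adjoint x * x)"
  have N0: "N \<ge> 0" by (simp add: N_def op_norm_nonneg)
  have "op_norm p x \<le> sqrt N"
  proof (rule op_norm_least)
    fix f
    have "complex_of_real (norm_sq p (mapply p x f)) = (\<Sum>i<p. cnj (mapply p x f i) * mapply p x f i)" by (rule norm_sq_inner)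
    also have "\<dots> = cnj (\<Sum>i<p. cnj (f i) * mapply p (mat_adjoint x) (mapply p x f) i)"
      using mapply_adjoint[OF x, of f "mapply p x f"] by simp
    also have "(\<Sum>i<p. cnj (f i) * mapply p (mat_adjoint x) (mapply p x f) i) = (\<Sum>i<p. cnj (f i) * mapply p (mat_adjoint x * x) f i)"
      by (intro sum.cong refl) (use x in \<open>simp add: mapply_mult[of "mat_adjoint x" p x]\<close>)
    finally have "cmod (complex_of_real (norm_sq p (mapply p x f))) = cmod (cnj (\<Sum>i<p. cnj (f i) * mapply p (mat_adjoint x * x) f i))" by (rule arg_cong)
    also have "\<dots> = cmod (\<Sum>i<p. cnj (f i) * mapply p (mat_adjoint x * x) f i)" by (rule complex_mod_cnj)
    finally have "norm_sq p (mapply p x f) = cmod (\<Sum>i<p. cnj (f i) * mapply p (mat_adjoint x * x) f i)" by simp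
    also have "\<dots> \<le> N * norm_sq p f"
    proof (rule field_le_epsilon)
      fix \<epsilon> :: real assume e: "\<epsilon> > 0"
      define t where "t = N + \<epsilon> / (norm_sq p f + 1)"
      have t: "t > 0" "N \<le> t" unfolding t_def using e N0 by (auto intro!: add_nonneg_pos divide_pos_pos add_nonneg_pos)
      have "cmod (\<Sum>i<p. cnj (f i) * mapply p (mat_adjoint x * x) f i) \<le> t * (\<Sum>i<p. (cmod (f i))\<^sup>2)"
      proof (rule norm_pairing_le[OF t(1)])
        have "norm_sq p (mapply p (mat_adjoint x * x) f) \<le> t\<^sup>2 * norm_sq p f"
          by (rule order_trans[OF op_norm_le], intro mult_right_mono power_mono) (use t N0 in \<open>auto simp: N_def\<close>)
        thus "(\<Sum>i<p. (cmod (mapply p (mat_adjoint x * x) f i))\<^sup>2) \<le> t\<^sup>2 * (\<Sum>i<p. (cmod (f i))\<^sup>2)" by (simp add: norm_sq_def)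
      qed
      also have "\<dots> = N * norm_sq p f + \<epsilon> * (norm_sq p f / (norm_sq p f + 1))" by (simp add: t_def norm_sq_def algebra_simps)
      also have "\<epsilon> * (norm_sq p f / (norm_sq p f + 1)) \<le> \<epsilon> * 1"
        using e by (intro mult_left_mono) (auto simp: divide_le_eq_1 add_nonneg_pos)
      finally show "cmod (\<Sum>i<p. cnj (f i) * mapply p (mat_adjoint x * x) f i) \<le> N * norm_sq p f + \<epsilon>" by simp
    qed
    finally show "norm_sq p (mapply p x f) \<le> (sqrt N)\<^sup>2 * norm_sq p f" using N0 by simp
  qed (simp add: N0)
  hence "(op_norm p x)\<^sup>2 \<le> (sqrt N)\<^sup>2" by (intro power_mono op_norm_nonneg)
  thus "op_norm p (mat_adjoint x * x) = (op_norm p x)\<^sup>2" using 1 N0 by (simp add: N_def)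
next
  fix s assume s: "(\<forall>n::nat. s n \<in> carrier_mat p p) \<and> (\<forall>e>0. \<exists>M. \<forall>m\<ge>M. \<forall>n\<ge>M. op_norm p (s m \<ominus>\<^bsub>mat_alg p\<^esub> s n) < e)"
  hence sc: "s n \<in> carrier_mat p p" for n by blast
  have "\<exists>l. (\<lambda>n. s n $$ (i,j)) \<longlonglongrightarrow> l" if ij: "i < p" "j < p" for i j
  proof -
    have "Cauchy (\<lambda>n. s n $$ (i,j))"
    proof (rule CauchyI)
      fix e :: real assume "e > 0"
      then obtain M where M: "\<forall>m\<ge>M. \<forall>n\<ge>M. op_norm p (s m \<ominus>\<^bsub>mat_alg p\<^esub> s n) < e" using s by blast
      have "cmod (s m $$ (i,j) - s n $$ (i,j)) < e" if "m \<ge> M" "n \<ge> M" for m n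
      proof -
        have "cmod ((s m - s n) $$ (i,j)) \<le> op_norm p (s m - s n)" by (rule op_norm_entry[OF ij])
        also have "\<dots> < e" using M that by (simp add: mat_alg_minus[OF sc sc])
        finally show ?thesis using sc[of m] sc[of n] ij by auto
      qed
      thus "\<exists>M. \<forall>m\<ge>M. \<forall>n\<ge>M. cmod (s m $$ (i,j) - s n $$ (i,j)) < e" by blast
    qed
    thus ?thesis by (simp add: Cauchy_convergent_iff convergent_def)
  qed
  hence "\<forall>i j. \<exists>l. i < p \<and> j < p \<longrightarrow> (\<lambda>n. s n $$ (i,j)) \<longlonglongrightarrow> l" by blast
  then obtain l where l: "\<And>i j. i < p \<Longrightarrow> j < p \<Longrightarrow> (\<lambda>n. s n $$ (i,j)) \<longlonglongrightarrow> l i j" by metis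
  define L where "L = mat p p (\<lambda>(i,j). l i j)"
  have L: "L \<in> carrier_mat p p" by (simp add: L_def)
  have "(\<lambda>n. op_norm p (s n \<ominus>\<^bsub>mat_alg p\<^esub> L)) \<longlonglongrightarrow> 0"
  proof (rule tendsto_sandwich)
    show "\<forall>\<^sub>F n in sequentially. 0 \<le> op_norm p (s n \<ominus>\<^bsub>mat_alg p\<^esub> L)" by (simp add: op_norm_nonneg)
    show "\<forall>\<^sub>F n in sequentially. op_norm p (s n \<ominus>\<^bsub>mat_alg p\<^esub> L) \<le> real p * (\<Sum>i<p. \<Sum>j<p. cmod (s n $$ (i,j) - l i j))"
    proof (intro always_eventually allI)
      fix n
      have "op_norm p (s n - L) \<le> real p * (\<Sum>i<p. \<Sum>j<p. cmod ((s n - L) $$ (i,j)))" by (rule op_norm_le_crude)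
      also have "(\<Sum>i<p. \<Sum>j<p. cmod ((s n - L) $$ (i,j))) = (\<Sum>i<p. \<Sum>j<p. cmod (s n $$ (i,j) - l i j))"
        using sc[of n] by (intro sum.cong refl) (auto simp: L_def)
      finally show "op_norm p (s n \<ominus>\<^bsub>mat_alg p\<^esub> L) \<le> real p * (\<Sum>i<p. \<Sum>j<p. cmod (s n $$ (i,j) - l i j))"
        by (simp add: mat_alg_minus[OF sc L])
    qed
    have "(\<lambda>n. real p * (\<Sum>i<p. \<Sum>j<p. cmod (s n $$ (i,j) - l i j))) \<longlonglongrightarrow> real p * (\<Sum>i<p. \<Sum>j<p. cmod (l i j - l i j))"
      by (intro tendsto_intros l) auto
    thus "(\<lambda>n. real p * (\<Sum>i<p. \<Sum>j<p. cmod (s n $$ (i,j) - l i j))) \<longlonglongrightarrow> 0" by simp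
  qed simp
  thus "\<exists>l\<in>carrier_mat p p. (\<lambda>n. op_norm p (s n \<ominus>\<^bsub>mat_alg p\<^esub> l)) \<longlonglongrightarrow> 0" using L by blast
qed

section \<open>Matrices embed into the reals\<close>

text \<open>
  The carrier of a matrix algebra has the cardinality of the continuum, so it fits into the reals.
\<close>

lemma inj_real_pairs: "\<exists>f :: real \<times> real \<Rightarrow> real. inj f"
proof -
  have "\<not> finite (UNIV :: real set)" by (rule infinite_UNIV_char_0)
  from card_of_Times_same_infinite[OF this, folded card_of_ordIso]
  obtain f :: "real \<times> real \<Rightarrow> real" where "bij_betw f (UNIV \<times> UNIV) UNIV" by blast
  thus ?thesis by (auto simp: bij_betw_def)
qed

lemma inj_real_lists: "\<exists>f :: real list \<Rightarrow> real. \<forall>n. inj_on f {xs. length xs = n}"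
proof -
  obtain g :: "real \<times> real \<Rightarrow> real" where g: "inj g" using inj_real_pairs by blast
  define f where "f = rec_list 0 (\<lambda>x _ r. g (x, r))"
  have fs: "f [] = 0" "f (x # xs) = g (x, f xs)" for x xs by (simp_all add: f_def)
  have "xs = ys" if "length xs = length ys" "f xs = f ys" for xs ys
    using that by (induction xs ys rule: list_induct2) (auto simp: fs dest: injD[OF g])
  thus ?thesis by (intro exI[of _ f] allI inj_onI) auto
qed

lemma matrices_embed_in_reals: "\<exists>g :: complex mat \<Rightarrow> real. inj_on g (carrier_mat p p)"
proof -
  obtain f :: "real list \<Rightarrow> real" where f: "\<And>n. inj_on f {xs. length xs = n}" using inj_real_lists by blast
  (* real and imaginary parts of the entries, listed row by row *)
  define enc where "enc x = map (\<lambda>k. let i = k div 2 div p; j = k div 2 mod p in if even k then Re (x $$ (i,j)) else Im (x $$ (i,j))) [0..<p * p * 2]" for x :: "complex mat"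
  have len: "length (enc x) = p * p * 2" for x by (simp add: enc_def)
  have "x = y" if xy: "x \<in> carrier_mat p p" "y \<in> carrier_mat p p" "f (enc x) = f (enc y)" for x y
  proof -
    have e: "enc x = enc y" using inj_onD[OF f[of "p * p * 2"] xy(3)] len by simp
    have "x $$ (i,j) = y $$ (i,j)" if ij: "i < p" "j < p" for i j
    proof -
      have "i * p + j < (i + 1) * p" using ij by simp
      also have "\<dots> \<le> p * p" using ij by (intro mult_le_mono1) simp
      finally have k: "i * p + j < p * p" .
      have d: "(i * p + j) div p = i" "(i * p + j) mod p = j" using ij by simp_all
      have r: "enc z ! (2 * (i * p + j)) = Re (z $$ (i,j))" "enc z ! (2 * (i * p + j) + 1) = Im (z $$ (i,j))" for z
        using k d by (simp_all add: enc_def Let_def)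
      show ?thesis using r[of x] r[of y] e by (simp add: complex_eq_iff)
    qed
    thus ?thesis using xy by (intro eq_matI) auto
  qed
  thus ?thesis by (intro exI[of _ "\<lambda>x. f (enc x)"] inj_onI)
qed

lemma matrix_copy_exists:
  "\<exists>g :: complex mat \<Rightarrow> 'u + real. inj_on g (carrier (mat_alg p)) \<and> unital_cstar_algebra (transport g (mat_alg p))"
proof -
  obtain g :: "complex mat \<Rightarrow> real" where g: "inj_on g (carrier_mat p p)" using matrices_embed_in_reals by blast
  have i: "inj_on (\<lambda>x. Inr (g x) :: 'u + real) (carrier (mat_alg p))"
    using g by (auto simp: inj_on_def mat_alg_simps)
  show ?thesis
    using i transport_unital_cstar[OF mat_alg_star_algebra i op_norm_cstar_norm] by blast
qed

section \<open>Abstract operator systems in coordinates\<close>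

lemma cstar_abelian_group: "abelian_group A \<Longrightarrow> abelian_group (cstar_opsys A)"
proof -
  assume "abelian_group A"
  then interpret abelian_group A .
  show ?thesis
  proof (rule abelian_groupI)
    fix x assume "x \<in> carrier (cstar_opsys A)"
    thus "\<exists>y\<in>carrier (cstar_opsys A). y \<oplus>\<^bsub>cstar_opsys A\<^esub> x = \<zero>\<^bsub>cstar_opsys A\<^esub>"
      by (intro bexI[of _ "\<ominus>\<^bsub>A\<^esub> x"]) (auto simp: cstar_simps l_neg)
  qed (auto simp: cstar_simps a_ac)
qed

lemma cstar_vectorspace:
  assumes "star_vector_space A" shows "vectorspace class_ring (cstar_opsys A)"
proof -
  interpret star_vector_space A by (rule assms)
  show ?thesis
    by (rule vectorspace_class_ringI[OF cstar_abelian_group[OF M.abelian_group_axioms]])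
      (auto simp: cstar_simps smul_add_left smul_add_right smul_mult smul_one)
qed

lemma linear_mapI:
  assumes "vectorspace class_ring V" "vectorspace class_ring W"
    and "\<And>x. x \<in> carrier V \<Longrightarrow> f x \<in> carrier W"
    and "\<And>x y. x \<in> carrier V \<Longrightarrow> y \<in> carrier V \<Longrightarrow> f (x \<oplus>\<^bsub>V\<^esub> y) = f x \<oplus>\<^bsub>W\<^esub> f y"
    and "\<And>c x. x \<in> carrier V \<Longrightarrow> f (c \<odot>\<^bsub>V\<^esub> x) = c \<odot>\<^bsub>W\<^esub> f x"
  shows "linear_map (class_ring :: complex ring) V W f"
proof -
  interpret V: vectorspace class_ring V by fact
  interpret W: vectorspace class_ring W by fact
  show ?thesis by unfold_locales (use assms(3-5) in \<open>auto simp: module_hom_def\<close>)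
qed

lemma linear_mapD:
  assumes "linear_map (class_ring :: complex ring) V W f"
  shows "\<And>x. x \<in> carrier V \<Longrightarrow> f x \<in> carrier W"
    and "\<And>x y. x \<in> carrier V \<Longrightarrow> y \<in> carrier V \<Longrightarrow> f (x \<oplus>\<^bsub>V\<^esub> y) = f x \<oplus>\<^bsub>W\<^esub> f y"
    and "\<And>c x. x \<in> carrier V \<Longrightarrow> f (c \<odot>\<^bsub>V\<^esub> x) = c \<odot>\<^bsub>W\<^esub> f x"
proof -
  interpret linear_map class_ring V W f by fact
  show "\<And>x. x \<in> carrier V \<Longrightarrow> f x \<in> carrier W" by simp
  show "\<And>x y. x \<in> carrier V \<Longrightarrow> y \<in> carrier V \<Longrightarrow> f (x \<oplus>\<^bsub>V\<^esub> y) = f x \<oplus>\<^bsub>W\<^esub> f y" by simp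
  show "\<And>c x. x \<in> carrier V \<Longrightarrow> f (c \<odot>\<^bsub>V\<^esub> x) = c \<odot>\<^bsub>W\<^esub> f x" using f_smult by simp
qed

text \<open>
  \<open>(r x; x\<^sup>* r)\<close>, the matrix whose positivity says \<open>\<parallel>x\<parallel> \<le> r\<close>. The involution \<open>st\<close> is a parameter in
  order to compare these matrices along maps between different systems.
\<close>

definition block :: "(complex, 'a, 'm) module_scheme \<Rightarrow> ('a \<Rightarrow> 'a) \<Rightarrow> real \<Rightarrow> 'a mat \<Rightarrow> 'a mat" where
  "block X st r x = four_block_mat (msmult X (of_real r) (munit X (dim_row x))) x
     (mat (dim_col x) (dim_row x) (\<lambda>(i, j). st (x $$ (j, i)))) (msmult X (of_real r) (munit X (dim_row x)))"

lemma mnorm_block: "mnorm X x = Inf {r. 0 \<le> r \<and> block X (adj X) r x \<in> mcone X (dim_row x + dim_row x)}"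
  by (simp add: mnorm_def block_def Let_def madj_def)

lemma block_index:
  assumes "x \<in> carrier_mat n n" "i < n + n" "j < n + n"
  shows "block X st r x $$ (i,j) =
    (if i < n then (if j < n then of_real r \<odot>\<^bsub>X\<^esub> (if i = j then \<one>\<^bsub>X\<^esub> else \<zero>\<^bsub>X\<^esub>) else x $$ (i, j - n))
     else (if j < n then st (x $$ (j, i - n)) else of_real r \<odot>\<^bsub>X\<^esub> (if i = j then \<one>\<^bsub>X\<^esub> else \<zero>\<^bsub>X\<^esub>)))"
  using assms by (auto simp: block_def msmult_def munit_def four_block_mat_def Let_def)

lemma block_carrier: "x \<in> carrier_mat n n \<Longrightarrow> block X st r x \<in> carrier_mat (n + n) (n + n)"
  unfolding block_def four_block_mat_def Let_def by (auto simp: msmult_def munit_def)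

text \<open>
  An abstract operator system \<open>X\<close> with chosen hermitian coordinates; the sublocale \<open>K\<close> below is its description
  by coordinate arrays.
\<close>

locale coord_operator_system = operator_system X for X :: "'a op_system" +
  fixes d :: nat and co :: "'a \<Rightarrow> nat \<Rightarrow> complex" and cb :: "(nat \<Rightarrow> complex) \<Rightarrow> 'a"
  assumes coords: "coordinates d co cb"
begin

lemma cb_closed[simp]: "cb c \<in> carrier X"
  and co_cb[simp]: "l < d \<Longrightarrow> co (cb c) l = c l"
  and co_inj: "x \<in> carrier X \<Longrightarrow> y \<in> carrier X \<Longrightarrow> (\<And>l. l < d \<Longrightarrow> co x l = co y l) \<Longrightarrow> x = y"
  and co_add[simp]: "x \<in> carrier X \<Longrightarrow> y \<in> carrier X \<Longrightarrow> l < d \<Longrightarrow> co (x \<oplus>\<^bsub>X\<^esub> y) l = co x l + co y l"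
  and co_smult[simp]: "x \<in> carrier X \<Longrightarrow> l < d \<Longrightarrow> co (z \<odot>\<^bsub>X\<^esub> x) l = z * co x l"
  and co_adj[simp]: "x \<in> carrier X \<Longrightarrow> l < d \<Longrightarrow> co (adj X x) l = cnj (co x l)"
  using coords unfolding coordinates_def by blast+

lemma co_zero[simp]: "l < d \<Longrightarrow> co \<zero>\<^bsub>X\<^esub> l = 0"
  using co_smult[of "\<zero>\<^bsub>X\<^esub>" l 0] smul_zero[of "\<zero>\<^bsub>X\<^esub>"] by simp

lemma co_finsum:
  "finite I \<Longrightarrow> f \<in> I \<rightarrow> carrier X \<Longrightarrow> l < d \<Longrightarrow> co (finsum X f I) l = (\<Sum>i\<in>I. co (f i) l)"
proof (induction I rule: finite_induct)
  case (insert x F)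
  hence 1: "f x \<in> carrier X" "f \<in> F \<rightarrow> carrier X" by auto
  show ?case using insert 1 by (simp add: M.finsum_insert)
qed simp

definition mat_of :: "nat \<Rightarrow> arr \<Rightarrow> 'a mat" where "mat_of n A = mat n n (\<lambda>(i,j). cb (A i j))"
definition arr_of :: "'a mat \<Rightarrow> arr" where "arr_of x = (\<lambda>i j l. co (x $$ (i,j)) l)"
definition unit_co :: "nat \<Rightarrow> complex" where "unit_co l = co \<one>\<^bsub>X\<^esub> l"
definition cone_co :: "nat \<Rightarrow> arr set" where "cone_co n = {A. mat_of n A \<in> mcone X n}"

lemma mat_of_mats[simp]: "mat_of n A \<in> mats X n n"
  by (rule matsI) (auto simp: mat_of_def)

lemma mat_of_eqI:
  assumes "x \<in> mats X n n" "\<And>i j l. i < n \<Longrightarrow> j < n \<Longrightarrow> l < d \<Longrightarrow> co (x $$ (i,j)) l = A i j l"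
  shows "x = mat_of n A"
  by (rule eq_matI) (use assms mats_carrier[OF assms(1)] matsD[OF assms(1)] in \<open>auto simp: mat_of_def intro: co_inj\<close>)

lemma mat_of_arr_of: "x \<in> mats X n n \<Longrightarrow> mat_of n (arr_of x) = x"
  by (rule mat_of_eqI[symmetric]) (simp_all add: arr_of_def)

lemma mat_of_index: "i < n \<Longrightarrow> j < n \<Longrightarrow> mat_of n A $$ (i,j) = cb (A i j)"
  by (simp add: mat_of_def)

lemma mat_of_dim[simp]: "dim_row (mat_of n A) = n" "dim_col (mat_of n A) = n"
  by (simp_all add: mat_of_def)

lemma mcone_iff: "x \<in> mcone X n \<longleftrightarrow> x \<in> mats X n n \<and> arr_of x \<in> cone_co n"
  using cone_mats mat_of_arr_of by (auto simp: cone_co_def subset_iff)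

lemma madd_mat_of: "madd X (mat_of n A) (mat_of n B) = mat_of n (\<lambda>i j l. A i j l + B i j l)"
  by (rule mat_of_eqI) (auto simp: madd_def mat_of_index intro!: matsI)

lemma msmult_mat_of: "msmult X c (mat_of n A) = mat_of n (\<lambda>i j l. c * A i j l)"
  by (rule mat_of_eqI) (auto simp: msmult_def mat_of_index intro!: matsI)

lemma madj_mat_of: "madj X (mat_of n A) = mat_of n (\<lambda>i j l. cnj (A j i l))"
  by (rule mat_of_eqI) (auto simp: madj_def mat_of_index adj_closed intro!: matsI)

lemma munit_mat_of: "munit X n = mat_of n (\<lambda>i j l. if i = j then unit_co l else 0)"
  by (rule mat_of_eqI) (auto simp: munit_def unit_co_def unit_closed intro!: matsI)

lemma mzero_mat_of: "mzero X n = mat_of n (\<lambda>i j l. 0)"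
  by (rule mat_of_eqI) (auto simp: mzero_def intro!: matsI)

lemma mconj_mat_of:
  assumes "\<alpha> \<in> carrier_mat m n"
  shows "mconj X \<alpha> (mat_of n A) = mat_of m (\<lambda>i j l. \<Sum>a<n. \<Sum>b<n. \<alpha> $$ (i,a) * cnj (\<alpha> $$ (j,b)) * A a b l)"
proof (rule mat_of_eqI)
  have e: "mconj X \<alpha> (mat_of n A) $$ (i,j) =
     finsum X (\<lambda>a. finsum X (\<lambda>b. (\<alpha> $$ (i,a) * cnj (\<alpha> $$ (j,b))) \<odot>\<^bsub>X\<^esub> cb (A a b)) {..<n}) {..<n}"
    if "i < m" "j < m" for i j
  proof -
    have "mconj X \<alpha> (mat_of n A) $$ (i,j) =
       finsum X (\<lambda>a. finsum X (\<lambda>b. (\<alpha> $$ (i,a) * cnj (\<alpha> $$ (j,b))) \<odot>\<^bsub>X\<^esub> mat_of n A $$ (a,b)) {..<n}) {..<n}"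
      using that assms by (simp add: mconj_def)
    also have "\<dots> = finsum X (\<lambda>a. finsum X (\<lambda>b. (\<alpha> $$ (i,a) * cnj (\<alpha> $$ (j,b))) \<odot>\<^bsub>X\<^esub> cb (A a b)) {..<n}) {..<n}"
      by (intro M.finsum_cong' refl) (auto simp: mat_of_index intro!: M.finsum_closed)
    finally show ?thesis .
  qed
  show "mconj X \<alpha> (mat_of n A) \<in> mats X m m"
  proof (rule matsI)
    show "mconj X \<alpha> (mat_of n A) \<in> carrier_mat m m" using assms by (simp add: mconj_def)
    show "mconj X \<alpha> (mat_of n A) $$ (i,j) \<in> carrier X" if "i < m" "j < m" for i j
      unfolding e[OF that] by (auto intro!: M.finsum_closed)
  qed
  fix i j l assume ij: "i < m" "j < m" "l < d"
  show "co (mconj X \<alpha> (mat_of n A) $$ (i,j)) l = (\<Sum>a<n. \<Sum>b<n. \<alpha> $$ (i,a) * cnj (\<alpha> $$ (j,b)) * A a b l)"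
    unfolding e[OF ij(1,2)] using ij(3)
    by (subst co_finsum, auto intro!: M.finsum_closed sum.cong) (subst co_finsum, auto)
qed

lemma mat_of_cong:
  assumes "\<And>i j l. i < n \<Longrightarrow> j < n \<Longrightarrow> l < d \<Longrightarrow> A i j l = B i j l" shows "mat_of n A = mat_of n B"
  by (rule mat_of_eqI) (use assms in \<open>auto simp: mat_of_index\<close>)

lemma madj_mat_of_iff: "madj X (mat_of n A) = mat_of n A \<longleftrightarrow> (\<forall>i<n. \<forall>j<n. \<forall>l<d. A j i l = cnj (A i j l))"
proof
  assume a: "madj X (mat_of n A) = mat_of n A"
  show "\<forall>i<n. \<forall>j<n. \<forall>l<d. A j i l = cnj (A i j l)"
  proof (intro allI impI)
    fix i j l assume ij: "i < n" "j < n" "l < d"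
    have "co (madj X (mat_of n A) $$ (j,i)) l = co (mat_of n A $$ (j,i)) l" by (simp only: a)
    thus "A j i l = cnj (A i j l)" using ij unfolding madj_mat_of by (simp add: mat_of_index)
  qed
next
  assume a: "\<forall>i<n. \<forall>j<n. \<forall>l<d. A j i l = cnj (A i j l)"
  have "mat_of n (\<lambda>i j l. cnj (A j i l)) = mat_of n A"
  proof (rule mat_of_cong)
    fix i j l assume "i < n" "j < n" "l < d"
    with a have "A i j l = cnj (A j i l)" by blast
    thus "cnj (A j i l) = A i j l" by simp
  qed
  thus "madj X (mat_of n A) = mat_of n A" by (simp only: madj_mat_of)
qed

lemma shift_mat_of:
  "madd X (msmult X (complex_of_real r) (munit X n)) (mat_of n A)
   = mat_of n (\<lambda>i j l. (if i = j then complex_of_real r * unit_co l else 0) + A i j l)"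
  unfolding munit_mat_of msmult_mat_of madd_mat_of by (rule mat_of_cong) simp

lemma coord_opsys_cone_co: "coord_opsys d unit_co cone_co"
proof
  show "cnj (unit_co l) = unit_co l" if "l < d" for l
    using co_adj[OF unit_closed that] unit_adj by (simp add: unit_co_def)
next
  fix A n B assume A: "A \<in> cone_co n" and e: "\<And>i j l. i < n \<Longrightarrow> j < n \<Longrightarrow> l < d \<Longrightarrow> A i j l = B i j l"
  have "mat_of n A = mat_of n B" by (rule mat_of_cong) (rule e)
  thus "B \<in> cone_co n" using A by (simp add: cone_co_def)
next
  fix A :: arr and n i j l :: nat assume A: "A \<in> cone_co n" and ij: "i < n" "j < n" "l < d"
  have "madj X (mat_of n A) = mat_of n A" using A cone_hermitian by (simp add: cone_co_def)
  thus "A j i l = cnj (A i j l)" unfolding madj_mat_of_iff using ij by blast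
next
  fix A n B assume "A \<in> cone_co n" "B \<in> cone_co n"
  thus "(\<lambda>i j l. A i j l + B i j l) \<in> cone_co n" using cone_add by (auto simp: cone_co_def madd_mat_of[symmetric])
next
  fix A n m and \<alpha> :: "nat \<Rightarrow> nat \<Rightarrow> complex"
  assume A: "A \<in> cone_co n"
  define a where "a = mat m n (\<lambda>(i,j). \<alpha> i j)"
  have "mconj X a (mat_of n A) \<in> mcone X m" using A by (intro cone_conj) (auto simp: cone_co_def a_def)
  hence "mat_of m (\<lambda>i j l. \<Sum>b<n. \<Sum>c<n. a $$ (i,b) * cnj (a $$ (j,c)) * A b c l) \<in> mcone X m"
    by (subst mconj_mat_of[symmetric]) (auto simp: a_def)
  also have "mat_of m (\<lambda>i j l. \<Sum>b<n. \<Sum>c<n. a $$ (i,b) * cnj (a $$ (j,c)) * A b c l)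
    = mat_of m (\<lambda>i j l. \<Sum>b<n. \<Sum>c<n. \<alpha> i b * cnj (\<alpha> j c) * A b c l)"
    by (rule mat_of_cong, intro sum.cong refl) (simp add: a_def)
  finally show "(\<lambda>i j l. \<Sum>b<n. \<Sum>c<n. \<alpha> i b * cnj (\<alpha> j c) * A b c l) \<in> cone_co m" by (simp add: cone_co_def)
next
  fix A :: arr and n i j l :: nat assume A: "A \<in> cone_co n" "(\<lambda>i j l. - A i j l) \<in> cone_co n" and ij: "i < n" "j < n" "l < d"
  have "msmult X (-1) (mat_of n A) \<in> mcone X n" using A(2) by (simp add: cone_co_def msmult_mat_of)
  hence "mat_of n A = mzero X n" using cone_proper[of "mat_of n A" n] A(1) by (simp add: cone_co_def)
  hence "co (mat_of n A $$ (i,j)) l = co (mat_of n (\<lambda>i j l. 0) $$ (i,j)) l" by (simp only: mzero_mat_of)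
  thus "A i j l = 0" using ij by (simp add: mat_of_index)
next
  fix n :: nat and A :: arr assume h: "\<And>i j l. i < n \<Longrightarrow> j < n \<Longrightarrow> l < d \<Longrightarrow> A j i l = cnj (A i j l)"
  have "madj X (mat_of n A) = mat_of n A" unfolding madj_mat_of_iff using h by blast
  from order_unit[OF mat_of_mats this]
  show "\<exists>r>0. (\<lambda>i j l. (if i = j then complex_of_real r * unit_co l else 0) + A i j l) \<in> cone_co n"
    unfolding shift_mat_of by (simp add: cone_co_def)
next
  fix n :: nat and A :: arr assume h: "\<And>i j l. i < n \<Longrightarrow> j < n \<Longrightarrow> l < d \<Longrightarrow> A j i l = cnj (A i j l)"
    and r: "\<And>r. r > 0 \<Longrightarrow> (\<lambda>i j l. (if i = j then complex_of_real r * unit_co l else 0) + A i j l) \<in> cone_co n"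
  have "madj X (mat_of n A) = mat_of n A" unfolding madj_mat_of_iff using h by blast
  from archimedean[OF mat_of_mats this] r show "A \<in> cone_co n" unfolding shift_mat_of by (simp add: cone_co_def)
qed

sublocale K: coord_opsys d unit_co cone_co by (rule coord_opsys_cone_co)

lemma linear_expand:
  fixes F :: "'a \<Rightarrow> complex"
  assumes "\<And>x y. x \<in> carrier X \<Longrightarrow> y \<in> carrier X \<Longrightarrow> F (x \<oplus>\<^bsub>X\<^esub> y) = F x + F y"
    and "\<And>c x. x \<in> carrier X \<Longrightarrow> F (c \<odot>\<^bsub>X\<^esub> x) = c * F x"
    and x: "x \<in> carrier X"
  shows "F x = (\<Sum>l<d. co x l * F (cb (\<lambda>k. if k = l then 1 else 0)))"
proof -
  define b where "b l = cb (\<lambda>k. if k = l then 1 else 0)" for l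
  have F0: "F \<zero>\<^bsub>X\<^esub> = 0" using assms(2)[of "\<zero>\<^bsub>X\<^esub>" 0] smul_zero[of "\<zero>\<^bsub>X\<^esub>"] by simp
  have fs: "F (finsum X f I) = (\<Sum>i\<in>I. F (f i))" if "finite I" "f \<in> I \<rightarrow> carrier X" for f and I :: "nat set"
    using that
  proof (induction I rule: finite_induct)
    case (insert a I)
    hence 1: "f a \<in> carrier X" "f \<in> I \<rightarrow> carrier X" by auto
    show ?case using insert 1 by (simp add: M.finsum_insert assms(1))
  qed (simp add: F0)
  have "x = finsum X (\<lambda>l. co x l \<odot>\<^bsub>X\<^esub> b l) {..<d}"
  proof (rule co_inj[OF x])
    show "finsum X (\<lambda>l. co x l \<odot>\<^bsub>X\<^esub> b l) {..<d} \<in> carrier X" by (auto intro!: M.finsum_closed simp: b_def)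
    fix k assume k: "k < d"
    have "co (finsum X (\<lambda>l. co x l \<odot>\<^bsub>X\<^esub> b l) {..<d}) k = (\<Sum>l<d. co x l * (if k = l then 1 else 0))"
      using k by (subst co_finsum) (auto simp: b_def intro!: sum.cong)
    also have "\<dots> = (\<Sum>l<d. if k = l then co x l else 0)" by (intro sum.cong refl) simp
    finally show "co x k = co (finsum X (\<lambda>l. co x l \<odot>\<^bsub>X\<^esub> b l) {..<d}) k" using k by simp
  qed
  hence "F x = F (finsum X (\<lambda>l. co x l \<odot>\<^bsub>X\<^esub> b l) {..<d})" by simp
  also have "\<dots> = (\<Sum>l<d. co x l * F (b l))"
    by (subst fs) (auto simp: b_def assms(2))
  finally show ?thesis by (simp add: b_def)
qed

text \<open>
  The linear map that takes the values \<open>\<phi>\<close> on the basis.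
\<close>

definition coord_map :: "nat \<Rightarrow> arr \<Rightarrow> 'a \<Rightarrow> complex mat" where
  "coord_map m \<phi> x = mat m m (\<lambda>(i,j). \<Sum>l<d. co x l * \<phi> l i j)"

lemma coord_map_simps:
  "coord_map m \<phi> x \<in> carrier_mat m m"
  "x \<in> carrier X \<Longrightarrow> y \<in> carrier X \<Longrightarrow> coord_map m \<phi> (x \<oplus>\<^bsub>X\<^esub> y) = coord_map m \<phi> x + coord_map m \<phi> y"
  "x \<in> carrier X \<Longrightarrow> coord_map m \<phi> (c \<odot>\<^bsub>X\<^esub> x) = c \<cdot>\<^sub>m coord_map m \<phi> x"
  "i < m \<Longrightarrow> j < m \<Longrightarrow> coord_map m \<phi> x $$ (i,j) = (\<Sum>l<d. co x l * \<phi> l i j)"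
  by (auto simp: coord_map_def distrib_right sum.distrib sum_distrib_left mult.assoc intro!: eq_matI)

lemma coord_map_unital: "K.unital m \<phi> \<Longrightarrow> coord_map m \<phi> \<one>\<^bsub>X\<^esub> = 1\<^sub>m m"
  by (rule eq_matI) (auto simp: coord_map_def K.unital_def unit_co_def)

lemma coord_map_unital_linear:
  assumes "K.unital m \<phi>" shows "unital_linear X (cstar_opsys (mat_alg m)) (coord_map m \<phi>)"
  unfolding unital_linear_def
proof
  show "linear_map class_ring X (cstar_opsys (mat_alg m)) (coord_map m \<phi>)"
  proof (rule linear_mapI)
    show "vectorspace class_ring X" by (rule vectorspace_axioms)
    show "vectorspace class_ring (cstar_opsys (mat_alg m))"
      using cstar_vectorspace star_algebra.axioms(1)[OF mat_alg_star_algebra] by blast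
  qed (auto simp: cstar_simps mat_alg_simps coord_map_simps)
  show "coord_map m \<phi> \<one>\<^bsub>X\<^esub> = \<one>\<^bsub>cstar_opsys (mat_alg m)\<^esub>" using coord_map_unital[OF assms] by (simp add: cstar_simps mat_alg_simps)
qed

lemma map_coord_map_mats: "x \<in> mats X n n \<Longrightarrow> map_mat (coord_map m \<phi>) x \<in> mats (mat_alg m) n n"
  by (rule matsI) (auto simp: mats_iff mat_alg_simps coord_map_simps)

lemma map_coord_map_psd:
  assumes "x \<in> mats X n n"
  shows "mat_psd m n (map_mat (coord_map m \<phi>) x) \<longleftrightarrow> K.amp_psd m \<phi> n (arr_of x)"
proof -
  have "(case p of (a, i) \<Rightarrow> \<lambda>(b, j). map_mat (coord_map m \<phi>) x $$ (a, b) $$ (i, j)) q = K.amp \<phi> (arr_of x) p q"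
    if "p \<in> grid n m" "q \<in> grid n m" for p q
    using that mats_carrier[OF assms] by (auto simp: K.amp_def arr_of_def coord_map_simps)
  thus ?thesis unfolding mat_psd_def K.amp_psd_def
    using psd_cong[of "grid n m" "\<lambda>(a, i) (b, j). map_mat (coord_map m \<phi>) x $$ (a, b) $$ (i, j)" "K.amp \<phi> (arr_of x)"]
      psd_cong[of "grid n m" "K.amp \<phi> (arr_of x)" "\<lambda>(a, i) (b, j). map_mat (coord_map m \<phi>) x $$ (a, b) $$ (i, j)"]
    by fastforce
qed

lemma ucp_co_imp_ucp:
  assumes "K.ucp_co m \<psi>" shows "ucp X (cstar_opsys (mat_alg m)) (coord_map m \<psi>)"
  unfolding ucp_def
proof (intro conjI allI ballI)
  show "unital_linear X (cstar_opsys (mat_alg m)) (coord_map m \<psi>)"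
    using assms by (intro coord_map_unital_linear) (simp add: K.ucp_co_def)
  fix n x assume "x \<in> mcone X n"
  hence x: "x \<in> mats X n n" "arr_of x \<in> cone_co n" by (simp_all add: mcone_iff)
  show "map_mat (coord_map m \<psi>) x \<in> mcone (cstar_opsys (mat_alg m)) n"
    unfolding mat_cone_iff map_coord_map_psd[OF x(1)] using map_coord_map_mats[OF x(1)] assms x(2) by (simp add: K.ucp_co_def)
qed

end

section \<open>Norms of amplifications\<close>

lemma map_block:
  assumes x: "x \<in> carrier_mat n n"
    and "f (of_real r \<odot>\<^bsub>X\<^esub> \<one>\<^bsub>X\<^esub>) = of_real r \<odot>\<^bsub>B\<^esub> \<one>\<^bsub>B\<^esub>" "f (of_real r \<odot>\<^bsub>X\<^esub> \<zero>\<^bsub>X\<^esub>) = of_real r \<odot>\<^bsub>B\<^esub> \<zero>\<^bsub>B\<^esub>"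
    and "\<And>i j. i < n \<Longrightarrow> j < n \<Longrightarrow> f (st (x $$ (i,j))) = st' (f (x $$ (i,j)))"
  shows "block B st' r (map_mat f x) = map_mat f (block X st r x)"
proof (rule eq_matI)
  have c: "map_mat f x \<in> carrier_mat n n" using x by simp
  show "dim_row (block B st' r (map_mat f x)) = dim_row (map_mat f (block X st r x))"
    "dim_col (block B st' r (map_mat f x)) = dim_col (map_mat f (block X st r x))"
    using block_carrier[OF c, of B st' r] block_carrier[OF x, of X st r] by auto
  fix i j assume "i < dim_row (map_mat f (block X st r x))" "j < dim_col (map_mat f (block X st r x))"
  hence ij: "i < n + n" "j < n + n" using block_carrier[OF x, of X st r] by auto
  have "map_mat f (block X st r x) $$ (i,j) = f (block X st r x $$ (i,j))"
    using ij block_carrier[OF x, of X st r] by auto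
  thus "block B st' r (map_mat f x) $$ (i,j) = map_mat f (block X st r x) $$ (i,j)"
    unfolding block_index[OF x ij] block_index[OF c ij] using ij x assms(2-4) by auto
qed

lemma mat_block_entry:
  assumes z: "z \<in> carrier_mat 1 1" "z $$ (0,0) \<in> carrier_mat m m" and "i < m" "j < m" "a < 2" "b < 2"
  shows "block (mat_alg m) mat_adjoint r z $$ (a,b) $$ (i,j) =
    (if a = b then (if i = j then of_real r else 0) else if a = 0 then z $$ (0,0) $$ (i,j) else cnj (z $$ (0,0) $$ (j,i)))"
proof -
  have ab: "a < 1 + 1" "b < 1 + 1" using assms by auto
  show ?thesis unfolding block_index[OF z(1) ab] using assms by (auto simp: mat_alg_simps less_2_cases_iff)
qed

lemma mat_block_qform:
  assumes z: "z \<in> carrier_mat 1 1" "z $$ (0,0) \<in> carrier_mat m m"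
  shows "qform (grid 2 m) (\<lambda>(a,i) (b,j). block (mat_alg m) mat_adjoint r z $$ (a,b) $$ (i,j)) f
    = complex_of_real (r * (norm_sq m (\<lambda>i. f (0,i)) + norm_sq m (\<lambda>i. f (1,i))))
      + (\<Sum>i<m. cnj (f (0,i)) * mapply m (z $$ (0,0)) (\<lambda>i. f (1,i)) i)
      + cnj (\<Sum>i<m. cnj (f (0,i)) * mapply m (z $$ (0,0)) (\<lambda>i. f (1,i)) i)"
proof -
  let ?y = "z $$ (0,0)"
  let ?E = "\<lambda>a i b j. (if a = b then (if i = j then complex_of_real r else 0) else if a = 0 then ?y $$ (i,j) else cnj (?y $$ (j,i)))"
  have "qform (grid 2 m) (\<lambda>(a,i) (b,j). block (mat_alg m) mat_adjoint r z $$ (a,b) $$ (i,j)) f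
    = qform (grid 2 m) (\<lambda>x y. ?E (fst x) (snd x) (fst y) (snd y)) f"
    by (rule qform_cong) (auto simp: mat_block_entry[OF z])
  also have "\<dots> = (\<Sum>a<2. \<Sum>b<2. \<Sum>i<m. \<Sum>j<m. cnj (f (a,i)) * ?E a i b j * f (b,j))"
    by (rule qform_pairs)
  also have "\<dots> = (\<Sum>i<m. \<Sum>j<m. cnj (f (0,i)) * (if i = j then complex_of_real r else 0) * f (0,j))
    + (\<Sum>i<m. \<Sum>j<m. cnj (f (0,i)) * ?y $$ (i,j) * f (1,j))
    + ((\<Sum>i<m. \<Sum>j<m. cnj (f (1,i)) * cnj (?y $$ (j,i)) * f (0,j))
    + (\<Sum>i<m. \<Sum>j<m. cnj (f (1,i)) * (if i = j then complex_of_real r else 0) * f (1,j)))"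
    by (simp add: numeral_2_eq_2)
  also have "(\<Sum>i<m. \<Sum>j<m. cnj (f (0,i)) * (if i = j then complex_of_real r else 0) * f (0,j)) = complex_of_real (r * norm_sq m (\<lambda>i. f (0,i)))"
    using qform_identity[of "{..<m}" "complex_of_real r" "\<lambda>i. f (0,i)"] by (simp add: qform_def norm_sq_def)
  also have "(\<Sum>i<m. \<Sum>j<m. cnj (f (1,i)) * (if i = j then complex_of_real r else 0) * f (1,j)) = complex_of_real (r * norm_sq m (\<lambda>i. f (1,i)))"
    using qform_identity[of "{..<m}" "complex_of_real r" "\<lambda>i. f (1,i)"] by (simp add: qform_def norm_sq_def)
  also have "(\<Sum>i<m. \<Sum>j<m. cnj (f (0,i)) * ?y $$ (i,j) * f (1,j)) = (\<Sum>i<m. cnj (f (0,i)) * mapply m ?y (\<lambda>i. f (1,i)) i)"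
    by (simp add: mapply_def sum_distrib_left mult.assoc)
  also have "(\<Sum>i<m. \<Sum>j<m. cnj (f (1,i)) * cnj (?y $$ (j,i)) * f (0,j)) = (\<Sum>j<m. \<Sum>i<m. cnj (f (1,i)) * cnj (?y $$ (j,i)) * f (0,j))"
    by (rule sum.swap)
  also have "\<dots> = cnj (\<Sum>i<m. cnj (f (0,i)) * mapply m ?y (\<lambda>i. f (1,i)) i)"
    unfolding mapply_def cnj_sum complex_cnj_mult sum_distrib_left
    by (intro sum.cong refl) (simp add: mult_ac)
  finally show ?thesis by (simp add: algebra_simps)
qed

text \<open>
  Evaluate the block form at \<open>(- x f, c' f)\<close>. The gap between \<open>c\<close> and \<open>c'\<close> covers the case \<open>c = 0\<close>.
\<close>

lemma opbound_of_block:
  assumes z: "z \<in> carrier_mat 1 1" "z $$ (0,0) \<in> carrier_mat m m"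
    and p: "mat_psd m 2 (block (mat_alg m) mat_adjoint c z)" and c: "0 \<le> c" "c < c'"
  shows "norm_sq m (mapply m (z $$ (0,0)) f) \<le> c'\<^sup>2 * norm_sq m f"
proof -
  define y where "y = mapply m (z $$ (0,0)) f"
  define F where "F = (\<lambda>(a,i). if a = (0::nat) then - y i else complex_of_real c' * f i)"
  have my: "mapply m (z $$ (0,0)) (\<lambda>i. complex_of_real c' * f i) i = complex_of_real c' * y i" for i
    by (simp add: mapply_def y_def sum_distrib_left mult_ac)
  have s: "(\<Sum>i<m. cnj (- y i) * (complex_of_real c' * y i)) = - complex_of_real (c' * norm_sq m y)"
  proof -
    have "(\<Sum>i<m. cnj (- y i) * (complex_of_real c' * y i)) = - (complex_of_real c' * (\<Sum>i<m. cnj (y i) * y i))"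
      by (simp add: sum_distrib_left sum_negf mult_ac)
    also have "(\<Sum>i<m. cnj (y i) * y i) = complex_of_real (norm_sq m y)" by (rule norm_sq_inner[symmetric])
    finally show ?thesis by simp
  qed
  have F0: "F (0,i) = - y i" and F1: "F (1,i) = complex_of_real c' * f i" for i by (simp_all add: F_def)
  have n1: "norm_sq m (\<lambda>i. - y i) = norm_sq m y" by (simp add: norm_sq_def)
  have n2: "norm_sq m (\<lambda>i. complex_of_real c' * f i) = c'\<^sup>2 * norm_sq m f"
    by (simp add: norm_sq_def norm_mult power_mult_distrib sum_distrib_left)
  have "0 \<le> qform (grid 2 m) (\<lambda>(a,i) (b,j). block (mat_alg m) mat_adjoint c z $$ (a,b) $$ (i,j)) F"
    using p unfolding mat_psd_def by (rule psdD)
  also have "\<dots> = complex_of_real (c * (norm_sq m y + c'\<^sup>2 * norm_sq m f)) + (- complex_of_real (c' * norm_sq m y)) + cnj (- complex_of_real (c' * norm_sq m y))"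
    unfolding mat_block_qform[OF z] F0 F1 my s n1 n2 ..
  finally have "0 \<le> c * (norm_sq m y + c'\<^sup>2 * norm_sq m f) - 2 * (c' * norm_sq m y)"
    by (simp add: complex_nonneg_iff)
  also have "\<dots> \<le> c' * (norm_sq m y + c'\<^sup>2 * norm_sq m f) - 2 * (c' * norm_sq m y)"
    using c by (intro diff_right_mono mult_right_mono) auto
  also have "\<dots> = c' * (c'\<^sup>2 * norm_sq m f - norm_sq m y)" by (simp add: algebra_simps)
  finally have "0 \<le> c'\<^sup>2 * norm_sq m f - norm_sq m y" using c by (simp add: zero_le_mult_iff)
  thus ?thesis by (simp add: y_def)
qed

lemma block_of_opbound:
  assumes z: "z \<in> carrier_mat 1 1" "z $$ (0,0) \<in> carrier_mat m m"
    and r: "r > 0" and b: "\<And>f. norm_sq m (mapply m (z $$ (0,0)) f) \<le> r\<^sup>2 * norm_sq m f"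
  shows "mat_psd m 2 (block (mat_alg m) mat_adjoint r z)"
  unfolding mat_psd_def psd_def
proof
  fix F :: "nat \<times> nat \<Rightarrow> complex"
  define f1 where "f1 i = F (0,i)" for i
  define f2 where "f2 i = F (1,i)" for i
  define s where "s = (\<Sum>i<m. cnj (f1 i) * mapply m (z $$ (0,0)) f2 i)"
  have "cmod s \<le> (\<Sum>i<m. cmod (f1 i) * cmod (mapply m (z $$ (0,0)) f2 i))"
    unfolding s_def by (rule order_trans[OF norm_sum]) (simp add: norm_mult)
  also have "\<dots> \<le> (\<Sum>i<m. (r * (cmod (f1 i))\<^sup>2 + (cmod (mapply m (z $$ (0,0)) f2 i))\<^sup>2 / r) / 2)"
    by (intro sum_mono weighted_am_gm r)
  also have "\<dots> = (r * norm_sq m f1 + norm_sq m (mapply m (z $$ (0,0)) f2) / r) / 2"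
    by (simp add: norm_sq_def sum.distrib sum_distrib_left flip: sum_divide_distrib)
  also have "norm_sq m (mapply m (z $$ (0,0)) f2) / r \<le> r * norm_sq m f2"
    using b[of f2] r by (simp add: field_simps power2_eq_square)
  finally have "2 * cmod s \<le> r * (norm_sq m f1 + norm_sq m f2)" by (simp add: algebra_simps)
  moreover have "- Re s \<le> cmod s" using abs_Re_le_cmod[of s] by linarith
  ultimately have k: "0 \<le> r * (norm_sq m f1 + norm_sq m f2) + 2 * Re s" by linarith
  have "qform (grid 2 m) (\<lambda>(a,i) (b,j). block (mat_alg m) mat_adjoint r z $$ (a,b) $$ (i,j)) F
    = complex_of_real (r * (norm_sq m f1 + norm_sq m f2)) + s + cnj s"
    unfolding mat_block_qform[OF z] f1_def f2_def s_def ..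
  also have "\<dots> = complex_of_real (r * (norm_sq m f1 + norm_sq m f2) + 2 * Re s)" by (simp add: complex_eq_iff)
  finally show "0 \<le> qform (grid 2 m) (\<lambda>(a,i) (b,j). block (mat_alg m) mat_adjoint r z $$ (a,b) $$ (i,j)) F"
    using k by (simp only: complex_nonneg_iff Re_complex_of_real Im_complex_of_real simp_thms)
qed

context coord_operator_system
begin

definition block_arr :: "nat \<Rightarrow> real \<Rightarrow> arr \<Rightarrow> arr" where
  "block_arr n r a = (\<lambda>i j l. if i < n then (if j < n then (if i = j then complex_of_real r * unit_co l else 0) else a i (j - n) l)
     else (if j < n then cnj (a j (i - n) l) else (if i = j then complex_of_real r * unit_co l else 0)))"

lemma block_mat_of:
  assumes x: "x \<in> mats X n n"
  shows "block X (adj X) r x = mat_of (n + n) (block_arr n r (arr_of x))"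
proof (rule mat_of_eqI)
  note xc = mats_carrier[OF x]
  have xe: "x $$ (i,j) \<in> carrier X" if "i < n" "j < n" for i j using matsD[OF x that] .
  show "block X (adj X) r x \<in> mats X (n + n) (n + n)"
  proof (rule matsI[OF block_carrier[OF xc]])
    fix i j assume ij: "i < n + n" "j < n + n"
    show "block X (adj X) r x $$ (i,j) \<in> carrier X" unfolding block_index[OF xc ij]
      using ij xe adj_closed unit_closed by auto
  qed
  fix i j l assume ij: "i < n + n" "j < n + n" "l < d"
  show "co (block X (adj X) r x $$ (i,j)) l = block_arr n r (arr_of x) i j l"
    unfolding block_index[OF xc ij(1,2)] block_arr_def arr_of_def unit_co_def
    using ij xe adj_closed unit_closed by auto
qed

lemma shift_block_arr: "K.shift t (block_arr n r a) = block_arr n (t + r) a"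
  by (auto simp: K.shift_def block_arr_def algebra_simps intro!: ext)

lemma block_arr_herm: "K.herm (n + n) (block_arr n r a)"
proof (rule K.hermI)
  fix i j l assume "l < d"
  thus "block_arr n r a j i l = cnj (block_arr n r a i j l)" using K.e_real[of l] by (auto simp: block_arr_def)
qed

text \<open>
  The cone is Archimedean, so the infimum in the definition of the norm is attained.
\<close>

lemma mnorm_le_iff_block:
  assumes x: "x \<in> mats X n n" shows "mnorm X x \<le> 1 \<longleftrightarrow> block_arr n 1 (arr_of x) \<in> cone_co (n + n)"
proof -
  define S where "S = {r. 0 \<le> r \<and> block_arr n r (arr_of x) \<in> cone_co (n + n)}"
  have dx: "dim_row x = n" using mats_carrier[OF x] by auto
  have mS: "mnorm X x = Inf S" unfolding mnorm_block S_def block_mat_of[OF x] dx by (simp add: cone_co_def)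
  have bdd: "bdd_below S" by (rule bdd_belowI[of _ 0]) (simp add: S_def)
  obtain r where "r > 0" "K.shift r (block_arr n 0 (arr_of x)) \<in> cone_co (n + n)" using K.herm_shift[OF block_arr_herm] by blast
  hence "r \<in> S" by (simp add: S_def shift_block_arr)
  hence ne: "S \<noteq> {}" by blast
  show ?thesis
  proof
    assume le: "mnorm X x \<le> 1"
    show "block_arr n 1 (arr_of x) \<in> cone_co (n + n)"
    proof (rule K.C_archI[OF block_arr_herm])
      fix t :: real assume "t > 0"
      hence "Inf S < 1 + t" using le mS by simp
      then obtain r where r: "r \<in> S" "r < 1 + t" using cInf_lessD[OF ne] by blast
      have "K.shift 0 (block_arr n r (arr_of x)) \<in> cone_co (n + n)" using r by (simp add: S_def)
      from K.shift_mono[OF this, of "1 + t - r"] r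
      show "K.shift t (block_arr n 1 (arr_of x)) \<in> cone_co (n + n)" by (simp add: shift_block_arr add.commute)
    qed
  next
    assume "block_arr n 1 (arr_of x) \<in> cone_co (n + n)"
    hence "1 \<in> S" by (simp add: S_def)
    thus "mnorm X x \<le> 1" unfolding mS by (rule cInf_lower[OF _ bdd])
  qed
qed

text \<open>
  Conjugation by \<open>diag(1,-1)\<close> changes the signs of the off-diagonal corners, which turns the block
  matrix of \<open>x\<close> into \<open>2\<close> minus itself. So blocks of contractions lie in the order interval \<open>[0,2]\<close>.
\<close>

lemma block_arr_reflect:
  assumes "block_arr n 1 a \<in> cone_co (n + n)" shows "K.shift 2 (K.neg (block_arr n 1 a)) \<in> cone_co (n + n)"
proof -
  define s where "s i = (if i < n then 1 else - 1 :: complex)" for i :: nat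
  have "(\<lambda>i j l. \<Sum>b<n+n. \<Sum>c<n+n. (if i = b then s i else 0) * cnj (if j = c then s j else 0) * block_arr n 1 a b c l) \<in> cone_co (n + n)"
    using K.C_conj[OF assms, of "\<lambda>i b. if i = b then s i else 0" "n + n"] .
  thus ?thesis
  proof (rule K.C_cong)
    fix i j l assume ij: "i < n + n" "j < n + n"
    have "(\<Sum>b<n+n. \<Sum>c<n+n. (if i = b then s i else 0) * cnj (if j = c then s j else 0) * block_arr n 1 a b c l)
      = (\<Sum>b<n+n. if i = b then (\<Sum>c<n+n. if j = c then s i * cnj (s j) * block_arr n 1 a b c l else 0) else 0)"
    proof (rule sum.cong[OF refl])
      fix b
      show "(\<Sum>c<n+n. (if i = b then s i else 0) * cnj (if j = c then s j else 0) * block_arr n 1 a b c l)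
        = (if i = b then (\<Sum>c<n+n. if j = c then s i * cnj (s j) * block_arr n 1 a b c l else 0) else 0)"
        by (cases "i = b") (simp_all only: if_True if_False simp_thms, intro sum.cong refl, auto)
    qed
    also have "\<dots> = s i * cnj (s j) * block_arr n 1 a i j l" using ij by simp
    also have "\<dots> = K.shift 2 (K.neg (block_arr n 1 a)) i j l"
      by (auto simp: K.shift_def K.neg_def block_arr_def s_def)
    finally show "(\<Sum>b<n+n. \<Sum>c<n+n. (if i = b then s i else 0) * cnj (if j = c then s j else 0) * block_arr n 1 a b c l)
      = K.shift 2 (K.neg (block_arr n 1 a)) i j l" .
  qed
qed

lemma coord_map_adj:
  assumes "K.hermitian_map m \<phi>" "x \<in> carrier X" shows "coord_map m \<phi> (adj X x) = mat_adjoint (coord_map m \<phi> x)"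
proof (rule eq_matI)
  fix i j assume "i < dim_row (mat_adjoint (coord_map m \<phi> x))" "j < dim_col (mat_adjoint (coord_map m \<phi> x))"
  hence ij: "i < m" "j < m" by (auto simp: coord_map_def)
  have "mat_adjoint (coord_map m \<phi> x) $$ (i,j) = cnj (coord_map m \<phi> x $$ (j,i))" using ij by (simp add: coord_map_def)
  also have "\<dots> = (\<Sum>l<d. cnj (co x l) * cnj (\<phi> l j i))" using ij by (simp add: coord_map_simps)
  also have "\<dots> = (\<Sum>l<d. co (adj X x) l * \<phi> l i j)"
  proof (rule sum.cong[OF refl])
    fix l assume "l \<in> {..<d}"
    hence "\<phi> l i j = cnj (\<phi> l j i)" using assms(1) ij unfolding K.hermitian_map_def by blast
    thus "cnj (co x l) * cnj (\<phi> l j i) = co (adj X x) l * \<phi> l i j" using assms(2) \<open>l \<in> {..<d}\<close> by simp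
  qed
  finally show "coord_map m \<phi> (adj X x) $$ (i,j) = mat_adjoint (coord_map m \<phi> x) $$ (i,j)" using ij by (simp add: coord_map_simps)
qed (auto simp: coord_map_def)

lemma coord_map_block:
  assumes "K.hermitian_map m \<phi>" "K.unital m \<phi>" and x: "x \<in> mats X n n"
  shows "block (mat_alg m) mat_adjoint r (map_mat (coord_map m \<phi>) x) = map_mat (coord_map m \<phi>) (block X (adj X) r x)"
proof (rule map_block[OF mats_carrier[OF x]])
  show "coord_map m \<phi> (complex_of_real r \<odot>\<^bsub>X\<^esub> \<one>\<^bsub>X\<^esub>) = complex_of_real r \<odot>\<^bsub>mat_alg m\<^esub> \<one>\<^bsub>mat_alg m\<^esub>"
    using coord_map_unital[OF assms(2)] unit_closed by (simp add: coord_map_simps mat_alg_simps)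
  show "coord_map m \<phi> (complex_of_real r \<odot>\<^bsub>X\<^esub> \<zero>\<^bsub>X\<^esub>) = complex_of_real r \<odot>\<^bsub>mat_alg m\<^esub> \<zero>\<^bsub>mat_alg m\<^esub>"
    by (simp add: coord_map_simps mat_alg_simps) (auto simp: coord_map_def intro!: eq_matI)
  show "coord_map m \<phi> (adj X (x $$ (i, j))) = mat_adjoint (coord_map m \<phi> (x $$ (i, j)))" if "i < n" "j < n" for i j
    by (rule coord_map_adj[OF assms(1) matsD[OF x that]])
qed

lemma transport_block:
  assumes g: "inj_on g (carrier (mat_alg m))" and z: "z \<in> mats (mat_alg m) n n"
  shows "block (cstar_opsys (transport g (mat_alg m))) (adj (cstar_opsys (transport g (mat_alg m)))) r (map_mat g z)
    = map_mat g (block (mat_alg m) mat_adjoint r z)"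
proof (rule map_block[OF mats_carrier[OF z]])
  note ts = transport_simps[OF mat_alg_star_algebra g, unfolded mat_alg_simps]
  show "g (complex_of_real r \<odot>\<^bsub>mat_alg m\<^esub> \<one>\<^bsub>mat_alg m\<^esub>)
    = complex_of_real r \<odot>\<^bsub>cstar_opsys (transport g (mat_alg m))\<^esub> \<one>\<^bsub>cstar_opsys (transport g (mat_alg m))\<^esub>"
    by (simp add: cstar_simps ts mat_alg_simps)
  show "g (complex_of_real r \<odot>\<^bsub>mat_alg m\<^esub> \<zero>\<^bsub>mat_alg m\<^esub>)
    = complex_of_real r \<odot>\<^bsub>cstar_opsys (transport g (mat_alg m))\<^esub> \<zero>\<^bsub>cstar_opsys (transport g (mat_alg m))\<^esub>"
    by (simp add: cstar_simps ts mat_alg_simps)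
  show "g (mat_adjoint (z $$ (i, j))) = adj (cstar_opsys (transport g (mat_alg m))) (g (z $$ (i, j)))" if "i < n" "j < n" for i j
    using matsD[OF z that] by (simp add: cstar_simps ts mat_alg_simps)
qed

lemma block_mats:
  "z \<in> mats (mat_alg m) n n \<Longrightarrow> block (mat_alg m) mat_adjoint r z \<in> mats (mat_alg m) (n + n) (n + n)"
proof (rule matsI)
  assume z: "z \<in> mats (mat_alg m) n n"
  show "block (mat_alg m) mat_adjoint r z \<in> carrier_mat (n + n) (n + n)" by (rule block_carrier[OF mats_carrier[OF z]])
  fix i j assume ij: "i < n + n" "j < n + n"
  have ze: "z $$ (i,j) \<in> carrier_mat m m" if "i < n" "j < n" for i j using matsD[OF z that] by (simp add: mat_alg_simps)
  show "block (mat_alg m) mat_adjoint r z $$ (i, j) \<in> carrier (mat_alg m)"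
    unfolding block_index[OF mats_carrier[OF z] ij] using ij ze by (auto simp: mat_alg_simps)
qed

lemma transport_mnorm:
  assumes g: "inj_on g (carrier (mat_alg m))" and z: "z \<in> mats (mat_alg m) n n"
  shows "mnorm (cstar_opsys (transport g (mat_alg m))) (map_mat g z)
    = Inf {r. 0 \<le> r \<and> mat_psd m (n + n) (block (mat_alg m) mat_adjoint r z)}"
proof -
  have d: "dim_row (map_mat g z) = n" using mats_carrier[OF z] by simp
  show ?thesis
    unfolding mnorm_block d transport_block[OF g z]
      transport_cone[OF mat_alg_star_algebra g block_mats[OF z]] mat_cone_iff
    using block_mats[OF z] by simp
qed

text \<open>
  Positivity up to \<open>\<epsilon>\<close> on the blocks of contractions, which are matrices of size \<open>2k\<close>, bounds the norm of the
  \<open>k\<close>-th amplification by \<open>1 + \<epsilon>\<close>.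
\<close>

lemma amp_norm_bound:
  assumes \<phi>: "K.hermitian_map m \<phi>" "K.unital m \<phi>" and \<epsilon>: "\<epsilon> > 0"
    and pos: "\<And>A. A \<in> cone_co (k + k) \<Longrightarrow> K.shift 2 (K.neg A) \<in> cone_co (k + k) \<Longrightarrow> K.amp_psd m \<phi> (k + k) (K.shift \<epsilon> A)"
    and g: "inj_on g (carrier (mat_alg m))"
  shows "amp_norm X (cstar_opsys (transport g (mat_alg m))) k (\<lambda>x. g (coord_map m \<phi> x)) \<le> ereal (1 + \<epsilon>)"
  unfolding amp_norm_def
proof (rule SUP_least)
  fix x assume "x \<in> {x \<in> mats X k k. mnorm X x \<le> 1}"
  hence x: "x \<in> mats X k k" and b: "block_arr k 1 (arr_of x) \<in> cone_co (k + k)" using mnorm_le_iff_block by auto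
  have z: "map_mat (coord_map m \<phi>) x \<in> mats (mat_alg m) k k" by (rule map_coord_map_mats[OF x])
  have "K.amp_psd m \<phi> (k + k) (block_arr k (\<epsilon> + 1) (arr_of x))"
    using pos[OF b block_arr_reflect[OF b]] by (simp add: shift_block_arr)
  hence "K.amp_psd m \<phi> (k + k) (arr_of (mat_of (k + k) (block_arr k (1 + \<epsilon>) (arr_of x))))"
    by (rule K.amp_psd_cong) (simp add: arr_of_def mat_of_index add.commute)
  hence "mat_psd m (k + k) (block (mat_alg m) mat_adjoint (1 + \<epsilon>) (map_mat (coord_map m \<phi>) x))"
    unfolding coord_map_block[OF \<phi> x] block_mat_of[OF x] by (simp add: map_coord_map_psd)
  hence "Inf {r. 0 \<le> r \<and> mat_psd m (k + k) (block (mat_alg m) mat_adjoint r (map_mat (coord_map m \<phi>) x))} \<le> 1 + \<epsilon>"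
    by (intro cInf_lower) (use \<epsilon> in \<open>auto intro!: bdd_belowI[of _ 0]\<close>)
  moreover have "map_mat (\<lambda>x. g (coord_map m \<phi> x)) x = map_mat g (map_mat (coord_map m \<phi>) x)" by (rule eq_matI) auto
  ultimately show "ereal (mnorm (cstar_opsys (transport g (mat_alg m))) (map_mat (\<lambda>x. g (coord_map m \<phi> x)) x)) \<le> ereal (1 + \<epsilon>)"
    by (simp add: transport_mnorm[OF g z])
qed

lemma restrict_carrier: "restrict_opsys X (carrier X) = X"
proof -
  have "{x \<in> mcone X n. elements_mat x \<subseteq> carrier X} = mcone X n" for n
    using cone_mats[of n] by (auto simp: mats_def)
  thus ?thesis by (simp add: restrict_opsys_def)
qed

lemma subsystem_carrier: "subsystem X (carrier X)"
  unfolding subsystem_def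
proof (intro conjI ballI)
  have "submodule class_ring (carrier X) X"
    by (rule submodule.intro) (use module_axioms in auto)
  thus "VectorSpace.subspace class_ring (carrier X) X"
    using vectorspace_axioms by (simp add: VectorSpace.subspace_def)
qed (use unit_closed adj_closed in auto)

lemma subsystem_subset: "subsystem X S \<Longrightarrow> S \<subseteq> carrier X"
  unfolding subsystem_def VectorSpace.subspace_def using submodule.subset by blast

text \<open>
  A finite-dimensional operator system is a subsystem of itself, and then every intermediate \<open>S\<close> is all of
  \<open>X\<close>.
\<close>

lemma cp_stableD:
  assumes "cp_stable TYPE('u) X" "fin_dim_opsys X" "\<delta> > 0"
  obtains k \<epsilon> where "k > 0" "(\<epsilon>::real) > 0"
    "\<And>(A :: ('u + real) star_space) \<phi>. unital_cstar_algebra A \<Longrightarrow> unital_linear X (cstar_opsys A) \<phi> \<Longrightarrow>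
       amp_norm X (cstar_opsys A) k \<phi> < ereal (1 + \<epsilon>) \<Longrightarrow>
       \<exists>\<psi>. ucp X (cstar_opsys A) \<psi> \<and> amp_norm X (cstar_opsys A) 1 (\<lambda>x. \<phi> x \<ominus>\<^bsub>A\<^esub> \<psi> x) < ereal \<delta>"
proof -
  have fd: "fin_dim_opsys (restrict_opsys X (carrier X))" using assms(2) by (simp add: restrict_carrier)
  from assms(1)[unfolded cp_stable_def, THEN spec, THEN mp, OF conjI[OF subsystem_carrier fd], THEN spec, THEN mp, OF assms(3)]
  obtain S k and \<epsilon> :: real where S: "subsystem X S" "carrier X \<subseteq> S" "k > 0" "\<epsilon> > 0" and
    st: "\<forall>A :: ('u + real) star_space. unital_cstar_algebra A \<longrightarrow>
            (\<forall>\<phi>. unital_linear (restrict_opsys X S) (cstar_opsys A) \<phi> \<and>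
                 amp_norm (restrict_opsys X S) (cstar_opsys A) k \<phi> < ereal (1 + \<epsilon>) \<longrightarrow>
              (\<exists>\<psi>. ucp (restrict_opsys X (carrier X)) (cstar_opsys A) \<psi> \<and>
                   amp_norm (restrict_opsys X (carrier X)) (cstar_opsys A) 1 (\<lambda>x. \<phi> x \<ominus>\<^bsub>A\<^esub> \<psi> x)
                     < ereal \<delta>))"
    by (elim exE conjE)
  have "S = carrier X" using S subsystem_subset by blast
  hence r: "restrict_opsys X S = X" by (simp add: restrict_carrier)
  show ?thesis
    by (rule that[OF S(3,4)]) (use st[unfolded r restrict_carrier] in simp)
qed

end

section \<open>CP-stability in coordinates\<close>

context coord_operator_system
begin

definition basis_vec :: "nat \<Rightarrow> 'a" where "basis_vec l = cb (\<lambda>k. if k = l then 1 else 0)"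

lemma transported_ucp_coordinates:
  assumes g: "inj_on g (carrier (mat_alg m))" and \<psi>: "ucp X (cstar_opsys (transport g (mat_alg m))) \<psi>"
  obtains \<psi>' where "K.ucp_co m \<psi>'" "\<And>x. x \<in> carrier X \<Longrightarrow> \<psi> x = g (coord_map m \<psi>' x)"
proof -
  note ts = transport_simps[OF mat_alg_star_algebra g, unfolded mat_alg_simps]
  have gi: "a = b" if "g a = g b" "a \<in> carrier_mat m m" "b \<in> carrier_mat m m" for a b
    using inj_onD[OF g that(1)] that by (simp add: mat_alg_simps)
  have lin: "linear_map class_ring X (cstar_opsys (transport g (mat_alg m))) \<psi>"
    and one: "\<psi> \<one>\<^bsub>X\<^esub> = g (1\<^sub>m m)"
    and pos: "\<And>n x. x \<in> mcone X n \<Longrightarrow> map_mat \<psi> x \<in> mcone (cstar_opsys (transport g (mat_alg m))) n"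
    using \<psi> by (auto simp: ucp_def unital_linear_def cstar_simps ts)
  have "\<forall>x. \<exists>y. x \<in> carrier X \<longrightarrow> y \<in> carrier_mat m m \<and> \<psi> x = g y"
    using linear_mapD(1)[OF lin] by (auto simp: cstar_simps ts)
  from choice[OF this] obtain \<Psi> where \<Psi>: "\<And>x. x \<in> carrier X \<Longrightarrow> \<Psi> x \<in> carrier_mat m m"
    "\<And>x. x \<in> carrier X \<Longrightarrow> \<psi> x = g (\<Psi> x)" by auto
  have add: "\<Psi> (x \<oplus>\<^bsub>X\<^esub> y) = \<Psi> x + \<Psi> y" if "x \<in> carrier X" "y \<in> carrier X" for x y
  proof (rule gi)
    have "g (\<Psi> (x \<oplus>\<^bsub>X\<^esub> y)) = \<psi> (x \<oplus>\<^bsub>X\<^esub> y)" using that by (simp add: \<Psi>(2))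
    also have "\<dots> = g (\<Psi> x) \<oplus>\<^bsub>cstar_opsys (transport g (mat_alg m))\<^esub> g (\<Psi> y)"
      using linear_mapD(2)[OF lin that] that by (simp add: \<Psi>(2))
    finally show "g (\<Psi> (x \<oplus>\<^bsub>X\<^esub> y)) = g (\<Psi> x + \<Psi> y)" using that \<Psi>(1) by (simp add: cstar_simps ts)
  qed (use that \<Psi>(1) in auto)
  have sm: "\<Psi> (c \<odot>\<^bsub>X\<^esub> x) = c \<cdot>\<^sub>m \<Psi> x" if "x \<in> carrier X" for c x
  proof (rule gi)
    have "g (\<Psi> (c \<odot>\<^bsub>X\<^esub> x)) = \<psi> (c \<odot>\<^bsub>X\<^esub> x)" using that by (simp add: \<Psi>(2))
    also have "\<dots> = c \<odot>\<^bsub>cstar_opsys (transport g (mat_alg m))\<^esub> g (\<Psi> x)"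
      using linear_mapD(3)[OF lin that] that by (simp add: \<Psi>(2))
    finally show "g (\<Psi> (c \<odot>\<^bsub>X\<^esub> x)) = g (c \<cdot>\<^sub>m \<Psi> x)" using that \<Psi>(1) by (simp add: cstar_simps ts)
  qed (use that \<Psi>(1) in auto)
  define \<psi>' where "\<psi>' = (\<lambda>l i j. \<Psi> (basis_vec l) $$ (i,j))"
  have eq: "\<Psi> x = coord_map m \<psi>' x" if x: "x \<in> carrier X" for x
  proof (rule eq_matI)
    show "dim_row (\<Psi> x) = dim_row (coord_map m \<psi>' x)" "dim_col (\<Psi> x) = dim_col (coord_map m \<psi>' x)" using \<Psi>(1)[OF x] by (auto simp: coord_map_def)
    fix i j assume "i < dim_row (coord_map m \<psi>' x)" "j < dim_col (coord_map m \<psi>' x)"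
    hence ij: "i < m" "j < m" by (auto simp: coord_map_def)
    have "\<Psi> x $$ (i,j) = (\<Sum>l<d. co x l * \<Psi> (cb (\<lambda>k. if k = l then 1 else 0)) $$ (i,j))"
    proof (rule linear_expand[OF _ _ x, of "\<lambda>x. \<Psi> x $$ (i,j)"])
      show "\<Psi> (x \<oplus>\<^bsub>X\<^esub> y) $$ (i,j) = \<Psi> x $$ (i,j) + \<Psi> y $$ (i,j)" if "x \<in> carrier X" "y \<in> carrier X" for x y
        using add[OF that] \<Psi>(1)[OF that(1)] \<Psi>(1)[OF that(2)] ij by simp
      show "\<Psi> (c \<odot>\<^bsub>X\<^esub> x) $$ (i,j) = c * \<Psi> x $$ (i,j)" if "x \<in> carrier X" for c x
        using sm[OF that] \<Psi>(1)[OF that] ij by simp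
    qed
    thus "\<Psi> x $$ (i,j) = coord_map m \<psi>' x $$ (i,j)" using ij by (simp add: coord_map_simps \<psi>'_def basis_vec_def)
  qed
  have "K.ucp_co m \<psi>'" unfolding K.ucp_co_def
  proof (intro conjI allI ballI)
    show "K.unital m \<psi>'" unfolding K.unital_def
    proof (intro allI impI)
      fix i j assume ij: "i < m" "j < m"
      have "\<Psi> \<one>\<^bsub>X\<^esub> = 1\<^sub>m m" by (rule gi) (use one \<Psi> unit_closed in auto)
      hence "coord_map m \<psi>' \<one>\<^bsub>X\<^esub> $$ (i,j) = (if i = j then 1 else 0)" using eq[OF unit_closed] ij by simp
      thus "(\<Sum>l<d. unit_co l * \<psi>' l i j) = (if i = j then 1 else 0)" using ij by (simp add: coord_map_simps unit_co_def)
    qed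
    fix n A assume "A \<in> cone_co n"
    hence A: "mat_of n A \<in> mcone X n" by (simp add: cone_co_def)
    have e: "map_mat \<psi> (mat_of n A) = map_mat g (map_mat (coord_map m \<psi>') (mat_of n A))"
      by (rule eq_matI) (auto simp: mat_of_index \<Psi>(2) eq)
    have "map_mat (coord_map m \<psi>') (mat_of n A) \<in> mcone (cstar_opsys (mat_alg m)) n"
      using pos[OF A] unfolding e transport_cone[OF mat_alg_star_algebra g map_coord_map_mats[OF mat_of_mats]] .
    hence "K.amp_psd m \<psi>' n (arr_of (mat_of n A))" by (simp add: mat_cone_iff map_coord_map_psd)
    thus "K.amp_psd m \<psi>' n A" by (rule K.amp_psd_cong) (simp add: arr_of_def mat_of_index)
  qed
  thus ?thesis by (rule that) (simp add: \<Psi>(2) eq)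
qed

text \<open>
  Distances of maps are measured on the unit ball, which contains small multiples of the basis vectors.
\<close>

lemma basis_norm_bound:
  obtains R :: real where "R > 0" "\<And>l. l < d \<Longrightarrow> mnorm X (mat 1 1 (\<lambda>_. complex_of_real (1 / R) \<odot>\<^bsub>X\<^esub> basis_vec l)) \<le> 1"
proof -
  define a where "a l = (\<lambda>(i::nat) (j::nat) k. if k = l then 1 else 0 :: complex)" for l :: nat
  have "\<forall>l. \<exists>r>0. K.shift r (block_arr 1 0 (a l)) \<in> cone_co (1 + 1)" using K.herm_shift[OF block_arr_herm] by blast
  from choice[OF this] obtain r where r: "\<And>l. r l > 0" "\<And>l. K.shift (r l) (block_arr 1 0 (a l)) \<in> cone_co (1 + 1)" by blast
  define R where "R = 1 + (\<Sum>l<d. r l)"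
  have R: "R > 0" unfolding R_def using sum_nonneg[of "{..<d}" r, OF less_imp_le[OF r(1)]] by linarith
  have "mnorm X (mat 1 1 (\<lambda>_. complex_of_real (1 / R) \<odot>\<^bsub>X\<^esub> basis_vec l)) \<le> 1" if l: "l < d" for l
  proof -
    have "r l \<le> (\<Sum>l<d. r l)" by (rule member_le_sum) (use l less_imp_le[OF r(1)] in auto)
    hence "r l \<le> R" by (simp add: R_def)
    from K.shift_mono[OF r(2) this] have "K.shift R (block_arr 1 0 (a l)) \<in> cone_co (1 + 1)" .
    from K.shift_scale[OF this, of "1 / R"] R
    have c: "K.shift 1 (\<lambda>i j k. complex_of_real (1 / R) * block_arr 1 0 (a l) i j k) \<in> cone_co (1 + 1)" by simp
    have x: "mat 1 1 (\<lambda>_. complex_of_real (1 / R) \<odot>\<^bsub>X\<^esub> basis_vec l) \<in> mats X 1 1"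
      by (rule matsI) (auto simp: basis_vec_def)
    show ?thesis unfolding mnorm_le_iff_block[OF x]
      by (rule K.C_cong[OF c]) (auto simp: K.shift_def block_arr_def a_def arr_of_def basis_vec_def)
  qed
  with R show ?thesis by (rule that)
qed

text \<open>
  CP-stability is applied to \<open>\<phi>\<close> followed by the passage to a copy of \<open>M\<^sub>m\<close> on the prescribed type; the
  resulting u.c.p. map is read back in coordinates.
\<close>

lemma stable_of_cp_stable:
  assumes cp: "cp_stable TYPE('u) X" and fd: "fin_dim_opsys X"
  shows "K.stable"
  unfolding K.stable_def
proof (intro allI impI)
  fix \<delta> :: real assume \<delta>: "\<delta> > 0"
  obtain R where R: "R > 0" "\<And>l. l < d \<Longrightarrow> mnorm X (mat 1 1 (\<lambda>_. complex_of_real (1 / R) \<odot>\<^bsub>X\<^esub> basis_vec l)) \<le> 1"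
    using basis_norm_bound by blast
  (* the basis vectors are scaled by 1 / R to lie in the unit ball *)
  define \<delta>' where "\<delta>' = \<delta> / R"
  have \<delta>': "\<delta>' > 0" using \<delta> R by (simp add: \<delta>'_def)
  obtain k \<epsilon> where k: "k > 0" "(\<epsilon>::real) > 0" and
    st: "\<And>(A :: ('u + real) star_space) \<phi>. unital_cstar_algebra A \<Longrightarrow> unital_linear X (cstar_opsys A) \<phi> \<Longrightarrow>
       amp_norm X (cstar_opsys A) k \<phi> < ereal (1 + \<epsilon>) \<Longrightarrow>
       \<exists>\<psi>. ucp X (cstar_opsys A) \<psi> \<and> amp_norm X (cstar_opsys A) 1 (\<lambda>x. \<phi> x \<ominus>\<^bsub>A\<^esub> \<psi> x) < ereal \<delta>'"
    by (rule cp_stableD[OF cp fd \<delta>']) (rule that; assumption)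
  show "\<exists>n>0. \<exists>\<epsilon>>0. \<forall>m \<phi>. K.hermitian_map m \<phi> \<longrightarrow> K.unital m \<phi> \<longrightarrow>
     (\<forall>A\<in>cone_co n. K.shift 2 (K.neg A) \<in> cone_co n \<longrightarrow> K.amp_psd m \<phi> n (K.shift \<epsilon> A)) \<longrightarrow>
     (\<exists>\<psi>. K.ucp_co m \<psi> \<and> (\<forall>l<d. opbound {..<m} (\<lambda>i j. \<phi> l i j - \<psi> l i j) \<delta>))"
  (* blocks of k by k matrices have size 2k, and half of the tolerance keeps the norm strictly below 1 + \<epsilon> *)
  proof (rule exI[of _ "k + k"], rule conjI, use k in simp, rule exI[of _ "\<epsilon> / 2"], rule conjI, use k in simp, intro allI impI)
    fix m \<phi>
    assume \<phi>: "K.hermitian_map m \<phi>" "K.unital m \<phi>"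
      and pos: "\<forall>A\<in>cone_co (k + k). K.shift 2 (K.neg A) \<in> cone_co (k + k) \<longrightarrow> K.amp_psd m \<phi> (k + k) (K.shift (\<epsilon> / 2) A)"
    obtain g :: "complex mat \<Rightarrow> 'u + real" where
      g: "inj_on g (carrier (mat_alg m))" "unital_cstar_algebra (transport g (mat_alg m))"
      using matrix_copy_exists by blast
    note ts = transport_simps[OF mat_alg_star_algebra g(1), unfolded mat_alg_simps]
    define T where "T = transport g (mat_alg m)"
    have sT: "star_algebra T" unfolding T_def by (rule transport_star_algebra[OF mat_alg_star_algebra g(1)])
    have ul: "unital_linear X (cstar_opsys T) (\<lambda>x. g (coord_map m \<phi> x))"
      unfolding unital_linear_def
    proof
      show "linear_map class_ring X (cstar_opsys T) (\<lambda>x. g (coord_map m \<phi> x))"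
      proof (rule linear_mapI)
        show "vectorspace class_ring X" by (rule vectorspace_axioms)
        show "vectorspace class_ring (cstar_opsys T)"
          using cstar_vectorspace star_algebra.axioms(1)[OF sT] by blast
      qed (auto simp: cstar_simps T_def ts coord_map_simps)
      show "g (coord_map m \<phi> \<one>\<^bsub>X\<^esub>) = \<one>\<^bsub>cstar_opsys T\<^esub>"
        using coord_map_unital[OF \<phi>(2)] by (simp add: cstar_simps T_def ts)
    qed
    have "amp_norm X (cstar_opsys T) k (\<lambda>x. g (coord_map m \<phi> x)) \<le> ereal (1 + \<epsilon> / 2)"
      unfolding T_def by (rule amp_norm_bound[OF \<phi> _ _ g(1)]) (use k pos in auto)
    also have "\<dots> < ereal (1 + \<epsilon>)" using k by simp
    finally have an: "amp_norm X (cstar_opsys T) k (\<lambda>x. g (coord_map m \<phi> x)) < ereal (1 + \<epsilon>)" .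
    obtain \<psi>0 where \<psi>0: "ucp X (cstar_opsys T) \<psi>0"
      "amp_norm X (cstar_opsys T) 1 (\<lambda>x. g (coord_map m \<phi> x) \<ominus>\<^bsub>T\<^esub> \<psi>0 x) < ereal \<delta>'"
      using st[OF g(2)[folded T_def] ul an] by blast
    obtain \<psi> where \<psi>: "K.ucp_co m \<psi>" "\<And>x. x \<in> carrier X \<Longrightarrow> \<psi>0 x = g (coord_map m \<psi> x)"
      using transported_ucp_coordinates[OF g(1) \<psi>0(1)[unfolded T_def]] by blast
    have "opbound {..<m} (\<lambda>i j. \<phi> l i j - \<psi> l i j) \<delta>" if l: "l < d" for l
    proof -
      define y where "y = complex_of_real (1 / R) \<odot>\<^bsub>X\<^esub> basis_vec l"
      have y: "y \<in> carrier X" by (simp add: y_def basis_vec_def)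
      define z where "z = mat 1 1 (\<lambda>_::nat\<times>nat. coord_map m \<phi> y - coord_map m \<psi> y)"
      have z: "z \<in> carrier_mat 1 1" "z $$ (0,0) \<in> carrier_mat m m" "z \<in> mats (mat_alg m) 1 1"
        by (auto simp: z_def coord_map_simps mat_alg_simps intro!: matsI minus_carrier_mat coord_map_simps(1))
      define D where "D = (\<lambda>x. g (coord_map m \<phi> x) \<ominus>\<^bsub>T\<^esub> \<psi>0 x)"
      have Dy: "D y = g (coord_map m \<phi> y - coord_map m \<psi> y)"
        unfolding D_def T_def \<psi>(2)[OF y]
        by (subst transport_minus[OF mat_alg_star_algebra g(1)]) (auto simp: mat_alg_simps coord_map_simps mat_alg_minus)
      have mz: "map_mat D (mat 1 1 (\<lambda>_. y)) = map_mat g z" by (rule eq_matI) (auto simp: z_def Dy)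
      have "mat 1 1 (\<lambda>_. y) \<in> {x \<in> mats X 1 1. mnorm X x \<le> 1}"
        using R(2)[OF l] y by (auto simp: y_def intro!: matsI)
      hence "ereal (mnorm (cstar_opsys T) (map_mat D (mat 1 1 (\<lambda>_. y)))) \<le> amp_norm X (cstar_opsys T) 1 D"
        unfolding amp_norm_def by (rule SUP_upper)
      also have "\<dots> < ereal \<delta>'" using \<psi>0(2) by (simp add: D_def)
      finally have lt: "mnorm (cstar_opsys T) (map_mat g z) < \<delta>'" unfolding mz by simp
      define S where "S = {r. 0 \<le> r \<and> mat_psd m (1 + 1) (block (mat_alg m) mat_adjoint r z)}"
      have "Inf S < \<delta>'" using lt unfolding T_def transport_mnorm[OF g(1) z(3)] S_def .
      moreover have "S \<noteq> {}"
      proof -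
        define c where "c = 1 + real m * (\<Sum>i<m. \<Sum>j<m. cmod (z $$ (0,0) $$ (i,j)))"
        have c0: "0 \<le> real m * (\<Sum>i<m. \<Sum>j<m. cmod (z $$ (0,0) $$ (i,j)))" by (intro mult_nonneg_nonneg sum_nonneg) auto
        have "mat_psd m 2 (block (mat_alg m) mat_adjoint c z)"
        proof (rule block_of_opbound[OF z(1,2)])
          show "c > 0" using c0 by (simp add: c_def)
          fix f
          have "norm_sq m (mapply m (z $$ (0,0)) f) \<le> (real m * (\<Sum>i<m. \<Sum>j<m. cmod (z $$ (0,0) $$ (i,j))))\<^sup>2 * norm_sq m f"
            by (rule op_norm_crude)
          also have "\<dots> \<le> c\<^sup>2 * norm_sq m f" using c0 by (intro mult_right_mono power_mono) (auto simp: c_def)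
          finally show "norm_sq m (mapply m (z $$ (0,0)) f) \<le> c\<^sup>2 * norm_sq m f" .
        qed
        hence "c \<in> S" using c0 by (simp add: S_def c_def numeral_2_eq_2)
        thus ?thesis by blast
      qed
      ultimately obtain c where c: "c \<in> S" "c < \<delta>'" using cInf_lessD by blast
      have ob: "norm_sq m (mapply m (z $$ (0,0)) f) \<le> \<delta>'\<^sup>2 * norm_sq m f" for f
        by (rule opbound_of_block[OF z(1,2)]) (use c in \<open>auto simp: S_def numeral_2_eq_2\<close>)
      have ze: "z $$ (0,0) $$ (i,j) = complex_of_real (1 / R) * (\<phi> l i j - \<psi> l i j)" if "i < m" "j < m" for i j
      proof -
        have "coord_map m \<chi> y $$ (i,j) = complex_of_real (1 / R) * \<chi> l i j" for \<chi>
        proof -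
          have "coord_map m \<chi> y $$ (i,j) = (\<Sum>k<d. if k = l then complex_of_real (1 / R) * \<chi> k i j else 0)"
            unfolding coord_map_simps(4)[OF that] by (intro sum.cong refl) (auto simp: y_def basis_vec_def)
          thus ?thesis using l by simp
        qed
        thus ?thesis using that by (simp add: z_def coord_map_def right_diff_distrib diff_divide_distrib)
      qed
      show ?thesis unfolding opbound_def
      proof
        fix f :: "nat \<Rightarrow> complex"
        have "norm_sq m (mapply m (z $$ (0,0)) f) = (\<Sum>i<m. (cmod (complex_of_real (1 / R) * (\<Sum>j<m. (\<phi> l i j - \<psi> l i j) * f j)))\<^sup>2)"
          unfolding norm_sq_def
        proof (intro sum.cong refl)
          fix i assume i: "i \<in> {..<m}"
          have "mapply m (z $$ (0,0)) f i = complex_of_real (1 / R) * (\<Sum>j<m. (\<phi> l i j - \<psi> l i j) * f j)"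
            unfolding mapply_def sum_distrib_left by (intro sum.cong refl) (use i in \<open>simp add: ze mult.assoc\<close>)
          thus "(cmod (mapply m (z $$ (0,0)) f i))\<^sup>2 = (cmod (complex_of_real (1 / R) * (\<Sum>j<m. (\<phi> l i j - \<psi> l i j) * f j)))\<^sup>2" by simp
        qed
        also have "\<dots> = (1 / R)\<^sup>2 * (\<Sum>i<m. (cmod (\<Sum>j<m. (\<phi> l i j - \<psi> l i j) * f j))\<^sup>2)"
          using R(1) unfolding norm_mult power_mult_distrib sum_distrib_left[symmetric] norm_of_real by simp
        finally have "(1 / R)\<^sup>2 * (\<Sum>i<m. (cmod (\<Sum>j<m. (\<phi> l i j - \<psi> l i j) * f j))\<^sup>2) \<le> (1 / R)\<^sup>2 * (\<delta>\<^sup>2 * norm_sq m f)"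
          using ob[of f] by (simp add: \<delta>'_def power_divide)
        thus "(\<Sum>i<m. (cmod (\<Sum>j<m. (\<phi> l i j - \<psi> l i j) * f j))\<^sup>2) \<le> \<delta>\<^sup>2 * (\<Sum>j<m. (cmod (f j))\<^sup>2)"
          using R(1) by (simp add: norm_sq_def)
      qed
    qed
    thus "\<exists>\<psi>. K.ucp_co m \<psi> \<and> (\<forall>l<d. opbound {..<m} (\<lambda>i j. \<phi> l i j - \<psi> l i j) \<delta>)" using \<psi>(1) by blast
  qed
qed

end

section \<open>Square-summable sequences\<close>

lemma ell2_norm_nonneg[simp]: "0 \<le> ell2_norm f" if "f \<in> ell2"
  using that by (simp add: ell2_norm_def ell2_def suminf_nonneg)

lemma ell2_norm_sums:
  assumes "f \<in> ell2" shows "(\<lambda>n. (cmod (f n))\<^sup>2) sums (ell2_norm f)\<^sup>2"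
  using assms by (simp add: ell2_norm_def ell2_def suminf_nonneg summable_sums)

lemma ell2_sum_le: "f \<in> ell2 \<Longrightarrow> (\<Sum>n<N. (cmod (f n))\<^sup>2) \<le> (ell2_norm f)\<^sup>2"
  using ell2_norm_sums[of f] sum_le_suminf[of "\<lambda>n. (cmod (f n))\<^sup>2" "{..<N}"] by (auto simp: sums_iff)

lemma ell2_coord_le: "f \<in> ell2 \<Longrightarrow> cmod (f s) \<le> ell2_norm f"
proof (rule power2_le_imp_le)
  assume f: "f \<in> ell2"
  have "(cmod (f s))\<^sup>2 \<le> (\<Sum>n<Suc s. (cmod (f n))\<^sup>2)" by (simp add: sum_nonneg)
  also have "\<dots> \<le> (ell2_norm f)\<^sup>2" by (rule ell2_sum_le[OF f])
  finally show "(cmod (f s))\<^sup>2 \<le> (ell2_norm f)\<^sup>2" .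
qed simp

lemma ell2I:
  assumes "\<And>N. (\<Sum>n<N. (cmod (f n))\<^sup>2) \<le> C"
  shows "f \<in> ell2" and "(ell2_norm f)\<^sup>2 \<le> C"
proof -
  have s: "summable (\<lambda>n. (cmod (f n))\<^sup>2)" by (rule summableI_nonneg_bounded[OF _ assms]) simp
  thus f: "f \<in> ell2" by (simp add: ell2_def)
  have "(\<Sum>n. (cmod (f n))\<^sup>2) \<le> C" by (rule suminf_le_const[OF s assms])
  thus "(ell2_norm f)\<^sup>2 \<le> C" using ell2_norm_sums[OF f] by (simp add: sums_iff)
qed

lemma sum_cmod_add_sq: "(\<Sum>n<N. (cmod (f n + g n))\<^sup>2) \<le> 2 * (\<Sum>n<N. (cmod (f n))\<^sup>2) + 2 * (\<Sum>n<N. (cmod (g n))\<^sup>2)"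
proof -
  have "(cmod (a + b))\<^sup>2 \<le> 2 * (cmod a)\<^sup>2 + 2 * (cmod b)\<^sup>2" for a b :: complex
  proof -
    have "(cmod (a + b))\<^sup>2 \<le> (cmod a + cmod b)\<^sup>2" by (intro power_mono norm_triangle_ineq) simp
    also have "\<dots> \<le> 2 * (cmod a)\<^sup>2 + 2 * (cmod b)\<^sup>2"
      using zero_le_power2[of "cmod a - cmod b"] unfolding power2_sum power2_diff by linarith
    finally show ?thesis .
  qed
  hence "(\<Sum>n<N. (cmod (f n + g n))\<^sup>2) \<le> (\<Sum>n<N. 2 * (cmod (f n))\<^sup>2 + 2 * (cmod (g n))\<^sup>2)" by (intro sum_mono)
  thus ?thesis by (simp add: sum.distrib sum_distrib_left)
qed

lemma ell2_add[simp]: "f \<in> ell2 \<Longrightarrow> g \<in> ell2 \<Longrightarrow> (\<lambda>n. f n + g n) \<in> ell2"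
proof (rule ell2I(1)[of _ "2 * (ell2_norm f)\<^sup>2 + 2 * (ell2_norm g)\<^sup>2"])
  fix N assume "f \<in> ell2" "g \<in> ell2"
  hence "2 * (\<Sum>n<N. (cmod (f n))\<^sup>2) + 2 * (\<Sum>n<N. (cmod (g n))\<^sup>2) \<le> 2 * (ell2_norm f)\<^sup>2 + 2 * (ell2_norm g)\<^sup>2"
    by (intro add_mono mult_left_mono ell2_sum_le) auto
  thus "(\<Sum>n<N. (cmod (f n + g n))\<^sup>2) \<le> 2 * (ell2_norm f)\<^sup>2 + 2 * (ell2_norm g)\<^sup>2"
    using sum_cmod_add_sq[of f g N] by linarith
qed

lemma ell2_scale[simp]: "f \<in> ell2 \<Longrightarrow> (\<lambda>n. c * f n) \<in> ell2"
  by (simp add: ell2_def norm_mult power_mult_distrib summable_mult)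

lemma ell2_zero[simp]: "(\<lambda>n. 0) \<in> ell2" by (simp add: ell2_def)

lemma ell2_finite: "(\<And>n. n \<ge> N \<Longrightarrow> f n = 0) \<Longrightarrow> f \<in> ell2"
  unfolding ell2_def by (auto intro!: summable_finite[of "{..<N}"]) (metis not_less)

lemma ell2_inner_sums:
  assumes f: "f \<in> ell2" and g: "g \<in> ell2"
  shows "(\<lambda>n. f n * cnj (g n)) sums ell2_inner f g" and "cmod (ell2_inner f g) \<le> ell2_norm f * ell2_norm g"
proof -
  have b: "(\<Sum>n<N. cmod (f n * cnj (g n))) \<le> ell2_norm f * ell2_norm g" for N
  proof -
    have l: "L2_set (\<lambda>n. cmod (h n)) {..<N} \<le> ell2_norm h" if "h \<in> ell2" for h
      unfolding L2_set_def by (intro real_le_lsqrt ell2_sum_le ell2_norm_nonneg that)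
    have "(\<Sum>n<N. cmod (f n * cnj (g n))) = (\<Sum>n<N. \<bar>cmod (f n)\<bar> * \<bar>cmod (g n)\<bar>)" by (simp add: norm_mult)
    also have "\<dots> \<le> L2_set (\<lambda>n. cmod (f n)) {..<N} * L2_set (\<lambda>n. cmod (g n)) {..<N}" by (rule L2_set_mult_ineq)
    also have "\<dots> \<le> ell2_norm f * ell2_norm g" by (intro mult_mono l f g ell2_norm_nonneg L2_set_nonneg)
    finally show ?thesis .
  qed
  have s: "summable (\<lambda>n. cmod (f n * cnj (g n)))" by (rule summableI_nonneg_bounded[OF _ b]) simp
  from summable_norm_cancel[OF s] show "(\<lambda>n. f n * cnj (g n)) sums ell2_inner f g"
    by (simp add: ell2_inner_def summable_sums)
  have "cmod (ell2_inner f g) \<le> (\<Sum>n. cmod (f n * cnj (g n)))" unfolding ell2_inner_def by (rule summable_norm[OF s])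
  also have "\<dots> \<le> ell2_norm f * ell2_norm g" by (rule suminf_le_const[OF s b])
  finally show "cmod (ell2_inner f g) \<le> ell2_norm f * ell2_norm g" .
qed

definition std_vec :: "nat \<Rightarrow> nat \<Rightarrow> complex" where "std_vec t = (\<lambda>n. if n = t then 1 else 0)"

lemma std_vec_ell2[simp]: "std_vec t \<in> ell2"
  by (rule ell2_finite[of "Suc t"]) (simp add: std_vec_def)

lemma inner_std_vec: "ell2_inner f (std_vec s) = f s" "ell2_inner (std_vec s) g = cnj (g s)"
proof -
  have "(\<lambda>n. f n * cnj (std_vec s n)) = (\<lambda>n. if n = s then f s else 0)" by (auto simp: std_vec_def)
  thus "ell2_inner f (std_vec s) = f s" unfolding ell2_inner_def using sums_single[of s "\<lambda>n. f s"] by (simp add: sums_iff)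
  have "(\<lambda>n. std_vec s n * cnj (g n)) = (\<lambda>n. if n = s then cnj (g s) else 0)" by (auto simp: std_vec_def)
  thus "ell2_inner (std_vec s) g = cnj (g s)" unfolding ell2_inner_def using sums_single[of s "\<lambda>n. cnj (g s)"] by (simp add: sums_iff)
qed

text \<open>
  The first part holds on finitely supported sequences and extends by continuity. For the second, evaluate \<open>L\<close>
  at the sequence of the conjugated coefficients, cut off at \<open>N\<close>.
\<close>

lemma ell2_functional:
  assumes add: "\<And>f g. f \<in> ell2 \<Longrightarrow> g \<in> ell2 \<Longrightarrow> L (\<lambda>n. f n + g n) = L f + L g"
    and scale: "\<And>c f. f \<in> ell2 \<Longrightarrow> L (\<lambda>n. c * f n) = c * L f"
    and bound: "\<And>f. f \<in> ell2 \<Longrightarrow> cmod (L f) \<le> K * ell2_norm f"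
  shows "f \<in> ell2 \<Longrightarrow> (\<lambda>t. L (std_vec t) * f t) sums L f"
    and "(\<Sum>t<N. (cmod (L (std_vec t)))\<^sup>2) \<le> K\<^sup>2"
proof -
  define tr where "tr f N = (\<lambda>n. if n < N then f n else 0 :: complex)" for f and N :: nat
  have tr: "tr f N \<in> ell2" for f N by (rule ell2_finite[of N]) (simp add: tr_def)
  have Ltr: "L (tr f N) = (\<Sum>t<N. L (std_vec t) * f t)" for f N
  proof (induction N)
    case 0
    have "L (\<lambda>n. 0 * 0) = 0 * L (\<lambda>n. 0)" by (rule scale) simp
    thus ?case by (simp add: tr_def)
  next
    case (Suc N)
    have "tr f (Suc N) = (\<lambda>n. tr f N n + f N * std_vec N n)"
      by (auto simp: tr_def std_vec_def less_Suc_eq)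
    thus ?case using Suc by (simp add: add tr scale)
  qed
  {
    assume f: "f \<in> ell2"
    (* the tails of f, whose norm tends to zero *)
    define ta where "ta N = (\<lambda>n. if n < N then 0 else f n)" for N
    have ta: "ta N \<in> ell2" "(ell2_norm (ta N))\<^sup>2 = (ell2_norm f)\<^sup>2 - (\<Sum>n<N. (cmod (f n))\<^sup>2)" for N
    proof -
      have "(\<lambda>n. (cmod (f n))\<^sup>2 - (if n \<in> {..<N} then (cmod (f n))\<^sup>2 else 0)) sums ((ell2_norm f)\<^sup>2 - (\<Sum>n<N. (cmod (f n))\<^sup>2))"
        by (intro sums_diff ell2_norm_sums[OF f] sums_If_finite_set) simp
      also have "(\<lambda>n. (cmod (f n))\<^sup>2 - (if n \<in> {..<N} then (cmod (f n))\<^sup>2 else 0)) = (\<lambda>n. (cmod (ta N n))\<^sup>2)"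
        by (auto simp: ta_def)
      finally have s: "(\<lambda>n. (cmod (ta N n))\<^sup>2) sums ((ell2_norm f)\<^sup>2 - (\<Sum>n<N. (cmod (f n))\<^sup>2))" .
      show t: "ta N \<in> ell2" using s by (auto simp: ell2_def sums_iff)
      show "(ell2_norm (ta N))\<^sup>2 = (ell2_norm f)\<^sup>2 - (\<Sum>n<N. (cmod (f n))\<^sup>2)"
        using sums_unique2[OF ell2_norm_sums[OF t] s] .
    qed
    have "(\<lambda>N. (ell2_norm (ta N))\<^sup>2) \<longlonglongrightarrow> (ell2_norm f)\<^sup>2 - (ell2_norm f)\<^sup>2"
      unfolding ta(2) by (intro tendsto_intros ell2_norm_sums[OF f, unfolded sums_def])
    hence "(\<lambda>N. sqrt ((ell2_norm (ta N))\<^sup>2)) \<longlonglongrightarrow> sqrt 0" by (intro tendsto_real_sqrt) simp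
    hence "(\<lambda>N. ell2_norm (ta N)) \<longlonglongrightarrow> 0" using ta(1) by simp
    hence z: "(\<lambda>N. K * ell2_norm (ta N)) \<longlonglongrightarrow> 0" by (rule tendsto_mult_right_zero)
    have Lf: "L f = (\<Sum>t<N. L (std_vec t) * f t) + L (ta N)" for N
    proof -
      have "f = (\<lambda>n. tr f N n + ta N n)" by (auto simp: tr_def ta_def)
      hence "L f = L (\<lambda>n. tr f N n + ta N n)" by simp
      thus ?thesis by (simp add: add[OF tr ta(1)] Ltr)
    qed
    have "(\<lambda>N. cmod (L (ta N))) \<longlonglongrightarrow> 0"
      by (rule tendsto_sandwich[OF _ _ tendsto_const z]) (use bound ta(1) in auto)
    hence "(\<lambda>N. L (ta N)) \<longlonglongrightarrow> 0" by (rule tendsto_norm_zero_cancel)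
    hence "(\<lambda>N. L f - L (ta N)) \<longlonglongrightarrow> L f - 0" by (intro tendsto_intros)
    moreover have "(\<lambda>N. L f - L (ta N)) = (\<lambda>N. \<Sum>t<N. L (std_vec t) * f t)" using Lf by (auto simp: algebra_simps)
    ultimately show "(\<lambda>t. L (std_vec t) * f t) sums L f" by (simp add: sums_def)
  }
  define h where "h = (\<lambda>t. cnj (L (std_vec t)))"
  define S where "S = (\<Sum>t<N. (cmod (L (std_vec t)))\<^sup>2)"
  have S0: "S \<ge> 0" by (simp add: S_def sum_nonneg)
  have "L (tr h N) = complex_of_real S"
    unfolding Ltr S_def of_real_sum by (intro sum.cong refl) (simp add: h_def cmod_sq)
  hence "S = cmod (L (tr h N))" using S0 by simp
  also have "\<dots> \<le> K * ell2_norm (tr h N)" by (rule bound[OF tr])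
  finally have a: "S \<le> K * ell2_norm (tr h N)" .
  have "(\<lambda>n. if n \<in> {..<N} then (cmod (L (std_vec n)))\<^sup>2 else 0) sums S" unfolding S_def by (rule sums_If_finite_set) simp
  also have "(\<lambda>n. if n \<in> {..<N} then (cmod (L (std_vec n)))\<^sup>2 else 0) = (\<lambda>n. (cmod (tr h N n))\<^sup>2)"
    by (auto simp: tr_def h_def)
  finally have "(ell2_norm (tr h N))\<^sup>2 = S" using sums_unique2[OF ell2_norm_sums[OF tr]] by simp
  moreover have "S\<^sup>2 \<le> (K * ell2_norm (tr h N))\<^sup>2" using a S0 by (intro power_mono)
  ultimately have "S * S \<le> K\<^sup>2 * S" by (metis power_mult_distrib power2_eq_square)
  thus "(\<Sum>t<N. (cmod (L (std_vec t)))\<^sup>2) \<le> K\<^sup>2"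
    unfolding S_def[symmetric] using S0 by (cases "S = 0") auto
qed

section \<open>Bounded operators on the sequence space and their matrices\<close>

lemma bounded_opsI:
  assumes "\<And>f. f \<notin> ell2 \<Longrightarrow> T f = undefined"
    and "\<And>f g. f \<in> ell2 \<Longrightarrow> g \<in> ell2 \<Longrightarrow> T (\<lambda>n. f n + g n) = (\<lambda>n. T f n + T g n)"
    and "\<And>c f. f \<in> ell2 \<Longrightarrow> T (\<lambda>n. c * f n) = (\<lambda>n. c * T f n)"
    and "\<And>f N. f \<in> ell2 \<Longrightarrow> (\<Sum>n<N. (cmod (T f n))\<^sup>2) \<le> K * (ell2_norm f)\<^sup>2" and "K \<ge> 0"
  shows "T \<in> bounded_ops"
proof -
  have "ell2_norm (T f) \<le> sqrt K * ell2_norm f" if "f \<in> ell2" for f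
    using real_le_rsqrt[OF ell2I(2)[of "T f", OF assms(4)[OF that]]] that by (simp add: real_sqrt_mult)
  moreover have "T f \<in> ell2" if "f \<in> ell2" for f using ell2I(1)[of "T f", OF assms(4)[OF that]] .
  ultimately show ?thesis unfolding bounded_ops_def PiE_def extensional_def using assms(1-3) by blast
qed

lemma bounded_opsD:
  assumes "T \<in> bounded_ops"
  shows "f \<in> ell2 \<Longrightarrow> T f \<in> ell2"
    and "f \<notin> ell2 \<Longrightarrow> T f = undefined"
    and "f \<in> ell2 \<Longrightarrow> g \<in> ell2 \<Longrightarrow> T (\<lambda>n. f n + g n) = (\<lambda>n. T f n + T g n)"
    and "f \<in> ell2 \<Longrightarrow> T (\<lambda>n. c * f n) = (\<lambda>n. c * T f n)"
  using assms unfolding bounded_ops_def PiE_def extensional_def by blast+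

lemma bounded_ops_bound:
  assumes "T \<in> bounded_ops"
  obtains K where "K > 0" "\<And>f. f \<in> ell2 \<Longrightarrow> ell2_norm (T f) \<le> K * ell2_norm f"
proof -
  obtain C where C: "\<And>f. f \<in> ell2 \<Longrightarrow> ell2_norm (T f) \<le> C * ell2_norm f"
    using assms unfolding bounded_ops_def by blast
  show ?thesis
  proof (rule that[of "\<bar>C\<bar> + 1"])
    fix f assume f: "f \<in> ell2"
    have "C * ell2_norm f \<le> (\<bar>C\<bar> + 1) * ell2_norm f" by (intro mult_right_mono) (use f in auto)
    thus "ell2_norm (T f) \<le> (\<bar>C\<bar> + 1) * ell2_norm f" using C[OF f] by linarith
  qed simp
qed

definition entry :: "((nat \<Rightarrow> complex) \<Rightarrow> nat \<Rightarrow> complex) \<Rightarrow> nat \<Rightarrow> nat \<Rightarrow> complex" where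
  "entry T s t = T (std_vec t) s"

lemma entry_expand:
  assumes T: "T \<in> bounded_ops" and f: "f \<in> ell2"
  shows "(\<lambda>t. entry T s t * f t) sums T f s"
proof -
  obtain K where K: "K > 0" "\<And>f. f \<in> ell2 \<Longrightarrow> ell2_norm (T f) \<le> K * ell2_norm f"
    using bounded_ops_bound[OF T] by blast
  show ?thesis unfolding entry_def
  proof (rule ell2_functional(1)[where L = "\<lambda>f. T f s" and K = K])
    fix f assume f: "f \<in> ell2"
    show "cmod (T f s) \<le> K * ell2_norm f"
      using ell2_coord_le[OF bounded_opsD(1)[OF T f], of s] K(2)[OF f] by linarith
  qed (use f bounded_opsD(3,4)[OF T] in auto)
qed

lemma bounded_ops_eqI:
  assumes "T \<in> bounded_ops" "U \<in> bounded_ops" "\<And>f. f \<in> ell2 \<Longrightarrow> T f = U f" shows "T = U"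
proof
  fix f show "T f = U f" using assms(3) bounded_opsD(2)[OF assms(1)] bounded_opsD(2)[OF assms(2)] by (cases "f \<in> ell2") auto
qed

lemma entry_eqI:
  assumes T: "T \<in> bounded_ops" and U: "U \<in> bounded_ops" and e: "\<And>s t. entry T s t = entry U s t"
  shows "T = U"
proof (rule bounded_ops_eqI[OF T U])
  fix f assume f: "f \<in> ell2"
  show "T f = U f"
  proof
    fix s show "T f s = U f s"
      using sums_unique2[OF entry_expand[OF T f, of s]] entry_expand[OF U f, of s] by (simp add: e)
  qed
qed

lemma entry_opbound:
  assumes T: "T \<in> bounded_ops"
  obtains K where "K > 0" "\<And>N. opbound {..<N} (entry T) K"
proof -
  obtain K where K: "K > 0" "\<And>f. f \<in> ell2 \<Longrightarrow> ell2_norm (T f) \<le> K * ell2_norm f"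
    using bounded_ops_bound[OF T] by blast
  have "opbound {..<N} (entry T) K" for N unfolding opbound_def
  proof
    fix f :: "nat \<Rightarrow> complex"
    define g where "g = (\<lambda>n. if n \<in> {..<N} then f n else 0)"
    have g: "g \<in> ell2" by (rule ell2_finite[of N]) (simp add: g_def)
    have "T g s = (\<Sum>t<N. entry T s t * f t)" for s
    proof -
      have "(\<lambda>t. if t \<in> {..<N} then entry T s t * f t else 0) sums (\<Sum>t<N. entry T s t * f t)"
        by (rule sums_If_finite_set) simp
      also have "(\<lambda>t. if t \<in> {..<N} then entry T s t * f t else 0) = (\<lambda>t. entry T s t * g t)" by (auto simp: g_def)
      finally show ?thesis using sums_unique2[OF entry_expand[OF T g, of s]] by simp
    qed
    hence "(\<Sum>s<N. (cmod (\<Sum>t<N. entry T s t * f t))\<^sup>2) = (\<Sum>s<N. (cmod (T g s))\<^sup>2)" by simp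
    also have "\<dots> \<le> (ell2_norm (T g))\<^sup>2" by (rule ell2_sum_le[OF bounded_opsD(1)[OF T g]])
    also have "\<dots> \<le> (K * ell2_norm g)\<^sup>2" by (rule power_mono[OF K(2)[OF g] ell2_norm_nonneg[OF bounded_opsD(1)[OF T g]]])
    also have "(ell2_norm g)\<^sup>2 = (\<Sum>t<N. (cmod (f t))\<^sup>2)"
    proof -
      have "(\<lambda>n. if n \<in> {..<N} then (cmod (f n))\<^sup>2 else 0) sums (\<Sum>t<N. (cmod (f t))\<^sup>2)" by (rule sums_If_finite_set) simp
      also have "(\<lambda>n. if n \<in> {..<N} then (cmod (f n))\<^sup>2 else 0) = (\<lambda>n. (cmod (g n))\<^sup>2)" by (auto simp: g_def)
      finally show ?thesis using sums_unique2[OF ell2_norm_sums[OF g]] by simp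
    qed
    hence "(K * ell2_norm g)\<^sup>2 = K\<^sup>2 * (\<Sum>t<N. (cmod (f t))\<^sup>2)" by (simp add: power_mult_distrib)
    finally show "(\<Sum>s<N. (cmod (\<Sum>t<N. entry T s t * f t))\<^sup>2) \<le> K\<^sup>2 * (\<Sum>t<N. (cmod (f t))\<^sup>2)" .
  qed
  with K(1) show ?thesis by (rule that)
qed

text \<open>
  Testing the hypothesis on the conjugate of a row shows that the rows are square-summable, so the
  series that define \<open>T f\<close> converge.
\<close>

lemma operator_of_matrix:
  assumes c: "c \<ge> 0" and M: "\<And>N f. (\<Sum>s<N. (cmod (\<Sum>t<N. M s t * f t))\<^sup>2) \<le> c * (\<Sum>t<N. (cmod (f t))\<^sup>2)"
  obtains T where "T \<in> bounded_ops" "\<And>s t. entry T s t = M s t"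
proof -
  have row: "(\<lambda>t. cnj (M s t)) \<in> ell2" for s
  proof (rule ell2I(1)[of _ c])
    fix N
    define n where "n = max N (Suc s)"
    define S where "S = (\<Sum>t<n. (cmod (M s t))\<^sup>2)"
    have S0: "S \<ge> 0" by (simp add: S_def sum_nonneg)
    have e: "(\<Sum>t<n. M s t * cnj (M s t)) = complex_of_real S"
      unfolding S_def of_real_sum by (intro sum.cong refl) (simp add: cmod_sq)
    have "(cmod (\<Sum>t<n. M s t * cnj (M s t)))\<^sup>2 \<le> (\<Sum>s<n. (cmod (\<Sum>t<n. M s t * cnj (M u t)))\<^sup>2)" if "u = s" for u
      unfolding that by (rule member_le_sum) (auto simp: n_def)
    also have "(\<Sum>s<n. (cmod (\<Sum>t<n. M s t * cnj (M u t)))\<^sup>2) \<le> c * (\<Sum>t<n. (cmod (cnj (M u t)))\<^sup>2)" for u by (rule M)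
    finally have "(cmod (\<Sum>t<n. M s t * cnj (M s t)))\<^sup>2 \<le> c * S" by (simp add: S_def)
    hence "S * S \<le> c * S" unfolding e using S0 by (simp add: power2_eq_square)
    hence "S \<le> c" using S0 c by (cases "S = 0") auto
    moreover have "(\<Sum>t<N. (cmod (cnj (M s t)))\<^sup>2) \<le> S"
      unfolding S_def by (subst complex_mod_cnj, rule sum_mono2) (auto simp: n_def)
    ultimately show "(\<Sum>t<N. (cmod (cnj (M s t)))\<^sup>2) \<le> c" by linarith
  qed
  define T where "T = (\<lambda>f\<in>ell2. \<lambda>s. \<Sum>t. M s t * f t)"
  have sm: "summable (\<lambda>t. M s t * f t)" if "f \<in> ell2" for f s
    using ell2_inner_sums(1)[OF that row[of s]] by (auto simp: sums_iff mult.commute)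
  have T: "T \<in> bounded_ops"
  proof (rule bounded_opsI[OF _ _ _ _ c])
    show "T (\<lambda>n. f n + g n) = (\<lambda>n. T f n + T g n)" if "f \<in> ell2" "g \<in> ell2" for f g
      using that suminf_add[OF sm[OF that(1)] sm[OF that(2)]] by (auto simp: T_def distrib_left)
    show "T (\<lambda>n. z * f n) = (\<lambda>n. z * T f n)" if "f \<in> ell2" for f z
      using that suminf_mult[OF sm[OF that], of z] by (auto simp: T_def mult.left_commute)
    fix f N assume f: "f \<in> ell2"
    have "(\<lambda>n. \<Sum>s<N. (cmod (\<Sum>t<n. M s t * f t))\<^sup>2) \<longlonglongrightarrow> (\<Sum>s<N. (cmod (\<Sum>t. M s t * f t))\<^sup>2)"
      by (intro tendsto_intros summable_LIMSEQ sm f)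
    moreover have "(\<Sum>s<N. (cmod (\<Sum>t<n. M s t * f t))\<^sup>2) \<le> c * (ell2_norm f)\<^sup>2" if "n \<ge> N" for n
    proof -
      have "(\<Sum>s<N. (cmod (\<Sum>t<n. M s t * f t))\<^sup>2) \<le> (\<Sum>s<n. (cmod (\<Sum>t<n. M s t * f t))\<^sup>2)"
        by (rule sum_mono2) (use that in auto)
      also have "\<dots> \<le> c * (\<Sum>t<n. (cmod (f t))\<^sup>2)" by (rule M)
      also have "\<dots> \<le> c * (ell2_norm f)\<^sup>2" by (intro mult_left_mono ell2_sum_le f c)
      finally show ?thesis .
    qed
    ultimately have "(\<Sum>s<N. (cmod (\<Sum>t. M s t * f t))\<^sup>2) \<le> c * (ell2_norm f)\<^sup>2"
      by (intro LIMSEQ_le_const2) auto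
    thus "(\<Sum>s<N. (cmod (T f s))\<^sup>2) \<le> c * (ell2_norm f)\<^sup>2" using f by (simp add: T_def)
  qed (simp add: T_def)
  moreover have "entry T s t = M s t" for s t
  proof -
    have "(\<lambda>u. M s u * std_vec t u) = (\<lambda>u. if u = t then M s t else 0)" by (auto simp: std_vec_def)
    thus ?thesis using sums_single[of t "\<lambda>_. M s t"] by (simp add: entry_def T_def sums_iff)
  qed
  ultimately show ?thesis by (rule that)
qed

text \<open>
  For fixed \<open>g\<close>, the functional \<open>f \<mapsto> \<langle>T f, g\<rangle>\<close> has square-summable coefficients by \<open>ell2_functional\<close>; their
  conjugates form the value of the adjoint at \<open>g\<close>.
\<close>

lemma adjoint_exists:
  assumes T: "T \<in> bounded_ops"
  obtains U where "U \<in> bounded_ops" "\<And>f g. f \<in> ell2 \<Longrightarrow> g \<in> ell2 \<Longrightarrow> ell2_inner (T f) g = ell2_inner f (U g)"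
proof -
  obtain K where K: "K > 0" "\<And>f. f \<in> ell2 \<Longrightarrow> ell2_norm (T f) \<le> K * ell2_norm f"
    using bounded_ops_bound[OF T] by blast
  note Tc = bounded_opsD(1)[OF T]
  define U where "U = (\<lambda>g\<in>ell2. \<lambda>t. cnj (ell2_inner (T (std_vec t)) g))"
  have ia: "ell2_inner (\<lambda>n. f n + f' n) g = ell2_inner f g + ell2_inner f' g" if "f \<in> ell2" "f' \<in> ell2" "g \<in> ell2" for f f' g
    using sums_add[OF ell2_inner_sums(1)[OF that(1,3)] ell2_inner_sums(1)[OF that(2,3)]]
    by (simp add: ell2_inner_def distrib_right sums_iff)
  have ia': "ell2_inner g (\<lambda>n. f n + f' n) = ell2_inner g f + ell2_inner g f'" if "f \<in> ell2" "f' \<in> ell2" "g \<in> ell2" for f f' g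
    using sums_add[OF ell2_inner_sums(1)[OF that(3,1)] ell2_inner_sums(1)[OF that(3,2)]]
    by (simp add: ell2_inner_def distrib_left sums_iff)
  have isc: "ell2_inner (\<lambda>n. c * f n) g = c * ell2_inner f g" if "f \<in> ell2" "g \<in> ell2" for c f g
    using sums_mult[OF ell2_inner_sums(1)[OF that], of c] by (simp add: ell2_inner_def mult.assoc sums_iff)
  have isc': "ell2_inner g (\<lambda>n. c * f n) = cnj c * ell2_inner g f" if "f \<in> ell2" "g \<in> ell2" for c f g
    using sums_mult[OF ell2_inner_sums(1)[OF that(2,1)], of "cnj c"] by (simp add: ell2_inner_def mult.left_commute sums_iff)
  have L: "(\<lambda>t. ell2_inner (T (std_vec t)) g * f t) sums ell2_inner (T f) g"
    "(\<Sum>t<N. (cmod (ell2_inner (T (std_vec t)) g))\<^sup>2) \<le> (K * ell2_norm g)\<^sup>2" if f: "f \<in> ell2" and g: "g \<in> ell2" for f g N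
  proof -
    have a: "ell2_inner (T (\<lambda>n. f n + f' n)) g = ell2_inner (T f) g + ell2_inner (T f') g" if "f \<in> ell2" "f' \<in> ell2" for f f'
      using that g by (simp add: bounded_opsD(3)[OF T] ia Tc)
    have s: "ell2_inner (T (\<lambda>n. c * f n)) g = c * ell2_inner (T f) g" if "f \<in> ell2" for c f
      using that g by (simp add: bounded_opsD(4)[OF T] isc Tc)
    have b: "cmod (ell2_inner (T f) g) \<le> (K * ell2_norm g) * ell2_norm f" if "f \<in> ell2" for f
    proof -
      have "cmod (ell2_inner (T f) g) \<le> ell2_norm (T f) * ell2_norm g" by (rule ell2_inner_sums(2)[OF Tc[OF that] g])
      also have "\<dots> \<le> (K * ell2_norm f) * ell2_norm g" by (intro mult_right_mono K that ell2_norm_nonneg g)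
      finally show ?thesis by (simp add: mult_ac)
    qed
    show "(\<lambda>t. ell2_inner (T (std_vec t)) g * f t) sums ell2_inner (T f) g"
      by (rule ell2_functional(1)[where L = "\<lambda>f. ell2_inner (T f) g", OF a s b f])
    show "(\<Sum>t<N. (cmod (ell2_inner (T (std_vec t)) g))\<^sup>2) \<le> (K * ell2_norm g)\<^sup>2"
      by (rule ell2_functional(2)[where L = "\<lambda>f. ell2_inner (T f) g", OF a s b])
  qed
  have "U \<in> bounded_ops"
  proof (rule bounded_opsI[where K = "K\<^sup>2"])
    show "(\<Sum>n<N. (cmod (U f n))\<^sup>2) \<le> K\<^sup>2 * (ell2_norm f)\<^sup>2" if "f \<in> ell2" for f N
      using L(2)[OF ell2_zero that] that by (simp add: U_def power_mult_distrib)
  qed (auto simp: U_def ia' isc' Tc)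
  moreover have "ell2_inner (T f) g = ell2_inner f (U g)" if "f \<in> ell2" "g \<in> ell2" for f g
    using L(1)[OF that] that(2) by (simp add: U_def ell2_inner_def[of f] mult.commute sums_iff)
  ultimately show ?thesis by (rule that)
qed

lemma B_ell2_simps:
  "carrier B_ell2 = bounded_ops" "mult B_ell2 = compose ell2" "one B_ell2 = (\<lambda>f\<in>ell2. f)"
  "zero B_ell2 = (\<lambda>f\<in>ell2. \<lambda>n. 0)" "add B_ell2 = (\<lambda>T U. \<lambda>f\<in>ell2. \<lambda>n. T f n + U f n)"
  "smult B_ell2 = (\<lambda>c T. \<lambda>f\<in>ell2. \<lambda>n. c * T f n)"
  by (simp_all add: B_ell2_def)

lemma adj_B_ell2:
  assumes T: "T \<in> bounded_ops"
  shows "adj B_ell2 T \<in> bounded_ops"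
    and "f \<in> ell2 \<Longrightarrow> g \<in> ell2 \<Longrightarrow> ell2_inner (T f) g = ell2_inner f (adj B_ell2 T g)"
    and "U \<in> bounded_ops \<Longrightarrow> (\<And>f g. f \<in> ell2 \<Longrightarrow> g \<in> ell2 \<Longrightarrow> ell2_inner (T f) g = ell2_inner f (U g)) \<Longrightarrow> adj B_ell2 T = U"
proof -
  define Q where "Q U \<longleftrightarrow> U \<in> bounded_ops \<and> (\<forall>f\<in>ell2. \<forall>g\<in>ell2. ell2_inner (T f) g = ell2_inner f (U g))" for U
  have un: "U = V" if "Q U" "Q V" for U V
  proof (rule bounded_ops_eqI)
    fix g assume g: "g \<in> ell2"
    show "U g = V g"
    proof
      fix s
      have "ell2_inner (std_vec s) (U g) = ell2_inner (std_vec s) (V g)"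
        using that g std_vec_ell2[of s] by (simp add: Q_def)
      thus "U g s = V g s" by (simp add: inner_std_vec)
    qed
  qed (use that in \<open>auto simp: Q_def\<close>)
  have a: "adj B_ell2 T = (THE U. Q U)" by (simp add: B_ell2_def Q_def)
  obtain U0 where "Q U0"
  proof (rule adjoint_exists[OF T])
    fix U assume "U \<in> bounded_ops" "\<And>f g. f \<in> ell2 \<Longrightarrow> g \<in> ell2 \<Longrightarrow> ell2_inner (T f) g = ell2_inner f (U g)"
    hence "Q U" by (simp add: Q_def)
    thus thesis by (rule that)
  qed
  note Q0 = this
  have Q: "Q (adj B_ell2 T)" unfolding a
  proof (rule theI[of Q, OF Q0])
    fix V assume "Q V" thus "V = U0" by (rule un[OF _ Q0])
  qed
  show "adj B_ell2 T \<in> bounded_ops" using Q unfolding Q_def by (rule conjunct1)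
  show "ell2_inner (T f) g = ell2_inner f (adj B_ell2 T g)" if "f \<in> ell2" "g \<in> ell2"
    using Q that by (simp add: Q_def)
  assume "U \<in> bounded_ops" "\<And>f g. f \<in> ell2 \<Longrightarrow> g \<in> ell2 \<Longrightarrow> ell2_inner (T f) g = ell2_inner f (U g)"
  hence "Q U" by (simp add: Q_def)
  thus "adj B_ell2 T = U" by (rule un[OF Q])
qed

lemma entry_adj: "T \<in> bounded_ops \<Longrightarrow> entry (adj B_ell2 T) s t = cnj (entry T t s)"
proof -
  assume T: "T \<in> bounded_ops"
  have "entry T t s = cnj (entry (adj B_ell2 T) s t)"
    using adj_B_ell2(2)[OF T std_vec_ell2 std_vec_ell2, of s t] by (simp add: inner_std_vec entry_def)
  thus ?thesis by simp
qed

lemma B_ell2_closed: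
  shows "\<one>\<^bsub>B_ell2\<^esub> \<in> bounded_ops" and "\<zero>\<^bsub>B_ell2\<^esub> \<in> bounded_ops"
    and "T \<in> bounded_ops \<Longrightarrow> U \<in> bounded_ops \<Longrightarrow> T \<oplus>\<^bsub>B_ell2\<^esub> U \<in> bounded_ops"
    and "T \<in> bounded_ops \<Longrightarrow> c \<odot>\<^bsub>B_ell2\<^esub> T \<in> bounded_ops"
    and "T \<in> bounded_ops \<Longrightarrow> U \<in> bounded_ops \<Longrightarrow> T \<otimes>\<^bsub>B_ell2\<^esub> U \<in> bounded_ops"
proof -
  have sq: "(ell2_norm (T f))\<^sup>2 \<le> K\<^sup>2 * (ell2_norm f)\<^sup>2"
    if "T \<in> bounded_ops" "\<And>f. f \<in> ell2 \<Longrightarrow> ell2_norm (T f) \<le> K * ell2_norm f" "f \<in> ell2" for T K f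
    using power_mono[OF that(2)[OF that(3)] ell2_norm_nonneg[OF bounded_opsD(1)[OF that(1,3)]], of 2]
    by (simp add: power_mult_distrib)
  show "\<one>\<^bsub>B_ell2\<^esub> \<in> bounded_ops"
    by (rule bounded_opsI[where K = 1]) (auto simp: B_ell2_simps ell2_sum_le)
  show "\<zero>\<^bsub>B_ell2\<^esub> \<in> bounded_ops"
    by (rule bounded_opsI[where K = 0]) (auto simp: B_ell2_simps)
  assume T: "T \<in> bounded_ops"
  note Td = bounded_opsD[OF T]
  obtain K where K: "K > 0" "\<And>f. f \<in> ell2 \<Longrightarrow> ell2_norm (T f) \<le> K * ell2_norm f"
    using bounded_ops_bound[OF T] by blast
  have Ts: "(\<Sum>n<N. (cmod (T f n))\<^sup>2) \<le> K\<^sup>2 * (ell2_norm f)\<^sup>2" if "f \<in> ell2" for f N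
    using ell2_sum_le[OF Td(1)[OF that], of N] sq[OF T K(2) that] by linarith
  show "c \<odot>\<^bsub>B_ell2\<^esub> T \<in> bounded_ops"
  proof (rule bounded_opsI[where K = "(cmod c)\<^sup>2 * K\<^sup>2"])
    fix f N assume f: "f \<in> ell2"
    have "(\<Sum>n<N. (cmod (c * T f n))\<^sup>2) = (cmod c)\<^sup>2 * (\<Sum>n<N. (cmod (T f n))\<^sup>2)"
      by (simp add: norm_mult power_mult_distrib sum_distrib_left)
    also have "\<dots> \<le> (cmod c)\<^sup>2 * (K\<^sup>2 * (ell2_norm f)\<^sup>2)" by (rule mult_left_mono[OF Ts[OF f]]) simp
    finally show "(\<Sum>n<N. (cmod ((c \<odot>\<^bsub>B_ell2\<^esub> T) f n))\<^sup>2) \<le> (cmod c)\<^sup>2 * K\<^sup>2 * (ell2_norm f)\<^sup>2"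
      using f by (simp add: B_ell2_simps mult.assoc)
  qed (auto simp: B_ell2_simps Td distrib_left mult.left_commute)
  assume U: "U \<in> bounded_ops"
  note Ud = bounded_opsD[OF U]
  obtain J where J: "J > 0" "\<And>f. f \<in> ell2 \<Longrightarrow> ell2_norm (U f) \<le> J * ell2_norm f"
    using bounded_ops_bound[OF U] by blast
  have Us: "(\<Sum>n<N. (cmod (U f n))\<^sup>2) \<le> J\<^sup>2 * (ell2_norm f)\<^sup>2" if "f \<in> ell2" for f N
    using ell2_sum_le[OF Ud(1)[OF that], of N] sq[OF U J(2) that] by linarith
  show "T \<oplus>\<^bsub>B_ell2\<^esub> U \<in> bounded_ops"
  proof (rule bounded_opsI[where K = "2 * K\<^sup>2 + 2 * J\<^sup>2"])
    fix f N assume f: "f \<in> ell2"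
    have "(\<Sum>n<N. (cmod (T f n + U f n))\<^sup>2) \<le> 2 * (\<Sum>n<N. (cmod (T f n))\<^sup>2) + 2 * (\<Sum>n<N. (cmod (U f n))\<^sup>2)"
      by (rule sum_cmod_add_sq)
    also have "\<dots> \<le> 2 * (K\<^sup>2 * (ell2_norm f)\<^sup>2) + 2 * (J\<^sup>2 * (ell2_norm f)\<^sup>2)"
      using Ts[OF f, of N] Us[OF f, of N] by linarith
    finally show "(\<Sum>n<N. (cmod ((T \<oplus>\<^bsub>B_ell2\<^esub> U) f n))\<^sup>2) \<le> (2 * K\<^sup>2 + 2 * J\<^sup>2) * (ell2_norm f)\<^sup>2"
      using f by (simp add: B_ell2_simps distrib_right mult.assoc)
  qed (auto simp: B_ell2_simps Td Ud distrib_left)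
  show "T \<otimes>\<^bsub>B_ell2\<^esub> U \<in> bounded_ops"
  proof (rule bounded_opsI[where K = "K\<^sup>2 * J\<^sup>2"])
    fix f N assume f: "f \<in> ell2"
    have "(\<Sum>n<N. (cmod (T (U f) n))\<^sup>2) \<le> K\<^sup>2 * (ell2_norm (U f))\<^sup>2" by (rule Ts[OF Ud(1)[OF f]])
    also have "\<dots> \<le> K\<^sup>2 * (J\<^sup>2 * (ell2_norm f)\<^sup>2)" by (rule mult_left_mono[OF sq[OF U J(2) f] zero_le_power2])
    finally show "(\<Sum>n<N. (cmod ((T \<otimes>\<^bsub>B_ell2\<^esub> U) f n))\<^sup>2) \<le> K\<^sup>2 * J\<^sup>2 * (ell2_norm f)\<^sup>2"
      using f by (simp add: B_ell2_simps compose_def mult.assoc)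
  qed (auto simp: B_ell2_simps compose_def Td Ud)
qed

lemma B_ell2_apply:
  assumes "f \<in> ell2"
  shows "\<one>\<^bsub>B_ell2\<^esub> f = f" "\<zero>\<^bsub>B_ell2\<^esub> f = (\<lambda>n. 0)" "(T \<oplus>\<^bsub>B_ell2\<^esub> U) f = (\<lambda>n. T f n + U f n)"
    "(c \<odot>\<^bsub>B_ell2\<^esub> T) f = (\<lambda>n. c * T f n)" "(T \<otimes>\<^bsub>B_ell2\<^esub> U) f = T (U f)"
  using assms by (simp_all add: B_ell2_simps compose_def)

lemma B_ell2_ring: "ring B_ell2"
proof (rule ringI)
  note cl = B_ell2_closed B_ell2_apply bounded_opsD B_ell2_simps(1)
  show "abelian_group B_ell2"
  proof (rule abelian_groupI, simp_all only: B_ell2_simps(1) B_ell2_closed)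
    fix x assume x: "x \<in> bounded_ops"
    show "\<exists>y\<in>bounded_ops. y \<oplus>\<^bsub>B_ell2\<^esub> x = \<zero>\<^bsub>B_ell2\<^esub>"
      by (rule bexI[of _ "(-1) \<odot>\<^bsub>B_ell2\<^esub> x"], rule bounded_ops_eqI) (use x in \<open>auto simp: cl\<close>)
    show "\<zero>\<^bsub>B_ell2\<^esub> \<oplus>\<^bsub>B_ell2\<^esub> x = x" by (rule bounded_ops_eqI) (use x in \<open>auto simp: cl\<close>)
    fix y assume y: "y \<in> bounded_ops"
    show "x \<oplus>\<^bsub>B_ell2\<^esub> y = y \<oplus>\<^bsub>B_ell2\<^esub> x" by (rule bounded_ops_eqI) (use x y in \<open>auto simp: cl\<close>)
    fix z assume z: "z \<in> bounded_ops"
    show "x \<oplus>\<^bsub>B_ell2\<^esub> y \<oplus>\<^bsub>B_ell2\<^esub> z = x \<oplus>\<^bsub>B_ell2\<^esub> (y \<oplus>\<^bsub>B_ell2\<^esub> z)"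
      by (rule bounded_ops_eqI) (use x y z in \<open>auto simp: cl add.assoc\<close>)
  qed
  show "Group.monoid B_ell2"
    by (rule monoidI; (simp add: B_ell2_simps(1) B_ell2_closed)?; rule bounded_ops_eqI) (auto simp: cl)
  fix x y z assume "x \<in> carrier B_ell2" "y \<in> carrier B_ell2" "z \<in> carrier B_ell2"
  hence xyz: "x \<in> bounded_ops" "y \<in> bounded_ops" "z \<in> bounded_ops" by (simp_all add: B_ell2_simps)
  show "(x \<oplus>\<^bsub>B_ell2\<^esub> y) \<otimes>\<^bsub>B_ell2\<^esub> z = x \<otimes>\<^bsub>B_ell2\<^esub> z \<oplus>\<^bsub>B_ell2\<^esub> y \<otimes>\<^bsub>B_ell2\<^esub> z"
    by (rule bounded_ops_eqI) (use xyz in \<open>auto simp: cl\<close>)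
  show "z \<otimes>\<^bsub>B_ell2\<^esub> (x \<oplus>\<^bsub>B_ell2\<^esub> y) = z \<otimes>\<^bsub>B_ell2\<^esub> x \<oplus>\<^bsub>B_ell2\<^esub> z \<otimes>\<^bsub>B_ell2\<^esub> y"
    by (rule bounded_ops_eqI) (use xyz in \<open>auto simp: cl\<close>)
qed

lemma entry_simps:
  "entry \<one>\<^bsub>B_ell2\<^esub> s t = (if s = t then 1 else 0)"
  "entry \<zero>\<^bsub>B_ell2\<^esub> s t = 0"
  "entry (T \<oplus>\<^bsub>B_ell2\<^esub> U) s t = entry T s t + entry U s t"
  "entry (c \<odot>\<^bsub>B_ell2\<^esub> T) s t = c * entry T s t"
  by (simp_all add: entry_def B_ell2_apply) (simp add: std_vec_def)

lemma entry_mult_adj: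
  assumes "T \<in> bounded_ops" "U \<in> bounded_ops"
  shows "(\<lambda>w. cnj (entry T w s) * entry U w t) sums entry (adj B_ell2 T \<otimes>\<^bsub>B_ell2\<^esub> U) s t"
  using entry_expand[OF adj_B_ell2(1)[OF assms(1)] bounded_opsD(1)[OF assms(2) std_vec_ell2], of s t]
  by (simp add: entry_adj[OF assms(1)] entry_def[of U] entry_def[of "adj B_ell2 T \<otimes>\<^bsub>B_ell2\<^esub> U"] B_ell2_apply)

lemma B_ell2_star_algebra: "star_algebra B_ell2"
proof (intro star_algebra.intro star_vector_space.intro)
  note cl = B_ell2_closed adj_B_ell2(1)
  show "vectorspace class_ring B_ell2"
    by (rule vectorspace_class_ringI[OF ring.is_abelian_group[OF B_ell2_ring]])
      (auto simp: B_ell2_simps(1) cl entry_simps distrib_left distrib_right mult.assoc intro!: entry_eqI)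
  show "star_vector_space_axioms B_ell2"
    by unfold_locales (auto simp: B_ell2_simps(1) cl entry_simps entry_adj intro!: entry_eqI)
  show "ring B_ell2" by (rule B_ell2_ring)
  show "star_algebra_axioms B_ell2"
  proof (unfold_locales, simp_all only: B_ell2_simps(1))
    fix x y c assume x: "x \<in> bounded_ops" and y: "y \<in> bounded_ops"
    show "c \<odot>\<^bsub>B_ell2\<^esub> x \<otimes>\<^bsub>B_ell2\<^esub> y = c \<odot>\<^bsub>B_ell2\<^esub> (x \<otimes>\<^bsub>B_ell2\<^esub> y)"
      by (rule bounded_ops_eqI) (use x y in \<open>auto simp: cl B_ell2_apply bounded_opsD\<close>)
    show "x \<otimes>\<^bsub>B_ell2\<^esub> (c \<odot>\<^bsub>B_ell2\<^esub> y) = c \<odot>\<^bsub>B_ell2\<^esub> (x \<otimes>\<^bsub>B_ell2\<^esub> y)"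
      by (rule bounded_ops_eqI) (use x y in \<open>auto simp: cl B_ell2_apply bounded_opsD\<close>)
    show "adj B_ell2 (x \<otimes>\<^bsub>B_ell2\<^esub> y) = adj B_ell2 y \<otimes>\<^bsub>B_ell2\<^esub> adj B_ell2 x"
    proof (rule adj_B_ell2(3))
      fix f g assume f: "f \<in> ell2" and g: "g \<in> ell2"
      have "ell2_inner (x (y f)) g = ell2_inner (y f) (adj B_ell2 x g)"
        by (rule adj_B_ell2(2)[OF x bounded_opsD(1)[OF y f] g])
      also have "\<dots> = ell2_inner f (adj B_ell2 y (adj B_ell2 x g))"
        by (rule adj_B_ell2(2)[OF y f bounded_opsD(1)[OF cl(6)[OF x] g]])
      finally show "ell2_inner ((x \<otimes>\<^bsub>B_ell2\<^esub> y) f) g = ell2_inner f ((adj B_ell2 y \<otimes>\<^bsub>B_ell2\<^esub> adj B_ell2 x) g)"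
        using f g by (simp add: B_ell2_apply)
    qed (use x y in \<open>auto simp: cl\<close>)
  qed
qed

lemma entry_finsum:
  "finite I \<Longrightarrow> f \<in> I \<rightarrow> bounded_ops \<Longrightarrow> entry (finsum B_ell2 f I) s t = (\<Sum>i\<in>I. entry (f i) s t)"
proof (induction I rule: finite_induct)
  interpret ring B_ell2 by (rule B_ell2_ring)
  case empty thus ?case by (simp add: entry_simps)
next
  interpret ring B_ell2 by (rule B_ell2_ring)
  case (insert x F)
  hence "f x \<in> carrier B_ell2" "f \<in> F \<rightarrow> carrier B_ell2" by (auto simp: B_ell2_simps)
  thus ?case using insert by (simp add: entry_simps)
qed

definition compression :: "nat \<Rightarrow> ((nat \<Rightarrow> complex) \<Rightarrow> nat \<Rightarrow> complex) \<Rightarrow> complex mat" where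
  "compression N T = mat N N (\<lambda>(s,t). entry T s t)"

lemma gram_entry:
  assumes x: "x \<in> mats B_ell2 n n" and ab: "a < n" "b < n"
  shows "gram B_ell2 x $$ (a,b) \<in> bounded_ops"
    and "(\<lambda>M. \<Sum>c<n. \<Sum>w<M. cnj (entry (x $$ (c,a)) w i) * entry (x $$ (c,b)) w j)
      \<longlonglongrightarrow> entry (gram B_ell2 x $$ (a,b)) i j"
proof -
  have xc: "x $$ (c,b) \<in> bounded_ops" if "c < n" "b < n" for b c using matsD[OF x that] by (simp add: B_ell2_simps)
  show "gram B_ell2 x $$ (a,b) \<in> bounded_ops"
    using mmult_madj_entry(2)[OF B_ell2_star_algebra x ab] by (simp add: B_ell2_simps)
  have "entry (gram B_ell2 x $$ (a,b)) i j
    = (\<Sum>c<n. entry (adj B_ell2 (x $$ (c,a)) \<otimes>\<^bsub>B_ell2\<^esub> x $$ (c,b)) i j)"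
    unfolding mmult_madj_entry(1)[OF B_ell2_star_algebra x ab]
    by (rule entry_finsum) (use xc ab in \<open>auto simp: B_ell2_closed adj_B_ell2(1)\<close>)
  moreover have "(\<lambda>M. \<Sum>c<n. \<Sum>w<M. cnj (entry (x $$ (c,a)) w i) * entry (x $$ (c,b)) w j)
    \<longlonglongrightarrow> (\<Sum>c<n. entry (adj B_ell2 (x $$ (c,a)) \<otimes>\<^bsub>B_ell2\<^esub> x $$ (c,b)) i j)"
    by (intro tendsto_sum entry_mult_adj[unfolded sums_def] xc) (use ab in auto)
  ultimately show "(\<lambda>M. \<Sum>c<n. \<Sum>w<M. cnj (entry (x $$ (c,a)) w i) * entry (x $$ (c,b)) w j)
      \<longlonglongrightarrow> entry (gram B_ell2 x $$ (a,b)) i j" by simp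
qed

text \<open>
  The compression of \<open>x\<^sup>* x\<close> to a finite corner is a limit of Gram matrices, obtained by summing over only
  finitely many coordinates of \<open>\<ell>\<^sup>2\<close>.
\<close>

lemma compression_ucp: "ucp (cstar_opsys B_ell2) (cstar_opsys (mat_alg N)) (compression N)"
  unfolding ucp_def unital_linear_def
proof (intro conjI allI ballI)
  show "linear_map class_ring (cstar_opsys B_ell2) (cstar_opsys (mat_alg N)) (compression N)"
    by (rule linear_mapI[OF cstar_vectorspace cstar_vectorspace])
      (auto simp: cstar_simps mat_alg_simps compression_def entry_simps intro: star_algebra.axioms(1)[OF B_ell2_star_algebra] star_algebra.axioms(1)[OF mat_alg_star_algebra])
  show "compression N \<one>\<^bsub>cstar_opsys B_ell2\<^esub> = \<one>\<^bsub>cstar_opsys (mat_alg N)\<^esub>"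
    by (rule eq_matI) (auto simp: cstar_simps mat_alg_simps compression_def entry_simps)
  fix n Y assume "Y \<in> mcone (cstar_opsys B_ell2) n"
  then obtain x where x: "x \<in> mats B_ell2 n n" "Y = gram B_ell2 x" by (auto simp: mcone_cstar)
  have dY: "Y \<in> carrier_mat n n" using mats_carrier[OF mmult_madj_mats[OF B_ell2_star_algebra x(1)]] x(2) by simp
  have "mat_psd N n (map_mat (compression N) Y)" unfolding mat_psd_def
  proof (rule psd_limit)
    show "psd (grid n N) (\<lambda>u v. \<Sum>cw\<in>grid n M. cnj (entry (x $$ (fst cw, fst u)) (snd cw) (snd u)) * entry (x $$ (fst cw, fst v)) (snd cw) (snd v))" for M
      by (rule psd_gram)
    fix u v assume uv: "u \<in> grid n N" "v \<in> grid n N"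
    have "(\<lambda>M. \<Sum>cw\<in>grid n M. cnj (entry (x $$ (fst cw, fst u)) (snd cw) (snd u)) * entry (x $$ (fst cw, fst v)) (snd cw) (snd v))
      \<longlonglongrightarrow> entry (Y $$ (fst u, fst v)) (snd u) (snd v)"
      unfolding x(2) sum.cartesian_product' fst_conv snd_conv by (rule gram_entry(2)[OF x(1)]) (use uv in auto)
    thus "(\<lambda>M. \<Sum>cw\<in>grid n M. cnj (entry (x $$ (fst cw, fst u)) (snd cw) (snd u)) * entry (x $$ (fst cw, fst v)) (snd cw) (snd v))
      \<longlonglongrightarrow> (case u of (a, i) \<Rightarrow> \<lambda>(b, j). map_mat (compression N) Y $$ (a, b) $$ (i, j)) v"
      using uv dY by (auto simp: case_prod_unfold compression_def)
  qed simp
  thus "map_mat (compression N) Y \<in> mcone (cstar_opsys (mat_alg N)) n"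
    unfolding mat_cone_iff using dY by (auto intro!: matsI simp: mat_alg_simps compression_def)
qed

section \<open>The algebraic tensor product with the bounded operators\<close>

abbreviation "BH \<equiv> cstar_opsys B_ell2"

lemma BH_simps: "carrier BH = bounded_ops" "one BH = one B_ell2" "zero BH = zero B_ell2" "add BH = add B_ell2" "smult BH = smult B_ell2"
  by (simp_all add: cstar_simps B_ell2_simps(1))

lemma opbound_subset:
  assumes "opbound I A B" "finite I" "J \<subseteq> I" shows "opbound J A B"
  unfolding opbound_def
proof
  fix f :: "'a \<Rightarrow> complex"
  define g where "g j = (if j \<in> J then f j else 0)" for j
  have s: "(\<Sum>j\<in>I. A i j * g j) = (\<Sum>j\<in>J. A i j * f j)" for i
    by (rule sum.mono_neutral_cong_right) (use assms in \<open>auto simp: g_def\<close>)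
  have s2: "(\<Sum>j\<in>I. (cmod (g j))\<^sup>2) = (\<Sum>j\<in>J. (cmod (f j))\<^sup>2)"
    by (rule sum.mono_neutral_cong_right) (use assms in \<open>auto simp: g_def\<close>)
  have "(\<Sum>i\<in>J. (cmod (\<Sum>j\<in>J. A i j * f j))\<^sup>2) \<le> (\<Sum>i\<in>I. (cmod (\<Sum>j\<in>I. A i j * g j))\<^sup>2)"
    unfolding s by (rule sum_mono2) (use assms in auto)
  also have "\<dots> \<le> B\<^sup>2 * (\<Sum>j\<in>I. (cmod (g j))\<^sup>2)" using assms(1) unfolding opbound_def by blast
  finally show "(\<Sum>i\<in>J. (cmod (\<Sum>j\<in>J. A i j * f j))\<^sup>2) \<le> B\<^sup>2 * (\<Sum>j\<in>J. (cmod (f j))\<^sup>2)" unfolding s2 .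
qed

lemma psd_partial_conj:
  assumes K: "psd (I \<times> S) K" and fin: "finite I" "finite S"
  shows "psd (J \<times> S) (\<lambda>(a,r) (b,s). \<Sum>x\<in>I. \<Sum>y\<in>I. \<alpha> a x * cnj (\<alpha> b y) * K (x,r) (y,s))"
proof (rule psd_cong[OF _ psd_conj[OF K, of "J \<times> S" "\<lambda>xr as. if snd xr = snd as then cnj (\<alpha> (fst as) (fst xr)) else 0"]])
  fix u v assume "u \<in> J \<times> S" "v \<in> J \<times> S"
  then obtain a r b s where uv: "u = (a,r)" "v = (b,s)" "r \<in> S" "s \<in> S" by auto
  have "(\<Sum>xr\<in>I \<times> S. \<Sum>ys\<in>I \<times> S. cnj (if snd xr = r then cnj (\<alpha> a (fst xr)) else 0) * K xr ys * (if snd ys = s then cnj (\<alpha> b (fst ys)) else 0))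
    = (\<Sum>x\<in>I. \<Sum>r'\<in>S. \<Sum>y\<in>I. \<Sum>s'\<in>S. if s = s' then (if r' = r then \<alpha> a x else 0) * K (x,r') (y,s') * cnj (\<alpha> b y) else 0)"
    unfolding sum.cartesian_product' by (intro sum.cong refl) auto
  also have "\<dots> = (\<Sum>x\<in>I. \<Sum>r'\<in>S. if r = r' then (\<Sum>y\<in>I. \<alpha> a x * K (x,r') (y,s) * cnj (\<alpha> b y)) else 0)"
    by (intro sum.cong refl) (use fin(2) uv(4) in \<open>auto simp: sum.delta'\<close>)
  also have "\<dots> = (\<Sum>x\<in>I. \<Sum>y\<in>I. \<alpha> a x * K (x,r) (y,s) * cnj (\<alpha> b y))"
    unfolding sum.delta'[OF fin(2)] using uv(3) by simp
  finally show "(\<Sum>xr\<in>I \<times> S. \<Sum>ys\<in>I \<times> S. cnj (if snd xr = snd u then cnj (\<alpha> (fst u) (fst xr)) else 0) * K xr ys *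
      (if snd ys = snd v then cnj (\<alpha> (fst v) (fst ys)) else 0))
    = (case u of (a,r) \<Rightarrow> \<lambda>(b,s). \<Sum>x\<in>I. \<Sum>y\<in>I. \<alpha> a x * cnj (\<alpha> b y) * K (x,r) (y,s)) v"
    unfolding uv fst_conv snd_conv case_prod_conv by (simp add: mult_ac)
qed

lemma bilinear_formsD:
  assumes "\<beta> \<in> bilinear_forms X Y"
  shows "x \<in> carrier X \<Longrightarrow> x' \<in> carrier X \<Longrightarrow> y \<in> carrier Y \<Longrightarrow> \<beta> (x \<oplus>\<^bsub>X\<^esub> x') y = \<beta> x y + \<beta> x' y"
    and "x \<in> carrier X \<Longrightarrow> y \<in> carrier Y \<Longrightarrow> y' \<in> carrier Y \<Longrightarrow> \<beta> x (y \<oplus>\<^bsub>Y\<^esub> y') = \<beta> x y + \<beta> x y'"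
    and "x \<in> carrier X \<Longrightarrow> y \<in> carrier Y \<Longrightarrow> \<beta> (c \<odot>\<^bsub>X\<^esub> x) y = c * \<beta> x y"
    and "x \<in> carrier X \<Longrightarrow> y \<in> carrier Y \<Longrightarrow> \<beta> x (c \<odot>\<^bsub>Y\<^esub> y) = c * \<beta> x y"
  using assms unfolding bilinear_forms_def by blast+

lemma matrix_product_bilinear:
  assumes \<phi>: "linear_map class_ring X (cstar_opsys (mat_alg p)) \<phi>" and \<psi>: "linear_map class_ring Y (cstar_opsys (mat_alg q)) \<psi>"
    and "i < p" "j < p" "k < q" "l < q"
  shows "(\<lambda>x y. \<phi> x $$ (i,j) * \<psi> y $$ (k,l)) \<in> bilinear_forms X Y"
proof -
  note a = linear_mapD[OF \<phi>, unfolded cstar_simps mat_alg_simps] and b = linear_mapD[OF \<psi>, unfolded cstar_simps mat_alg_simps]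
  have a2: "\<phi> (x \<oplus>\<^bsub>X\<^esub> x') $$ (i,j) = \<phi> x $$ (i,j) + \<phi> x' $$ (i,j)" if "x \<in> carrier X" "x' \<in> carrier X" for x x'
    using a(1)[OF that(1)] a(1)[OF that(2)] assms(3,4) by (simp add: a(2)[OF that])
  have a3: "\<phi> (c \<odot>\<^bsub>X\<^esub> x) $$ (i,j) = c * \<phi> x $$ (i,j)" if "x \<in> carrier X" for c x
    using a(1)[OF that(1)] assms(3,4) by (simp add: a(3)[OF that])
  have b2: "\<psi> (x \<oplus>\<^bsub>Y\<^esub> x') $$ (k,l) = \<psi> x $$ (k,l) + \<psi> x' $$ (k,l)" if "x \<in> carrier Y" "x' \<in> carrier Y" for x x'
    using b(1)[OF that(1)] b(1)[OF that(2)] assms(5,6) by (simp add: b(2)[OF that])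
  have b3: "\<psi> (c \<odot>\<^bsub>Y\<^esub> x) $$ (k,l) = c * \<psi> x $$ (k,l)" if "x \<in> carrier Y" for c x
    using b(1)[OF that(1)] assms(5,6) by (simp add: b(3)[OF that])
  show ?thesis unfolding bilinear_forms_def by (simp add: a2 a3 b2 b3 distrib_left distrib_right)
qed

lemma alg_tensor_simps:
  "zero (alg_tensor X Y) = (\<lambda>\<beta>\<in>bilinear_forms X Y. 0)"
  "add (alg_tensor X Y) = (\<lambda>u v. \<lambda>\<beta>\<in>bilinear_forms X Y. u \<beta> + v \<beta>)"
  "smult (alg_tensor X Y) = (\<lambda>c u. \<lambda>\<beta>\<in>bilinear_forms X Y. c * u \<beta>)"
  "one (alg_tensor X Y) = tens X Y \<one>\<^bsub>X\<^esub> \<one>\<^bsub>Y\<^esub>"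
  "carrier (alg_tensor X Y) = {(\<lambda>\<beta>\<in>bilinear_forms X Y. \<Sum>i<n. tens X Y (x i) (y i) \<beta>) | (n::nat) x y.
                  \<forall>i<n. x i \<in> carrier X \<and> y i \<in> carrier Y}"
  by (simp_all add: alg_tensor_def)

lemma mcone_tensor:
  "mcone (tensor_min X Y) k = {u \<in> mats (alg_tensor X Y) k k.
        \<forall>p q \<phi> \<psi>. ucp X (cstar_opsys (mat_alg p)) \<phi> \<and> ucp Y (cstar_opsys (mat_alg q)) \<psi> \<longrightarrow>
          map_mat (tens_map p q \<phi> \<psi>) u \<in> mcone (cstar_opsys (mat_alg (p * q))) k}"
  "mcone (tensor_max X Y) k = {u \<in> mats (alg_tensor X Y) k k. \<forall>r::real. r > 0 \<longrightarrow>
        madd (alg_tensor X Y) u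
          (msmult (alg_tensor X Y) (of_real r) (munit (alg_tensor X Y) k)) \<in> max_precone X Y k}"
  by (simp_all add: tensor_min_def tensor_max_def star_space.extend_def op_system.fields_def)

lemma bilinear_finsum_right:
  assumes \<beta>: "\<beta> \<in> bilinear_forms X BH" and x: "x \<in> carrier X" and I: "finite I" "f \<in> I \<rightarrow> bounded_ops"
  shows "finsum B_ell2 f I \<in> bounded_ops" "\<beta> x (finsum B_ell2 f I) = (\<Sum>i\<in>I. \<beta> x (f i))"
proof -
  interpret ring B_ell2 by (rule B_ell2_ring)
  have c: "f \<in> I \<rightarrow> carrier B_ell2" using I by (simp add: B_ell2_simps)
  show "finsum B_ell2 f I \<in> bounded_ops" using finsum_closed[OF c] by (simp add: B_ell2_simps)
  show "\<beta> x (finsum B_ell2 f I) = (\<Sum>i\<in>I. \<beta> x (f i))" using I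
  proof (induction I rule: finite_induct)
    case empty
    have "0 \<odot>\<^bsub>B_ell2\<^esub> \<zero>\<^bsub>B_ell2\<^esub> = \<zero>\<^bsub>B_ell2\<^esub>"
      by (rule entry_eqI) (simp_all add: B_ell2_closed entry_simps)
    thus ?case using bilinear_formsD(4)[OF \<beta> x, of "\<zero>\<^bsub>B_ell2\<^esub>" 0] by (simp add: BH_simps B_ell2_closed)
  next
    case (insert a F)
    hence 1: "f a \<in> carrier B_ell2" "f \<in> F \<rightarrow> carrier B_ell2" by (auto simp: B_ell2_simps)
    show ?case using insert 1 finsum_closed[OF 1(2)] bilinear_formsD(2)[OF \<beta> x, of "f a" "finsum B_ell2 f F"]
      by (simp add: BH_simps B_ell2_simps(1))
  qed
qed

context coord_operator_system
begin

abbreviation "AT \<equiv> alg_tensor X BH"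

text \<open>
  \<open>\<Sum>\<^sub>l e\<^sub>l \<otimes> U\<^sub>l\<close>; every element of the tensor product has this form (\<open>alg_tensor_op_tensor\<close>).
\<close>

definition op_tensor :: "(nat \<Rightarrow> (nat \<Rightarrow> complex) \<Rightarrow> nat \<Rightarrow> complex) \<Rightarrow> ('a \<Rightarrow> ((nat \<Rightarrow> complex) \<Rightarrow> nat \<Rightarrow> complex) \<Rightarrow> complex) \<Rightarrow> complex" where
  "op_tensor U = (\<lambda>\<beta>\<in>bilinear_forms X BH. \<Sum>l<d. \<beta> (basis_vec l) (U l))"

lemma basis_vec_simps: "basis_vec l \<in> carrier X" "k < d \<Longrightarrow> co (basis_vec l) k = (if k = l then 1 else 0)"
  by (simp_all add: basis_vec_def)

lemma bilinear_expand:
  assumes "\<beta> \<in> bilinear_forms X Y" "x \<in> carrier X" "y \<in> carrier Y"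
  shows "\<beta> x y = (\<Sum>l<d. co x l * \<beta> (basis_vec l) y)"
  unfolding basis_vec_def by (rule linear_expand[where F = "\<lambda>x. \<beta> x y"]) (use bilinear_formsD[OF assms(1)] assms(2,3) in auto)

lemma op_tensor_cong: "(\<And>l. l < d \<Longrightarrow> U l = V l) \<Longrightarrow> op_tensor U = op_tensor V"
  unfolding op_tensor_def by (intro restrict_ext sum.cong) auto

lemma alg_tensor_op_tensor:
  assumes "u \<in> carrier AT"
  obtains U where "\<And>l. U l \<in> bounded_ops" "u = op_tensor U"
proof -
  obtain n :: nat and x y where xy: "\<And>i. i < n \<Longrightarrow> x i \<in> carrier X" "\<And>i. i < n \<Longrightarrow> y i \<in> bounded_ops"
    and u: "u = (\<lambda>\<beta>\<in>bilinear_forms X BH. \<Sum>i<n. tens X BH (x i) (y i) \<beta>)"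
    using assms by (auto simp: alg_tensor_simps BH_simps)
  define U where "U l = finsum B_ell2 (\<lambda>i. co (x i) l \<odot>\<^bsub>B_ell2\<^esub> y i) {..<n}" for l
  have c: "(\<lambda>i. co (x i) l \<odot>\<^bsub>B_ell2\<^esub> y i) \<in> {..<n} \<rightarrow> bounded_ops" for l using xy by (auto simp: B_ell2_closed)
  have z: "(\<lambda>x y. 0) \<in> bilinear_forms X BH" by (simp add: bilinear_forms_def)
  show ?thesis
  proof (rule that[of U])
    show "U l \<in> bounded_ops" for l unfolding U_def by (rule bilinear_finsum_right(1)[OF z basis_vec_simps(1) _ c]) simp
    show "u = op_tensor U" unfolding u op_tensor_def
    proof (rule restrict_ext)
      fix \<beta> assume \<beta>: "\<beta> \<in> bilinear_forms X BH"
      have "(\<Sum>i<n. tens X BH (x i) (y i) \<beta>) = (\<Sum>i<n. \<Sum>l<d. co (x i) l * \<beta> (basis_vec l) (y i))"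
        using \<beta> by (intro sum.cong refl) (simp add: tens_def bilinear_expand[OF \<beta>] xy BH_simps)
      also have "\<dots> = (\<Sum>l<d. \<Sum>i<n. co (x i) l * \<beta> (basis_vec l) (y i))" by (rule sum.swap)
      also have "\<dots> = (\<Sum>l<d. \<beta> (basis_vec l) (U l))"
        unfolding U_def
        by (intro sum.cong refl, subst bilinear_finsum_right(2)[OF \<beta> basis_vec_simps(1) _ c])
          (use bilinear_formsD(4)[OF \<beta> basis_vec_simps(1)] xy in \<open>auto simp: BH_simps\<close>)
      finally show "(\<Sum>i<n. tens X BH (x i) (y i) \<beta>) = (\<Sum>l<d. \<beta> (basis_vec l) (U l))" .
    qed
  qed
qed

lemma op_tensor_closed: "(\<And>l. l < d \<Longrightarrow> U l \<in> bounded_ops) \<Longrightarrow> op_tensor U \<in> carrier AT"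
  unfolding alg_tensor_simps mem_Collect_eq op_tensor_def
  by (intro exI[of _ d] exI[of _ basis_vec] exI[of _ U] conjI restrict_ext) (auto simp: tens_def BH_simps basis_vec_simps)

lemma op_tensor_add: "(\<And>l. U l \<in> bounded_ops) \<Longrightarrow> (\<And>l. V l \<in> bounded_ops) \<Longrightarrow> op_tensor U \<oplus>\<^bsub>AT\<^esub> op_tensor V = op_tensor (\<lambda>l. U l \<oplus>\<^bsub>B_ell2\<^esub> V l)"
  unfolding alg_tensor_simps op_tensor_def
  by (intro restrict_ext) (simp add: bilinear_formsD(2)[OF _ basis_vec_simps(1), of _ BH, unfolded BH_simps] sum.distrib)

lemma op_tensor_smult: "(\<And>l. U l \<in> bounded_ops) \<Longrightarrow> c \<odot>\<^bsub>AT\<^esub> op_tensor U = op_tensor (\<lambda>l. c \<odot>\<^bsub>B_ell2\<^esub> U l)"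
  unfolding alg_tensor_simps op_tensor_def
  by (intro restrict_ext) (simp add: bilinear_formsD(4)[OF _ basis_vec_simps(1), of _ BH, unfolded BH_simps] sum_distrib_left)

lemma tens_op_tensor: "x \<in> carrier X \<Longrightarrow> y \<in> bounded_ops \<Longrightarrow> tens X BH x y = op_tensor (\<lambda>l. co x l \<odot>\<^bsub>B_ell2\<^esub> y)"
  unfolding tens_def op_tensor_def
  by (intro restrict_ext) (simp add: bilinear_formsD(4)[OF _ basis_vec_simps(1), of _ BH, unfolded BH_simps] bilinear_expand[where Y = BH] BH_simps)

lemma alg_tensor_closed:
  "u \<in> carrier AT \<Longrightarrow> w \<in> carrier AT \<Longrightarrow> u \<oplus>\<^bsub>AT\<^esub> w \<in> carrier AT"
  "u \<in> carrier AT \<Longrightarrow> c \<odot>\<^bsub>AT\<^esub> u \<in> carrier AT"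
  "x \<in> carrier X \<Longrightarrow> y \<in> bounded_ops \<Longrightarrow> tens X BH x y \<in> carrier AT"
  "\<zero>\<^bsub>AT\<^esub> \<in> carrier AT"
proof -
  show "u \<in> carrier AT \<Longrightarrow> c \<odot>\<^bsub>AT\<^esub> u \<in> carrier AT"
    by (erule alg_tensor_op_tensor) (simp add: op_tensor_smult op_tensor_closed B_ell2_closed)
  show "x \<in> carrier X \<Longrightarrow> y \<in> bounded_ops \<Longrightarrow> tens X BH x y \<in> carrier AT"
    by (simp add: tens_op_tensor op_tensor_closed B_ell2_closed)
  show "\<zero>\<^bsub>AT\<^esub> \<in> carrier AT"
    unfolding alg_tensor_simps mem_Collect_eq by (intro exI[of _ 0] conjI restrict_ext) auto
  assume u: "u \<in> carrier AT" and w: "w \<in> carrier AT"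
  show "u \<oplus>\<^bsub>AT\<^esub> w \<in> carrier AT"
    by (rule alg_tensor_op_tensor[OF u], rule alg_tensor_op_tensor[OF w]) (simp add: op_tensor_add op_tensor_closed B_ell2_closed)
qed

lemma alg_tensor_abelian_monoid: "abelian_monoid AT"
proof (rule abelian_monoidI)
  fix x assume "x \<in> carrier AT"
  then obtain n :: nat and p q where x: "x = (\<lambda>\<beta>\<in>bilinear_forms X BH. \<Sum>i<n. tens X BH (p i) (q i) \<beta>)"
    by (auto simp: alg_tensor_simps)
  show "\<zero>\<^bsub>AT\<^esub> \<oplus>\<^bsub>AT\<^esub> x = x" unfolding x by (auto simp: alg_tensor_simps)
next
  fix x y z
  show "x \<oplus>\<^bsub>AT\<^esub> y \<oplus>\<^bsub>AT\<^esub> z = x \<oplus>\<^bsub>AT\<^esub> (y \<oplus>\<^bsub>AT\<^esub> z)" "x \<oplus>\<^bsub>AT\<^esub> y = y \<oplus>\<^bsub>AT\<^esub> x"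
    unfolding alg_tensor_simps by (intro restrict_ext; simp)+
qed (simp_all add: alg_tensor_closed)

lemma alg_tensor_finsum:
  assumes "finite I" "f \<in> I \<rightarrow> carrier AT" "\<beta> \<in> bilinear_forms X BH"
  shows "finsum AT f I \<in> carrier AT" "finsum AT f I \<beta> = (\<Sum>i\<in>I. f i \<beta>)"
proof -
  interpret abelian_monoid AT by (rule alg_tensor_abelian_monoid)
  show "finsum AT f I \<in> carrier AT" by (rule finsum_closed[OF assms(2)])
  show "finsum AT f I \<beta> = (\<Sum>i\<in>I. f i \<beta>)" using assms
  proof (induction I rule: finite_induct)
    case (insert a F)
    hence 1: "f a \<in> carrier AT" "f \<in> F \<rightarrow> carrier AT" by auto
    show ?case using insert 1 by (simp add: finsum_insert) (simp add: alg_tensor_simps)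
  qed (simp add: alg_tensor_simps)
qed

lemma mconj_mtens:
  assumes P: "P \<in> mats X p p" and Q: "Q \<in> mats B_ell2 q q" and \<alpha>: "\<alpha> \<in> carrier_mat k (p * q)" and ab: "a < k" "b < k"
  shows "mconj AT \<alpha> (mtens X BH P Q) $$ (a,b) \<in> carrier AT"
    and "\<beta> \<in> bilinear_forms X BH \<Longrightarrow> (mconj AT \<alpha> (mtens X BH P Q) $$ (a,b)) \<beta> =
      (\<Sum>x<p * q. \<Sum>y<p * q. \<alpha> $$ (a,x) * cnj (\<alpha> $$ (b,y)) * \<beta> (P $$ (x div q, y div q)) (Q $$ (x mod q, y mod q)))"
proof -
  have dP: "dim_row P = p" "dim_row Q = q" using mats_carrier[OF P] mats_carrier[OF Q] by auto
  have t: "(\<alpha> $$ (a,x) * cnj (\<alpha> $$ (b,y))) \<odot>\<^bsub>AT\<^esub> mtens X BH P Q $$ (x,y) \<in> carrier AT" 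
    "\<beta> \<in> bilinear_forms X BH \<Longrightarrow> ((\<alpha> $$ (a,x) * cnj (\<alpha> $$ (b,y))) \<odot>\<^bsub>AT\<^esub> mtens X BH P Q $$ (x,y)) \<beta>
      = \<alpha> $$ (a,x) * cnj (\<alpha> $$ (b,y)) * \<beta> (P $$ (x div q, y div q)) (Q $$ (x mod q, y mod q))"
    if "x < p * q" "y < p * q" for x y \<beta>
  proof -
    have q: "q > 0" using that by (cases q) auto
    have "P $$ (x div q, y div q) \<in> carrier X" using that by (intro matsD[OF P]) (simp_all add: less_mult_imp_div_less)
    moreover have "Q $$ (x mod q, y mod q) \<in> bounded_ops" using matsD[OF Q, of "x mod q" "y mod q"] q by (simp add: B_ell2_simps)
    moreover have m: "mtens X BH P Q $$ (x,y) = tens X BH (P $$ (x div q, y div q)) (Q $$ (x mod q, y mod q))"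
      using that by (simp add: mtens_def Let_def dP)
    ultimately show "(\<alpha> $$ (a,x) * cnj (\<alpha> $$ (b,y))) \<odot>\<^bsub>AT\<^esub> mtens X BH P Q $$ (x,y) \<in> carrier AT"
      by (simp add: alg_tensor_closed)
    show "\<beta> \<in> bilinear_forms X BH \<Longrightarrow> ((\<alpha> $$ (a,x) * cnj (\<alpha> $$ (b,y))) \<odot>\<^bsub>AT\<^esub> mtens X BH P Q $$ (x,y)) \<beta>
      = \<alpha> $$ (a,x) * cnj (\<alpha> $$ (b,y)) * \<beta> (P $$ (x div q, y div q)) (Q $$ (x mod q, y mod q))"
      unfolding m by (simp add: alg_tensor_simps tens_def)
  qed
  have d: "dim_row (mtens X BH P Q) = p * q" "dim_col (mtens X BH P Q) = p * q" by (simp_all add: mtens_def Let_def dP)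
  have e: "mconj AT \<alpha> (mtens X BH P Q) $$ (a,b) = finsum AT (\<lambda>x. finsum AT (\<lambda>y.
      (\<alpha> $$ (a,x) * cnj (\<alpha> $$ (b,y))) \<odot>\<^bsub>AT\<^esub> mtens X BH P Q $$ (x,y)) {..<p * q}) {..<p * q}"
    using ab \<alpha> by (simp add: mconj_def d)
  have z: "(\<lambda>x y. 0) \<in> bilinear_forms X BH" by (simp add: bilinear_forms_def)
  have i: "(\<lambda>y. (\<alpha> $$ (a,x) * cnj (\<alpha> $$ (b,y))) \<odot>\<^bsub>AT\<^esub> mtens X BH P Q $$ (x,y)) \<in> {..<p * q} \<rightarrow> carrier AT" if "x < p * q" for x
    using t(1)[OF that] by auto
  have o: "(\<lambda>x. finsum AT (\<lambda>y. (\<alpha> $$ (a,x) * cnj (\<alpha> $$ (b,y))) \<odot>\<^bsub>AT\<^esub> mtens X BH P Q $$ (x,y)) {..<p * q}) \<in> {..<p * q} \<rightarrow> carrier AT"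
    using alg_tensor_finsum(1)[OF finite_lessThan i z] by auto
  show "mconj AT \<alpha> (mtens X BH P Q) $$ (a,b) \<in> carrier AT"
    unfolding e by (rule alg_tensor_finsum(1)[OF finite_lessThan o z])
  assume \<beta>: "\<beta> \<in> bilinear_forms X BH"
  show "(mconj AT \<alpha> (mtens X BH P Q) $$ (a,b)) \<beta> =
      (\<Sum>x<p * q. \<Sum>y<p * q. \<alpha> $$ (a,x) * cnj (\<alpha> $$ (b,y)) * \<beta> (P $$ (x div q, y div q)) (Q $$ (x mod q, y mod q)))"
    unfolding e alg_tensor_finsum(2)[OF finite_lessThan o \<beta>]
    by (intro sum.cong refl, subst alg_tensor_finsum(2)[OF finite_lessThan i \<beta>]) (auto simp: t(2)[OF _ _ \<beta>])
qed

end

section \<open>Maximal positivity implies minimal positivity\<close>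

context coord_operator_system
begin

text \<open>
  The image is \<open>\<alpha> K \<alpha>\<^sup>*\<close>, where \<open>K\<close> is the Kronecker product of \<open>\<phi>(P)\<close> and \<open>\<psi>(Q)\<close> with the factors
  regrouped.
\<close>

lemma max_precone_positive:
  assumes w: "w \<in> max_precone X BH k" and \<phi>: "ucp X (cstar_opsys (mat_alg m)) \<phi>" and \<psi>: "ucp BH (cstar_opsys (mat_alg n)) \<psi>"
  shows "mat_psd (m * n) k (map_mat (tens_map m n \<phi> \<psi>) w)"
proof -
  obtain \<alpha> P Q p q where P: "P \<in> mcone X p" and Q: "Q \<in> mcone BH q" and \<alpha>: "\<alpha> \<in> carrier_mat k (p * q)"
    and w: "w = mconj AT \<alpha> (mtens X BH P Q)"
    using w unfolding max_precone_def by blast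
  have Pm: "P \<in> mats X p p" using P cone_mats by blast
  have Qm: "Q \<in> mats B_ell2 q q" using Q mmult_madj_mats[OF B_ell2_star_algebra] by (auto simp: mcone_cstar)
  have dP: "P \<in> carrier_mat p p" "Q \<in> carrier_mat q q" using mats_carrier[OF Pm] mats_carrier[OF Qm] .
  have dw: "w \<in> carrier_mat k k" using \<alpha> by (simp add: w mconj_def)
  have l\<phi>: "linear_map class_ring X (cstar_opsys (mat_alg m)) \<phi>" and l\<psi>: "linear_map class_ring BH (cstar_opsys (mat_alg n)) \<psi>"
    using \<phi> \<psi> by (auto simp: ucp_def unital_linear_def)
  have "map_mat \<phi> P \<in> mcone (cstar_opsys (mat_alg m)) p" "map_mat \<psi> Q \<in> mcone (cstar_opsys (mat_alg n)) q"
    using \<phi> \<psi> P Q by (auto simp: ucp_def)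
  hence "psd (grid p m) (\<lambda>(x,i) (y,j). map_mat \<phi> P $$ (x,y) $$ (i,j))"
    "psd (grid q n) (\<lambda>(x,i) (y,j). map_mat \<psi> Q $$ (x,y) $$ (i,j))"
    by (simp_all add: mat_cone_iff mat_psd_def)
  note kr = psd_kron[OF this(1) _ this(2)]
  define H where "H = (\<lambda>(x,r) (y,s). \<phi> (P $$ (x div q, y div q)) $$ (r div n, s div n) * \<psi> (Q $$ (x mod q, y mod q)) $$ (r mod n, s mod n))"
  (* regroups ((x div q, x mod q), (r div n, r mod n)) by tensor factors *)
  define g where "g = (\<lambda>(x,r). ((x div q, r div n), (x mod q, r mod n)))"
  have mods: "x div q < p" "x mod q < q" if "x < p * q" for x p q :: nat
    using that by (cases q; simp add: less_mult_imp_div_less)+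
  have "psd ({..<p * q} \<times> {..<m * n}) (\<lambda>u v. (\<lambda>(i,a) (j,b). (\<lambda>(x,i) (y,j). map_mat \<phi> P $$ (x,y) $$ (i,j)) i j * (\<lambda>(x,i) (y,j). map_mat \<psi> Q $$ (x,y) $$ (i,j)) a b) (g u) (g v))"
    by (rule psd_pullback[OF kr]) (auto simp: g_def mods)
  hence "psd ({..<p * q} \<times> {..<m * n}) H"
    by (rule psd_cong[rotated]) (use dP mods in \<open>auto simp: g_def H_def\<close>)
  from psd_partial_conj[OF this, of "{..<k}" "\<lambda>a x. \<alpha> $$ (a,x)"]
  have "psd ({..<k} \<times> {..<m * n}) (\<lambda>(a,r) (b,s). \<Sum>x<p * q. \<Sum>y<p * q. \<alpha> $$ (a,x) * cnj (\<alpha> $$ (b,y)) * H (x,r) (y,s))" by simp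
  thus ?thesis unfolding mat_psd_def
  proof (rule psd_cong[rotated])
    fix u v assume "u \<in> {..<k} \<times> {..<m * n}" "v \<in> {..<k} \<times> {..<m * n}"
    then obtain a r b s where uv: "u = (a,r)" "v = (b,s)" "a < k" "b < k" "r < m * n" "s < m * n" by auto
    have "map_mat (tens_map m n \<phi> \<psi>) w $$ (a,b) $$ (r,s)
      = (w $$ (a,b)) (\<lambda>x y. \<phi> x $$ (r div n, s div n) * \<psi> y $$ (r mod n, s mod n))"
      using dw uv by (simp add: tens_map_def)
    also have "\<dots> = (\<Sum>x<p * q. \<Sum>y<p * q. \<alpha> $$ (a,x) * cnj (\<alpha> $$ (b,y)) * H (x,r) (y,s))"
      unfolding w
      by (subst mconj_mtens(2)[OF Pm Qm \<alpha> uv(3,4) matrix_product_bilinear[OF l\<phi> l\<psi>]]) (use uv mods in \<open>auto simp: H_def\<close>)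
    finally show "(case u of (a,r) \<Rightarrow> \<lambda>(b,s). \<Sum>x<p * q. \<Sum>y<p * q. \<alpha> $$ (a,x) * cnj (\<alpha> $$ (b,y)) * H (x,r) (y,s)) v
      = (case u of (a,i) \<Rightarrow> \<lambda>(b,j). map_mat (tens_map m n \<phi> \<psi>) w $$ (a,b) $$ (i,j)) v"
      by (simp add: uv)
  qed
qed

lemma shifted_index:
  assumes "u \<in> mats AT k k" "a < k" "b < k" "\<beta> \<in> bilinear_forms X BH"
  shows "(madd AT u (msmult AT c (munit AT k)) $$ (a,b)) \<beta>
    = (u $$ (a,b)) \<beta> + (if a = b then c * \<beta> \<one>\<^bsub>X\<^esub> \<one>\<^bsub>B_ell2\<^esub> else 0)"
  using assms mats_carrier[OF assms(1)]
  by (auto simp: madd_def msmult_def munit_def alg_tensor_simps tens_def BH_simps)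

text \<open>
  The images of \<open>u + 1/(t+1)\<close> are positive semidefinite and converge to the image of \<open>u\<close>.
\<close>

lemma max_le_min:
  assumes u: "u \<in> mcone (tensor_max X BH) k"
  shows "u \<in> mcone (tensor_min X BH) k"
  unfolding mcone_tensor
proof (intro CollectI conjI allI impI)
  show um: "u \<in> mats AT k k" using u by (simp add: mcone_tensor)
  have du: "u \<in> carrier_mat k k" by (rule mats_carrier[OF um])
  fix m n \<phi> \<psi> assume ucp: "ucp X (cstar_opsys (mat_alg m)) \<phi> \<and> ucp BH (cstar_opsys (mat_alg n)) \<psi>"
  have l\<phi>: "linear_map class_ring X (cstar_opsys (mat_alg m)) \<phi>" "\<phi> \<one>\<^bsub>X\<^esub> = 1\<^sub>m m"
    and l\<psi>: "linear_map class_ring BH (cstar_opsys (mat_alg n)) \<psi>" "\<psi> \<one>\<^bsub>B_ell2\<^esub> = 1\<^sub>m n"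
    using ucp by (auto simp: ucp_def unital_linear_def cstar_simps mat_alg_simps)
  define w where "w t = madd AT u (msmult AT (complex_of_real (1 / real (Suc t))) (munit AT k))" for t
  have dw: "w t \<in> carrier_mat k k" for t using du by (simp add: w_def madd_def)
  have "mat_psd (m * n) k (map_mat (tens_map m n \<phi> \<psi>) u)" unfolding mat_psd_def
  proof (rule psd_limit)
    fix t
    have "w t \<in> max_precone X BH k" using u unfolding mcone_tensor w_def by (auto simp del: of_real_divide of_nat_Suc)
    from max_precone_positive[OF this, of m \<phi> n \<psi>] ucp
    show "psd ({..<k} \<times> {..<m * n}) (\<lambda>(a,i) (b,j). map_mat (tens_map m n \<phi> \<psi>) (w t) $$ (a,b) $$ (i,j))"
      by (simp add: mat_psd_def)
  next
    fix x y assume "x \<in> {..<k} \<times> {..<m * n}" "y \<in> {..<k} \<times> {..<m * n}"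
    then obtain a r b s where xy: "x = (a,r)" "y = (b,s)" "a < k" "b < k" "r < m * n" "s < m * n" by auto
    define \<beta> where "\<beta> = (\<lambda>x y. \<phi> x $$ (r div n, s div n) * \<psi> y $$ (r mod n, s mod n))"
    have n: "r mod n < n" "s mod n < n" using xy(5,6) by (cases n; simp)+
    have \<beta>: "\<beta> \<in> bilinear_forms X BH" unfolding \<beta>_def
      by (rule matrix_product_bilinear[OF l\<phi>(1) l\<psi>(1)]) (use xy n in \<open>auto simp: less_mult_imp_div_less\<close>)
    have "map_mat (tens_map m n \<phi> \<psi>) (w t) $$ (a,b) $$ (r,s)
      = map_mat (tens_map m n \<phi> \<psi>) u $$ (a,b) $$ (r,s) + complex_of_real (1 / real (Suc t)) * (if a = b then \<beta> \<one>\<^bsub>X\<^esub> \<one>\<^bsub>B_ell2\<^esub> else 0)" for t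
      using shifted_index[OF um xy(3,4) \<beta>, of "complex_of_real (1 / real (Suc t))"] dw[of t] du xy
      by (simp add: tens_map_def w_def \<beta>_def)
    moreover have "(\<lambda>t. map_mat (tens_map m n \<phi> \<psi>) u $$ (a,b) $$ (r,s) + complex_of_real (1 / real (Suc t)) * (if a = b then \<beta> \<one>\<^bsub>X\<^esub> \<one>\<^bsub>B_ell2\<^esub> else 0))
      \<longlonglongrightarrow> map_mat (tens_map m n \<phi> \<psi>) u $$ (a,b) $$ (r,s) + complex_of_real 0 * (if a = b then \<beta> \<one>\<^bsub>X\<^esub> \<one>\<^bsub>B_ell2\<^esub> else 0)"
      by (intro tendsto_intros LIMSEQ_Suc[OF lim_1_over_n])
    ultimately show "(\<lambda>t. (case x of (a,i) \<Rightarrow> \<lambda>(b,j). map_mat (tens_map m n \<phi> \<psi>) (w t) $$ (a,b) $$ (i,j)) y)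
      \<longlonglongrightarrow> (case x of (a,i) \<Rightarrow> \<lambda>(b,j). map_mat (tens_map m n \<phi> \<psi>) u $$ (a,b) $$ (i,j)) y"
      by (simp add: xy)
  qed simp
  thus "map_mat (tens_map m n \<phi> \<psi>) u \<in> mcone (cstar_opsys (mat_alg (m * n))) k"
    unfolding mat_cone_iff using du by (auto intro!: matsI simp: mat_alg_simps tens_map_def)
qed

section \<open>Minimal positivity implies maximal positivity\<close>

lemma matrix_of_operators_opbound:
  assumes k: "k > 0" and K: "K \<ge> 0" "\<And>a b N. a < k \<Longrightarrow> b < k \<Longrightarrow> opbound {..<N} (T a b) K"
  shows "opbound {..<N} (\<lambda>i j. T (i mod k) (j mod k) (i div k) (j div k)) (real k * K)"
proof (rule opbound_subset[of "{..<N * k}"])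
  show "opbound {..<N * k} (\<lambda>i j. T (i mod k) (j mod k) (i div k) (j div k)) (real k * K)"
    unfolding opbound_def
  proof
    fix f :: "nat \<Rightarrow> complex"
    note sdm = sum_lessThan_mult[OF k]
    have "(cmod (\<Sum>j<N * k. T a (j mod k) s (j div k) * f j))\<^sup>2 \<le> real k * (\<Sum>b<k. (cmod (\<Sum>t<N. T a b s t * f (t * k + b)))\<^sup>2)" for a s
    proof -
      have "(\<Sum>j<N * k. T a (j mod k) s (j div k) * f j) = (\<Sum>t<N. \<Sum>b<k. T a b s t * f (t * k + b))"
        unfolding sdm by (intro sum.cong refl) simp
      also have "\<dots> = (\<Sum>b<k. \<Sum>t<N. T a b s t * f (t * k + b))" by (rule sum.swap)
      finally show ?thesis by (simp add: sum_norm_squared_le)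
    qed
    note row = this
    have "(\<Sum>i<N * k. (cmod (\<Sum>j<N * k. T (i mod k) (j mod k) (i div k) (j div k) * f j))\<^sup>2)
      \<le> (\<Sum>i<N * k. real k * (\<Sum>b<k. (cmod (\<Sum>t<N. T (i mod k) b (i div k) t * f (t * k + b)))\<^sup>2))"
      by (intro sum_mono row)
    also have "\<dots> = (\<Sum>s<N. \<Sum>a<k. real k * (\<Sum>b<k. (cmod (\<Sum>t<N. T a b s t * f (t * k + b)))\<^sup>2))"
      unfolding sdm by (intro sum.cong refl) simp
    also have "\<dots> = (\<Sum>a<k. \<Sum>s<N. real k * (\<Sum>b<k. (cmod (\<Sum>t<N. T a b s t * f (t * k + b)))\<^sup>2))"
      by (rule sum.swap)
    also have "\<dots> = (\<Sum>a<k. real k * (\<Sum>b<k. \<Sum>s<N. (cmod (\<Sum>t<N. T a b s t * f (t * k + b)))\<^sup>2))"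
      unfolding sum_distrib_left[symmetric] by (intro sum.cong refl arg_cong[where f = "(*) (real k)"] sum.swap)
    also have "\<dots> \<le> (\<Sum>a<k. real k * (\<Sum>b<k. K\<^sup>2 * (\<Sum>t<N. (cmod (f (t * k + b)))\<^sup>2)))"
    proof (intro sum_mono mult_left_mono)
      fix a b assume "a \<in> {..<k}" "b \<in> {..<k}"
      hence "opbound {..<N} (T a b) K" using K(2) by simp
      thus "(\<Sum>s<N. (cmod (\<Sum>t<N. T a b s t * f (t * k + b)))\<^sup>2) \<le> K\<^sup>2 * (\<Sum>t<N. (cmod (f (t * k + b)))\<^sup>2)"
        unfolding opbound_def by (rule spec)
    qed simp
    also have "\<dots> = (real k * K)\<^sup>2 * (\<Sum>b<k. \<Sum>t<N. (cmod (f (t * k + b)))\<^sup>2)"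
      by (simp add: sum_distrib_left[symmetric] power2_eq_square)
    also have "(\<Sum>b<k. \<Sum>t<N. (cmod (f (t * k + b)))\<^sup>2) = (\<Sum>j<N * k. (cmod (f j))\<^sup>2)"
      unfolding sdm by (rule sum.swap)
    finally show "(\<Sum>i<N * k. (cmod (\<Sum>j<N * k. T (i mod k) (j mod k) (i div k) (j div k) * f j))\<^sup>2)
      \<le> (real k * K)\<^sup>2 * (\<Sum>j<N * k. (cmod (f j))\<^sup>2)" .
  qed
qed (use k in auto)

text \<open>
  The factorization needs a state. If there is none then states separate points trivially, so the system
  is zero-dimensional and there is nothing to factor.
\<close>

lemma factorization_of_positive:
  assumes st: "K.stable"
    and v: "\<And>N m \<psi>. K.ucp_co m \<psi> \<Longrightarrow> K.amp_psd m \<psi> N v"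
    and B: "B > 0" "\<And>l N. l < d \<Longrightarrow> opbound {..<N} (\<lambda>i j. v i j l) B"
    and r: "r > 0"
  obtains p P R c where "p > 0" "P \<in> cone_co p" "\<And>w j. j < w \<Longrightarrow> R w j = 0" "c \<ge> 0"
    "\<And>M f. (\<Sum>w<M. (cmod (\<Sum>j<M. R w j * f j))\<^sup>2) \<le> c * (\<Sum>j<M. (cmod (f j))\<^sup>2)"
    "\<And>i j l. l < d \<Longrightarrow> K.shift r v i j l =
      (\<Sum>g<p. \<Sum>h<p. P g h l * (\<Sum>w\<le>i * p + g. cnj (R w (i * p + g)) * R w (j * p + h)))"
proof (cases "\<exists>l<d. unit_co l \<noteq> 0")
  case True
  then obtain \<omega> where "K.state \<omega>" by (rule K.state_exists)
  show thesis by (rule K.infinite_factorization[OF st \<open>K.state \<omega>\<close> v B r]) (assumption | rule that | assumption)+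
next
  case False
  have "\<not> K.state \<omega>" for \<omega> using False by (auto simp: K.state_def)
  hence "d = 0" using K.states_separate[of "\<lambda>_. 1" 0] by auto
  (* with d = 0 the identities to be proved range over no l *)
  show thesis
    by (rule that[of 1 "\<lambda>i j l. 0" "\<lambda>w j. 0" 0]) (use K.C_zero \<open>d = 0\<close> in auto)
qed

end

context coord_operator_system
begin

text \<open>
  A matrix of operators is an infinite scalar matrix when the position \<open>(s,a)\<close>, with \<open>a < k\<close>, is numbered \<open>s * k + a\<close>.
  Apply minimal positivity to \<open>\<psi>\<close> and the compression to the first \<open>N\<close> coordinates.
\<close>

lemma min_cone_coordinates:
  assumes k: "k > 0" and u: "u \<in> mcone (tensor_min X BH) k"
    and U: "\<And>a b. a < k \<Longrightarrow> b < k \<Longrightarrow> u $$ (a,b) = op_tensor (U a b)"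
    and \<psi>: "K.ucp_co m \<psi>"
  shows "K.amp_psd m \<psi> N (\<lambda>i j l. entry (U (i mod k) (j mod k) l) (i div k) (j div k))"
proof -
  note \<psi>' = ucp_co_imp_ucp[OF \<psi>]
  have du: "u \<in> carrier_mat k k" using u mats_carrier by (auto simp: mcone_tensor)
  have "map_mat (tens_map m N (coord_map m \<psi>) (compression N)) u \<in> mcone (cstar_opsys (mat_alg (m * N))) k"
    using u \<psi>' compression_ucp by (simp add: mcone_tensor)
  hence ps: "psd ({..<k} \<times> {..<m * N}) (\<lambda>(a,i) (b,j). map_mat (tens_map m N (coord_map m \<psi>) (compression N)) u $$ (a,b) $$ (i,j))"
    by (simp add: mat_cone_iff mat_psd_def)
  (* position w of the corner is (w div k, w mod k), and w div k goes to the inner index of the Kronecker product *)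
  define g where "g = (\<lambda>(w,i). (w mod k, i * N + w div k))"
  have idx: "i * N + w div k < m * N" "(i * N + w div k) div N = i" "(i * N + w div k) mod N = w div k" "w div k < N"
    if "w < N" "i < m" for i w
  proof -
    show w: "w div k < N" using that(1) div_le_dividend[of w k] by linarith
    have "i * N + w div k < Suc i * N" using w by simp
    also have "\<dots> \<le> m * N" using that(2) by (intro mult_right_mono) auto
    finally show "i * N + w div k < m * N" .
    show "(i * N + w div k) div N = i" "(i * N + w div k) mod N = w div k" using w by simp_all
  qed
  have l\<psi>: "linear_map class_ring X (cstar_opsys (mat_alg m)) (coord_map m \<psi>)" and lc: "linear_map class_ring BH (cstar_opsys (mat_alg N)) (compression N)"
    using \<psi>' compression_ucp by (auto simp: ucp_def unital_linear_def)
  have "psd (grid N m) (\<lambda>x y. (\<lambda>(a,i) (b,j). map_mat (tens_map m N (coord_map m \<psi>) (compression N)) u $$ (a,b) $$ (i,j)) (g x) (g y))"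
    by (rule psd_pullback[OF ps]) (use k idx in \<open>auto simp: g_def\<close>)
  thus ?thesis unfolding K.amp_psd_def
  proof (rule psd_cong[rotated])
    fix x y assume "x \<in> grid N m" "y \<in> grid N m"
    then obtain w i z j where xy: "x = (w,i)" "y = (z,j)" "w < N" "z < N" "i < m" "j < m" by auto
    note ix = idx[OF xy(3,5)] and iy = idx[OF xy(4,6)]
    have wz: "w mod k < k" "z mod k < k" using k by auto
    have "(map_mat (tens_map m N (coord_map m \<psi>) (compression N)) u $$ (w mod k, z mod k)) $$ (i * N + w div k, j * N + z div k)
      = op_tensor (U (w mod k) (z mod k)) (\<lambda>x y. coord_map m \<psi> x $$ (i,j) * compression N y $$ (w div k, z div k))"
      using du wz ix iy by (simp add: tens_map_def U)
    also have "\<dots> = (\<Sum>l<d. coord_map m \<psi> (basis_vec l) $$ (i,j) * compression N (U (w mod k) (z mod k) l) $$ (w div k, z div k))"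
      using matrix_product_bilinear[OF l\<psi> lc xy(5,6) ix(4) iy(4)] by (simp add: op_tensor_def)
    also have "\<dots> = (\<Sum>l<d. entry (U (w mod k) (z mod k) l) (w div k) (z div k) * \<psi> l i j)"
    proof (intro sum.cong refl)
      fix l assume l: "l \<in> {..<d}"
      have "coord_map m \<psi> (basis_vec l) $$ (i,j) = (\<Sum>n<d. if n = l then \<psi> n i j else 0)"
        unfolding coord_map_simps(4)[OF xy(5,6)] by (intro sum.cong refl) (auto simp: basis_vec_simps)
      hence "coord_map m \<psi> (basis_vec l) $$ (i,j) = \<psi> l i j" using l by simp
      thus "coord_map m \<psi> (basis_vec l) $$ (i,j) * compression N (U (w mod k) (z mod k) l) $$ (w div k, z div k)
        = entry (U (w mod k) (z mod k) l) (w div k) (z div k) * \<psi> l i j"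
        using ix(4) iy(4) by (simp add: compression_def)
    qed
    finally show "(\<lambda>(a,i) (b,j). map_mat (tens_map m N (coord_map m \<psi>) (compression N)) u $$ (a,b) $$ (i,j)) (g x) (g y)
      = K.amp \<psi> (\<lambda>i j l. entry (U (i mod k) (j mod k) l) (i div k) (j div k)) x y"
      by (simp add: xy g_def K.amp_def)
  qed
qed

lemma operator_entries_bounded:
  assumes k: "k > 0" and U: "\<And>a b l. U a b l \<in> bounded_ops"
  obtains B where "B > 0" "\<And>l N. l < d \<Longrightarrow> opbound {..<N} (\<lambda>i j. entry (U (i mod k) (j mod k) l) (i div k) (j div k)) B"
proof -
  have "\<exists>C>0. \<forall>N. opbound {..<N} (entry T) C" if "T \<in> bounded_ops" for T
    by (rule entry_opbound[OF that]) blast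
  hence "\<forall>a b l. \<exists>C>0. \<forall>N. opbound {..<N} (entry (U a b l)) C" using U by blast
  then obtain C where C: "\<And>a b l. C a b l > 0" "\<And>a b l N. opbound {..<N} (entry (U a b l)) (C a b l)" by metis
  define S where "S = 1 + (\<Sum>a<k. \<Sum>b<k. \<Sum>l<d. C a b l)"
  have nn: "0 \<le> C a b l" for a b l using C(1)[of a b l] by simp
  have le: "C a b l \<le> S" if "a < k" "b < k" "l < d" for a b l
  proof -
    have "C a b l \<le> (\<Sum>l<d. C a b l)" by (rule member_le_sum) (use that nn in auto)
    also have "\<dots> \<le> (\<Sum>b<k. \<Sum>l<d. C a b l)" by (rule member_le_sum[where f = "\<lambda>b. \<Sum>l<d. C a b l"]) (use that nn in \<open>auto intro: sum_nonneg\<close>)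
    also have "\<dots> \<le> (\<Sum>a<k. \<Sum>b<k. \<Sum>l<d. C a b l)" by (rule member_le_sum[where f = "\<lambda>a. \<Sum>b<k. \<Sum>l<d. C a b l"]) (use that nn in \<open>auto intro!: sum_nonneg\<close>)
    finally show ?thesis by (simp add: S_def)
  qed
  have S: "S > 0" unfolding S_def by (intro add_pos_nonneg sum_nonneg nn) simp
  show ?thesis
  proof (rule that[of "real k * S"])
    show "real k * S > 0" using S k by simp
    show "opbound {..<N} (\<lambda>i j. entry (U (i mod k) (j mod k) l) (i div k) (j div k)) (real k * S)" if l: "l < d" for l N
    proof (rule matrix_of_operators_opbound[OF k, where T = "\<lambda>a b. entry (U a b l)"])
      show "opbound {..<N} (entry (U a b l)) S" if "a < k" "b < k" for a b N
        by (rule opbound_mono[OF C(2) nn le]) (use that l in auto)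
    qed (use S in simp)
  qed
qed

lemma submatrix_operator:
  assumes n: "n > 0" and c: "c \<ge> 0" "\<And>M f. (\<Sum>w<M. (cmod (\<Sum>j<M. R w j * f j))\<^sup>2) \<le> c * (\<Sum>j<M. (cmod (f j))\<^sup>2)"
    and x: "x < n" "y < n"
  obtains T where "T \<in> bounded_ops" "\<And>s t. entry T s t = R (s * n + x) (t * n + y)"
proof (rule operator_of_matrix[OF c(1), where M = "\<lambda>s t. R (s * n + x) (t * n + y)"])
  fix N :: nat and f :: "nat \<Rightarrow> complex"
  note sdm = sum_lessThan_mult[OF n]
  define g where "g j = (if j mod n = y then f (j div n) else 0)" for j
  have g: "(\<Sum>j<N * n. F j (g j)) = (\<Sum>t<N. F (t * n + y) (f t))" if "\<And>j. F j 0 = 0" for F :: "nat \<Rightarrow> complex \<Rightarrow> 'b::comm_monoid_add"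
  proof -
    have "(\<Sum>j<N * n. F j (g j)) = (\<Sum>t<N. \<Sum>b<n. if y = b then F (t * n + b) (f t) else 0)"
      unfolding sdm by (intro sum.cong refl) (auto simp: g_def that)
    thus ?thesis using x(2) by simp
  qed
  have "(\<Sum>s<N. (cmod (\<Sum>t<N. R (s * n + x) (t * n + y) * f t))\<^sup>2) = (\<Sum>s<N. (cmod (\<Sum>j<N * n. R (s * n + x) j * g j))\<^sup>2)"
    by (intro sum.cong refl arg_cong[where f = "\<lambda>z. (cmod z)\<^sup>2"] g[of "\<lambda>j z. R (_ * n + x) j * z", symmetric]) simp
  also have "\<dots> \<le> (\<Sum>s<N. \<Sum>a<n. (cmod (\<Sum>j<N * n. R (s * n + a) j * g j))\<^sup>2)"
    by (intro sum_mono member_le_sum[where f = "\<lambda>a. (cmod (\<Sum>j<N * n. R (_ * n + a) j * g j))\<^sup>2"]) (use x in auto)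
  also have "\<dots> = (\<Sum>w<N * n. (cmod (\<Sum>j<N * n. R w j * g j))\<^sup>2)" by (rule sdm[symmetric])
  also have "\<dots> \<le> c * (\<Sum>j<N * n. (cmod (g j))\<^sup>2)" by (rule c(2))
  also have "(\<Sum>j<N * n. (cmod (g j))\<^sup>2) = (\<Sum>t<N. (cmod (f t))\<^sup>2)" by (rule g[of "\<lambda>j z. (cmod z)\<^sup>2"]) simp
  finally show "(\<Sum>s<N. (cmod (\<Sum>t<N. R (s * n + x) (t * n + y) * f t))\<^sup>2) \<le> c * (\<Sum>t<N. (cmod (f t))\<^sup>2)" .
qed (rule that)

text \<open>
  The series for an entry of \<open>Y\<^sup>* Y\<close> is finite because \<open>R\<close> is triangular, and it is the sum that occurs in
  \<open>infinite_factorization\<close>.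
\<close>

lemma gram_of_triangular:
  assumes n: "n > 0" and tri: "\<And>w j. j < w \<Longrightarrow> R w j = 0"
    and x: "x \<in> mats B_ell2 n n" "\<And>c c' s t. c < n \<Longrightarrow> c' < n \<Longrightarrow> entry (x $$ (c,c')) s t = R (s * n + c) (t * n + c')"
    and ab: "a < n" "b < n"
  shows "entry (gram B_ell2 x $$ (a,b)) s t = (\<Sum>w\<le>s * n + a. cnj (R w (s * n + a)) * R w (t * n + b))"
proof (rule LIMSEQ_unique[OF gram_entry(2)[OF x(1) ab]])
  note sdm = sum_lessThan_mult[OF n]
  have "(\<Sum>c<n. \<Sum>w<M. cnj (entry (x $$ (c,a)) w s) * entry (x $$ (c,b)) w t) = (\<Sum>w\<le>s * n + a. cnj (R w (s * n + a)) * R w (t * n + b))"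
    if M: "M \<ge> Suc s" for M
  proof -
    have "(\<Sum>c<n. \<Sum>w<M. cnj (entry (x $$ (c,a)) w s) * entry (x $$ (c,b)) w t)
      = (\<Sum>c<n. \<Sum>w<M. cnj (R (w * n + c) (s * n + a)) * R (w * n + c) (t * n + b))"
      by (intro sum.cong refl) (use ab x(2) in simp)
    also have "\<dots> = (\<Sum>w<M. \<Sum>c<n. cnj (R (w * n + c) (s * n + a)) * R (w * n + c) (t * n + b))" by (rule sum.swap)
    also have "\<dots> = (\<Sum>w<M * n. cnj (R w (s * n + a)) * R w (t * n + b))" by (rule sdm[symmetric])
    also have "\<dots> = (\<Sum>w\<le>s * n + a. cnj (R w (s * n + a)) * R w (t * n + b))"
    proof (rule sum.mono_neutral_right)
      have "s * n + a < Suc s * n" using ab by simp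
      also have "\<dots> \<le> M * n" using M by (rule mult_right_mono) simp
      finally show "{..s * n + a} \<subseteq> {..<M * n}" by auto
    qed (use tri in auto)
    finally show ?thesis .
  qed
  thus "(\<lambda>M. \<Sum>c<n. \<Sum>w<M. cnj (entry (x $$ (c,a)) w s) * entry (x $$ (c,b)) w t)
    \<longlonglongrightarrow> (\<Sum>w\<le>s * n + a. cnj (R w (s * n + a)) * R w (t * n + b))"
    by (intro tendsto_eventually eventually_sequentiallyI)
qed

text \<open>
  For the matrix \<open>\<alpha>\<close> that selects the position \<open>(g, a * p + g)\<close> for every \<open>g\<close>.
\<close>

lemma sum_selected:
  fixes F :: "nat \<Rightarrow> nat \<Rightarrow> 'b::comm_monoid_add"
  assumes q: "a * p + p \<le> q"
  shows "(\<Sum>x<p * q. if x mod q = a * p + x div q then F (x div q) (x mod q) else 0) = (\<Sum>g<p. F g (a * p + g))"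
proof (cases "p = 0")
  case False
  hence "q > 0" using q by simp
  from sum_divmod[OF this, of "\<lambda>(g,c). if c = a * p + g then F g c else 0" p]
  have "(\<Sum>x<p * q. if x mod q = a * p + x div q then F (x div q) (x mod q) else 0)
    = (\<Sum>g<p. \<Sum>c<q. if c = a * p + g then F g c else 0)"
    by (simp add: sum.cartesian_product')
  also have "\<dots> = (\<Sum>g<p. F g (a * p + g))" using q by (intro sum.cong refl) (simp add: sum.delta)
  finally show ?thesis .
qed simp

text \<open>
  The factorization of \<open>v + r\<close>, read as an identity of operators. The row \<open>(s * k + a) * p + g\<close> of \<open>R\<close> splits
  into the coordinate \<open>s\<close> of \<open>\<ell>\<^sup>2\<close> and the matrix position \<open>a * p + g\<close> below \<open>k * p\<close>, so \<open>R\<close> is a \<open>k p \<times> k p\<close> matrix \<open>Y\<close> of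
  operators, and the contraction with \<open>P\<close> is the conjugation by a selection matrix \<open>\<alpha>\<close>.
\<close>

lemma min_le_max:
  assumes st: "K.stable" and u: "u \<in> mcone (tensor_min X BH) k"
  shows "u \<in> mcone (tensor_max X BH) k"
  unfolding mcone_tensor
proof (intro CollectI conjI allI impI)
  show um: "u \<in> mats AT k k" using u by (simp add: mcone_tensor)
  have du: "u \<in> carrier_mat k k" by (rule mats_carrier[OF um])
  fix r :: real assume r: "r > 0"
  define W where "W = madd AT u (msmult AT (complex_of_real r) (munit AT k))"
  have dW: "W \<in> carrier_mat k k" using du by (simp add: W_def madd_def)
  have "W \<in> max_precone X BH k"
  (* for k = 0 the numbering by k makes no sense, but all matrices are empty *)
  proof (cases "k = 0")
    case True
    define Q where "Q = mmult B_ell2 (madj B_ell2 (mat 0 0 undefined)) (mat 0 0 undefined)"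
    have "Q \<in> mcone BH 0" unfolding mcone_cstar Q_def by (auto intro!: matsI)
    moreover have "mat_of 0 (\<lambda>i j l. 0) \<in> mcone X 0" using K.C_zero[of 0] by (simp add: cone_co_def)
    moreover have "W = mconj AT (0\<^sub>m 0 0) (mtens X BH (mat_of 0 (\<lambda>i j l. 0)) Q)"
      by (rule eq_matI) (use dW True in \<open>auto simp: mconj_def\<close>)
    moreover have "0\<^sub>m 0 0 \<in> carrier_mat k (0 * 0)" using True by simp
    ultimately show ?thesis unfolding max_precone_def by blast
  next
    case False
    hence k: "k > 0" by simp
    have "\<exists>U. (\<forall>l. U l \<in> bounded_ops) \<and> (a < k \<and> b < k \<longrightarrow> u $$ (a,b) = op_tensor U)" for a b
    proof (cases "a < k \<and> b < k")
      case True
      show ?thesis by (rule alg_tensor_op_tensor[OF matsD[OF um conjunct1[OF True] conjunct2[OF True]]]) blast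
    next
      case False thus ?thesis by (intro exI[of _ "\<lambda>l. \<one>\<^bsub>B_ell2\<^esub>"]) (auto simp: B_ell2_closed)
    qed
    then obtain U where U: "\<And>a b l. U a b l \<in> bounded_ops" "\<And>a b. a < k \<Longrightarrow> b < k \<Longrightarrow> u $$ (a,b) = op_tensor (U a b)"
      by metis
    define v :: arr where "v = (\<lambda>i j l. entry (U (i mod k) (j mod k) l) (i div k) (j div k))"
    have v: "K.amp_psd m \<psi> N v" if "K.ucp_co m \<psi>" for N m \<psi>
      unfolding v_def by (rule min_cone_coordinates[OF k u U(2) that])
    obtain B where B: "B > 0" "\<And>l N. l < d \<Longrightarrow> opbound {..<N} (\<lambda>i j. v i j l) B"
      unfolding v_def by (rule operator_entries_bounded[of k U, OF k U(1)]) blast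
    obtain p P R c where p: "p > 0" and P: "P \<in> cone_co p" and tri: "\<And>w j. j < w \<Longrightarrow> R w j = 0" and c: "c \<ge> 0"
      "\<And>M f. (\<Sum>w<M. (cmod (\<Sum>j<M. R w j * f j))\<^sup>2) \<le> c * (\<Sum>j<M. (cmod (f j))\<^sup>2)"
      and fac: "\<And>i j l. l < d \<Longrightarrow> K.shift r v i j l =
        (\<Sum>g<p. \<Sum>h<p. P g h l * (\<Sum>w\<le>i * p + g. cnj (R w (i * p + g)) * R w (j * p + h)))"
      by (rule factorization_of_positive[OF st v B r]) blast+
    define n where "n = k * p"
    have n: "n > 0" using k p by (simp add: n_def)
    have ind: "a * p + g < n" if "a < k" "g < p" for a g
    proof -
      have "a * p + g < Suc a * p" using that by simp
      also have "\<dots> \<le> n" unfolding n_def using that by (intro mult_right_mono) auto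
      finally show ?thesis .
    qed
    have "\<exists>T. T \<in> bounded_ops \<and> (\<forall>s t. entry T s t = R (s * n + x) (t * n + y))" if "x < n" "y < n" for x y
      by (rule submatrix_operator[OF n c that]) blast
    then obtain T where T: "\<And>x y. x < n \<Longrightarrow> y < n \<Longrightarrow> T x y \<in> bounded_ops"
      "\<And>x y s t. x < n \<Longrightarrow> y < n \<Longrightarrow> entry (T x y) s t = R (s * n + x) (t * n + y)" by metis
    define Y where "Y = mat n n (\<lambda>(x,y). T x y)"
    have Y: "Y \<in> mats B_ell2 n n" by (rule matsI) (auto simp: Y_def T B_ell2_simps)
    define Q where "Q = gram B_ell2 Y"
    have Qc: "Q \<in> mcone BH n" unfolding mcone_cstar Q_def using Y by blast
    have Qm: "Q \<in> mats B_ell2 n n" unfolding Q_def by (rule mmult_madj_mats[OF B_ell2_star_algebra Y])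
    have Qe: "entry (Q $$ (x,y)) s t = (\<Sum>w\<le>s * n + x. cnj (R w (s * n + x)) * R w (t * n + y))" if "x < n" "y < n" for x y s t
      unfolding Q_def by (rule gram_of_triangular[OF n tri Y _ that]) (auto simp: Y_def T)
    have Qb: "Q $$ (x,y) \<in> bounded_ops" if "x < n" "y < n" for x y using matsD[OF Qm that] by (simp add: B_ell2_simps)
    define \<alpha> where "\<alpha> = mat k (p * n) (\<lambda>(a,x). if x mod n = a * p + x div n then 1 else 0 :: complex)"
    have \<alpha>: "\<alpha> \<in> carrier_mat k (p * n)" by (simp add: \<alpha>_def)
    have Pm: "mat_of p P \<in> mats X p p" "mat_of p P \<in> mcone X p" using P by (auto simp: cone_co_def)
    define Z where "Z = mconj AT \<alpha> (mtens X BH (mat_of p P) Q)"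
    have "W = Z"
    proof (rule eq_matI)
      have dZ: "Z \<in> carrier_mat k k" using \<alpha> by (simp add: Z_def mconj_def)
      show "dim_row W = dim_row Z" "dim_col W = dim_col Z" using dW dZ by auto
      fix a b assume "a < dim_row Z" "b < dim_col Z"
      hence ab: "a < k" "b < k" using dZ by auto
      have mq: "a * p + p \<le> n" "b * p + p \<le> n" using ind[OF ab(1), of "p - 1"] ind[OF ab(2), of "p - 1"] p by auto
      define V where "V l = U a b l \<oplus>\<^bsub>B_ell2\<^esub> (if a = b then complex_of_real r * unit_co l else 0) \<odot>\<^bsub>B_ell2\<^esub> \<one>\<^bsub>B_ell2\<^esub>" for l
      define G where "G l = finsum B_ell2 (\<lambda>(g,h). P g h l \<odot>\<^bsub>B_ell2\<^esub> Q $$ (a * p + g, b * p + h)) (grid p p)" for l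
      have z: "(\<lambda>x y. 0) \<in> bilinear_forms X BH" by (simp add: bilinear_forms_def)
      have Gc: "(\<lambda>(g,h). P g h l \<odot>\<^bsub>B_ell2\<^esub> Q $$ (a * p + g, b * p + h)) \<in> grid p p \<rightarrow> bounded_ops" for l
        using Qb ind ab by (auto simp: B_ell2_closed)
      have VG: "V l = G l" if l: "l < d" for l
      proof (rule entry_eqI)
        show "V l \<in> bounded_ops" by (simp add: V_def B_ell2_closed U)
        show "G l \<in> bounded_ops" unfolding G_def by (rule bilinear_finsum_right(1)[OF z basis_vec_simps(1) _ Gc]) simp
        fix s t
        have i: "(s * k + a) * p + g = s * n + (a * p + g)" "(t * k + b) * p + g = t * n + (b * p + g)" for g
          by (simp_all add: n_def algebra_simps)
        have eq: "s * k + a = t * k + b \<longleftrightarrow> s = t \<and> a = b"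
        proof
          assume "s * k + a = t * k + b"
          hence "(s * k + a) div k = (t * k + b) div k" "(s * k + a) mod k = (t * k + b) mod k" by simp_all
          thus "s = t \<and> a = b" using ab by simp
        qed simp
        have "entry (V l) s t = K.shift r v (s * k + a) (t * k + b) l"
          using ab by (simp add: V_def entry_simps K.shift_def v_def eq)
        also have "\<dots> = (\<Sum>g<p. \<Sum>h<p. P g h l * entry (Q $$ (a * p + g, b * p + h)) s t)"
          unfolding fac[OF l] i by (intro sum.cong refl) (simp add: Qe ind ab)
        also have "\<dots> = entry (G l) s t"
          unfolding G_def by (subst entry_finsum[OF _ Gc]) (simp_all add: sum.cartesian_product' entry_simps)
        finally show "entry (V l) s t = entry (G l) s t" .
      qed
      have mc: "Z $$ (a,b) \<in> carrier AT" unfolding Z_def by (rule mconj_mtens(1)[OF Pm(1) Qm \<alpha> ab])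
      have "W $$ (a,b) = op_tensor V"
      proof -
        have "W $$ (a,b) = op_tensor (U a b) \<oplus>\<^bsub>AT\<^esub> complex_of_real r \<odot>\<^bsub>AT\<^esub> (if a = b then tens X BH \<one>\<^bsub>X\<^esub> \<one>\<^bsub>B_ell2\<^esub> else \<zero>\<^bsub>AT\<^esub>)"
          using du ab by (simp add: W_def madd_def msmult_def munit_def U alg_tensor_simps(4) BH_simps)
        also have "\<dots> = op_tensor V"
        proof (cases "a = b")
          case True
          thus ?thesis unfolding V_def
            by (simp add: tens_op_tensor unit_closed B_ell2_closed op_tensor_smult op_tensor_add U(1))
              (intro op_tensor_cong arg_cong2[where f = "add B_ell2"] refl entry_eqI; simp add: B_ell2_closed entry_simps unit_co_def)
        next
          case False
          have "complex_of_real r \<odot>\<^bsub>AT\<^esub> \<zero>\<^bsub>AT\<^esub> = op_tensor (\<lambda>l. 0 \<odot>\<^bsub>B_ell2\<^esub> \<one>\<^bsub>B_ell2\<^esub>)"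
            unfolding op_tensor_def alg_tensor_simps
            by (intro restrict_ext) (simp add: bilinear_formsD(4)[OF _ basis_vec_simps(1), of _ BH, unfolded BH_simps] B_ell2_closed)
          thus ?thesis using False unfolding V_def by (simp add: op_tensor_add U(1) B_ell2_closed)
        qed
        finally show ?thesis .
      qed
      also have "op_tensor V = op_tensor G" by (rule op_tensor_cong) (rule VG)
      also have "op_tensor G = Z $$ (a,b)"
      proof (rule alg_tensor_op_tensor[OF mc])
        fix U' assume U': "Z $$ (a,b) = op_tensor U'"
        show "op_tensor G = Z $$ (a,b)"
          unfolding U' op_tensor_def
        proof (rule restrict_ext)
          fix \<beta> assume \<beta>: "\<beta> \<in> bilinear_forms X BH"
          have "(\<Sum>l<d. \<beta> (basis_vec l) (U' l)) = (Z $$ (a,b)) \<beta>" using \<beta> by (simp add: U' op_tensor_def)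
          also have "\<dots> = (\<Sum>x<p * n. \<Sum>y<p * n. \<alpha> $$ (a,x) * cnj (\<alpha> $$ (b,y)) * \<beta> (mat_of p P $$ (x div n, y div n)) (Q $$ (x mod n, y mod n)))"
            unfolding Z_def by (rule mconj_mtens(2)[OF Pm(1) Qm \<alpha> ab \<beta>])
          also have "\<dots> = (\<Sum>x<p * n. if x mod n = a * p + x div n then
              (\<Sum>y<p * n. if y mod n = b * p + y div n then \<beta> (mat_of p P $$ (x div n, y div n)) (Q $$ (x mod n, y mod n)) else 0) else 0)"
            by (intro sum.cong refl) (use ab in \<open>auto simp: \<alpha>_def intro!: sum.cong\<close>)
          also have "\<dots> = (\<Sum>g<p. \<Sum>h<p. \<beta> (mat_of p P $$ (g,h)) (Q $$ (a * p + g, b * p + h)))"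
            unfolding sum_selected[OF mq(2), of "\<lambda>h y. \<beta> (mat_of p P $$ (_ div n, h)) (Q $$ (_ mod n, y))"]
            by (rule sum_selected[OF mq(1), of "\<lambda>g x. \<Sum>h<p. \<beta> (mat_of p P $$ (g,h)) (Q $$ (x, b * p + h))"])
          also have "\<dots> = (\<Sum>g<p. \<Sum>h<p. \<Sum>l<d. P g h l * \<beta> (basis_vec l) (Q $$ (a * p + g, b * p + h)))"
            using Qb ind ab by (intro sum.cong refl, subst bilinear_expand[OF \<beta>]) (auto simp: mat_of_index BH_simps)
          also have "\<dots> = (\<Sum>l<d. \<Sum>g<p. \<Sum>h<p. P g h l * \<beta> (basis_vec l) (Q $$ (a * p + g, b * p + h)))"
            by (rule sum_rotate3)
          also have "\<dots> = (\<Sum>l<d. \<beta> (basis_vec l) (G l))"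
          proof (intro sum.cong refl)
            fix l
            have "\<beta> (basis_vec l) (G l) = (\<Sum>(g,h)\<in>grid p p. \<beta> (basis_vec l) (P g h l \<odot>\<^bsub>B_ell2\<^esub> Q $$ (a * p + g, b * p + h)))"
              unfolding G_def by (subst bilinear_finsum_right(2)[OF \<beta> basis_vec_simps(1) _ Gc]) (auto intro!: sum.cong)
            also have "\<dots> = (\<Sum>g<p. \<Sum>h<p. P g h l * \<beta> (basis_vec l) (Q $$ (a * p + g, b * p + h)))"
              unfolding sum.cartesian_product' case_prod_conv
              by (intro sum.cong refl bilinear_formsD(4)[OF \<beta> basis_vec_simps(1), unfolded BH_simps] Qb ind ab) auto
            finally show "(\<Sum>g<p. \<Sum>h<p. P g h l * \<beta> (basis_vec l) (Q $$ (a * p + g, b * p + h))) = \<beta> (basis_vec l) (G l)" ..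
          qed
          finally show "(\<Sum>l<d. \<beta> (basis_vec l) (G l)) = (\<Sum>l<d. \<beta> (basis_vec l) (U' l))" ..
        qed
      qed
      finally show "W $$ (a,b) = Z $$ (a,b)" .
    qed
    thus ?thesis unfolding max_precone_def Z_def using Pm(2) Qc \<alpha> by blast
  qed
  thus "madd AT u (msmult AT (complex_of_real r) (munit AT k)) \<in> max_precone X BH k" by (simp add: W_def)
qed

end

theorem theorem2:
  fixes E :: "'a op_system"
  assumes "operator_system E"
    and "fin_dim_opsys E"
    and "cp_stable TYPE('u) E"
  shows "\<forall>k. mcone (tensor_min E (cstar_opsys B_ell2)) k = mcone (tensor_max E (cstar_opsys B_ell2)) k"
proof
  fix k
  interpret operator_system E by (rule assms(1))
  obtain d co cb where "coordinates d co cb"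
    using coordinates_exist assms(2) unfolding fin_dim_opsys_def by blast
  then interpret coord_operator_system E d co cb by unfold_locales
  show "mcone (tensor_min E BH) k = mcone (tensor_max E BH) k"
    using min_le_max[OF stable_of_cp_stable[OF assms(3,2)]] max_le_min by blast
qed

end
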